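(* Let $X$ be a LOTS. The following are equivalent. (1) $X$ is a CHLOTS. (2) There exists an $\Omega$-bounded, additive subtree of the simple tree on $\mathbb{Z},\Omega$, the completion of whose branch space is order isomorphic to $X$. (3) There exist an IHLOTS $D$, dense in $\mathbb{R}$, and an $\Omega$-bounded, additive subtree of the simple tree on $D,\Omega$, the completion of whose branch space is order isomorphic to $X$. (4) There exists an $\Omega$-bounded, reproductive bi-ordered tree with $S_0$ a HLOTS, the completion of whose branch space is order isomorphic to $X$.
   Context: A LOTS is a totally ordered set with the order topology; it is complete if every nonempty bounded subset has a supremum and infimum. A HLOTS is a LOTS with at least three points which is order isomorphic to every nonempty open convex subset of itself; a CHLOTS is a complete HLOTS and an IHLOTS is a non-complete HLOTS. The completion of an order dense LOTS $Y$ is the (essentially unique) complete order dense LOTS containing $Y$ as a dense subset and having a max (resp. min) iff $Y$ does (the branch spaces in (2)-(4) are order dense). $\Omega$ is the first uncountable ordinal. Trees. A tree is a nonempty partially ordered set $(T,\prec)$ with every predecessor set $A_p=\{q:q\prec p\}$ well-ordered; $o(p)$ is the order type of $A_p$; $T_p$ is $p$ together with all elements above it; $S_p=\{q\in T_p:o(q)=o(p)+1\}$; the height $h(A)$ of $A\subset T$ is the least ordinal greater than $o(p)$ for all $p\in A$. Trees are assumed semi-normal: there is a unique root $0$ with $o(0)=0$; no $S_p$ is a singleton; if $A_p=A_q$ with $o(p)=o(q)$ a limit ordinal then $p=q$. A tree is bi-ordered if its height is $>1$ and each nonempty $S_p$ carries a linear order. A branch is a maximal linearly ordered subset, $x_i$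 is its element of order $i$, and the branch space $X(T)$ is the set of branches ordered by: $x<y$ iff for some $\epsilon$, $x_\epsilon=y_\epsilon$ and $x_{\epsilon+1}<y_{\epsilon+1}$ in $S_{x_\epsilon}$. $T$ is $\Omega$-bounded if $h(x)<\Omega$ for all branches $x$. A subset $T_1\subset T$ is a subtree if $p\in T_1$ implies $A_p\subset T_1$. $T$ is reproductive if for every $p\in T$ there is a bijection $T\to T_p$ preserving in both directions $\prec$ and the linear orders on successor sets. For a LOTS $Y$ with at least two points, the simple tree on $Y,\Omega$ has as vertices of order $i<\Omega$ the functions $i\to Y$, with $q\prec p$ iff $p$ properly extends $q$; the successors of $p:i\to Y$ are ordered by their value at $i$. For $p\in Y^i$, $q\in Y^j$ the sum $p+q\in Y^{i+j}$ is the concatenation: $(p+q)(k)=p(k)$ for $k<i$ and $(p+q)(i+k)=q(k)$ for $k<j$. A subset $T$ of the simple tree is additive if it contains the root and all vertices of order $1$ and, for all vertices $p,q$ of the simple tree, $p+q\in T$ iff $p\in T$ and $q\in T$. *)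

theory Defs
  imports "HOL-Analysis.Analysis"
begin

unbundle cardinal_syntax

section \<open>LOTS\<close>

text \<open>
  A LOTS is given by its reflexive linear order \<open>r\<close>, i.e. \<^prop>\<open>Linear_order r\<close>; its
  point set is \<^term>\<open>Field r\<close>.
\<close>

definition lots_topology :: "'a rel \<Rightarrow> 'a topology" where
  "lots_topology r = topology_generated_by
     ({Field r} \<union> underS r ` Field r \<union> aboveS r ` Field r)"

definition order_isomorphic :: "'a rel \<Rightarrow> 'b rel \<Rightarrow> bool" where
  "order_isomorphic r s \<longleftrightarrow> (\<exists>f. iso r s f)"

definition order_convex :: "'a rel \<Rightarrow> 'a set \<Rightarrow> bool" where
  "order_convex r U \<longleftrightarrow>
     U \<subseteq> Field r \<and> (\<forall>a\<in>U. \<forall>b\<in>U. \<forall>c. (a, c) \<in> r \<and> (c, b) \<in> r \<longrightarrow> c \<in> U)"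

definition has_sup :: "'a rel \<Rightarrow> 'a set \<Rightarrow> bool" where
  "has_sup r A \<longleftrightarrow> (\<exists>s \<in> Above r A. \<forall>u \<in> Above r A. (s, u) \<in> r)"

definition has_inf :: "'a rel \<Rightarrow> 'a set \<Rightarrow> bool" where
  "has_inf r A \<longleftrightarrow> (\<exists>s \<in> Under r A. \<forall>u \<in> Under r A. (u, s) \<in> r)"

definition complete_lots :: "'a rel \<Rightarrow> bool" where
  "complete_lots r \<longleftrightarrow>
     Linear_order r \<and>
     (\<forall>A \<subseteq> Field r. A \<noteq> {} \<and> Above r A \<noteq> {} \<and> Under r A \<noteq> {} \<longrightarrow> has_sup r A \<and> has_inf r A)"

definition HLOTS :: "'a rel \<Rightarrow> bool" where
  "HLOTS r \<longleftrightarrow>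
     Linear_order r \<and>
     (\<exists>a\<in>Field r. \<exists>b\<in>Field r. \<exists>c\<in>Field r. a \<noteq> b \<and> a \<noteq> c \<and> b \<noteq> c) \<and>
     (\<forall>U. openin (lots_topology r) U \<and> order_convex r U \<and> U \<noteq> {} \<longrightarrow>
        order_isomorphic r (Restr r U))"

definition CHLOTS :: "'a rel \<Rightarrow> bool" where
  "CHLOTS r \<longleftrightarrow> HLOTS r \<and> complete_lots r"

definition IHLOTS :: "'a rel \<Rightarrow> bool" where
  "IHLOTS r \<longleftrightarrow> HLOTS r \<and> \<not> complete_lots r"

definition order_dense :: "'a rel \<Rightarrow> bool" where
  "order_dense r \<longleftrightarrow>
     (\<forall>(a, b)\<in>r. a \<noteq> b \<longrightarrow> (\<exists>c. c \<noteq> a \<and> c \<noteq> b \<and> (a, c) \<in> r \<and> (c, b) \<in> r))"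

definition has_max :: "'a rel \<Rightarrow> bool" where
  "has_max r \<longleftrightarrow> (\<exists>m\<in>Field r. \<forall>a\<in>Field r. (a, m) \<in> r)"

definition has_min :: "'a rel \<Rightarrow> bool" where
  "has_min r \<longleftrightarrow> (\<exists>m\<in>Field r. \<forall>a\<in>Field r. (m, a) \<in> r)"

text \<open>
  \<open>Z\<close> is a completion of the order dense LOTS \<open>Y\<close>; the inclusion of \<open>Y\<close> in \<open>Z\<close> is replaced
  by an order embedding \<open>e\<close>, so that the points of \<open>Y\<close> and \<open>Z\<close> may have different types.
\<close>

definition is_completion :: "'b rel \<Rightarrow> 'a rel \<Rightarrow> bool" where
  "is_completion Y Z \<longleftrightarrow>
     Linear_order Y \<and> order_dense Y \<and> complete_lots Z \<and> order_dense Z \<and>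
     (\<exists>e. e ` Field Y \<subseteq> Field Z \<and> iso Y (Restr Z (e ` Field Y)) e \<and>
          lots_topology Z closure_of (e ` Field Y) = Field Z) \<and>
     (has_max Z \<longleftrightarrow> has_max Y) \<and> (has_min Z \<longleftrightarrow> has_min Y)"

text \<open>
  Being unique up to isomorphism, the completion is isomorphic to \<open>X\<close> iff some completion is;
  a completion isomorphic to \<open>X\<close> can be taken on the point type of \<open>X\<close>.
\<close>

definition completion_isomorphic :: "'b rel \<Rightarrow> 'a rel \<Rightarrow> bool" where
  "completion_isomorphic Y X \<longleftrightarrow> (\<exists>Z :: 'a rel. is_completion Y Z \<and> order_isomorphic Z X)"


section \<open>Trees\<close>

text \<open>
  Ordinals are represented by well-order relations, compared by \<open><o\<close>, \<open>\<le>o\<close> and \<open>=o\<close>;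
  \<open>Omega\<close> is the first uncountable ordinal.
\<close>

definition Omega :: "nat set rel" where
  "Omega = cardSuc natLeq"

text \<open>The ordinal successor: a new largest element \<^term>\<open>None\<close> is added.\<close>

definition osucc :: "'a rel \<Rightarrow> 'a option rel" where
  "osucc r = map_prod Some Some ` r \<union> (insert None (Some ` Field r)) \<times> {None}"

text \<open>
  \<open>prec\<close> is the strict order \<open>\<prec>\<close>, and \<open>sord T p\<close> is the reflexive linear order on the
  successor set of \<open>p\<close>. Both are only meaningful on \<open>verts T\<close>, so that a subset of the
  vertices is turned into a tree by updating \<open>verts\<close> alone.
\<close>

record 'v tree =
  verts :: "'v set"
  prec :: "'v rel"
  sord :: "'v \<Rightarrow> 'v rel"

definition preds :: "'v tree \<Rightarrow> 'v \<Rightarrow> 'v set" where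
  "preds T p = {q \<in> verts T. (q, p) \<in> prec T}"

definition order_of :: "'v tree \<Rightarrow> 'v \<Rightarrow> 'v rel" where
  "order_of T p = {(a, b) \<in> preds T p \<times> preds T p. a = b \<or> (a, b) \<in> prec T}"

definition tree_above :: "'v tree \<Rightarrow> 'v \<Rightarrow> 'v set" where
  "tree_above T p = {q \<in> verts T. q = p \<or> (p, q) \<in> prec T}"

definition succs :: "'v tree \<Rightarrow> 'v \<Rightarrow> 'v set" where
  "succs T p = {q \<in> tree_above T p. order_of T q =o osucc (order_of T p)}"

definition succ_order :: "'v tree \<Rightarrow> 'v \<Rightarrow> 'v rel" where
  "succ_order T p = Restr (sord T p) (succs T p)"

definition tree_root :: "'v tree \<Rightarrow> 'v" where
  "tree_root T = (THE r. r \<in> verts T \<and> order_of T r = {})"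

text \<open>
  The least ordinal greater than all \<open>o(p)\<close>, \<open>p \<in> A\<close>. It is the order type of the set of
  orders of the vertices at or below some member of \<open>A\<close>, hence has a representative over the
  vertex type.
\<close>

definition height :: "'v tree \<Rightarrow> 'v set \<Rightarrow> 'v rel" where
  "height T A = (SOME h. Well_order h \<and> (\<forall>p\<in>A. order_of T p <o h) \<and>
     (\<forall>k :: 'v rel. Well_order k \<and> (\<forall>p\<in>A. order_of T p <o k) \<longrightarrow> h \<le>o k))"

definition limit_ordinal :: "'a rel \<Rightarrow> bool" where
  "limit_ordinal r \<longleftrightarrow> Well_order r \<and> r \<noteq> {} \<and> \<not> has_max r"

definition semi_normal_tree :: "'v tree \<Rightarrow> bool" where
  "semi_normal_tree T \<longleftrightarrow>
     verts T \<noteq> {} \<and>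
     irrefl (Restr (prec T) (verts T)) \<and> trans (Restr (prec T) (verts T)) \<and>
     (\<forall>p\<in>verts T. well_order_on (preds T p) (order_of T p)) \<and>
     (\<exists>!r. r \<in> verts T \<and> order_of T r = {}) \<and>
     (\<forall>p\<in>verts T. \<nexists>q. succs T p = {q}) \<and>
     (\<forall>p\<in>verts T. \<forall>q\<in>verts T.
        preds T p = preds T q \<and> order_of T p =o order_of T q \<and> limit_ordinal (order_of T p)
        \<longrightarrow> p = q)"

definition bi_ordered_tree :: "'v tree \<Rightarrow> bool" where
  "bi_ordered_tree T \<longleftrightarrow>
     semi_normal_tree T \<and> natLeq_on 1 <o height T (verts T) \<and>
     (\<forall>p\<in>verts T. succs T p \<noteq> {} \<longrightarrow> linear_order_on (succs T p) (succ_order T p))"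

definition branches :: "'v tree \<Rightarrow> 'v set set" where
  "branches T = {x. pred_on.maxchain (verts T) (\<lambda>p q. (p, q) \<in> prec T) x}"

text \<open>
  The branch \<open>x\<close> is less than the branch \<open>y\<close>. Here \<open>\<epsilon>\<close> is the order of \<open>p\<close>, so that
  \<open>p = x\<^sub>\<epsilon> = y\<^sub>\<epsilon>\<close>, and \<open>a\<close>, \<open>b\<close> are the elements of \<open>x\<close>, \<open>y\<close> of order \<open>\<epsilon> + 1\<close>.
\<close>

definition branch_less :: "'v tree \<Rightarrow> 'v set \<Rightarrow> 'v set \<Rightarrow> bool" where
  "branch_less T x y \<longleftrightarrow>
     (\<exists>p \<in> x \<inter> y. \<exists>a \<in> x \<inter> succs T p. \<exists>b \<in> y \<inter> succs T p. a \<noteq> b \<and> (a, b) \<in> succ_order T p)"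

definition branch_space :: "'v tree \<Rightarrow> 'v set rel" where
  "branch_space T = relation_of (\<lambda>x y. x = y \<or> branch_less T x y) (branches T)"

definition Omega_bounded :: "'v tree \<Rightarrow> bool" where
  "Omega_bounded T \<longleftrightarrow> (\<forall>x\<in>branches T. height T x <o Omega)"

definition subtree :: "'v tree \<Rightarrow> 'v set \<Rightarrow> bool" where
  "subtree T T1 \<longleftrightarrow> T1 \<subseteq> verts T \<and> (\<forall>p\<in>T1. preds T p \<subseteq> T1)"

definition reproductive :: "'v tree \<Rightarrow> bool" where
  "reproductive T \<longleftrightarrow>
     (\<forall>p\<in>verts T. \<exists>f. bij_betw f (verts T) (tree_above T p) \<and>
        (\<forall>q\<in>verts T. \<forall>q'\<in>verts T. (q, q') \<in> prec T \<longleftrightarrow> (f q, f q') \<in> prec T) \<and>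
        (\<forall>q\<in>verts T. \<forall>a\<in>succs T q. \<forall>b\<in>succs T q.
           (a, b) \<in> succ_order T q \<longleftrightarrow> (f a, f b) \<in> succ_order T (f q)))"


section \<open>The simple tree on a LOTS and \<open>\<Omega>\<close>\<close>

text \<open>The ordinals below \<open>\<Omega>\<close> as a type, with ordinal addition.\<close>

typedef omega1 = "Field Omega"
proof -
  have "\<not> finite (Field Omega)"
    unfolding Omega_def
    by (simp add: cardSuc_finite[OF natLeq_Card_order] Field_natLeq)
  then show ?thesis
    by (metis ex_in_conv finite.emptyI)
qed

instantiation omega1 :: wellorder
begin

definition less_eq_omega1 :: "omega1 \<Rightarrow> omega1 \<Rightarrow> bool" where
  "i \<le> j \<longleftrightarrow> (Rep_omega1 i, Rep_omega1 j) \<in> Omega"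

definition less_omega1 :: "omega1 \<Rightarrow> omega1 \<Rightarrow> bool" where
  "(i :: omega1) < j \<longleftrightarrow> i \<le> j \<and> \<not> j \<le> i"

instance
proof -
  have wo: "Well_order Omega"
    unfolding Omega_def
    using cardSuc_Card_order[OF natLeq_Card_order] card_order_on_well_order_on by blast
  then have lin: "refl_on (Field Omega) Omega" "trans Omega" "antisym Omega"
    "total_on (Field Omega) Omega" and wf: "wf (Omega - Id)"
    by (auto simp: order_on_defs)
  have lt: "{(i :: omega1, j). i < j} \<subseteq> inv_image (Omega - Id) Rep_omega1"
    using lin(1) Rep_omega1
    by (auto simp: less_omega1_def less_eq_omega1_def inv_image_def Rep_omega1_inject)
  have wf_lt: "wf {(i :: omega1, j). i < j}"
    by (rule wf_subset[OF wf_inv_image[OF wf] lt])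
  show "OFCLASS(omega1, wellorder_class)"
  proof
    fix i j k :: omega1
    show "(i < j) = (i \<le> j \<and> \<not> j \<le> i)"
      by (simp add: less_omega1_def)
    show "i \<le> i"
      using lin(1) Rep_omega1 by (auto simp: less_eq_omega1_def refl_on_def)
    show "i \<le> j \<Longrightarrow> j \<le> k \<Longrightarrow> i \<le> k"
      using lin(2) by (auto simp: less_eq_omega1_def dest: transD)
    show "i \<le> j \<Longrightarrow> j \<le> i \<Longrightarrow> i = j"
      using lin(3) by (auto simp: less_eq_omega1_def Rep_omega1_inject[symmetric] dest: antisymD)
    show "i \<le> j \<or> j \<le> i"
      using lin(1,4) Rep_omega1[of i] Rep_omega1[of j]
      by (cases "Rep_omega1 i = Rep_omega1 j")
        (auto simp: less_eq_omega1_def total_on_def refl_on_def)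
  next
    fix P :: "omega1 \<Rightarrow> bool" and a
    assume "\<And>x. (\<And>y. y < x \<Longrightarrow> P y) \<Longrightarrow> P x"
    then show "P a"
      using wf_induct_rule[OF wf_lt, of P a] by auto
  qed
qed

end

text \<open>\<open>i + j = sup ({i} \<union> {(i + d) + 1 | d < j})\<close>\<close>

function oplus :: "omega1 \<Rightarrow> omega1 \<Rightarrow> omega1" (infixl \<open>\<oplus>\<^sub>o\<close> 65) where
  "i \<oplus>\<^sub>o j = (LEAST c. i \<le> c \<and> (\<forall>d \<in> {..<j}. i \<oplus>\<^sub>o d < c))"
  by auto
termination
  by (relation "inv_image {(d, j). d < j} snd") (auto simp: wf)

declare oplus.simps [simp del]

text \<open>
  A function \<open>i \<rightarrow> Y\<close>, where \<open>i < \<Omega>\<close>, is a partial function on \<^typ>\<open>omega1\<close> with domain the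
  ordinal \<open>i\<close> (the set of smaller ordinals). Extension of functions is then \<open>\<subseteq>\<^sub>m\<close>.
\<close>

definition simple_verts :: "'y rel \<Rightarrow> (omega1 \<rightharpoonup> 'y) set" where
  "simple_verts Y = {p. (\<exists>i. dom p = {..<i}) \<and> ran p \<subseteq> Field Y}"

definition vlen :: "(omega1 \<rightharpoonup> 'y) \<Rightarrow> omega1" where
  "vlen p = (THE i. dom p = {..<i})"

definition simple_tree :: "'y rel \<Rightarrow> (omega1 \<rightharpoonup> 'y) tree" where
  "simple_tree Y =
     \<lparr> verts = simple_verts Y,
       prec = {(q, p). q \<subseteq>\<^sub>m p \<and> q \<noteq> p},
       sord = (\<lambda>p. {(a, b). (the (a (vlen p)), the (b (vlen p))) \<in> Y}) \<rparr>"

definition vertex_sum :: "(omega1 \<rightharpoonup> 'y) \<Rightarrow> (omega1 \<rightharpoonup> 'y) \<Rightarrow> (omega1 \<rightharpoonup> 'y)" where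
  "vertex_sum p q =
     (\<lambda>l. if l < vlen p then p l else q (THE k. vlen p \<oplus>\<^sub>o k = l))"

definition additive :: "'y rel \<Rightarrow> (omega1 \<rightharpoonup> 'y) set \<Rightarrow> bool" where
  "additive Y T \<longleftrightarrow>
     T \<subseteq> simple_verts Y \<and>
     tree_root (simple_tree Y) \<in> T \<and>
     (\<forall>p\<in>simple_verts Y. order_of (simple_tree Y) p =o natLeq_on 1 \<longrightarrow> p \<in> T) \<and>
     (\<forall>p\<in>simple_verts Y. \<forall>q\<in>simple_verts Y. vertex_sum p q \<in> T \<longleftrightarrow> p \<in> T \<and> q \<in> T)"

definition has_additive_tree :: "'y rel \<Rightarrow> 'a rel \<Rightarrow> bool" where
  "has_additive_tree Y X \<longleftrightarrow>
     (\<exists>T1. subtree (simple_tree Y) T1 \<and> additive Y T1 \<and>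
        Omega_bounded (simple_tree Y\<lparr>verts := T1\<rparr>) \<and>
        completion_isomorphic (branch_space (simple_tree Y\<lparr>verts := T1\<rparr>)) X)"

text \<open>
  HOL cannot quantify over types inside a formula, so a vertex type has to be chosen for an
  existential statement about arbitrary trees. The left summand \<open>'v\<close> is a type variable, so
  trees on every type are covered; the right summand guarantees that the type contains all
  vertices of the simple tree on a set of reals.
\<close>

type_synonym 'v vertex = "'v + (omega1 \<rightharpoonup> real)"

end

theory Submission
 imports Defs
begin

text \<open>
  From trees to orders: in the completion of the branch space of a reproductive tree, every vertex
  spans an open interval isomorphic to the whole. For a point \<open>a\<close> consider the vertices whose interval
  contains \<open>a\<close>. If there is a last one, the order of its successors describes the points above \<open>a\<close>
  inside its interval; otherwise countably many right end points decrease to \<open>a\<close> or to the end of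
  the interior of their intersection. Either way the set of points above \<open>a\<close> is isomorphic to the
  whole, and so is dually the set of points below \<open>a\<close>; this is enough for homogeneity.

  From orders to trees: for every letter \<open>s\<close> of an alphabet choose an isomorphism of \<open>X\<close> onto an open
  interval, the intervals being ordered like the letters, and compose these maps along transfinite
  words. At a limit the nested intervals are either degenerate, and the word is a branch, or the
  interior of their intersection is again isomorphic to \<open>X\<close>, and the word is a vertex. The isomorphism
  at a limit is chosen coherently for eventually equal words and multiplicatively for the Cantor
  normal form of the length; hence whether a word is a vertex depends on its summands only, which is
  additivity. Branches are countable because \<open>X\<close> has no uncountable monotone sequence.

  For (2) the letters are the integers. For (3) and (4) they are the infinite integer words with
  nondegenerate intersection, coded by reals through contractions of the line onto \<open>(z, z + 1)\<close>;
  one of the interval maps fixes an interval pointwise, so that such words exist.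
\<close>

section \<open>Isomorphisms of linear orders\<close>

text \<open>Homogeneity is tested on final and initial segments only: by completeness an open convex
  set is an interval, a segment or everything, and a fixed point of an isomorphism onto an interval
  turns it into one onto a segment. Isomorphisms also respect a marked set \<open>C\<close> (see
  \<open>sim\<close>): \<open>C = {}\<close> serves completions, and \<open>C = D\<close> the dense
  set of reals, whose homogeneity comes from maps of the line that preserve \<open>D\<close>.

  Boundedness by the first uncountable ordinal enters as countability of chains of vertices: the end
  points along a chain have a coinitial sequence of type omega, along which gaps that are copies of
  the whole are summed by comparison with one fixed sequence of such gaps.

  The obstacle to additivity is that the isomorphism chosen at a limit is arbitrary, so a word and
  its tail might survive different limits. Let \<open>i = a + k\<close> with \<open>a\<close>
  indecomposable and \<open>k\<close> a limit. Either some \<open>m < k\<close> absorbs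
  \<open>a\<close>, and then the word and its tail agree from \<open>m\<close> on and coherence
  compares them; or \<open>a\<close> is the leading term of every \<open>a + l\<close> with
  \<open>0 < l < k\<close>, and multiplicativity compares them.\<close>

definition siso :: "('a => 'a => bool) => ('b => 'b => bool) => ('a => 'b) => 'a set => 'b set => bool" where
 "siso lt lt' f U V \<longleftrightarrow> bij_betw f U V & (ALL x:U. ALL y:U. lt x y \<longleftrightarrow> lt' (f x) (f y))"

lemma siso_id: "siso lt lt (\<lambda>x. x) U U" by (auto simp: siso_def bij_betw_def)

lemma siso_comp: "siso lt lt' f U V ==> siso lt' lt'' g V W ==> siso lt lt'' (g \<circ> f) U W"
 unfolding siso_def using bij_betw_trans bij_betwE by (metis comp_apply)

lemma siso_inv: "siso lt lt' f U V ==> siso lt' lt (inv_into U f) V U" unfolding siso_def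
proof (intro conjI ballI; elim conjE)
 assume f: "bij_betw f U V" "ALL x:U. ALL y:U. lt x y = lt' (f x) (f y)"
 thus b: "bij_betw (inv_into U f) V U" by (simp add: bij_betw_inv_into)
 fix x y assume "x : V" "y : V"
 thus "lt' x y = lt (inv_into U f x) (inv_into U f y)"
  using f bij_betwE[OF b] bij_betw_inv_into_right[OF f(1)] by simp
qed

lemma siso_subset: "siso lt lt' f U V ==> W <= U ==> siso lt lt' f W (f ` W)"
 unfolding siso_def by (metis bij_betw_subset subsetD)

lemma siso_mem: "siso lt lt' f U V ==> x : U ==> f x : V" unfolding siso_def by (auto dest: bij_betwE)

lemma siso_less: "siso lt lt' f U V ==> x : U ==> y : U ==> lt' (f x) (f y) \<longleftrightarrow> lt x y"
 unfolding siso_def by auto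

lemma siso_eq: "siso lt lt' f U V ==> x : U ==> y : U ==> f x = f y \<longleftrightarrow> x = y"
 unfolding siso_def bij_betw_def inj_on_def by auto

lemma siso_image: "siso lt lt' f U V ==> f ` U = V" unfolding siso_def by (auto dest: bij_betw_imp_surj_on)

lemma siso_Collect:
 "siso lt lt' h U V ==> (!!x. x : U ==> P x \<longleftrightarrow> Q (h x)) ==> h ` {x:U. P x} = {y:V. Q y}"
 unfolding siso_def bij_betw_def by auto

lemma siso_surj: "siso lt lt' f U V ==> y : V ==> EX x:U. f x = y" using siso_image by fast

lemma siso_cong: "siso lt lt' f U V ==> (!!x. x : U ==> g x = f x) ==> siso lt lt' g U V"
 unfolding siso_def by (metis bij_betw_cong)

text \<open>The blocks are not assumed disjoint: totality of \<open>lti\<close> and asymmetry of the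
  orders force it, so the index picked by \<open>SOME\<close> is unambiguous and comparison of
  points in different blocks reduces to comparison of indices.\<close>

lemma siso_glue:
 assumes f: "!!i. i : I ==> siso lt lt' (f i) (U i) (V i)"
  and tot: "!!i j. i : I ==> j : I ==> i ~= j ==> lti i j \<or> lti j i"
  and U: "!!i j x y. i : I ==> j : I ==> lti i j ==> x : U i ==> y : U j ==> lt x y"
  and V: "!!i j x y. i : I ==> j : I ==> lti i j ==> x : V i ==> y : V j ==> lt' x y"
  and as: "!!x y. lt x y ==> ~ lt y x" "!!x y. lt' x y ==> ~ lt' y x"
 shows "EX g. siso lt lt' g (\<Union>i\<in>I. U i) (\<Union>i\<in>I. V i) & (ALL i:I. ALL x:U i. g x = f i x)"
proof -
 define g where "g x = f (SOME i. i : I & x : U i) x" for x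
 have uniq: "i = j" if "i : I" "j : I" "x : U i" "x : U j" for i j x
  using that tot[of i j] U[of i j x x] U[of j i x x] as(1)[of x x] by blast
 have g: "g x = f i x" if "i : I" "x : U i" for i x
 proof -
  have "(SOME i. i : I & x : U i) = i" using that uniq by (intro some_equality) auto
  thus ?thesis by (simp add: g_def)
 qed
 have lt: "lt x y \<longleftrightarrow> lt' (g x) (g y)" if "i : I" "j : I" "x : U i" "y : U j" for i j x y
 proof (cases "i = j")
  case True
  thus ?thesis using that g f[of i] by (simp add: siso_less)
 next
  case False
  have "g x : V i" "g y : V j" using that g f siso_mem by metis+
  thus ?thesis using False tot[of i j] that U[of i j x y] U[of j i y x] V[of i j "g x" "g y"]
    V[of j i "g y" "g x"] as by blast
 qed
 have "inj_on g (\<Union>i\<in>I. U i)"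
 proof (rule inj_onI)
  fix x y assume "x : (\<Union>i\<in>I. U i)" "y : (\<Union>i\<in>I. U i)" and eq: "g x = g y"
  then obtain i j where ij: "i : I" "x : U i" "j : I" "y : U j" by auto
  have m: "g x : V i" "g y : V j" using ij g f siso_mem by metis+
  have "i = j"
   using tot[of i j] V[of i j "g x" "g y"] V[of j i "g y" "g x"] as(2)[of "g x" "g x"] ij m eq by auto
  thus "x = y" using ij eq g f[of i] siso_eq by metis
 qed
 moreover have "g ` (\<Union>i\<in>I. U i) = (\<Union>i\<in>I. V i)"
 proof -
  have "g ` U i = V i" if "i : I" for i
   using siso_image[OF f[OF that]] g[OF that] by (metis (no_types, lifting) image_cong)
  thus ?thesis by (simp add: image_UN)
 qed
 ultimately have "siso lt lt' g (\<Union>i\<in>I. U i) (\<Union>i\<in>I. V i)"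
  unfolding siso_def bij_betw_def using lt by blast
 thus ?thesis using g by blast
qed

locale lin = linorder less_eq less
 for less_eq :: "'a => 'a => bool" (infix \<open><=.\<close> 50) and less (infix \<open><.\<close> 50)
begin

lemma siso_mono:
 assumes "bij_betw f U V" "!!x y. x : U ==> y : U ==> x <. y ==> f x <. f y"
 shows "siso (<.) (<.) f U V" unfolding siso_def using assms by (metis less_asym neqE less_irrefl)

text \<open>\<open>C\<close> acts as a colouring that the isomorphism respects. With
  \<open>C = {}\<close> this is plain isomorphism; with \<open>C\<close> a dense subset of the line
  it yields isomorphisms of \<open>C\<close> by restriction.\<close>

definition sim :: "'a set => 'a set => 'a set => bool" where
 "sim C U V \<longleftrightarrow> (EX f. siso (<.) (<.) f U V & (ALL x:U. f x : C \<longleftrightarrow> x : C))"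

lemma sim_refl: "sim C U U" unfolding sim_def using siso_id by blast

lemma sim_sym: "sim C U V ==> sim C V U" unfolding sim_def
proof (elim exE conjE)
 fix f assume f: "siso (<.) (<.) f U V" "ALL x:U. (f x : C) = (x : C)"
 have "inv_into U f y : C \<longleftrightarrow> y : C" if "y : V" for y
  using f that siso_image[OF f(1)] by (metis f_inv_into_f inv_into_into)
 thus "EX f. siso (<.) (<.) f V U & (ALL x:V. (f x : C) = (x : C))" using siso_inv[OF f(1)] by blast
qed

lemma sim_trans: "sim C U V ==> sim C V W ==> sim C U W" unfolding sim_def
proof (elim exE conjE)
 fix f g assume f: "siso (<.) (<.) f U V" "ALL x:U. (f x : C) = (x : C)"
  and g: "siso (<.) (<.) g V W" "ALL x:V. (g x : C) = (x : C)"
 thus "EX f. siso (<.) (<.) f U W & (ALL x:U. (f x : C) = (x : C))"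
  using siso_comp[OF f(1) g(1)] siso_mem[OF f(1)] by (intro exI[of _ "g \<circ> f"]) auto
qed

lemma sim_glue:
 assumes "!!i. i : I ==> sim C (U i) (V i)"
  and tot: "!!i j. i : I ==> j : I ==> i ~= j ==> lti i j \<or> lti j i"
  and U: "!!i j x y. i : I ==> j : I ==> lti i j ==> x : U i ==> y : U j ==> x <. y"
  and V: "!!i j x y. i : I ==> j : I ==> lti i j ==> x : V i ==> y : V j ==> x <. y"
 shows "sim C (\<Union>i\<in>I. U i) (\<Union>i\<in>I. V i)"
proof -
 obtain f where f: "!!i. i : I ==> siso (<.) (<.) (f i) (U i) (V i)"
  "!!i x. i : I ==> x : U i ==> f i x : C \<longleftrightarrow> x : C" using assms(1) unfolding sim_def by metis
 obtain g where g: "siso (<.) (<.) g (\<Union>i\<in>I. U i) (\<Union>i\<in>I. V i)" "!!i x. i : I ==> x : U i ==> g x = f i x"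
 proof -
  have "EX g. siso (<.) (<.) g (\<Union>i\<in>I. U i) (\<Union>i\<in>I. V i) & (ALL i:I. ALL x:U i. g x = f i x)"
  proof (rule siso_glue[where lti = lti])
   show "x <. y" if "i : I" "j : I" "lti i j" "x : U i" "y : U j" for i j x y using U that .
   show "x <. y" if "i : I" "j : I" "lti i j" "x : V i" "y : V j" for i j x y using V that .
  qed (use f(1) tot in auto)
  thus ?thesis using that by blast
 qed
 show ?thesis unfolding sim_def using g f(2) by (intro exI[of _ g]) auto
qed

lemma sim_Un:
 assumes "sim C U V" "sim C U' V'" "!!x y. x : U ==> y : U' ==> x <. y"
  "!!x y. x : V ==> y : V' ==> x <. y"
 shows "sim C (U \<union> U') (V \<union> V')"
proof -
 have "sim C (\<Union>b\<in>UNIV. if b then U' else U) (\<Union>b\<in>UNIV. if b then V' else V)"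
  by (rule sim_glue[where lti = "\<lambda>a b. ~ a & b"]) (use assms in \<open>auto split: if_splits\<close>)
 thus ?thesis by (simp add: UNIV_bool Un_commute)
qed

end

section \<open>Complete linear orders without endpoints\<close>

text \<open>The order is total on the whole type, but only its restriction to the carrier \<open>A\<close> matters.\<close>

locale clo = lin less_eq less
 for less_eq :: "'a => 'a => bool" (infix \<open><=.\<close> 50) and less (infix \<open><.\<close> 50) +
 fixes A :: "'a set"
 assumes ne: "A ~= {}"
  and no_top: "x : A ==> EX y:A. x <. y"
  and no_bot: "x : A ==> EX y:A. y <. x"
  and dense: "x : A ==> y : A ==> x <. y ==> EX z:A. x <. z & z <. y"
  and complete: "S <= A ==> S ~= {} ==> u : A ==> (!!x. x : S ==> x <=. u) ==>
   EX s:A. (ALL x:S. x <=. s) & (ALL v:A. (ALL x:S. x <=. v) --> s <=. v)"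
begin

definition Up where "Up a = {x:A. a <. x}"
definition Dn where "Dn a = {x:A. x <. a}"
definition Ivl where "Ivl a b = {x:A. a <. x & x <. b}"

lemma complete_inf:
 assumes "S <= A" "S ~= {}" "u : A" "!!x. x : S ==> u <=. x"
 shows "EX s:A. (ALL x:S. s <=. x) & (ALL v:A. (ALL x:S. v <=. x) --> v <=. s)"
proof -
 let ?L = "{v:A. ALL x:S. v <=. x}"
 obtain a where a: "a : S" using assms by auto
 have "EX s:A. (ALL x:?L. x <=. s) & (ALL v:A. (ALL x:?L. x <=. v) --> s <=. v)"
  by (rule complete[of ?L a]) (use assms a in auto)
 then obtain s where s: "s : A" "ALL x:?L. x <=. s" "ALL v:A. (ALL x:?L. x <=. v) --> s <=. v" by blast
 have "s <=. x" if "x : S" for x using s(3) that assms(1) by auto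
 thus ?thesis using s by blast
qed

text \<open>Statements about lower sets are obtained by interpreting the locale in the reversed
  order; the equations collected in \<open>duals\<close> translate the notions back.\<close>

lemma clo_dual: "clo (\<lambda>x y. y <=. x) (\<lambda>x y. y <. x) A"
proof -
 interpret d: linorder "\<lambda>x y. y <=. x" "\<lambda>x y. y <. x" by (rule dual_linorder)
 show ?thesis
 proof (unfold_locales, goal_cases)
  case 1 show ?case by (rule ne)
 next
  case (2 x) thus ?case by (rule no_bot)
 next
  case (3 x) thus ?case by (rule no_top)
 next
  case (4 x y) thus ?case using dense[of y x] by blast
 next
  case (5 S u) thus ?case by (rule complete_inf)
 qed
qed

lemma Up_dual: "clo.Up (\<lambda>x y. y <. x) A = Dn"
 and Dn_dual: "clo.Dn (\<lambda>x y. y <. x) A = Up"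
 and Ivl_dual: "clo.Ivl (\<lambda>x y. y <. x) A a b = Ivl b a"
 by (auto simp: clo.Up_def[OF clo_dual] clo.Dn_def[OF clo_dual] clo.Ivl_def[OF clo_dual]
   Up_def Dn_def Ivl_def fun_eq_iff)

lemma siso_dual: "siso (\<lambda>x y. y <. x) (\<lambda>x y. y <. x) f U V = siso (<.) (<.) f U V"
 unfolding siso_def by blast

lemma lin_dual: "lin (\<lambda>x y. y <=. x) (\<lambda>x y. y <. x)" by (intro lin.intro dual_linorder)

lemma sim_dual: "lin.sim (\<lambda>x y. y <. x) C U V = sim C U V"
 by (simp add: lin.sim_def[OF lin_dual] sim_def siso_dual)

lemmas duals = Up_dual Dn_dual Ivl_dual sim_dual siso_dual

section \<open>Similarity of segments and intervals\<close>

lemma siso_Up: "siso (<.) (<.) h A V ==> a : A ==> h ` Up a = {x:V. h a <. x}"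
 unfolding Up_def by (rule siso_Collect) (simp_all add: siso_less)

lemma siso_Dn: "siso (<.) (<.) h A V ==> a : A ==> h ` Dn a = {x:V. x <. h a}"
 unfolding Dn_def by (rule siso_Collect) (simp_all add: siso_less)

text \<open>Knaster-Tarski: take the infimum of the points with \<open>h x <= x\<close>. The point
  \<open>q\<close> lies in this set, and \<open>p\<close> bounds it from below because
  \<open>p\<close> is below every value of \<open>h\<close>.\<close>

lemma siso_fixpoint:
 assumes h: "siso (<.) (<.) h A (Ivl p q)" and pq: "p : A" "q : A" "p <. q"
 obtains r where "r : Ivl p q" "h r = r"
proof -
 let ?S = "{x:A. h x <=. x}"
 have hA: "h x : A" "p <. h x" "h x <. q" if "x : A" for x using siso_mem[OF h that] by (auto simp: Ivl_def)
 have hm: "h x <=. h y" if "x : A" "y : A" "x <=. y" for x y using siso_less[OF h] that by (metis le_less)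
 have "EX s:A. (ALL x:?S. s <=. x) & (ALL v:A. (ALL x:?S. v <=. x) --> v <=. s)"
 proof (rule complete_inf[of _ p])
  show "?S ~= {}" using hA[OF pq(2)] pq(2) by auto
  fix x assume "x : ?S" thus "p <=. x" using hA[of x] by auto
 qed (use pq in auto)
 then obtain r where r: "r : A" "ALL x:?S. r <=. x" "ALL v:A. (ALL x:?S. v <=. x) --> v <=. r" by blast
 have "h r <=. r"
 proof -
  have "ALL x:?S. h r <=. x" using r(1,2) hm order_trans by blast
  thus ?thesis using r(3) hA(1)[OF r(1)] by blast
 qed
 moreover from this have "r <=. h r" using r hA[OF r(1)] hm[of "h r" r] by auto
 ultimately have "h r = r" by simp
 thus ?thesis using that siso_mem[OF h r(1)] by metis
qed

text \<open>Keep everything up to a fixed point of the isomorphism \<open>A \<rightarrow> (p, q)\<close>, and contract above it.\<close>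

lemma sim_Up:
 assumes "sim C A (Ivl p q)" and pq: "p : A" "q : A" "p <. q"
 shows "sim C A (Up p)"
proof -
 obtain h where h: "siso (<.) (<.) h A (Ivl p q)" "ALL x:A. h x : C \<longleftrightarrow> x : C"
  using assms unfolding sim_def by blast
 obtain r where r: "r : Ivl p q" "h r = r" using siso_fixpoint[OF h(1) pq] .
 have rA: "r : A" using r by (auto simp: Ivl_def)
 have hr: "h ` Up r = {x:Ivl p q. r <. x}" using siso_Up[OF h(1) rA] r by simp
 have "sim C (Up r) {x:Ivl p q. r <. x}"
  unfolding sim_def using siso_subset[OF h(1), of "Up r"] h(2) hr by (auto simp: Up_def)
 hence "sim C ({x:A. p <. x & x <=. r} \<union> Up r) ({x:A. p <. x & x <=. r} \<union> {x:Ivl p q. r <. x})"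
  by (intro sim_Un sim_refl) (auto simp: Up_def)
 moreover have "{x:A. p <. x & x <=. r} \<union> Up r = Up p" using r by (auto simp: Up_def Ivl_def)
 moreover have "{x:A. p <. x & x <=. r} \<union> {x:Ivl p q. r <. x} = Ivl p q" using r by (auto simp: Ivl_def)
 ultimately have "sim C (Up p) (Ivl p q)" by simp
 thus ?thesis using assms(1) sim_sym sim_trans by blast
qed

lemma sim_Dn:
 assumes "sim C A (Ivl p q)" and pq: "p : A" "q : A" "p <. q"
 shows "sim C A (Dn q)"
proof -
 interpret d: clo "\<lambda>x y. y <=. x" "\<lambda>x y. y <. x" A by (rule clo_dual)
 show ?thesis using d.sim_Up[of C q p] assms by (simp add: duals)
qed

text \<open>Cut the whole order at \<open>b\<close>: the part below goes to \<open>(a, b)\<close>,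
  the part above to \<open>(b, c)\<close>, and \<open>b\<close> stays fixed, so its colour is
  automatically preserved.\<close>

lemma sim_Ivl_trans:
 assumes ab: "sim C A (Ivl a b)" and bc: "sim C A (Ivl b c)"
  and "a : A" "b : A" "c : A" "a <. b" "b <. c"
 shows "sim C A (Ivl a c)"
proof -
 have "sim C (Dn b) (Ivl a b)" "sim C (Up b) (Ivl b c)"
  using sim_Dn[OF ab] sim_Up[OF bc] ab bc assms sim_sym sim_trans by blast+
 hence "sim C (Dn b \<union> ({b} \<union> Up b)) (Ivl a b \<union> ({b} \<union> Ivl b c))"
  by (intro sim_Un sim_refl) (use assms in \<open>auto simp: Dn_def Up_def Ivl_def\<close>)
 moreover have "Dn b \<union> ({b} \<union> Up b) = A" "Ivl a b \<union> ({b} \<union> Ivl b c) = Ivl a c"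
  using assms by (auto simp: Dn_def Up_def Ivl_def)
 ultimately show ?thesis by simp
qed

section \<open>Gaps summed along a decreasing sequence\<close>

lemma decseq_cover:
 assumes "!!n. f (Suc n) <. f n" "y <. f 0" "f m <=. y"
 shows "EX n. f (Suc n) <=. y & y <. f n"
proof -
 define n where "n = (LEAST k. f k <=. y)"
 have n: "f n <=. y" unfolding n_def by (rule LeastI, rule assms(3))
 have "n ~= 0" using n assms(2) by (metis not_le)
 then obtain k where k: "n = Suc k" using not0_implies_Suc by blast
 have "~ f k <=. y" using not_less_Least[of k "\<lambda>k. f k <=. y"] k n_def by auto
 thus ?thesis using n k not_le by auto
qed

lemma decseq_less:
 assumes "!!n. f (Suc n) <. f n" "m < n"
 shows "f n <. f m" using assms(2)
proof (induction n)
 case (Suc n)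
 thus ?case using assms(1)[of n] by (metis less_trans less_Suc_eq)
qed simp

text \<open>The reference sequence for all later sums of gaps. Its points avoid \<open>C\<close> so
  that they can be matched with the division points of another sequence avoiding
  \<open>C\<close>.\<close>

definition coin :: "'a set => bool" where
 "coin C \<longleftrightarrow> (EX c::nat => 'a. (ALL n. c n : A & c n ~: C & c (Suc n) <. c n & sim C A (Ivl (c (Suc n)) (c n))) &
   (ALL x:A. EX n. c n <. x))"

text \<open>Each block is a gap together with the division point on top of it. Block 0 lacks its top
  point because \<open>f 0\<close> does not belong to the open interval.\<close>

lemma decseq_pieces:
 assumes "!!n. f (Suc n) <. f n" "!!n. f n : A" "!!n. a <. f n" "!!x. x : A ==> a <. x ==> EX n. f n <. x"
 shows "Ivl a (f 0) = (\<Union>n. (if n = 0 then {} else {f n}) \<union> Ivl (f (Suc n)) (f n))"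
proof (intro equalityI subsetI)
 fix x assume x: "x : Ivl a (f 0)"
 then obtain m where "f m <. x" using assms(4) by (auto simp: Ivl_def)
 then obtain n where n: "f (Suc n) <=. x" "x <. f n"
  using decseq_cover[of f x m, OF assms(1)] x less_imp_le by (auto simp: Ivl_def)
 show "x : (\<Union>n. (if n = 0 then {} else {f n}) \<union> Ivl (f (Suc n)) (f n))"
 proof (cases "f (Suc n) = x")
  case True
  thus ?thesis by (intro UN_I[of "Suc n"]) auto
 next
  case False
  thus ?thesis using n x by (intro UN_I[of n]) (auto simp: Ivl_def)
 qed
next
 fix x assume "x : (\<Union>n. (if n = 0 then {} else {f n}) \<union> Ivl (f (Suc n)) (f n))"
 then obtain n where n: "n ~= 0 & x = f n \<or> x : Ivl (f (Suc n)) (f n)" by (auto split: if_splits)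
 have le: "f n <=. f 0" using decseq_less[of f 0 n, OF assms(1)] by (cases "n = 0") auto
 from n show "x : Ivl a (f 0)"
 proof
  assume "n ~= 0 & x = f n"
  thus ?thesis using decseq_less[of f 0 n, OF assms(1)] assms(2,3) by (auto simp: Ivl_def)
 next
  assume "x : Ivl (f (Suc n)) (f n)"
  thus ?thesis using assms(3)[of "Suc n"] le by (auto simp: Ivl_def)
 qed
qed

lemma decseq_pieces_less:
 assumes f: "!!n. f (Suc n) <. f n" and "m < n"
  "x : (if n = 0 then {} else {f n}) \<union> Ivl (f (Suc n)) (f n)"
  "y : (if m = 0 then {} else {f m}) \<union> Ivl (f (Suc m)) (f m)"
 shows "x <. y"
proof -
 have "x <=. f n" using assms(3) by (auto simp: Ivl_def split: if_splits)
 moreover have "f n <=. f (Suc m)" using decseq_less[of f "Suc m" n, OF f] assms(2) by (cases "Suc m = n") auto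
 moreover have "f (Suc m) <. y" using assms(4) f by (auto simp: Ivl_def split: if_splits)
 ultimately show ?thesis by order
qed

text \<open>Both sequences have type omega reversed, gaps similar to \<open>A\<close> and division
  points outside \<open>C\<close>. Hence the intervals can be matched block by block, and the
  reference sequence fills \<open>Dn (c 0)\<close>, which is a copy of \<open>A\<close>.\<close>

lemma sim_decseq:
 assumes co: "coin C"
  and f: "!!n. f (Suc n) <. f n" "!!n. f n : A" "!!n. a <. f n"
   "!!x. x : A ==> a <. x ==> EX n. f n <. x"
   "!!n. f n ~: C" "!!n. sim C A (Ivl (f (Suc n)) (f n))"
 shows "sim C A (Ivl a (f 0))"
proof -
 obtain c :: "nat => 'a" where c: "!!n. c n : A" "!!n. c n ~: C" "!!n. c (Suc n) <. c n"
  "!!n. sim C A (Ivl (c (Suc n)) (c n))" "!!x. x : A ==> EX n. c n <. x" using co unfolding coin_def by blast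
 have c0: "Dn (c 0) = (\<Union>n. (if n = 0 then {} else {c n}) \<union> Ivl (c (Suc n)) (c n))"
 proof -
  have "Dn (c 0) <= (\<Union>n. (if n = 0 then {} else {c n}) \<union> Ivl (c (Suc n)) (c n))"
  proof
   fix x assume x: "x : Dn (c 0)"
   hence xA: "x : A" "x <. c 0" by (auto simp: Dn_def)
   then obtain m where m: "c m <. x" using c(5) by blast
   obtain n where n: "c (Suc n) <=. x" "x <. c n"
    using decseq_cover[of c x m, OF c(3)] xA m less_imp_le by blast
   show "x : (\<Union>n. (if n = 0 then {} else {c n}) \<union> Ivl (c (Suc n)) (c n))"
   proof (cases "c (Suc n) = x")
    case True
    thus ?thesis by (intro UN_I[of "Suc n"]) auto
   next
    case False
    thus ?thesis using n xA by (intro UN_I[of n]) (auto simp: Ivl_def)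
   qed
  qed
  moreover have "(if n = 0 then {} else {c n}) \<union> Ivl (c (Suc n)) (c n) <= Dn (c 0)" for n
   using decseq_less[of c 0 n, OF c(3)] c(1) by (cases "n = 0") (auto simp: Ivl_def Dn_def)
  ultimately show ?thesis by blast
 qed
 have f0: "Ivl a (f 0) = (\<Union>n. (if n = 0 then {} else {f n}) \<union> Ivl (f (Suc n)) (f n))"
  by (rule decseq_pieces) (fact f)+
 have "sim C (Dn (c 0)) (Ivl a (f 0))" unfolding c0 f0
 proof (rule sim_glue[where lti = "\<lambda>m n. n < m"])
  fix n :: nat
  have "sim C (Ivl (c (Suc n)) (c n)) (Ivl (f (Suc n)) (f n))" using c(4) f(6) sim_sym sim_trans by blast
  moreover have "sim C (if n = 0 then {} else {c n}) (if n = 0 then {} else {f n})"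
   unfolding sim_def siso_def using c(2) f(5) by (intro exI[of _ "\<lambda>_. f n"]) (auto simp: bij_betw_def)
  ultimately have "sim C (Ivl (c (Suc n)) (c n) \<union> (if n = 0 then {} else {c n}))
    (Ivl (f (Suc n)) (f n) \<union> (if n = 0 then {} else {f n}))"
   by (intro sim_Un) (auto simp: Ivl_def split: if_splits)
  thus "sim C ((if n = 0 then {} else {c n}) \<union> Ivl (c (Suc n)) (c n))
    ((if n = 0 then {} else {f n}) \<union> Ivl (f (Suc n)) (f n))" by (simp add: Un_commute)
 next
  fix i j :: nat and x y
  assume "j < i" "x : (if i = 0 then {} else {c i}) \<union> Ivl (c (Suc i)) (c i)"
   "y : (if j = 0 then {} else {c j}) \<union> Ivl (c (Suc j)) (c j)"
  thus "x <. y" by (rule decseq_pieces_less[of c, OF c(3)])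
 next
  fix i j :: nat and x y
  assume "j < i" "x : (if i = 0 then {} else {f i}) \<union> Ivl (f (Suc i)) (f i)"
   "y : (if j = 0 then {} else {f j}) \<union> Ivl (f (Suc j)) (f j)"
  thus "x <. y" by (rule decseq_pieces_less[of f, OF f(1)])
 qed auto
 moreover have "sim C A (Dn (c 0))" using sim_Dn[of C "c 1" "c 0"] c(1,3,4)[of 0] c(1)[of 1] by simp
 ultimately show ?thesis using sim_trans by blast
qed

text \<open>Step \<open>n\<close> goes below both the current point and the \<open>n\<close>-th
  member of an enumeration of \<open>W\<close>, so the sequence passes every member.\<close>

lemma countable_coinitial:
 assumes "countable W" "W ~= {}" "!!x. x : W ==> EX y:W. y <. x" "w : W"
 obtains f :: "nat => 'a" where "f 0 = w" "!!n. f n : W" "!!n. f (Suc n) <. f n"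
  "!!x. x : W ==> EX n. f n <. x"
proof -
 define g where "g = from_nat_into W"
 have g: "g n : W" for n unfolding g_def using assms(2) by (rule from_nat_into)
 have gs: "EX n. g n = x" if "x : W" for x unfolding g_def using assms(1) that by (metis from_nat_into_surj)
 define nx where "nx x n = (SOME y. y : W & y <. x & y <. g n)" for x n
 have nx: "nx x n : W & nx x n <. x & nx x n <. g n" if "x : W" for x n
 proof -
  have "EX y:W. y <. x & y <. g n"
  proof (cases "x <. g n")
   case True
   thus ?thesis using assms(3)[OF that] less_trans by blast
  next
   case False
   thus ?thesis using assms(3)[OF g[of n]] less_le_trans not_less by blast
  qed
  hence "EX y. y : W & y <. x & y <. g n" by blast
  thus ?thesis unfolding nx_def by (rule someI_ex)
 qed
 define f where "f = rec_nat w (\<lambda>n x. nx x n)"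
 have f0: "f 0 = w" and fS: "f (Suc n) = nx (f n) n" for n by (simp_all add: f_def)
 have fW: "f n : W" for n using assms(4) nx by (induction n) (auto simp: f0 fS)
 show ?thesis
 proof (rule that[of f])
  fix x assume "x : W"
  then obtain n where "g n = x" using gs by blast
  hence "f (Suc n) <. x" using nx[OF fW[of n], of n] fS by simp
  thus "EX n. f n <. x" by blast
 next
  show "f (Suc n) <. f n" for n using nx[OF fW[of n], of n] fS by simp
 qed (use f0 fW in auto)
qed

definition leads :: "'a set => 'a => 'a => bool" where
 "leads C a b \<longleftrightarrow> a = b \<or> (a <. b & sim C A (Ivl a b))"

lemma leads_trans: "leads C a b ==> leads C b c ==> a : A ==> b : A ==> c : A ==> leads C a c"
 unfolding leads_def using sim_Ivl_trans[of C a b c] less_trans by blast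

text \<open>The limit step of the inductions along chains. If the infimum \<open>a\<close> is not
  attained, then \<open>W\<close> has no least member, a strictly decreasing sequence starting at
  \<open>w\<close> is coinitial in it, and its gaps are summed by \<open>sim_decseq\<close>.\<close>

lemma leads_inf:
 assumes co: "coin C" and W: "countable W" "W <= A - C" "w : W"
  and a: "a : A" "!!x. x : W ==> a <=. x" "!!v. v : A ==> (!!x. x : W ==> v <=. x) ==> v <=. a"
  and leads: "!!x y. x : W ==> y : W ==> x <. y ==> leads C x y"
 shows "leads C a w"
proof (cases "a : W")
 case True
 thus ?thesis using leads[OF True W(3)] a(2)[OF W(3)] unfolding leads_def by auto
next
 case False
 have nomin: "EX y:W. y <. x" if "x : W" for x
 proof (rule ccontr)
  assume "~ ?thesis"
  hence "x <=. a" using a(3)[of x] that W(2) by (meson DiffD1 not_less subsetD)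
  thus False using a(2)[OF that] False that order_antisym by blast
 qed
 obtain f where f: "f 0 = w" "!!n. f n : W" "!!n. f (Suc n) <. f n" "!!x. x : W ==> EX n. f n <. x"
  using countable_coinitial[OF W(1) _ nomin W(3)] W(3) by blast
 have af: "a <. f n" for n using a(2)[OF f(2)[of n]] False f(2)[of n] by (metis le_less)
 have "sim C A (Ivl a (f 0))"
 proof (rule sim_decseq[OF co])
  show "f (Suc n) <. f n" "a <. f n" for n by (fact f(3), fact af)
  fix x assume x: "x : A" "a <. x"
  then obtain y where "y : W" "y <. x" using a(3)[of x] by (meson not_le)
  thus "EX n. f n <. x" using f(4) less_trans by blast
 next
  fix n show "sim C A (Ivl (f (Suc n)) (f n))"
   using leads[OF f(2)[of "Suc n"] f(2)[of n] f(3)[of n]] f(3)[of n] unfolding leads_def by auto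
 qed (use f(2) W(2) in auto)
 thus ?thesis unfolding leads_def using af[of 0] f(1) by simp
qed

lemma leads_Up: "leads C a b ==> a ~= b ==> a : A ==> b : A ==> sim C A (Up a)"
 unfolding leads_def using sim_Up[of C a b] by blast

text \<open>An interval \<open>(a, b)\<close> is the image of a lower segment under the isomorphism
  onto \<open>Up a\<close>. By completeness the points above some member of \<open>U\<close> form an
  upper segment or everything, dually for those below some member, and \<open>U\<close> is the
  intersection of the two.\<close>

lemma sim_convex:
 assumes Up: "!!a. a : A ==> sim C A (Up a)" and Dn: "!!a. a : A ==> sim C A (Dn a)"
  and U: "U <= A" "U ~= {}" "!!x y z. x : U ==> y : U ==> z : A ==> x <. z ==> z <. y ==> z : U"
   "!!x. x : U ==> EX y:U. x <. y" "!!x. x : U ==> EX y:U. y <. x"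
 shows "sim C A U"
proof -
 have Ivl: "sim C A (Ivl a b)" if ab: "a : A" "b : A" "a <. b" for a b
 proof -
  obtain h where h: "siso (<.) (<.) h A (Up a)" "ALL x:A. h x : C \<longleftrightarrow> x : C"
   using Up[OF ab(1)] unfolding sim_def by blast
  obtain b' where b': "b' : A" "h b' = b" using siso_surj[OF h(1), of b] ab by (auto simp: Up_def)
  have "sim C (Dn b') (h ` Dn b')"
   unfolding sim_def using siso_subset[OF h(1), of "Dn b'"] h(2) by (auto simp: Dn_def)
  moreover have "h ` Dn b' = Ivl a b" using siso_Dn[OF h(1) b'(1)] b' by (auto simp: Up_def Ivl_def)
  ultimately show ?thesis using sim_trans[OF Dn[OF b'(1)]] by simp
 qed
 have lo: "(EX a:A. {x:A. EX u:U. u <. x} = Up a) \<or> {x:A. EX u:U. u <. x} = A"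
 proof (cases "EX b:A. ALL u:U. b <=. u")
  case True
  then obtain b where b: "b : A" "ALL u:U. b <=. u" by blast
  have "EX s:A. (ALL x:U. s <=. x) & (ALL v:A. (ALL x:U. v <=. x) --> v <=. s)"
   by (rule complete_inf[OF U(1,2) b(1)]) (use b(2) in simp)
  then obtain s where s: "s : A" "ALL x:U. s <=. x" "ALL v:A. (ALL x:U. v <=. x) --> v <=. s" by blast
  have "(EX u:U. u <. x) \<longleftrightarrow> s <. x" if "x : A" for x
   using s(2) s(3)[rule_format, OF that] le_less_trans not_le by blast
  hence "{x:A. EX u:U. u <. x} = Up s" unfolding Up_def by blast
  thus ?thesis using s(1) by blast
 next
  case False
  hence "ALL b:A. EX u:U. u <. b" using not_le by blast
  thus ?thesis by blast
 qed
 have hi: "(EX b:A. {x:A. EX u:U. x <. u} = Dn b) \<or> {x:A. EX u:U. x <. u} = A"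
 proof (cases "EX b:A. ALL u:U. u <=. b")
  case True
  then obtain b where b: "b : A" "ALL u:U. u <=. b" by blast
  have "EX s:A. (ALL x:U. x <=. s) & (ALL v:A. (ALL x:U. x <=. v) --> s <=. v)"
   by (rule complete[OF U(1,2) b(1)]) (use b(2) in simp)
  then obtain s where s: "s : A" "ALL x:U. x <=. s" "ALL v:A. (ALL x:U. x <=. v) --> s <=. v" by blast
  have "(EX u:U. x <. u) \<longleftrightarrow> x <. s" if "x : A" for x
   using s(2) s(3)[rule_format, OF that] less_le_trans not_le by blast
  hence "{x:A. EX u:U. x <. u} = Dn s" unfolding Dn_def by blast
  thus ?thesis using s(1) by blast
 next
  case False
  hence "ALL b:A. EX u:U. b <. u" using not_le by blast
  thus ?thesis by blast
 qed
 have U_eq: "U = {x:A. EX u:U. u <. x} \<inter> {x:A. EX u:U. x <. u}" (is "U = ?R")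
 proof
  show "U <= ?R" using U(1,4,5) by blast
  show "?R <= U" using U(3) by blast
 qed
 have AA: "sim C A A" by (rule sim_refl)
 show ?thesis
 proof (cases "EX a:A. {x:A. EX u:U. u <. x} = Up a")
  case True
  then obtain a where a: "a : A" "{x:A. EX u:U. u <. x} = Up a" by blast
  show ?thesis
  proof (cases "EX b:A. {x:A. EX u:U. x <. u} = Dn b")
   case True
   then obtain b where b: "b : A" "{x:A. EX u:U. x <. u} = Dn b" by blast
   have UI: "U = Ivl a b" using U_eq unfolding a(2) b(2) by (auto simp: Up_def Dn_def Ivl_def)
   hence "a <. b" using U(2) by (auto simp: Ivl_def)
   thus ?thesis using Ivl a b UI by blast
  next
   case False
   hence "U = Up a" using U_eq hi unfolding a(2) by (auto simp: Up_def)
   thus ?thesis using Up a by simp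
  qed
 next
  case False
  hence loA: "{x:A. EX u:U. u <. x} = A" using lo by blast
  show ?thesis
  proof (cases "EX b:A. {x:A. EX u:U. x <. u} = Dn b")
   case True
   then obtain b where b: "b : A" "{x:A. EX u:U. x <. u} = Dn b" by blast
   hence "U = Dn b" using U_eq loA by (auto simp: Dn_def)
   thus ?thesis using Dn b by simp
  next
   case False
   hence "U = A" using U_eq loA hi by auto
   thus ?thesis using AA by simp
  qed
 qed
qed

end

section \<open>Hulls, and extension of isomorphisms by cuts\<close>

context lin
begin

definition slt :: "'a set => 'a set => bool" where
 "slt U V \<longleftrightarrow> (ALL x:U. ALL y:V. x <. y)"

lemma slt_dual: "lin.slt (\<lambda>x y. y <. x) = (\<lambda>U V. slt V U)"
proof (intro ext)
 fix U V
 interpret d: lin "\<lambda>x y. y <=. x" "\<lambda>x y. y <. x" by (intro lin.intro dual_linorder)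
 show "d.slt U V = slt V U" unfolding d.slt_def slt_def by blast
qed

end

context clo
begin

text \<open>The convex hull in \<open>A\<close> stripped of its end points; for a set without
  largest and smallest member it contains that set.\<close>

definition chull :: "'a set => 'a set" where
 "chull U = {x:A. EX u:U. EX v:U. u <. x & x <. v}"

lemma chull_mono: "U <= V ==> chull U <= chull V" unfolding chull_def by (intro Collect_mono) blast

definition dense_in :: "'a set => bool" where
 "dense_in E \<longleftrightarrow> E <= A & (ALL x:A. ALL y:A. x <. y --> (EX e:E. x <. e & e <. y))"

lemma dense_inD: "dense_in E ==> x : A ==> y : A ==> x <. y ==> EX e:E. x <. e & e <. y"
 unfolding dense_in_def by blast

lemma dense_in_above: "dense_in E ==> a : A ==> EX e:E. a <. e" using no_top[of a] dense_inD[of E a] by blast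

lemma dense_in_below: "dense_in E ==> a : A ==> EX e:E. e <. a" using no_bot[of a] dense_inD[of E _ a] by blast

lemma chull_dense: "dense_in E ==> chull E = A" using dense_in_above dense_in_below unfolding chull_def by blast

text \<open>Extension by cuts: \<open>R x y\<close> says that \<open>y\<close> fills the cut of
  \<open>E'\<close> corresponding to the cut of \<open>E\<close> at \<open>x\<close>. Completeness
  gives such a \<open>y\<close>, density makes it unique. The clause on hulls is what later carries
  the interval of a vertex to the interval of a vertex.\<close>

lemma siso_extend:
 assumes dE: "dense_in E"
  and E': "E' <= A" "ALL x:chull E'. ALL y:chull E'. x <. y --> (EX e:E'. x <. e & e <. y)"
  and f: "siso (<.) (<.) f E E'"
 obtains F where "siso (<.) (<.) F A (chull E')" "!!W. W <= E ==> F ` chull W = chull (f ` W)"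
proof -
 define R where "R x y \<longleftrightarrow> (ALL a:E. (a <. x --> f a <=. y) & (x <. a --> y <=. f a))" for x y
 have E: "E <= A" "!!x y. x : A ==> y : A ==> x <. y ==> EX e:E. x <. e & e <. y"
  using dE unfolding dense_in_def by blast+
 note Eu = dense_in_above[OF dE] dense_in_below[OF dE]
 have fE: "f a : E'" "f a : A" if "a : E" for a using siso_mem[OF f that] E'(1) by auto
 have fm: "f a <. f b \<longleftrightarrow> a <. b" if "a : E" "b : E" for a b using siso_less[OF f that] .
 have fhull: "f a : chull E'" if aE: "a : E" for a
 proof -
  have "a : A" using aE E(1) by blast
  then obtain b c where "b : E" "a <. b" "c : E" "c <. a" using Eu[of a] by blast
  thus ?thesis unfolding chull_def using fE fm aE by blast
 qed
 have ex: "EX y:chull E'. R x y" if x: "x : A" for x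
 proof -
  let ?S = "f ` {a:E. a <. x}"
  obtain u v where u: "u : E" "u <. x" and v: "v : E" "x <. v" using Eu[OF x] by blast
  have "EX s:A. (ALL x:?S. x <=. s) & (ALL v:A. (ALL x:?S. x <=. v) --> s <=. v)"
  proof (rule complete[of _ "f v"])
   fix y assume "y : ?S"
   then obtain a where "a : E" "a <. x" "y = f a" by blast
   thus "y <=. f v" using fm[of a v] v by auto
  qed (use u v fE in auto)
  then obtain s where s: "s : A" "ALL x:?S. x <=. s" "ALL v:A. (ALL x:?S. x <=. v) --> s <=. v" by blast
  have R: "R x s" unfolding R_def
  proof (intro ballI conjI impI)
   fix a assume a: "a : E" "x <. a"
   have "f y <=. f a" if "y : E" "y <. x" for y using fm[of y a] that a less_imp_le less_trans by blast
   hence "ALL y:?S. y <=. f a" by blast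
   thus "s <=. f a" using s(3) fE[OF a(1)] by blast
  qed (use s(2) in auto)
  obtain u' where u': "u' : E" "u <. u'" "u' <. x" using E(2)[of u x] u x E(1) by blast
  obtain v' where v': "v' : E" "x <. v'" "v' <. v" using E(2)[of x v] v x E(1) by blast
  have "f u' <=. s" "s <=. f v'" using R u' v' unfolding R_def by auto
  moreover have "f u <. f u'" "f v' <. f v" using fm u u' v v' by auto
  ultimately have "f u <. s" "s <. f v" by order+
  hence "s : chull E'" unfolding chull_def using s(1) fE u v by blast
  thus ?thesis using R by blast
 qed
 \<comment> \<open>Two members \<open>e < e'\<close> of \<open>E'\<close> between \<open>y\<close>
   and \<open>y'\<close> are needed: with one alone, \<open>x\<close> could be its preimage, which
   violates neither cut condition.\<close>
 have uniq_aux: False if asm: "y : chull E'" "y' : chull E'" "R x y" "R x y'" "y <. y'" for x y y'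
 proof -
  obtain e where e: "e : E'" "y <. e" "e <. y'" using E'(2) asm by blast
  obtain a where a: "a : E" "f a = e" using siso_surj[OF f e(1)] by blast
  obtain e' where e': "e' : E'" "e <. e'" "e' <. y'"
   using E'(2)[rule_format, of e y'] fhull[OF a(1)] a e asm by blast
  obtain a' where a': "a' : E" "f a' = e'" using siso_surj[OF f e'(1)] by blast
  have "~ a <. x"
  proof
   assume "a <. x"
   hence "e <=. y" using asm(3) a unfolding R_def by blast
   thus False using e e' by order
  qed
  moreover have "~ x <. a'"
  proof
   assume "x <. a'"
   hence "y' <=. e'" using asm(4) a' unfolding R_def by blast
   thus False using e' by order
  qed
  moreover have "a <. a'" using fm[of a a'] a a' e'(2) by simp
  ultimately show False by order
 qed
 have uniq: "y = y'" if "y : chull E'" "y' : chull E'" "R x y" "R x y'" for x y y'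
  using uniq_aux[of y y' x] uniq_aux[of y' y x] that by (metis neqE)
 define F where "F x = (SOME y. y : chull E' & R x y)" for x
 have F: "F x : chull E'" "R x (F x)" if "x : A" for x
  using someI_ex[of "\<lambda>y. y : chull E' & R x y"] ex[OF that] unfolding F_def by blast+
 have Fm: "F x <. F y" if asm: "x : A" "y : A" "x <. y" for x y
 proof -
  obtain a where a: "a : E" "x <. a" "a <. y" using E(2) asm by blast
  obtain b where b: "b : E" "a <. b" "b <. y" using E(2)[of a y] asm a E(1) by blast
  have "F x <=. f a" using F(2)[OF asm(1)] a unfolding R_def by blast
  moreover have "f b <=. F y" using F(2)[OF asm(2)] b unfolding R_def by blast
  moreover have "f a <. f b" using fm a b by blast
  ultimately show ?thesis by order
 qed
 have Ff: "F a = f a" if "a : E" for a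
 proof (rule uniq[of _ _ a])
  show "R a (f a)" unfolding R_def using fm that by (auto simp: le_less)
 qed (use F that E(1) fhull in auto)
 have surj: "EX x:A. F x = y" if y: "y : chull E'" for y
 proof -
  obtain e1 e2 where e: "e1 : E'" "e1 <. y" "e2 : E'" "y <. e2" using y unfolding chull_def by blast
  obtain a1 a2 where a: "a1 : E" "f a1 = e1" "a2 : E" "f a2 = e2"
   using siso_surj[OF f e(1)] siso_surj[OF f e(3)] by blast
  let ?S = "{a:E. f a <. y}"
  have "EX s:A. (ALL x:?S. x <=. s) & (ALL v:A. (ALL x:?S. x <=. v) --> s <=. v)"
  proof (rule complete[of _ a2])
   fix x assume "x : ?S"
   hence "f x <. f a2" "x : E" using a e by auto
   thus "x <=. a2" using fm a by auto
  qed (use a e E(1) in auto)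
  then obtain s where s: "s : A" "ALL x:?S. x <=. s" "ALL v:A. (ALL x:?S. x <=. v) --> s <=. v" by blast
  have "R s y" unfolding R_def
  proof (intro ballI conjI impI)
   fix b assume b: "b : E" "b <. s"
   show "f b <=. y"
   proof (rule ccontr)
    assume "~ f b <=. y"
    hence yb: "y <. f b" by order
    have "x <=. b" if "x : E" "f x <. y" for x
    proof -
     have "f x <. f b" using that yb by order
     thus ?thesis using fm[of x b] that b less_imp_le by blast
    qed
    hence "ALL x:?S. x <=. b" by blast
    hence "s <=. b" using s(3) b E(1) by blast
    thus False using b(2) by order
   qed
  next
   fix b assume b: "b : E" "s <. b"
   show "y <=. f b"
   proof (rule ccontr)
    assume "~ y <=. f b"
    hence "f b <. y" by order
    hence "b <=. s" using s(2) b by blast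
    thus False using b(2) by order
   qed
  qed
  hence "F s = y" using uniq[of "F s" y s] F s(1) y by blast
  thus ?thesis using s(1) by blast
 qed
 have iso: "siso (<.) (<.) F A (chull E')"
 proof (rule siso_mono)
  have "inj_on F A" using Fm by (metis inj_onI less_irrefl neqE)
  moreover have "F ` A = chull E'" using F(1) surj by blast
  ultimately show "bij_betw F A (chull E')" unfolding bij_betw_def by blast
 qed (rule Fm)
 show ?thesis
 proof (rule that[OF iso])
  fix W assume W: "W <= E"
  have hA: "chull W <= A" unfolding chull_def by blast
  show "F ` chull W = chull (f ` W)"
  proof
   show "F ` chull W <= chull (f ` W)"
   proof
    fix y assume "y : F ` chull W"
    then obtain x u v where x: "y = F x" "x : A" "u : W" "v : W" "u <. x" "x <. v" unfolding chull_def by blast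
    have "F u <. F x" "F x <. F v" using Fm x W E(1) by blast+
    moreover have "F u = f u" "F v = f v" using Ff x W by blast+
    moreover have "F x : A" using F(1)[OF x(2)] unfolding chull_def by blast
    ultimately show "y : chull (f ` W)" unfolding chull_def using x by auto
   qed
   show "chull (f ` W) <= F ` chull W"
   proof
    fix y assume "y : chull (f ` W)"
    then obtain u v where uv: "u : W" "v : W" "f u <. y" "y <. f v" "y : A" unfolding chull_def by blast
    hence "y : chull E'" unfolding chull_def using fE W by blast
    then obtain x where x: "x : A" "F x = y" using surj by blast
    have "u : A" "v : A" using uv W E(1) by auto
    hence "u <. x" "x <. v"
     using siso_less[OF iso, of u x] siso_less[OF iso, of x v] Ff[of u] Ff[of v] uv x W by auto
    hence "x : chull W" unfolding chull_def using x uv by blast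
    thus "y : F ` chull W" using x by blast
   qed
  qed
 qed
qed

end

section \<open>Reproductive systems of convex sets\<close>

text \<open>
  The members of \<open>EE\<close> stand for the sets of branches through the vertices of a tree, the members of
  \<open>S\<close> for those of the vertices of order 1.
\<close>

locale esys = clo less_eq less A
 for less_eq :: "'a => 'a => bool" (infix \<open><=.\<close> 50) and less (infix \<open><.\<close> 50) and A +
 fixes EE S :: "'a set set" and E0 :: "'a set"
 assumes E0: "E0 : EE" "E0 <= A"
  and E0_dense: "x : A ==> y : A ==> less x y ==> EX e:E0. less x e & less e y"
  and mem: "U : EE ==> U ~= {}" "U : EE ==> U <= E0"
  and conv: "U : EE ==> x : U ==> z : U ==> y : E0 ==> x <. y ==> y <. z ==> y : U"
  and iso: "U : EE ==> EX f. siso less less f E0 U & (ALL V:EE. f ` V : EE)"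
  and laminar: "U : EE ==> V : EE ==> x : U ==> x : V ==> U <= V \<or> V <= U"
  and wf: "K <= EE ==> K ~= {} ==> x : \<Inter>K ==> EX M:K. ALL V:K. V <= M"
  and cnt: "K <= EE ==> (!!U V. U : K ==> V : K ==> U <= V \<or> V <= U) ==> countable K"
  and lim: "K <= EE ==> K ~= {} ==> (!!U V. U : K ==> V : K ==> U <= V \<or> V <= U) ==>
   (!!U. U : K ==> EX V:K. ~ U <= V) ==> x : \<Inter>K ==> y : \<Inter>K ==> x <. y ==> \<Inter>K : EE"
  and S: "S <= EE" "\<Union>S = E0" "E0 ~: S"
  and S_sub: "U : EE ==> U ~= E0 ==> EX s:S. U <= s"
  and S_tot: "s : S ==> t : S ==> s ~= t ==> slt s t \<or> slt t s"
  and S_top: "s : S ==> EX t:S. slt s t" and S_bot: "s : S ==> EX t:S. slt t s"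
  and S_iso: "Q <= S ==> Q ~= {} ==>
   (!!s t u. s : Q ==> t : Q ==> u : S ==> slt s u ==> slt u t ==> u : Q) ==>
   (!!s. s : Q ==> EX t:Q. slt s t) ==> (!!s. s : Q ==> EX t:Q. slt t s) ==>
   EX f. siso slt slt f S Q"
  and S_coin: "EX c::nat => 'a set. (ALL n. c n : S & slt (c (Suc n)) (c n) &
   (ALL t:S. slt (c (Suc n)) t & slt t (c n) -->
    (EX u:S. slt (c (Suc n)) u & slt u t) & (EX u:S. slt t u & slt u (c n)))) &
   (ALL t:S. EX n. slt (c n) t)"
  and S_cof: "EX c::nat => 'a set. (ALL n. c n : S & slt (c n) (c (Suc n)) &
   (ALL t:S. slt t (c (Suc n)) & slt (c n) t -->
    (EX u:S. slt u (c (Suc n)) & slt t u) & (EX u:S. slt u t & slt (c n) u))) &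
   (ALL t:S. EX n. slt t (c n))"
begin

lemma esys_dual: "esys (\<lambda>x y. y <=. x) (\<lambda>x y. y <. x) A EE S E0"
proof -
 interpret d: clo "\<lambda>x y. y <=. x" "\<lambda>x y. y <. x" A by (rule clo_dual)
 note [simp] = slt_dual siso_dual
 show ?thesis
 proof (intro esys.intro clo_dual esys_axioms.intro, goal_cases)
  case 1 show ?case by (rule E0)
 next
  case 2 show ?case by (rule E0)
 next
  case (3 x y) thus ?case using E0_dense[of y x] by blast
 next
  case (4 U) thus ?case by (rule mem)
 next
  case (5 U) thus ?case by (rule mem)
 next
  case (6 U x z y) thus ?case using conv[of U z x y] by blast
 next
  case (7 U) thus ?case using iso by simp
 next
  case (8 U V x) thus ?case by (rule laminar)
 next
  case (9 K x) thus ?case by (rule wf)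
 next
  case (10 K) thus ?case by (rule cnt)
 next
  case (11 K x y) thus ?case using lim[of K y x] by blast
 next
  case 12 show ?case by (rule S)
 next
  case 13 show ?case by (rule S)
 next
  case 14 show ?case by (rule S)
 next
  case (15 U) thus ?case by (rule S_sub)
 next
  case (16 s t) thus ?case using S_tot[of s t] by auto
 next
  case (17 s) thus ?case using S_bot by simp
 next
  case (18 s) thus ?case using S_top by simp
 next
  case (19 Q)
  have "EX f. siso slt slt f S Q"
  proof (rule S_iso)
   show "Q <= S" "Q ~= {}" by (fact 19)+
   show "u : Q" if "s : Q" "t : Q" "u : S" "slt s u" "slt u t" for s t u
    by (rule 19(3)[of t s u]) (use that in \<open>simp_all add: slt_dual\<close>)
   show "EX t:Q. slt s t" if "s : Q" for s using 19(5)[OF that] unfolding slt_dual .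
   show "EX t:Q. slt t s" if "s : Q" for s using 19(4)[OF that] unfolding slt_dual .
  qed
  thus ?case unfolding siso_def slt_dual by blast
 next
  case 20 show ?case using S_cof by simp
 next
  case 21 show ?case using S_coin by simp
 qed
qed

lemma dense_E0: "dense_in E0" unfolding dense_in_def using E0 E0_dense by blast

lemma memA: "U : EE ==> U <= A" using mem(2) E0(2) by blast

lemma no_end:
 assumes "U : EE" "x : U"
 shows "EX y:U. x <. y" "EX y:U. y <. x"
proof -
 obtain f where f: "siso (<.) (<.) f E0 U" using iso[OF assms(1)] by blast
 obtain x' where x': "x' : E0" "f x' = x" using siso_surj[OF f assms(2)] by blast
 have "x' : A" using x' E0 by blast
 then obtain y z where "y : E0" "x' <. y" "z : E0" "z <. x'"
  using dense_in_above[OF dense_E0] dense_in_below[OF dense_E0] by meson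
 thus "EX y:U. x <. y" "EX y:U. y <. x" using siso_less[OF f] siso_mem[OF f] x' by blast+
qed

lemma sub_chull: "U : EE ==> U <= chull U" unfolding chull_def using no_end memA by blast

lemma chull_dense_in:
 assumes "W <= E0" "!!x y z. x : W ==> z : W ==> y : E0 ==> x <. y ==> y <. z ==> y : W"
 shows "ALL x:chull W. ALL y:chull W. x <. y --> (EX e:W. x <. e & e <. y)"
proof (intro ballI impI)
 fix x y assume xy: "x : chull W" "y : chull W" "x <. y"
 then obtain u v where uv: "u : W" "u <. x" "v : W" "y <. v" "x : A" "y : A" unfolding chull_def by blast
 then obtain e where e: "e : E0" "x <. e" "e <. y" using E0_dense xy(3) by blast
 have "u <. e" "e <. v" using uv e by order+
 thus "EX e:W. x <. e & e <. y" using assms(2) uv e by blast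
qed

lemma extend_from_E0:
 assumes "siso (<.) (<.) f E0 W"
  "W <= E0" "!!x y z. x : W ==> z : W ==> y : E0 ==> x <. y ==> y <. z ==> y : W"
 obtains F where "siso (<.) (<.) F A (chull W)" "!!V. V <= E0 ==> F ` chull V = chull (f ` V)"
proof (rule siso_extend[OF dense_E0 _ chull_dense_in[OF assms(2)] assms(1)])
 show "W <= A" using assms(2) E0(2) by blast
qed (use assms(3) that in blast)+

lemma iso_chull:
 assumes "U : EE"
 obtains f F where "siso (<.) (<.) f E0 U" "!!V. V : EE ==> f ` V : EE"
  "siso (<.) (<.) F A (chull U)" "!!V. V : EE ==> F ` chull V = chull (f ` V)"
proof -
 obtain f where f: "siso (<.) (<.) f E0 U" "ALL V:EE. f ` V : EE" using iso[OF assms] by blast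
 obtain F where F: "siso (<.) (<.) F A (chull U)" "!!V. V <= E0 ==> F ` chull V = chull (f ` V)"
 proof (rule extend_from_E0[OF f(1) mem(2)[OF assms]])
  show "y : U" if "x : U" "z : U" "y : E0" "x <. y" "y <. z" for x y z using conv[OF assms] that by blast
 qed (use that in blast)
 show ?thesis by (rule that[OF f(1) _ F(1)]) (use f(2) F(2) mem(2) in blast)+
qed

lemma sim_empty: "siso (<.) (<.) F U V ==> sim {} U V" unfolding sim_def by blast

lemma sim_chull: "U : EE ==> sim {} A (chull U)" using iso_chull sim_empty by metis

lemma bounded:
 assumes "U : EE" "U ~= E0"
 shows "EX a:A. ALL x:U. a <. x" "EX b:A. ALL x:U. x <. b"
proof -
 obtain s where s: "s : S" "U <= s" using S_sub assms by blast
 obtain t u where tu: "t : S" "slt t s" "u : S" "slt s u" using S_top S_bot s(1) by meson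
 obtain a b where "a : t" "b : u" using mem(1) S(1) tu by blast
 moreover have "a : A" "b : A" using memA S(1) tu calculation by blast+
 ultimately show "EX a:A. ALL x:U. a <. x" "EX b:A. ALL x:U. x <. b"
  using tu(2,4) s(2) unfolding slt_def by blast+
qed

section \<open>End points of vertices, and points that lie in no letter\<close>

definition lo where "lo U = (SOME l. l : A & (ALL x:U. l <. x) & (ALL v:A. (ALL x:U. v <. x) --> v <=. l))"
definition hi where "hi U = (SOME l. l : A & (ALL x:U. x <. l) & (ALL v:A. (ALL x:U. x <. v) --> l <=. v))"

lemma hi:
 assumes U: "U : EE" "U ~= E0"
 shows "hi U : A" "!!x. x : U ==> x <. hi U" "!!v. v : A ==> v <. hi U ==> EX x:U. v <. x"
proof -
 obtain b where b: "b : A" "ALL x:U. x <. b" using bounded[OF U] by blast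
 have "EX s:A. (ALL x:U. x <=. s) & (ALL v:A. (ALL x:U. x <=. v) --> s <=. v)"
  by (rule complete[OF memA[OF U(1)] mem(1)[OF U(1)] b(1)]) (use b(2) less_imp_le in simp)
 then obtain s where s: "s : A" "ALL x:U. x <=. s" "ALL v:A. (ALL x:U. x <=. v) --> s <=. v" by blast
 have s': "x <. s" if "x : U" for x using no_end(1)[OF U(1) that] s(2) less_le_trans by blast
 have "EX l. l : A & (ALL x:U. x <. l) & (ALL v:A. (ALL x:U. x <. v) --> l <=. v)"
  using s(1,3) s' less_imp_le by blast
 note h = someI_ex[OF this, folded hi_def]
 show "hi U : A" "!!x. x : U ==> x <. hi U" using h by blast+
 fix v assume v: "v : A" "v <. hi U"
 have "~ s <=. v" using h s(1) s' v by (meson leD less_le_trans)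
 thus "EX x:U. v <. x" using s(3) v(1) not_le by blast
qed

lemma lo_dual: "esys.hi (\<lambda>x y. y <=. x) (\<lambda>x y. y <. x) A = lo"
proof -
 interpret d: esys "\<lambda>x y. y <=. x" "\<lambda>x y. y <. x" A EE S E0 by (rule esys_dual)
 show ?thesis unfolding fun_eq_iff d.hi_def lo_def by blast
qed

lemma lo:
 assumes U: "U : EE" "U ~= E0"
 shows "lo U : A" "!!x. x : U ==> lo U <. x" "!!v. v : A ==> lo U <. v ==> EX x:U. x <. v"
proof -
 interpret d: esys "\<lambda>x y. y <=. x" "\<lambda>x y. y <. x" A EE S E0 by (rule esys_dual)
 show "lo U : A" "!!x. x : U ==> lo U <. x" "!!v. v : A ==> lo U <. v ==> EX x:U. x <. v"
  using d.hi[OF U] unfolding lo_dual by blast+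
qed

lemma chull_Ivl:
 assumes U: "U : EE" "U ~= E0"
 shows "chull U = Ivl (lo U) (hi U)" "lo U <. hi U"
proof -
 show "chull U = Ivl (lo U) (hi U)"
 proof (intro equalityI subsetI)
  fix x assume "x : chull U"
  thus "x : Ivl (lo U) (hi U)" unfolding chull_def Ivl_def using hi(2)[OF U] lo(2)[OF U] less_trans by blast
 next
  fix x assume "x : Ivl (lo U) (hi U)"
  thus "x : chull U" unfolding chull_def Ivl_def using hi(3)[OF U] lo(3)[OF U] by blast
 qed
 obtain x where "x : U" using mem(1)[OF U(1)] by blast
 thus "lo U <. hi U" using hi(2)[OF U] lo(2)[OF U] less_trans by blast
qed

lemma S_mem: "s : S ==> s : EE" "s : S ==> s ~= E0" using S(1,3) by blast+

lemma S_less: "s : S ==> t : S ==> x : s ==> y : t ==> x <. y ==> s = t \<or> slt s t"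
 using S_tot[of s t] unfolding slt_def by (metis less_asym)

lemma slt_trans: "slt s t ==> slt t u ==> t : S ==> slt s u"
 unfolding slt_def using mem(1)[OF S_mem(1)] less_trans by blast

text \<open>The letters in \<open>V\<close> are ordered like all letters, and any two letters are
  isomorphic as sets of points through \<open>E0\<close>. Gluing these maps gives \<open>E0\<close>
  isomorphic to the union of \<open>V\<close>, which then extends to the hulls.\<close>

lemma sim_Union:
 assumes V: "V <= S" "V ~= {}" "!!s t u. s : V ==> t : V ==> u : S ==> slt s u ==> slt u t ==> u : V"
  "!!s. s : V ==> EX t:V. slt s t" "!!s. s : V ==> EX t:V. slt t s"
 shows "sim {} A (chull (\<Union>V))"
proof -
 have "EX f. siso slt slt f S V" by (rule S_iso) (fact V)+
 then obtain f where f: "siso slt slt f S V" by blast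
 have fS: "f s : S" if "s : S" for s using siso_mem[OF f that] V(1) by blast
 have "EX g. siso (<.) (<.) g s (f s)" if sS: "s : S" for s
 proof -
  obtain g where "siso (<.) (<.) g E0 s" using iso[OF S_mem(1)[OF sS]] by blast
  moreover obtain h where "siso (<.) (<.) h E0 (f s)" using iso[OF S_mem(1)[OF fS[OF sS]]] by blast
  ultimately show ?thesis using siso_comp[OF siso_inv] by blast
 qed
 then obtain g where g: "!!s. s : S ==> siso (<.) (<.) (g s) s (f s)" by metis
 have "EX G. siso (<.) (<.) G (\<Union>s\<in>S. s) (\<Union>s\<in>S. f s) & (ALL s:S. ALL x:s. G x = g s x)"
 proof (rule siso_glue[where lti = slt])
  show "slt i j \<or> slt j i" if "i : S" "j : S" "i ~= j" for i j using S_tot that by blast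
  show "x <. y" if "i : S" "j : S" "slt i j" "x : i" "y : j" for i j x y using that unfolding slt_def by blast
  show "x <. y" if "i : S" "j : S" "slt i j" "x : f i" "y : f j" for i j x y
  proof -
   have "slt (f i) (f j)" using siso_less[OF f] that by blast
   thus ?thesis using that unfolding slt_def by blast
  qed
 qed (use g in auto)
 then obtain G where G: "siso (<.) (<.) G (\<Union>s\<in>S. s) (\<Union>s\<in>S. f s)" by blast
 have "(\<Union>s\<in>S. f s) = \<Union>V" using siso_image[OF f] by auto
 hence G': "siso (<.) (<.) G E0 (\<Union>V)" using G S(2) by simp
 obtain F where "siso (<.) (<.) F A (chull (\<Union>V))"
 proof (rule extend_from_E0[OF G'])
  show "\<Union>V <= E0" using V(1) S(2) by blast
  fix x y z assume xz: "x : \<Union>V" "z : \<Union>V" "y : E0" "x <. y" "y <. z"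
  then obtain s t u where stu: "s : V" "x : s" "t : V" "z : t" "u : S" "y : u" using S(2) by blast
  have "s = u \<or> slt s u" "u = t \<or> slt u t" using S_less stu xz V(1) by blast+
  hence "u : V" using V(3)[of s t u] stu by blast
  thus "y : \<Union>V" using stu by blast
 qed
 thus ?thesis by (rule sim_empty)
qed

text \<open>Look at the letters above \<open>a\<close>. If there is a first one, density of
  \<open>E0\<close> leaves no room below it, so \<open>a\<close> is its left end point. Otherwise
  these letters form an endless final segment, and \<open>Up a\<close> is the hull of their
  union.\<close>

lemma outside_up:
 assumes a: "a : A" "!!s. s : S ==> a ~: chull s"
 shows "sim {} A (Up a)"
proof -
 define V where "V = {s:S. ALL x:s. a <. x}"
 have V_iff: "s : V" if sx: "s : S" "x : s" "a <. x" for s x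
 proof -
  have "a <. y" if y: "y : s" for y
  proof (rule ccontr)
   assume "~ a <. y"
   moreover have "a ~= y" using a(2)[OF sx(1)] sub_chull[OF S_mem(1)[OF sx(1)]] y by blast
   ultimately have "y <. a" by order
   hence "a : chull s" unfolding chull_def using a(1) sx(2,3) y by blast
   thus False using a(2) sx(1) by blast
  qed
  thus ?thesis using sx(1) V_def by blast
 qed
 have VS: "V <= S" unfolding V_def by blast
 have V_up: "t : V" if "s : V" "t : S" "slt s t" for s t
 proof -
  have "s ~= {}" "t ~= {}" using mem(1)[OF S_mem(1)] that VS by blast+
  then obtain x y where xy: "x : s" "y : t" by blast
  have "a <. x" "x <. y" using that xy unfolding V_def slt_def by blast+
  hence "a <. y" by order
  thus ?thesis using V_iff that(2) xy by blast
 qed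
 obtain e where e: "e : E0" "a <. e" using dense_in_above[OF dense_E0 a(1)] by blast
 have Vne: "V ~= {}" using e S(2) V_iff by blast
 show ?thesis
 proof (cases "EX s:V. ALL t:V. t = s \<or> slt s t")
  case True
  then obtain s where s: "s : V" "ALL t:V. t = s \<or> slt s t" by blast
  have sS: "s : EE" "s ~= E0" using S_mem s VS by blast+
  have "lo s = a"
  proof (rule ccontr)
   assume ne: "lo s ~= a"
   have "a <=. lo s"
   proof (rule ccontr)
    assume "~ a <=. lo s"
    hence "lo s <. a" by order
    then obtain x where "x : s" "x <. a" using lo(3)[OF sS a(1)] by blast
    moreover have "a <. x" using s(1) calculation(1) unfolding V_def by blast
    ultimately show False by order
   qed
   hence "a <. lo s" using ne by order
   then obtain e where e: "e : E0" "a <. e" "e <. lo s" using E0_dense[OF a(1) lo(1)[OF sS]] by blast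
   then obtain t where t: "t : S" "e : t" using S(2) by blast
   hence "t : V" using V_iff e by blast
   hence "t = s \<or> slt s t" using s(2) by blast
   moreover obtain x where x: "x : s" using mem(1) sS by blast
   ultimately have "e : s \<or> x <. e" using t unfolding slt_def by blast
   thus False using lo(2)[OF sS] x e(3) by (meson less_asym less_trans)
  qed
  hence "sim {} A (Ivl a (hi s))" "a <. hi s" using sim_chull[OF sS(1)] chull_Ivl[OF sS] by auto
  thus ?thesis using sim_Up a(1) hi(1)[OF sS] by blast
 next
  case False
  have "sim {} A (chull (\<Union>V))"
  proof (rule sim_Union[OF VS Vne])
   show "EX t:V. slt s t" if "s : V" for s using S_top V_up VS that by blast
   show "EX t:V. slt t s" if "s : V" for s using False S_tot VS that by blast
  qed (use V_up in blast)
  moreover have "chull (\<Union>V) = Up a"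
  proof (intro equalityI subsetI)
   fix x assume "x : chull (\<Union>V)"
   then obtain u where "u : \<Union>V" "u <. x" "x : A" unfolding chull_def by blast
   moreover have "a <. u" using calculation(1) unfolding V_def by blast
   ultimately show "x : Up a" unfolding Up_def using less_trans by blast
  next
   fix x assume "x : Up a"
   hence x: "x : A" "a <. x" unfolding Up_def by auto
   obtain e where e: "e : E0" "a <. e" "e <. x" using E0_dense[OF a(1) x] by blast
   obtain e' where e': "e' : E0" "x <. e'" using dense_in_above[OF dense_E0 x(1)] by blast
   have "a <. e'" using e' x by order
   hence "e : \<Union>V" "e' : \<Union>V" using e e' S(2) V_iff by blast+
   thus "x : chull (\<Union>V)" unfolding chull_def using x e e' by blast
  qed
  ultimately show ?thesis by simp
 qed
qed

text \<open>The division points are the left ends of a coinitial sequence of letters. A gap consists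
  of the hull of the lower letter, followed by the letters strictly between, which are none or an
  endless convex set.\<close>

lemma coin_empty: "coin {}"
proof -
 obtain c :: "nat => 'a set" where c: "!!n. c n : S" "!!n. slt (c (Suc n)) (c n)"
  "!!n t. t : S ==> slt (c (Suc n)) t ==> slt t (c n) ==>
    (EX u:S. slt (c (Suc n)) u & slt u t) & (EX u:S. slt t u & slt u (c n))"
  "!!t. t : S ==> EX n. slt (c n) t" using S_coin by blast
 have cE: "c n : EE" "c n ~= E0" for n using S_mem c(1) by blast+
 have step: "lo (c (Suc n)) <. lo (c n) & sim {} A (Ivl (lo (c (Suc n))) (lo (c n)))" for n
 proof -
  let ?s = "c (Suc n)" and ?t = "c n"
  have 1: "sim {} A (Ivl (lo ?s) (hi ?s))" "lo ?s <. hi ?s"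
   using sim_chull[OF cE(1)[of "Suc n"]] chull_Ivl[OF cE[of "Suc n"]] by auto
  have le: "hi ?s <=. lo ?t"
  proof (rule ccontr)
   assume "~ hi ?s <=. lo ?t"
   hence "lo ?t <. hi ?s" by order
   then obtain x where x: "x : ?s" "lo ?t <. x" using hi(3)[OF cE lo(1)[OF cE]] by blast
   obtain y where y: "y : ?t" "y <. x" using lo(3)[OF cE _ x(2)] memA[OF cE(1)] x(1) by blast
   show False using c(2)[of n] x y unfolding slt_def by (meson less_asym)
  qed
  \<comment> \<open>If the lower letter reaches up to the left end of the upper one, its hull is
    already the gap. Otherwise the room left over is filled by letters in between, which
    \<open>S_coin\<close> makes endless.\<close>
  show ?thesis
  proof (cases "hi ?s = lo ?t")
   case True
   thus ?thesis using 1 by simp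
  next
   case False
   hence lt: "hi ?s <. lo ?t" using le by order
   define V where "V = {u:S. slt ?s u & slt u ?t}"
   have V_iff: "u : V" if u: "u : S" "e : u" "hi ?s <. e" "e <. lo ?t" for u e
   proof -
    obtain x y where xy: "x : ?s" "y : ?t" using mem(1) cE(1) by blast
    have "x <. e" "e <. y" using hi(2)[OF cE xy(1)] lo(2)[OF cE xy(2)] u by order+
    hence "?s = u \<or> slt ?s u" "u = ?t \<or> slt u ?t" using S_less c(1) u xy by blast+
    moreover have "u ~= ?s" using hi(2)[OF cE, of e "Suc n"] u by (meson less_asym)
    moreover have "u ~= ?t" using lo(2)[OF cE, of e n] u by (meson less_asym)
    ultimately show ?thesis using u(1) unfolding V_def by blast
   qed
   have VS: "V <= S" unfolding V_def by blast
   have hull_eq: "chull (\<Union>V) = Ivl (hi ?s) (lo ?t)"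
   proof (intro equalityI subsetI)
    fix x assume "x : chull (\<Union>V)"
    then obtain u v U W where uv: "u : U" "U : V" "v : W" "W : V" "u <. x" "x <. v" "x : A"
     unfolding chull_def by blast
    have "hi ?s <=. u"
    proof (rule ccontr)
     assume "~ hi ?s <=. u"
     hence "u <. hi ?s" by order
     moreover have "u : A" using uv VS S(1) memA by blast
     ultimately obtain y where y: "y : ?s" "u <. y" using hi(3)[OF cE] by blast
     have "slt ?s U" using uv(2) unfolding V_def by blast
     hence "y <. u" unfolding slt_def using y(1) uv(1) by blast
     thus False using y(2) by order
    qed
    moreover have "v <=. lo ?t"
    proof (rule ccontr)
     assume "~ v <=. lo ?t"
     hence "lo ?t <. v" by order
     moreover have "v : A" using uv VS S(1) memA by blast
     ultimately obtain y where y: "y : ?t" "y <. v" using lo(3)[OF cE] by blast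
     have "slt W ?t" using uv(4) unfolding V_def by blast
     hence "v <. y" unfolding slt_def using y(1) uv(3) by blast
     thus False using y(2) by order
    qed
    ultimately have "hi ?s <. x" "x <. lo ?t" using uv by order+
    thus "x : Ivl (hi ?s) (lo ?t)" unfolding Ivl_def using uv by blast
   next
    fix x assume "x : Ivl (hi ?s) (lo ?t)"
    hence x: "x : A" "hi ?s <. x" "x <. lo ?t" unfolding Ivl_def by auto
    obtain e where e: "e : E0" "hi ?s <. e" "e <. x" using E0_dense[OF hi(1)[OF cE] x(1,2)] by blast
    obtain e' where e': "e' : E0" "x <. e'" "e' <. lo ?t" using E0_dense[OF x(1) lo(1)[OF cE] x(3)] by blast
    have "e <. lo ?t" "hi ?s <. e'" using e e' x by order+
    hence "e : \<Union>V" "e' : \<Union>V" using e e' S(2) V_iff by blast+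
    thus "x : chull (\<Union>V)" unfolding chull_def using x e e' by blast
   qed
   obtain e where "e : E0" "hi ?s <. e" "e <. lo ?t" using E0_dense[OF hi(1)[OF cE] lo(1)[OF cE] lt] by blast
   hence Vne: "V ~= {}" using V_iff S(2) by blast
   have "sim {} A (chull (\<Union>V))"
   proof (rule sim_Union[OF VS Vne])
    fix s t u assume "s : V" "t : V" "u : S" "slt s u" "slt u t"
    thus "u : V" unfolding V_def using slt_trans by blast
   next
    fix s assume "s : V"
    hence s: "s : S" "slt ?s s" "slt s ?t" unfolding V_def by auto
    obtain u v where "u : S" "slt ?s u" "slt u s" "v : S" "slt s v" "slt v ?t" using c(3)[OF s] by blast
    moreover have "slt ?s v" using slt_trans[OF s(2) \<open>slt s v\<close> s(1)] .
    moreover have "slt u ?t" using slt_trans[OF \<open>slt u s\<close> s(3) s(1)] .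
    ultimately show "EX t:V. slt s t" "EX t:V. slt t s" unfolding V_def by blast+
   qed
   hence "sim {} A (Ivl (hi ?s) (lo ?t))" using hull_eq by simp
   hence "sim {} A (Ivl (lo ?s) (lo ?t))"
    using sim_Ivl_trans[OF 1(1)] 1(2) lt lo(1)[OF cE] hi(1)[OF cE] by blast
   moreover have "lo ?s <. lo ?t" using 1(2) lt by order
   ultimately show ?thesis by blast
  qed
 qed
 show ?thesis unfolding coin_def
 proof (intro exI[of _ "\<lambda>n. lo (c n)"] conjI allI ballI)
  fix x assume "x : A"
  then obtain e where e: "e : E0" "e <. x" using dense_in_below[OF dense_E0] by blast
  then obtain t where t: "t : S" "e : t" using S(2) by blast
  then obtain n where n: "slt (c n) t" using c(4) by blast
  obtain y where y: "y : c n" using mem(1) cE by blast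
  hence "y <. e" using n t unfolding slt_def by blast
  hence "lo (c n) <. x" using lo(2)[OF cE y] e by order
  thus "EX n. lo (c n) <. x" by blast
 qed (use step lo(1)[OF cE] in auto)
qed

text \<open>Pull \<open>a\<close> back along an isomorphism of the whole onto the hull of
  \<open>U\<close> that maps vertices to vertices. Letters go to proper subvertices of
  \<open>U\<close>, so the pulled back point lies in no letter and \<open>outside_up\<close>
  applies.\<close>

lemma inner_up:
 assumes U: "U : EE" and a: "a : chull U" and out: "!!W. W : EE ==> W \<subset> U ==> a ~: chull W"
 shows "sim {} A {x:chull U. a <. x}"
proof -
 obtain f F where f: "siso (<.) (<.) f E0 U" "!!V. V : EE ==> f ` V : EE"
  and F: "siso (<.) (<.) F A (chull U)" "!!V. V : EE ==> F ` chull V = chull (f ` V)"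
  using iso_chull[OF U] by blast
 obtain a' where a': "a' : A" "F a' = a" using siso_surj[OF F(1) a] by blast
 have "sim {} A (Up a')"
 proof (rule outside_up[OF a'(1)])
  fix s assume s: "s : S"
  show "a' ~: chull s"
  proof
   assume "a' : chull s"
   hence "a : chull (f ` s)" using F(2)[OF S_mem(1)[OF s]] a' by blast
   moreover have "f ` s \<subset> U"
   proof
    show "f ` s <= U" using siso_image[OF f(1)] mem(2)[OF S_mem(1)[OF s]] by blast
    show "f ` s ~= U"
    proof
     assume eq: "f ` s = U"
     have "E0 <= s"
     proof
      fix x assume x: "x : E0"
      then obtain y where y: "y : s" "f y = f x" using siso_mem[OF f(1) x] eq by (metis imageE)
      hence "y = x" using siso_eq[OF f(1)] x mem(2)[OF S_mem(1)[OF s]] by blast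
      thus "x : s" using y by blast
     qed
     thus False using mem(2)[OF S_mem(1)[OF s]] S_mem(2)[OF s] by blast
    qed
   qed
   ultimately show False using out f(2)[OF S_mem(1)[OF s]] by blast
  qed
 qed
 moreover have "sim {} (Up a') (F ` Up a')" by (rule sim_empty[OF siso_subset[OF F(1)]]) (auto simp: Up_def)
 ultimately show ?thesis using siso_Up[OF F(1) a'(1)] a'(2) sim_trans by metis
qed

text \<open>The common point \<open>a\<close> need not belong to \<open>E0\<close>; a point of
  \<open>E0\<close> slightly below it lies in both sets, and \<open>laminar\<close> applies
  there.\<close>

lemma chull_laminar:
 assumes "U : EE" "V : EE" "a : chull U" "a : chull V"
 shows "U <= V \<or> V <= U"
proof -
 obtain u u' v v' where uv: "u : U" "u' : U" "u <. a" "a <. u'" "v : V" "v' : V" "v <. a" "a <. v'" "a : A"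
  using assms(3,4) unfolding chull_def by blast
 define m where "m = (if u <. v then v else u)"
 have m: "m : A" "m <. a" "u <=. m" "v <=. m"
  unfolding m_def using uv memA[OF assms(1)] memA[OF assms(2)] by auto
 obtain e where e: "e : E0" "m <. e" "e <. a" using E0_dense[OF m(1) uv(9) m(2)] by blast
 have "u <. e" "v <. e" "e <. u'" "e <. v'" using m e uv by order+
 hence "e : U" "e : V" using conv assms(1,2) uv e(1) by blast+
 thus ?thesis using laminar assms(1,2) by blast
qed

text \<open>Well-foundedness asks for a point common to all members. The members above a fixed
  nonempty \<open>U\<close> have one, and the rest of the chain lies inside
  \<open>U\<close>.\<close>

lemma chain_greatest:
 assumes "K <= EE" "K ~= {}" "!!U V. U : K ==> V : K ==> U <= V \<or> V <= U"
 shows "EX M:K. ALL V:K. V <= M"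
proof -
 obtain U where U: "U : K" using assms by blast
 then obtain x where x: "x : U" using mem(1) assms(1) by blast
 have "EX M:{V:K. U <= V}. ALL V:{V:K. U <= V}. V <= M" by (rule wf[of _ x]) (use assms(1) U x in auto)
 then obtain M where M': "M : {V:K. U <= V}" "ALL V:{V:K. U <= V}. V <= M" by (elim bexE)
 have M: "M : K" "U <= M" "!!V. V : K ==> U <= V ==> V <= M" using M' by simp_all
 have "V <= M" if "V : K" for V using assms(3)[OF U that]
 proof
  assume "U <= V" thus ?thesis using M(3) that by simp
 next
  assume "V <= U" thus ?thesis using M(2) by simp
 qed
 thus ?thesis using M(1) by blast
qed

text \<open>The vertices whose hull contains \<open>a\<close> form a chain, well ordered by reverse
  inclusion. Without a last one, the point to be understood is the infimum \<open>b\<close> of their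
  right ends: it is \<open>a\<close> itself, or it is above \<open>a\<close> and the intersection of
  the chain is one more vertex, starting at \<open>a\<close>.\<close>

theorem Up_good:
 assumes a: "a : A"
 shows "sim {} A (Up a)"
proof -
 define K where "K = {U:EE. a : chull U}"
 have KE: "K <= EE" unfolding K_def by blast
 have ch: "U <= V \<or> V <= U" if "U : K" "V : K" for U V
  using chull_laminar[of U V a] that unfolding K_def by blast
 have E0K: "E0 : K" unfolding K_def using E0(1) a chull_dense[OF dense_E0] by blast
 show ?thesis
 proof (cases "EX U:K. ALL V:K. U <= V")
  case True
  then obtain U where U: "U : K" "ALL V:K. U <= V" by blast
  have UE: "U : EE" "a : chull U" using U(1) unfolding K_def by auto
  have sim: "sim {} A {x:chull U. a <. x}" by (rule inner_up[OF UE]) (use U(2) K_def in blast)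
  show ?thesis
  proof (cases "U = E0")
   case True
   thus ?thesis using sim chull_dense[OF dense_E0] unfolding Up_def by simp
  next
   case False
   have aU: "lo U <. a" "a <. hi U" using UE(2) unfolding chull_Ivl[OF UE(1) False] Ivl_def by auto
   have "{x:chull U. a <. x} = Ivl a (hi U)"
    unfolding chull_Ivl(1)[OF UE(1) False] using aU(1) less_trans unfolding Ivl_def by blast
   thus ?thesis using sim sim_Up[OF _ a hi(1)[OF UE(1) False] aU(2)] by simp
  qed
 next
  case False
  \<comment> \<open>The root is removed because it is unbounded and has no end points.\<close>
  define K' where "K' = K - {E0}"
  have K'E: "U : EE" "U ~= E0" if "U : K'" for U using that KE unfolding K'_def by auto
  have K'ne: "K' ~= {}"
  proof
   assume "K' = {}"
   hence "ALL V:K. E0 <= V" unfolding K'_def by blast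
   thus False using False E0K by blast
  qed
  note hi' = hi[OF K'E]
  have hi_mono: "hi U <=. hi V" if UV: "U : K'" "V : K'" "U <= V" for U V
  proof (rule ccontr)
   assume "~ hi U <=. hi V"
   hence "hi V <. hi U" by order
   then obtain x where x: "x : U" "hi V <. x" using hi'(3)[OF UV(1,1) hi'(1)[OF UV(2,2)]] by blast
   hence "x <. hi V" using hi'(2)[OF UV(2,2)] UV(3) by blast
   thus False using x(2) by order
  qed
  have up_K': "W : K'" if W: "W : EE" "U : K'" "U <= W" "W ~= E0" for U W
   using W chull_mono[OF W(3)] unfolding K'_def K_def by blast
  \<comment> \<open>Two points, because \<open>lim\<close> makes an intersection a vertex only if it
    is nondegenerate.\<close>
  have two: "EX x:E0. EX y:E0. x <. y & b <. x & y <. c" if bc: "b : A" "c : A" "b <. c" for b c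
  proof -
   obtain x where x: "x : E0" "b <. x" "x <. c" using E0_dense[OF bc] by blast
   hence "x : A" using E0(2) by blast
   then obtain y where "y : E0" "x <. y" "y <. c" using E0_dense[OF _ bc(2) x(3)] by blast
   thus ?thesis using x by blast
  qed
  \<comment> \<open>Transfinite induction along the chain, from the root towards smaller sets, in
    the form of a greatest counterexample \<open>q\<close>.\<close>
  have leads: "leads {} (hi Q) (hi P)" if QP: "Q : K'" "P : K'" "Q <= P" for Q P
  proof (rule ccontr)
   assume neg: "~ leads {} (hi Q) (hi P)"
   define Bad where "Bad = {Q:K'. EX P:K'. Q <= P & ~ leads {} (hi Q) (hi P)}"
   have "Bad ~= {}" using neg QP unfolding Bad_def by blast
   have "EX M:Bad. ALL V:Bad. V <= M"
   proof (rule chain_greatest)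
    show "Bad <= EE" using K'E(1) unfolding Bad_def by blast
    show "Bad ~= {}" by fact
    show "U <= V \<or> V <= U" if "U : Bad" "V : Bad" for U V using ch that unfolding Bad_def K'_def by blast
   qed
   then obtain q where q: "q : Bad" "ALL V:Bad. V <= q" by blast
   then obtain p where p: "q : K'" "p : K'" "q <= p" "~ leads {} (hi q) (hi p)" unfolding Bad_def by blast
   have "p ~= q" using p(4) unfolding leads_def by blast
   define M where "M = {U:K'. q \<subset> U}"
   have pM: "p : M" using p \<open>p ~= q\<close> unfolding M_def by blast
   have IH: "leads {} (hi U) (hi V)" if UV: "U : M" "V : K'" "U <= V" for U V
   proof (rule ccontr)
    assume "~ ?thesis"
    hence "U : Bad" using UV unfolding Bad_def M_def by blast
    thus False using q(2) UV(1) unfolding M_def by blast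
   qed
   have MK: "M <= K'" unfolding M_def by blast
   have chM: "U <= V \<or> V <= U" if "U : M" "V : M" for U V using ch that MK unfolding K'_def by blast
   note qE = K'E[OF p(1)] and pE = K'E[OF p(2)]
   show False
   proof (cases "EX U:M. ALL V:M. U <= V")
    case True
    \<comment> \<open>Successor step. A vertex properly inside \<open>r\<close> whose hull contains
      \<open>hi q\<close> meets \<open>q\<close>, hence contains it properly, against minimality of
      \<open>r\<close>; so \<open>inner_up\<close> describes the gap from \<open>hi q\<close> to
      \<open>hi r\<close>.\<close>
    then obtain r where r: "r : M" "ALL V:M. r <= V" by blast
    have rK: "r : K'" "q \<subset> r" using r(1) unfolding M_def by auto
    note rE = K'E[OF rK(1)]
    have "leads {} (hi q) (hi r)"
    proof (cases "hi q = hi r")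
     case True
     thus ?thesis unfolding leads_def by blast
    next
     case False
     have lt: "hi q <. hi r" using hi_mono[OF p(1) rK(1)] rK(2) False by (metis le_less psubset_imp_subset)
     obtain x where x: "x : q" using mem(1)[OF qE(1)] by blast
     have lor: "lo r <. hi q" using lo(2)[OF rE, of x] hi(2)[OF qE x] rK(2) x by (meson less_trans psubsetD)
     hence hq: "hi q : chull r" unfolding chull_Ivl(1)[OF rE] Ivl_def using lt hi(1)[OF qE] by blast
     have hqq: "hi q ~: chull q" unfolding chull_Ivl(1)[OF qE] Ivl_def by auto
     have "sim {} A {x:chull r. hi q <. x}"
     proof (rule inner_up[OF rE(1) hq])
      fix W assume W: "W : EE" "W \<subset> r"
      show "hi q ~: chull W"
      proof
       assume h: "hi q : chull W"
       then obtain w w' where w: "w : W" "w' : W" "w <. hi q" "hi q <. w'" unfolding chull_def by blast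
       then obtain x where x: "x : q" "w <. x" using hi(3)[OF qE] memA[OF W(1)] by blast
       have "x <. w'" using hi(2)[OF qE x(1)] w by order
       hence "x : W" using conv[OF W(1) w(1,2) _ x(2)] mem(2)[OF qE(1)] x(1) by blast
       hence "q <= W \<or> W <= q" using laminar qE(1) W(1) x(1) by blast
       hence qW: "q \<subset> W" using chull_mono[of W q] h hqq by blast
       have "W ~= E0" using W(2) mem(2)[OF rE(1)] by blast
       hence "W : K'" using up_K'[OF W(1) p(1)] qW by blast
       hence "W : M" unfolding M_def using qW by blast
       thus False using r(2) W(2) by blast
      qed
     qed
     moreover have "{x:chull r. hi q <. x} = Ivl (hi q) (hi r)"
      unfolding chull_Ivl(1)[OF rE] using lor less_trans unfolding Ivl_def by blast
     ultimately show ?thesis unfolding leads_def using lt by simp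
    qed
    moreover have "leads {} (hi r) (hi p)" using IH[OF r(1) p(2)] r(2) pM by blast
    ultimately show False using leads_trans p(4) hi(1)[OF qE] hi(1)[OF rE] hi(1)[OF pE] by blast
   next
    case False
    have cM: "countable M" by (rule cnt) (use MK K'E(1) chM in blast)+
    have "leads {} (hi q) (hi p)"
    proof (rule leads_inf[OF coin_empty, of "hi ` M"])
     show "countable (hi ` M)" using cM by blast
     show "hi ` M <= A - {}" using hi' MK by blast
     show "hi p : hi ` M" using pM by blast
     show "hi q : A" using hi(1)[OF qE] .
     show "hi q <=. x" if "x : hi ` M" for x using hi_mono p(1) that unfolding M_def by blast
     show "leads {} x y" if xy: "x : hi ` M" "y : hi ` M" "x <. y" for x y
     proof -
      obtain U V where UV: "U : M" "V : M" "x = hi U" "y = hi V" using xy by blast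
      have "~ V <= U" using hi_mono[of V U] UV MK xy(3) by (meson leD subsetD)
      hence "U <= V" using chM UV by blast
      thus ?thesis using IH UV MK by blast
     qed
     \<comment> \<open>Limit step: \<open>hi q\<close> is the infimum of the earlier right ends. A
       larger lower bound would leave two points in the intersection of \<open>M\<close>, which
       would then be a vertex and a least member of \<open>M\<close>.\<close>
     fix v assume v: "v : A" "!!x. x : hi ` M ==> v <=. x"
     show "v <=. hi q"
     proof (rule ccontr)
      assume "~ v <=. hi q"
      hence "hi q <. v" by order
      then obtain e1 e2 where e: "e1 : E0" "e2 : E0" "e1 <. e2" "hi q <. e1" "e2 <. v"
       using two[OF hi(1)[OF qE] v(1)] by blast
      obtain x where x: "x : q" using mem(1)[OF qE(1)] by blast
      have "e1 : U & e2 : U" if U: "U : M" for U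
      proof -
       have UE: "U : EE" "U ~= E0" using K'E MK U by blast+
       have "v <=. hi U" using v(2) U by blast
       hence "e2 <. hi U" using e(5) by order
       then obtain y where y: "y : U" "e2 <. y" using hi(3)[OF UE] e(2) E0(2) by blast
       have "x <. hi q" using hi(2)[OF qE x] .
       hence "x <. e1" "x <. e2" "e1 <. y" using e y by order+
       moreover have "x : U" using x U unfolding M_def by blast
       ultimately show ?thesis using conv[OF UE(1) _ y(1)] e(1,2) y(2) by blast
      qed
      hence eM: "e1 : \<Inter>M" "e2 : \<Inter>M" by blast+
      have IE: "\<Inter>M : EE"
      proof (rule lim[OF _ _ _ _ eM e(3)])
       show "M <= EE" using MK K'E by blast
       show "M ~= {}" using pM by blast
       show "U <= V \<or> V <= U" if "U : M" "V : M" for U V using chM that .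
       show "EX V:M. ~ U <= V" if "U : M" for U using False that by blast
      qed
      have "q <= \<Inter>M" unfolding M_def by blast
      moreover have "e1 ~: q" using hi(2)[OF qE] e(4) by (meson less_asym)
      ultimately have sub: "q \<subset> \<Inter>M" using eM by blast
      have "\<Inter>M ~= E0" using pM pE mem(2)[OF pE(1)] by blast
      hence "\<Inter>M : K'" using up_K'[OF IE p(1)] sub by blast
      hence "\<Inter>M : M" unfolding M_def[symmetric] using sub by (simp add: M_def)
      thus False using False by blast
     qed
    qed
    thus False using p(4) by blast
   qed
  qed
  have a_hi: "a <. hi U" if "U : K'" for U
   using that chull_Ivl(1)[OF K'E[OF that]] unfolding K'_def K_def Ivl_def by auto
  have "EX s:A. (ALL x:hi ` K'. s <=. x) & (ALL v:A. (ALL x:hi ` K'. v <=. x) --> v <=. s)"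
   by (rule complete_inf[of _ a]) (use hi'(1) K'ne a a_hi less_imp_le in auto)
  then obtain b where b: "b : A" "ALL x:hi ` K'. b <=. x" "ALL v:A. (ALL x:hi ` K'. v <=. x) --> v <=. b" by blast
  obtain P where P: "P : K'" using K'ne by blast
  have lb: "leads {} b (hi P)"
  proof (rule leads_inf[OF coin_empty, of "hi ` K'"])
   have "countable K'" by (rule cnt) (use K'E(1) ch K'_def in blast)+
   thus "countable (hi ` K')" by blast
   show "hi ` K' <= A - {}" using hi' by blast
   show "hi P : hi ` K'" using P by blast
   show "leads {} x y" if xy: "x : hi ` K'" "y : hi ` K'" "x <. y" for x y
   proof -
    obtain U V where UV: "U : K'" "V : K'" "x = hi U" "y = hi V" using xy by blast
    have "~ V <= U" using hi_mono[of V U] UV xy(3) by (meson leD)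
    hence "U <= V" using ch UV unfolding K'_def by blast
    thus ?thesis using leads UV by blast
   qed
   show "b : A" by (rule b(1))
   show "b <=. x" if "x : hi ` K'" for x using b(2) that by blast
   show "v <=. b" if "v : A" "!!x. x : hi ` K' ==> v <=. x" for v using b(3) that by blast
  qed
  have ab: "a <=. b" using b(3) a a_hi less_imp_le by blast
  show ?thesis
  proof (cases "a = b")
   case True
   hence "a ~= hi P" using a_hi[OF P] by auto
   thus ?thesis using leads_Up[of "{}" a "hi P"] lb True a hi'(1)[OF P P] by simp
  next
   case neq: False
   \<comment> \<open>All points of \<open>E0\<close> in \<open>(a, b)\<close> belong to every member
     of \<open>K\<close>, so the intersection is a vertex. It is not in \<open>K\<close>, as
     \<open>K\<close> has no least member; hence its hull misses \<open>a\<close>, and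
     \<open>a\<close> must be its left end.\<close>
   hence ltab: "a <. b" using ab by order
   have inK: "e : U" if e: "e : E0" "a <. e" "e <. b" and U: "U : K" for e U
   proof (cases "U = E0")
    case True
    thus ?thesis using e by simp
   next
    case False
    hence UK: "U : K'" using U K'_def by blast
    note UE = K'E[OF UK]
    obtain u where u: "u : U" "u <. a" using U unfolding K_def chull_def by blast
    have "b <=. hi U" using b(2) UK by blast
    hence "e <. hi U" using e(3) by order
    then obtain y where y: "y : U" "e <. y" using hi(3)[OF UE] e(1) E0(2) by blast
    have "u <. e" using u(2) e(2) by order
    thus ?thesis using conv[OF UE(1) u(1) y(1) e(1)] y(2) by blast
   qed
   obtain e1 e2 where e: "e1 : E0" "e2 : E0" "e1 <. e2" "a <. e1" "e2 <. b" using two[OF a b(1) ltab] by blast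
   have "e1 <. b" "a <. e2" using e by order+
   hence eK: "e1 : \<Inter>K" "e2 : \<Inter>K" using inK e by blast+
   have IE: "\<Inter>K : EE"
   proof (rule lim[OF KE _ ch _ eK e(3)])
    show "K ~= {}" using E0K by blast
    show "EX V:K. ~ U <= V" if "U : K" for U using False that by blast
   qed
   have nK: "\<Inter>K ~: K" using False by blast
   hence na: "a ~: chull (\<Inter>K)" using IE unfolding K_def[symmetric] by (simp add: K_def)
   have nE: "\<Inter>K ~= E0" using nK E0K by metis
   have "lo (\<Inter>K) <=. a"
   proof (rule ccontr)
    assume "~ lo (\<Inter>K) <=. a"
    hence al: "a <. lo (\<Inter>K)" by order
    have lA: "lo (\<Inter>K) : A" using lo(1)[OF IE nE] .
    define m where "m = (if lo (\<Inter>K) <. b then lo (\<Inter>K) else b)"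
    have m: "m : A" "a <. m" "m <=. b" "m <=. lo (\<Inter>K)" unfolding m_def using al lA b(1) ltab by auto
    obtain e where e: "e : E0" "a <. e" "e <. m" using E0_dense[OF a m(1,2)] by blast
    have "e <. b" using e m by order
    hence "e : \<Inter>K" using inK e by blast
    hence "lo (\<Inter>K) <. e" using lo(2)[OF IE nE] by blast
    thus False using e m by order
   qed
   moreover have ahi: "a <. hi (\<Inter>K)" using hi(2)[OF IE nE eK(1)] e(4) by order
   ultimately have "lo (\<Inter>K) = a"
    using na a unfolding chull_Ivl(1)[OF IE nE] Ivl_def by (metis (mono_tags, lifting) le_less mem_Collect_eq)
   hence "sim {} A (Ivl a (hi (\<Inter>K)))" using sim_chull[OF IE] chull_Ivl(1)[OF IE nE] by simp
   thus ?thesis using sim_Up[OF _ a hi(1)[OF IE nE] ahi] by blast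
  qed
 qed
qed

theorem Dn_good: "a : A ==> sim {} A (Dn a)"
proof -
 interpret d: esys "\<lambda>x y. y <=. x" "\<lambda>x y. y <. x" A EE S E0 by (rule esys_dual)
 show "a : A ==> sim {} A (Dn a)" using d.Up_good[of a] by (simp add: duals)
qed

end

section \<open>Homogeneous linearly ordered sets\<close>

text \<open>The order locales work with a linear order of the whole type. Points outside the field
  are placed above it and ordered among themselves by an arbitrary well-order.\<close>

lemma linear_order_extend:
 assumes "Linear_order r"
 obtains le lt where "lin le lt" "!!x y. x : Field r ==> y : Field r ==> (x, y) : r \<longleftrightarrow> le x y"
proof -
 obtain w :: "'a rel" where w: "Well_order w" "Field w = UNIV" using well_ordering by (elim exE conjE)
 have wl: "(x, x) : w" "(x, y) : w ==> (y, z) : w ==> (x, z) : w" "(x, y) : w ==> (y, x) : w ==> x = y"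
  "(x, y) : w \<or> (y, x) : w" for x y z
  using w unfolding order_on_defs refl_on_def trans_def antisym_def total_on_def by (metis UNIV_I)+
 have rl: "x : Field r ==> (x, x) : r" "(x, y) : r ==> (y, z) : r ==> (x, z) : r" "(x, y) : r ==> (y, x) : r ==> x = y"
  "x : Field r ==> y : Field r ==> (x, y) : r \<or> (y, x) : r" for x y z
  using assms unfolding order_on_defs refl_on_def trans_def antisym_def total_on_def by metis+
 define le where "le x y \<longleftrightarrow> (if x : Field r then y : Field r --> (x, y) : r else y ~: Field r & (x, y) : w)" for x y
 define lt where "lt x y \<longleftrightarrow> le x y & ~ le y x" for x y
 have "class.linorder le lt"
 proof
  fix x y z
  show "lt x y \<longleftrightarrow> le x y & ~ le y x" by (rule lt_def)
  show "le x x" unfolding le_def using rl wl by auto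
  show "le x y ==> le y z ==> le x z" unfolding le_def using rl(2) wl(2) by (auto split: if_splits)
  show "le x y ==> le y x ==> x = y" unfolding le_def using rl(3) wl(3) by (auto split: if_splits)
  show "le x y \<or> le y x" unfolding le_def using rl(4) wl(4) by (auto split: if_splits)
 qed
 hence "lin le lt" by (rule lin.intro)
 thus ?thesis by (rule that) (simp add: le_def)
qed

locale lots = lin less_eq less
 for less_eq :: "'a => 'a => bool" (infix \<open><=.\<close> 50) and less (infix \<open><.\<close> 50) +
 fixes r :: "'a rel"
 assumes Lr: "Linear_order r"
  and r_le: "x : Field r ==> y : Field r ==> (x, y) : r \<longleftrightarrow> x <=. y"
begin

lemma r_iff: "(x, y) : r \<longleftrightarrow> x : Field r & y : Field r & x <=. y"
 using r_le by (metis FieldI1 FieldI2)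

text \<open>In a dense order without end points these are the nonempty open convex sets; this form
  mentions no topology and is what is transported along isomorphisms.\<close>

definition endless :: "'a set => bool" where
 "endless U \<longleftrightarrow> U <= Field r & U ~= {} &
   (ALL x:U. ALL y:U. ALL z:Field r. x <. z & z <. y --> z : U) &
   (ALL x:U. EX y:U. x <. y) & (ALL x:U. EX y:U. y <. x)"

lemma underS_eq: "c : Field r ==> underS r c = {x:Field r. x <. c}"
 unfolding underS_def using r_iff by (auto simp: less_le)

lemma aboveS_eq: "c : Field r ==> aboveS r c = {x:Field r. c <. x}"
 unfolding aboveS_def using r_iff by (auto simp: less_le)

lemma Restr_Field: "U <= Field r ==> Field (Restr r U) = U"
proof
 assume U: "U <= Field r"
 show "U <= Field (Restr r U)"
 proof
  fix x assume "x : U"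
  hence "(x, x) : Restr r U" using U r_le[of x x] by auto
  thus "x : Field (Restr r U)" by (rule FieldI1)
 qed
qed (auto simp: Field_def)

lemma iso_siso:
 assumes "U <= Field r"
 shows "order_isomorphic r (Restr r U) \<longleftrightarrow> (EX f. siso (<.) (<.) f (Field r) U)"
proof
 assume "order_isomorphic r (Restr r U)"
 then obtain f where f: "bij_betw f (Field r) U" "ALL a:Field r. ALL b:Field r. (a, b) : r \<longleftrightarrow> (f a, f b) : Restr r U"
  unfolding order_isomorphic_def iso_iff2 Restr_Field[OF assms] by blast
 have "siso (<.) (<.) f (Field r) U"
 proof (rule siso_mono[OF f(1)])
  fix x y assume xy: "x : Field r" "y : Field r" "x <. y"
  hence "(f x, f y) : r" using f(2) r_iff less_imp_le by blast
  hence "f x <=. f y" using r_iff by blast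
  moreover have "f x ~= f y" using f(1) xy unfolding bij_betw_def inj_on_def by auto
  ultimately show "f x <. f y" by order
 qed
 thus "EX f. siso (<.) (<.) f (Field r) U" by blast
next
 assume "EX f. siso (<.) (<.) f (Field r) U"
 then obtain f where f: "siso (<.) (<.) f (Field r) U" by blast
 have "(a, b) : r \<longleftrightarrow> (f a, f b) : Restr r U" if ab: "a : Field r" "b : Field r" for a b
 proof -
  have "f a : U" "f b : U" using siso_mem[OF f] ab by blast+
  thus ?thesis
   using siso_less[OF f ab(2,1)] r_iff[of a b] r_iff[of "f a" "f b"] ab assms by (auto simp: not_less[symmetric])
 qed
 thus "order_isomorphic r (Restr r U)"
  unfolding order_isomorphic_def iso_iff2 Restr_Field[OF assms] using f unfolding siso_def by blast
qed

text \<open>Induction over the generation of the topology from rays. The two sides are separate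
  implications because a point that is an end of the order has neighbours on one side only.\<close>

lemma openin_nbhd:
 assumes "openin (lots_topology r) U" "m : U"
 shows "m : Field r & ((EX a:Field r. a <. m) --> (EX a:Field r. a <. m & (ALL x:Field r. a <. x & x <=. m --> x : U))) &
  ((EX a:Field r. m <. a) --> (EX a:Field r. m <. a & (ALL x:Field r. m <=. x & x <. a --> x : U)))"
proof -
 have "generate_topology_on ({Field r} \<union> underS r ` Field r \<union> aboveS r ` Field r) U"
  using assms(1) unfolding lots_topology_def openin_topology_generated_by_iff .
 thus ?thesis using assms(2)
 proof (induction arbitrary: m)
  case Empty thus ?case by simp
 next
  case (Int U V)
  have mU: "m : U" "m : V" using Int.prems by auto
  note IU = Int.IH(1)[OF mU(1)] and IV = Int.IH(2)[OF mU(2)]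
  show ?case
  proof (intro conjI impI)
   show "m : Field r" using IU by blast
   assume ex: "EX a:Field r. a <. m"
   obtain a where a: "a : Field r" "a <. m" "ALL x:Field r. a <. x & x <=. m --> x : U" using IU ex by blast
   obtain b where b: "b : Field r" "b <. m" "ALL x:Field r. b <. x & x <=. m --> x : V" using IV ex by blast
   define c where "c = (if a <. b then b else a)"
   have "c : Field r" "c <. m" "a <=. c" "b <=. c" unfolding c_def using a b by auto
   thus "EX a:Field r. a <. m & (ALL x:Field r. a <. x & x <=. m --> x : U \<inter> V)"
    using a(3) b(3) by (intro bexI[of _ c]) (auto intro: le_less_trans)
  next
   assume ex: "EX a:Field r. m <. a"
   obtain a where a: "a : Field r" "m <. a" "ALL x:Field r. m <=. x & x <. a --> x : U" using IU ex by blast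
   obtain b where b: "b : Field r" "m <. b" "ALL x:Field r. m <=. x & x <. b --> x : V" using IV ex by blast
   define c where "c = (if a <. b then a else b)"
   have "c : Field r" "m <. c" "c <=. a" "c <=. b" unfolding c_def using a b by auto
   thus "EX a:Field r. m <. a & (ALL x:Field r. m <=. x & x <. a --> x : U \<inter> V)"
    using a(3) b(3) by (intro bexI[of _ c]) (auto intro: less_le_trans)
  qed
 next
  case (UN K)
  then obtain k where k: "k : K" "m : k" by blast
  show ?case using UN.IH[OF k] k(1) by blast
 next
  case (Basis s)
  then consider "s = Field r" | c where "c : Field r" "s = {x:Field r. x <. c}" | c where "c : Field r" "s = {x:Field r. c <. x}"
   using underS_eq aboveS_eq by auto
  thus ?case
  proof cases
   case 1
   thus ?thesis using Basis.prems by blast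
  next
   case 2
   thus ?thesis using Basis.prems le_less_trans by blast
  next
   case 3
   thus ?thesis using Basis.prems less_le_trans by blast
  qed
 qed
qed

lemma openin_underS: "c : Field r ==> openin (lots_topology r) {x:Field r. x <. c}"
 and openin_aboveS: "c : Field r ==> openin (lots_topology r) {x:Field r. c <. x}"
 unfolding lots_topology_def using underS_eq aboveS_eq by (auto intro!: topology_generated_by_Basis)

lemma openin_Ivl: "a : Field r ==> b : Field r ==> openin (lots_topology r) {x:Field r. a <. x & x <. b}"
 using openin_Int[OF openin_aboveS[of a] openin_underS[of b]] by (simp add: Int_def conj_ac cong: conj_cong)

lemma endless_openin:
 assumes "endless U"
 shows "openin (lots_topology r) U" "order_convex r U"
proof -
 note en = assms[unfolded endless_def]
 note U = en[THEN conjunct1] en[THEN conjunct2, THEN conjunct2, THEN conjunct1]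
  en[THEN conjunct2, THEN conjunct2, THEN conjunct2, THEN conjunct1]
  en[THEN conjunct2, THEN conjunct2, THEN conjunct2, THEN conjunct2]
 have "U = (\<Union>a\<in>U. \<Union>b\<in>U. {x:Field r. a <. x & x <. b})" (is "_ = ?V")
 proof
  show "U <= ?V"
  proof
   fix x assume x: "x : U"
   then obtain y z where "y : U" "x <. y" "z : U" "z <. x" using U(3,4) by meson
   thus "x : ?V" using x U(1) by auto
  qed
  show "?V <= U"
  proof
   fix x assume "x : ?V"
   then obtain y z where "y : U" "z : U" "x : Field r" "y <. x & x <. z" by auto
   thus "x : U" using U(2) by metis
  qed
 qed
 moreover have "openin (lots_topology r) ?V"
  by (intro openin_Union) (use openin_Ivl U(1) in \<open>auto intro!: openin_Union\<close>)
 ultimately show "openin (lots_topology r) U" by simp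
 show "order_convex r U" unfolding order_convex_def
 proof (intro conjI ballI allI impI)
  fix a b c assume abc: "a : U" "b : U" "(a, c) : r & (c, b) : r"
  hence "a = c \<or> c = b \<or> (c : Field r & a <. c & c <. b)" using r_iff by (auto simp: le_less)
  thus "c : U" using abc U(2) by blast
 qed (rule U(1))
qed

text \<open>If \<open>m\<close> is the top, the points below \<open>m\<close> form a copy of the
  whole and so have a top \<open>p\<close>. Then the ray above \<open>p\<close> is the singleton
  \<open>m\<close>, a nonempty open convex set that cannot be a copy of an order with several
  points.\<close>

lemma HLOTS_no_top:
 assumes "HLOTS r" "m : Field r"
 shows "EX x:Field r. m <. x"
proof (rule ccontr)
 assume "~ ?thesis"
 hence top: "x <=. m" if "x : Field r" for x using that not_le by blast
 obtain a b c where abc: "a : Field r" "b : Field r" "c : Field r" "a ~= b" "a ~= c" "b ~= c"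
  using assms unfolding HLOTS_def by blast
 have hom: "EX f. siso (<.) (<.) f (Field r) U" if "openin (lots_topology r) U" "order_convex r U" "U ~= {}" for U
 proof -
  have "U <= Field r" using that(2) unfolding order_convex_def by blast
  thus ?thesis using that assms(1) iso_siso unfolding HLOTS_def by blast
 qed
 let ?U = "{x:Field r. x <. m}"
 have "order_convex r ?U" unfolding order_convex_def using r_iff le_less_trans by blast
 moreover have "?U ~= {}" using top[OF abc(1)] top[OF abc(2)] abc by (auto simp: le_less)
 ultimately obtain f where f: "siso (<.) (<.) f (Field r) ?U" using hom openin_underS[OF assms(2)] by blast
 let ?p = "f m"
 have p: "?p : Field r" "?p <. m" using siso_mem[OF f assms(2)] by auto
 have "{x:Field r. ?p <. x} <= {m}"
 proof
  fix x assume x: "x : {x:Field r. ?p <. x}"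
  show "x : {m}"
  proof (rule ccontr)
   assume "x ~: {m}"
   hence "x : ?U" using x top by (auto simp: less_le)
   then obtain y where y: "y : Field r" "f y = x" using siso_surj[OF f] by blast
   have "m <. y" using siso_less[OF f assms(2) y(1)] x y(2) by simp
   thus False using top[OF y(1)] by order
  qed
 qed
 hence V: "{x:Field r. ?p <. x} = {m}" using p assms(2) by blast
 moreover have "order_convex r {x:Field r. ?p <. x}" unfolding order_convex_def using r_iff less_le_trans by blast
 ultimately obtain g where g: "siso (<.) (<.) g (Field r) {m}" using hom[OF openin_aboveS[OF p(1)]] by auto
 have "g a = m" "g b = m" using siso_mem[OF g] abc by auto
 thus False using siso_eq[OF g abc(1,2)] abc(4) by simp
qed

text \<open>If nothing lies between \<open>x\<close> and \<open>y\<close>, the open ray below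
  \<open>y\<close> has the largest element \<open>x\<close>, although it is a copy of an order
  without top.\<close>

lemma HLOTS_dense:
 assumes "HLOTS r" "x : Field r" "y : Field r" "x <. y"
 shows "EX z:Field r. x <. z & z <. y"
proof (rule ccontr)
 assume neg: "~ ?thesis"
 let ?U = "{z:Field r. z <. y}"
 have "order_convex r ?U" unfolding order_convex_def using r_iff le_less_trans by blast
 moreover have "?U ~= {}" using assms by blast
 ultimately have "EX f. siso (<.) (<.) f (Field r) ?U"
  using assms(1) openin_underS[OF assms(3)] iso_siso[of ?U] unfolding HLOTS_def by blast
 then obtain f where f: "siso (<.) (<.) f (Field r) ?U" by blast
 obtain x' where x': "x' : Field r" "f x' = x" using siso_surj[OF f, of x] assms by blast
 obtain y' where y': "y' : Field r" "x' <. y'" using HLOTS_no_top[OF assms(1) x'(1)] by blast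
 have "x <. f y'" "f y' : ?U" using siso_less[OF f x'(1) y'(1)] siso_mem[OF f y'(1)] x' y' by auto
 thus False using neg by blast
qed

lemma lots_dual: "lots (\<lambda>x y. y <=. x) (\<lambda>x y. y <. x) (r\<inverse>)"
proof -
 interpret d: lin "\<lambda>x y. y <=. x" "\<lambda>x y. y <. x" by (intro lin.intro dual_linorder)
 show ?thesis
 proof
  show "Linear_order (r\<inverse>)" using Lr by simp
  fix x y assume "x : Field (r\<inverse>)" "y : Field (r\<inverse>)"
  thus "(x, y) : r\<inverse> \<longleftrightarrow> y <=. x" using r_le by simp
 qed
qed

end

lemma lots_topology_converse: "lots_topology (r\<inverse>) = lots_topology r"
proof -
 have "underS (r\<inverse>) = aboveS r" "aboveS (r\<inverse>) = underS r"
  unfolding underS_def aboveS_def by auto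
 thus ?thesis unfolding lots_topology_def by (simp add: Un_ac)
qed

lemma HLOTS_converse: "HLOTS r ==> HLOTS (r\<inverse>)"
proof -
 assume H: "HLOTS r"
 have conv: "order_convex (r\<inverse>) U = order_convex r U" for U unfolding order_convex_def by auto
 have oi: "order_isomorphic r (Restr r U) ==> order_isomorphic (r\<inverse>) (Restr (r\<inverse>) U)" for U
 proof -
  have F: "Field (Restr (r\<inverse>) U) = Field (Restr r U)" unfolding Field_def by auto
  assume "order_isomorphic r (Restr r U)"
  then obtain f where "bij_betw f (Field r) (Field (Restr r U))"
   "ALL a:Field r. ALL b:Field r. (a, b) : r \<longleftrightarrow> (f a, f b) : Restr r U"
   unfolding order_isomorphic_def iso_iff2 by blast
  thus "order_isomorphic (r\<inverse>) (Restr (r\<inverse>) U)"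
   unfolding order_isomorphic_def iso_iff2 F Field_converse by (intro exI[of _ f]) auto
 qed
 show ?thesis using H unfolding HLOTS_def lots_topology_converse conv Field_converse using oi by auto
qed

context lots
begin

lemma HLOTS_no_bot: "HLOTS r ==> m : Field r ==> EX x:Field r. x <. m"
proof -
 interpret d: lots "\<lambda>x y. y <=. x" "\<lambda>x y. y <. x" "r\<inverse>" by (rule lots_dual)
 show "HLOTS r ==> m : Field r ==> EX x:Field r. x <. m" using d.HLOTS_no_top[OF HLOTS_converse] by simp
qed

lemma HLOTS_iff:
 "HLOTS r \<longleftrightarrow> Field r ~= {} & (ALL x:Field r. EX y:Field r. x <. y) & (ALL x:Field r. EX y:Field r. y <. x) &
  (ALL x:Field r. ALL y:Field r. x <. y --> (EX z:Field r. x <. z & z <. y)) &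
  (ALL U. endless U --> (EX f. siso (<.) (<.) f (Field r) U))" (is "_ \<longleftrightarrow> ?R")
proof
 assume H: "HLOTS r"
 have "Field r ~= {}" using H unfolding HLOTS_def by blast
 moreover have "EX f. siso (<.) (<.) f (Field r) U" if "endless U" for U
  using H endless_openin[OF that] iso_siso[of U] that unfolding HLOTS_def endless_def by blast
 ultimately show ?R using HLOTS_no_top[OF H] HLOTS_no_bot[OF H] HLOTS_dense[OF H] by blast
next
 assume R: ?R
 then obtain a where a: "a : Field r" by blast
 then obtain b where b: "b : Field r" "a <. b" using R by blast
 then obtain c where c: "c : Field r" "b <. c" using R by blast
 have "a ~= b" "b ~= c" "a ~= c" using b c by auto
 hence 3: "EX a:Field r. EX b:Field r. EX c:Field r. a ~= b & a ~= c & b ~= c" using a b c by blast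
 have "order_isomorphic r (Restr r U)" if U: "openin (lots_topology r) U" "order_convex r U" "U ~= {}" for U
 proof -
  have UF: "U <= Field r" using U(2) unfolding order_convex_def by blast
  have "endless U" unfolding endless_def
  proof (intro conjI ballI impI)
   show "U <= Field r" "U ~= {}" by fact+
   fix x y z assume "x : U" "y : U" "z : Field r" "x <. z & z <. y"
   thus "z : U" using U(2) UF r_le[of x z] r_le[of z y] unfolding order_convex_def by (meson less_imp_le subsetD)
  next
   fix x assume x: "x : U"
   obtain y where y: "y : Field r" "x <. y" "ALL z:Field r. x <=. z & z <. y --> z : U"
    using openin_nbhd[OF U(1) x] R UF x by blast
   then obtain z where "z : Field r" "x <. z" "z <. y" using R UF x by blast
   thus "EX y:U. x <. y" using y(3) less_imp_le by blast
  next
   fix x assume x: "x : U"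
   obtain y where y: "y : Field r" "y <. x" "ALL z:Field r. y <. z & z <=. x --> z : U"
    using openin_nbhd[OF U(1) x] R UF x by blast
   then obtain z where "z : Field r" "y <. z" "z <. x" using R UF x by blast
   thus "EX y:U. y <. x" using y(3) less_imp_le by blast
  qed
  thus ?thesis using R iso_siso[OF UF] by blast
 qed
 thus "HLOTS r" unfolding HLOTS_def using Lr 3 by blast
qed

lemma complete_lots_iff:
 assumes "Field r ~= {}" "ALL x:Field r. EX y:Field r. x <. y" "ALL x:Field r. EX y:Field r. y <. x"
  "ALL x:Field r. ALL y:Field r. x <. y --> (EX z:Field r. x <. z & z <. y)"
 shows "complete_lots r \<longleftrightarrow> clo (<=.) (<.) (Field r)"
proof
 assume C: "complete_lots r"
 show "clo (<=.) (<.) (Field r)"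
 proof (unfold_locales, goal_cases)
  case 1 show ?case by (rule assms(1))
 next
  case (2 x) thus ?case using assms(2) by blast
 next
  case (3 x) thus ?case using assms(3) by blast
 next
  case (4 x y) thus ?case using assms(4) by blast
 next
  case (5 S u)
  obtain s0 where s0: "s0 : S" using 5 by blast
  \<comment> \<open>Completeness is stated for sets bounded on both sides, so the set is truncated
    at one of its members; the supremum does not change.\<close>
  let ?S = "{x:S. s0 <=. x}"
  have "u : Above r ?S" unfolding Above_def using 5(1,3,4) r_le[of _ u] by blast
  moreover have "s0 : Under r ?S" unfolding Under_def using 5(1) r_le[of s0] s0 by blast
  moreover have "?S <= Field r" "?S ~= {}" using s0 5(1) by auto
  ultimately have "has_sup r ?S" using C unfolding complete_lots_def by (metis empty_iff)
  then obtain s where s: "s : Above r ?S" "ALL u:Above r ?S. (s, u) : r" unfolding has_sup_def by blast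
  have sF: "s : Field r" using s(1) unfolding Above_def by blast
  have le: "x <=. s" if x: "x : S" for x
  proof (cases "s0 <=. x")
   case True
   thus ?thesis using s(1) x r_iff unfolding Above_def by blast
  next
   case False
   moreover have "s0 <=. s" using s(1) s0 r_iff unfolding Above_def by blast
   ultimately show ?thesis by order
  qed
  have "s <=. v" if v: "v : Field r" "ALL x:S. x <=. v" for v
  proof -
   have "v : Above r ?S" unfolding Above_def using v 5(1) r_le by blast
   thus ?thesis using s(2) r_iff by blast
  qed
  thus ?case using sF le by blast
 qed
next
 assume "clo (<=.) (<.) (Field r)"
 then interpret clo "(<=.)" "(<.)" "Field r" .
 have "has_sup r S & has_inf r S" if S: "S <= Field r" "S ~= {}" "Above r S ~= {}" "Under r S ~= {}" for S
 proof
  obtain u where u: "u : Field r" "!!x. x : S ==> x <=. u" using S(3) r_iff unfolding Above_def by blast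
  obtain s where s: "s : Field r" "ALL x:S. x <=. s" "ALL v:Field r. (ALL x:S. x <=. v) --> s <=. v"
   using complete[OF S(1,2) u] by blast
  show "has_sup r S" unfolding has_sup_def Above_def using s S(1) r_iff by (intro bexI[of _ s]) blast+
  obtain v where v: "v : Field r" "!!x. x : S ==> v <=. x" using S(4) r_iff unfolding Under_def by blast
  obtain t where t: "t : Field r" "ALL x:S. t <=. x" "ALL v:Field r. (ALL x:S. v <=. x) --> v <=. t"
   using complete_inf[OF S(1,2) v] by blast
  show "has_inf r S" unfolding has_inf_def Under_def using t S(1) r_iff by (intro bexI[of _ t]) blast+
 qed
 thus "complete_lots r" unfolding complete_lots_def using Lr by blast
qed

lemma CHLOTS_iff:
 "CHLOTS r \<longleftrightarrow> clo (<=.) (<.) (Field r) & (ALL U. endless U --> (EX f. siso (<.) (<.) f (Field r) U))"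
proof
 assume "CHLOTS r"
 thus "clo (<=.) (<.) (Field r) & (ALL U. endless U --> (EX f. siso (<.) (<.) f (Field r) U))"
  unfolding CHLOTS_def HLOTS_iff using complete_lots_iff by blast
next
 assume R: "clo (<=.) (<.) (Field r) & (ALL U. endless U --> (EX f. siso (<.) (<.) f (Field r) U))"
 then interpret clo "(<=.)" "(<.)" "Field r" by blast
 have *: "Field r ~= {}" "ALL x:Field r. EX y:Field r. x <. y" "ALL x:Field r. EX y:Field r. y <. x"
  "ALL x:Field r. ALL y:Field r. x <. y --> (EX z:Field r. x <. z & z <. y)"
  using ne no_top no_bot dense by blast+
 show "CHLOTS r" unfolding CHLOTS_def HLOTS_iff using complete_lots_iff[OF *] R * by blast
qed

text \<open>Any strictly increasing sequence spans an open convex set, which is a copy of the whole.\<close>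

lemma HLOTS_cofinal:
 assumes H: "HLOTS r"
 obtains c :: "nat => 'a" where "!!n. c n : Field r" "!!n. c n <. c (Suc n)" "!!x. x : Field r ==> EX n. x <. c n"
proof -
 note R = H[unfolded HLOTS_iff]
 obtain a where a: "a : Field r" using R by blast
 define nx where "nx x = (SOME y. y : Field r & x <. y)" for x
 have nx: "nx x : Field r & x <. nx x" if "x : Field r" for x
 proof -
  have "EX y. y : Field r & x <. y" using R that by blast
  thus ?thesis unfolding nx_def by (rule someI_ex)
 qed
 define s where "s = rec_nat a (\<lambda>n. nx)"
 have s0: "s 0 = a" and sS: "s (Suc n) = nx (s n)" for n by (simp_all add: s_def)
 have sF: "s n : Field r" for n using a nx by (induction n) (auto simp: s0 sS)
 have sl: "s n <. s (Suc n)" for n using nx[OF sF[of n]] sS by simp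
 let ?U = "{x:Field r. EX n. x <. s n}"
 have "endless ?U" unfolding endless_def
 proof (intro conjI ballI impI)
  show "?U ~= {}" using a sl[of 0] s0 by auto
  fix x assume "x : ?U"
  then obtain n where n: "x : Field r" "x <. s n" by blast
  show "EX y:?U. x <. y" using n sF sl by blast
  obtain y where "y : Field r" "y <. x" using R n(1) by blast
  moreover hence "y <. s n" using n(2) by order
  ultimately show "EX y:?U. y <. x" by blast
 next
  fix x y z assume "x : ?U" "y : ?U" "z : Field r" "x <. z & z <. y"
  thus "z : ?U" using less_trans by blast
 qed blast
 then obtain f where f: "siso (<.) (<.) f (Field r) ?U" using R by blast
 define c where "c n = inv_into (Field r) f (s n)" for n
 have sU: "s n : ?U" for n using sF sl by blast
 have c: "c n : Field r" "f (c n) = s n" for n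
  using siso_mem[OF siso_inv[OF f] sU[of n]] siso_image[OF f] sU[of n] f_inv_into_f[of "s n" f "Field r"]
  unfolding c_def by blast+
 show ?thesis
 proof (rule that[of c])
  show "c n : Field r" for n by (rule c)
  show "c n <. c (Suc n)" for n using siso_less[OF f c(1)[of n] c(1)[of "Suc n"]] c(2) sl by simp
  fix x assume x: "x : Field r"
  then obtain n where "f x <. s n" using siso_mem[OF f x] by blast
  hence "x <. c n" using siso_less[OF f x c(1)[of n]] c(2) by simp
  thus "EX n. x <. c n" by blast
 qed
qed

lemma HLOTS_coinitial:
 assumes H: "HLOTS r"
 obtains c :: "nat => 'a" where "!!n. c n : Field r" "!!n. c (Suc n) <. c n" "!!x. x : Field r ==> EX n. c n <. x"
proof -
 interpret d: lots "\<lambda>x y. y <=. x" "\<lambda>x y. y <. x" "r\<inverse>" by (rule lots_dual)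
 show ?thesis using d.HLOTS_cofinal[OF HLOTS_converse[OF H]] that by (metis Field_converse)
qed

lemma has_max_iff: "has_max r \<longleftrightarrow> (EX m:Field r. ALL a:Field r. a <=. m)"
 and has_min_iff: "has_min r \<longleftrightarrow> (EX m:Field r. ALL a:Field r. m <=. a)"
 unfolding has_max_def has_min_def using r_le by blast+

end

section \<open>Completions\<close>

lemma order_denseD:
 "order_dense r ==> (a, b) : r ==> a ~= b ==> EX c. c ~= a & c ~= b & (a, c) : r & (c, b) : r"
 unfolding order_dense_def by (drule bspec) auto

text \<open>Transport of the completion to \<open>X\<close>: composing the embedding with the
  isomorphism places the points of \<open>Y\<close> directly in \<open>X\<close>, and density in the
  topological sense becomes density for intervals.\<close>

lemma completion_isomorphicD:
 fixes X :: "'a rel" and Y :: "'b rel"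
 assumes X: "lots le lt X" and YX: "completion_isomorphic Y X"
 obtains e where "e ` Field Y <= Field X"
  "!!x y. x : Field Y ==> y : Field Y ==> x ~= y ==> (x, y) : Y \<longleftrightarrow> lt (e x) (e y)"
  "!!a b. a : Field X ==> b : Field X ==> lt a b ==> EX y:Field Y. lt a (e y) & lt (e y) b"
  "complete_lots X" "order_dense X" "has_max X \<longleftrightarrow> has_max Y" "has_min X \<longleftrightarrow> has_min Y"
  "Linear_order Y" "order_dense Y"
proof -
 interpret X: lots le lt X by (rule X)
 obtain Z :: "'a rel" where Z: "is_completion Y Z" "order_isomorphic Z X"
  using YX unfolding completion_isomorphic_def by blast
 obtain g where g: "bij_betw g (Field Z) (Field X)" "!!a b. a : Field Z ==> b : Field Z ==> (a, b) : Z \<longleftrightarrow> (g a, g b) : X"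
  using Z(2) unfolding order_isomorphic_def iso_iff2 by blast
 obtain e where e: "e ` Field Y <= Field Z" "iso Y (Restr Z (e ` Field Y)) e"
  "lots_topology Z closure_of (e ` Field Y) = Field Z" using Z(1) unfolding is_completion_def by blast
 have LZ: "Linear_order Z" "complete_lots Z" "order_dense Z" "Linear_order Y" "order_dense Y"
  "has_max Z \<longleftrightarrow> has_max Y" "has_min Z \<longleftrightarrow> has_min Y"
  using Z(1) unfolding is_completion_def complete_lots_def by auto
 obtain lez ltz where "lin lez ltz" "!!x y. x : Field Z ==> y : Field Z ==> (x, y) : Z \<longleftrightarrow> lez x y"
  using linear_order_extend[OF LZ(1)] by blast
 then interpret Z: lots lez ltz Z using LZ(1) by (intro lots.intro lots_axioms.intro)
 have gF: "g a : Field X" if "a : Field Z" for a using g(1) that by (rule bij_betw_apply)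
 have g_inj: "g a = g b \<longleftrightarrow> a = b" if "a : Field Z" "b : Field Z" for a b
  using g(1) that unfolding bij_betw_def inj_on_def by blast
 have g_surj: "EX a:Field Z. g a = x" if "x : Field X" for x
  using g(1) that unfolding bij_betw_def by (metis imageE)
 have gle: "lez a b \<longleftrightarrow> le (g a) (g b)" if "a : Field Z" "b : Field Z" for a b
  using g(2) Z.r_le X.r_le gF that by metis
 have glt: "ltz a b \<longleftrightarrow> lt (g a) (g b)" if "a : Field Z" "b : Field Z" for a b
  using gle that Z.not_le X.not_le by metis
 have FR: "Field (Restr Z (e ` Field Y)) = e ` Field Y" by (rule Z.Restr_Field[OF e(1)])
 have e': "bij_betw e (Field Y) (e ` Field Y)" "!!a b. a : Field Y ==> b : Field Y ==> (a, b) : Y \<longleftrightarrow> (e a, e b) : Z"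
  using e(2) unfolding iso_iff2 FR by auto
 have dense: "EX z:Field Z. ltz x z & ltz z y" if "x : Field Z" "y : Field Z" "ltz x y" for x y
 proof -
  have "(x, y) : Z" "x ~= y" using that Z.r_iff Z.less_imp_le by auto
  then obtain c where "c ~= x" "c ~= y" "(x, c) : Z" "(c, y) : Z" using order_denseD[OF LZ(3)] by blast
  thus ?thesis using Z.r_iff Z.less_le by metis
 qed
 show ?thesis
 proof (rule that[of "g \<circ> e"])
  show "(g \<circ> e) ` Field Y <= Field X" using e(1) gF by auto
  fix x y assume xy: "x : Field Y" "y : Field Y" "x ~= y"
  have eF: "e x : Field Z" "e y : Field Z" using e(1) xy by auto
  have ne: "e x ~= e y" using e'(1) xy unfolding bij_betw_def inj_on_def by blast
  have "(x, y) : Y \<longleftrightarrow> ltz (e x) (e y)" using e'(2)[OF xy(1,2)] Z.r_le[OF eF] ne Z.le_less by auto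
  thus "(x, y) : Y \<longleftrightarrow> lt ((g \<circ> e) x) ((g \<circ> e) y)" using glt[OF eF] by simp
 next
  fix a b assume ab: "a : Field X" "b : Field X" "lt a b"
  obtain a' b' where ab': "a' : Field Z" "g a' = a" "b' : Field Z" "g b' = b" using g_surj ab by meson
  hence "ltz a' b'" using glt ab by auto
  then obtain c where c: "c : Field Z" "ltz a' c" "ltz c b'" using dense ab' by blast
  have "c : lots_topology Z closure_of (e ` Field Y)" using e(3) c(1) by simp
  hence cl: "c : T & openin (lots_topology Z) T --> (EX y. y : e ` Field Y & y : T)" for T
   unfolding in_closure_of by simp
  have "c : {x:Field Z. ltz a' x & ltz x b'}" using c by simp
  then obtain z where z: "z : e ` Field Y" "z : {x:Field Z. ltz a' x & ltz x b'}"
   using cl[of "{x:Field Z. ltz a' x & ltz x b'}"] Z.openin_Ivl[OF ab'(1,3)] by metis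
  then obtain y where "y : Field Y" "z = e y" by blast
  thus "EX y:Field Y. lt a ((g \<circ> e) y) & lt ((g \<circ> e) y) b" using z(2) glt ab' by (intro bexI[of _ y]) auto
 next
  have Ab: "Above X (g ` S) = g ` Above Z S" "Under X (g ` S) = g ` Under Z S" if "S <= Field Z" for S
   unfolding Above_def Under_def using that g(2) g_surj gF by (auto simp: image_def subset_iff; metis)+
  have "has_sup X S & has_inf X S" if S: "S <= Field X" "S ~= {}" "Above X S ~= {}" "Under X S ~= {}" for S
  proof -
   define S' where "S' = {z:Field Z. g z : S}"
   have S': "S' <= Field Z" "g ` S' = S" unfolding S'_def using g_surj S(1) by auto
   have "has_sup Z S' & has_inf Z S'"
    using LZ(2) S' S Ab[OF S'(1)] unfolding complete_lots_def by (metis image_is_empty)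
   then obtain s t where s: "s : Above Z S'" "ALL u:Above Z S'. (s, u) : Z"
    and t: "t : Under Z S'" "ALL u:Under Z S'. (u, t) : Z" unfolding has_sup_def has_inf_def by blast
   have sub: "Above Z S' <= Field Z" "Under Z S' <= Field Z" unfolding Above_def Under_def by blast+
   have "g s : Above X S" "ALL u:Above X S. (g s, u) : X"
    using s(1) s(2) subsetD[OF sub(1)] Ab(1)[OF S'(1)] g(2)[of s] S'(2) by force+
   moreover have "g t : Under X S" "ALL u:Under X S. (u, g t) : X"
    using t(1) t(2) subsetD[OF sub(2)] Ab(2)[OF S'(1)] g(2)[of _ t] S'(2) by force+
   ultimately show ?thesis unfolding has_sup_def has_inf_def by blast
  qed
  thus "complete_lots X" unfolding complete_lots_def using X.Lr by blast
  show "order_dense X" unfolding order_dense_def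
  proof (intro ballI, clarify)
   fix a b assume ab: "(a, b) : X" "a ~= b"
   hence abF: "a : Field X" "b : Field X" "lt a b" using X.r_iff X.less_le by auto
   obtain a' b' where ab': "a' : Field Z" "g a' = a" "b' : Field Z" "g b' = b" using g_surj abF by meson
   hence "ltz a' b'" using glt abF by auto
   then obtain c where c: "c : Field Z" "ltz a' c" "ltz c b'" using dense ab' by blast
   hence "lt a (g c)" "lt (g c) b" "g c : Field X" using glt ab' gF by auto
   thus "EX c. c ~= a & c ~= b & (a, c) : X & (c, b) : X"
    using X.r_iff abF X.less_le by (intro exI[of _ "g c"]) auto
  qed
  have gi: "Field X = g ` Field Z" using bij_betw_imp_surj_on[OF g(1)] by simp
  have "has_max X \<longleftrightarrow> (EX m:Field Z. ALL a:Field Z. (g a, g m) : X)"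
   "has_min X \<longleftrightarrow> (EX m:Field Z. ALL a:Field Z. (g m, g a) : X)"
   unfolding has_max_def has_min_def gi by simp_all
  moreover have "(EX m:Field Z. ALL a:Field Z. (g a, g m) : X) \<longleftrightarrow> has_max Z"
   "(EX m:Field Z. ALL a:Field Z. (g m, g a) : X) \<longleftrightarrow> has_min Z"
   unfolding has_max_def has_min_def by (intro bex_cong ball_cong refl; simp add: g(2))+
  ultimately have "has_max X \<longleftrightarrow> has_max Z" "has_min X \<longleftrightarrow> has_min Z" by simp_all
  thus "has_max X \<longleftrightarrow> has_max Y" "has_min X \<longleftrightarrow> has_min Y" using LZ by auto
 qed (use LZ in auto)
qed

text \<open>The order \<open>X\<close> itself is taken as the completion. Linearity and density of
  \<open>Y\<close> are pulled back along \<open>e\<close>; since the image is dense in an order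
  without ends, \<open>Y\<close> has no ends either.\<close>

lemma completion_isomorphicI:
 fixes X :: "'a rel" and Y :: "'b rel"
 assumes X: "lots le lt X" and clo: "clo le lt (Field X)"
  and e: "e ` Field Y <= Field X" "refl_on (Field Y) Y"
   "!!x y. x : Field Y ==> y : Field Y ==> x ~= y ==> e x ~= e y"
   "!!x y. x : Field Y ==> y : Field Y ==> x ~= y ==> (x, y) : Y \<longleftrightarrow> lt (e x) (e y)"
   "!!a b. a : Field X ==> b : Field X ==> lt a b ==> EX y:Field Y. lt a (e y) & lt (e y) b"
 shows "completion_isomorphic Y X"
proof -
 interpret X: lots le lt X by (rule X)
 interpret C: clo le lt "Field X" by (rule clo)
 have eF: "e x : Field X" if "x : Field Y" for x using e(1) that by blast
 have Y_iff: "(x, y) : Y \<longleftrightarrow> x : Field Y & y : Field Y & (e x, e y) : X" for x y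
 proof (cases "x : Field Y & y : Field Y")
  case True
  thus ?thesis
   using e(2) e(3,4)[of x y] X.r_le[OF eF[of x] eF[of y]] X.le_less by (cases "x = y") (auto simp: refl_on_def)
 next
  case False
  thus ?thesis by (auto intro: FieldI1 FieldI2)
 qed
 have inj: "x = y" if "x : Field Y" "y : Field Y" "e x = e y" for x y using e(3) that by blast
 have LX: "trans X" "antisym X" "total_on (Field X) X" using X.Lr unfolding order_on_defs by auto
 have LY: "Linear_order Y" unfolding order_on_defs
 proof (intro conjI)
  show "Y <= Field Y \<times> Field Y" by (auto intro: FieldI1 FieldI2)
  show "refl_on (Field Y) Y" by (rule e(2))
  show "trans Y" using transD[OF LX(1)] unfolding trans_def Y_iff[of _ _] by blast
  show "antisym Y" using antisymD[OF LX(2)] inj unfolding antisym_def using Y_iff by blast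
  show "total_on (Field Y) Y" unfolding total_on_def
  proof (intro ballI impI)
   fix x y assume xy: "x : Field Y" "y : Field Y" "x ~= y"
   hence "(e x, e y) : X \<or> (e y, e x) : X" using LX(3) eF e(3) unfolding total_on_def by blast
   thus "(x, y) : Y \<or> (y, x) : Y" using xy Y_iff by blast
  qed
 qed
 have dX: "order_dense X" unfolding order_dense_def
 proof (intro ballI, clarify)
  fix a b assume "(a, b) : X" "a ~= b"
  hence ab: "a : Field X" "b : Field X" "lt a b" using X.r_iff X.less_le by auto
  then obtain c where "c : Field X" "lt a c" "lt c b" using C.dense by blast
  thus "EX c. c ~= a & c ~= b & (a, c) : X & (c, b) : X" using X.r_iff ab X.less_le by (intro exI[of _ c]) auto
 qed
 have dY: "order_dense Y" unfolding order_dense_def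
 proof (intro ballI, clarify)
  fix a b assume ab: "(a, b) : Y" "a ~= b"
  hence abF: "a : Field Y" "b : Field Y" by (auto intro: FieldI1 FieldI2)
  hence "lt (e a) (e b)" using e(4) ab by blast
  then obtain c where c: "c : Field Y" "lt (e a) (e c)" "lt (e c) (e b)" using e(5) eF abF by blast
  hence "c ~= a" "c ~= b" by auto
  thus "EX c. c ~= a & c ~= b & (a, c) : Y & (c, b) : Y" using c e(4) abF by (intro exI[of _ c]) auto
 qed
 have cX: "complete_lots X" using X.complete_lots_iff C.ne C.no_top C.no_bot C.dense clo by blast
 have isoe: "iso Y (Restr X (e ` Field Y)) e"
  unfolding iso_iff2 X.Restr_Field[OF e(1)] using inj Y_iff by (auto simp: bij_betw_def inj_on_def)
 have top: "topspace (lots_topology X) = Field X"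
  unfolding lots_topology_def topology_generated_by_topspace underS_def aboveS_def by (auto simp: Field_def)
 have cl: "lots_topology X closure_of (e ` Field Y) = Field X"
 proof (intro equalityI subsetI)
  fix x assume "x : lots_topology X closure_of (e ` Field Y)"
  thus "x : Field X" unfolding in_closure_of top by blast
 next
  fix x assume x: "x : Field X"
  show "x : lots_topology X closure_of (e ` Field Y)" unfolding in_closure_of top
  proof (intro conjI allI impI)
   fix T assume "x : T & openin (lots_topology X) T"
   hence T: "openin (lots_topology X) T" "x : T" by auto
   obtain b where b: "b : Field X" "lt x b" "ALL z:Field X. le x z & lt z b --> z : T"
    using X.openin_nbhd[OF T] C.no_top[OF x] by blast
   then obtain y where "y : Field Y" "lt x (e y)" "lt (e y) b" using e(5) x by blast
   thus "EX y. y : e ` Field Y & y : T" using b(3) eF X.less_imp_le by blast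
  qed (rule x)
 qed
 have noX: "~ has_max X" "~ has_min X"
  unfolding X.has_max_iff X.has_min_iff using C.no_top C.no_bot X.not_le by meson+
 have noY: "~ has_max Y" "~ has_min Y"
 proof -
  have "EX y:Field Y. (y, m) ~: Y" "EX y:Field Y. (m, y) ~: Y" if m: "m : Field Y" for m
  proof -
   obtain a b where ab: "a : Field X" "lt (e m) a" "b : Field X" "lt b (e m)"
    using C.no_top[OF eF[OF m]] C.no_bot[OF eF[OF m]] by blast
   obtain y z where yz: "y : Field Y" "lt (e m) (e y)" "z : Field Y" "lt (e z) (e m)"
    using e(5)[OF eF[OF m] ab(1,2)] e(5)[OF ab(3) eF[OF m] ab(4)] by blast
   hence "m ~= y" "m ~= z" "~ lt (e y) (e m)" "~ lt (e m) (e z)" using X.less_asym by auto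
   thus "EX y:Field Y. (y, m) ~: Y" "EX y:Field Y. (m, y) ~: Y" using yz m e(4) by blast+
  qed
  thus "~ has_max Y" "~ has_min Y" unfolding has_max_def has_min_def by blast+
 qed
 have "is_completion Y X" unfolding is_completion_def using LY dY cX dX e(1) isoe cl noX noY by blast
 moreover have "order_isomorphic X X" unfolding order_isomorphic_def iso_iff2 by (intro exI[of _ id]) auto
 ultimately show ?thesis unfolding completion_isomorphic_def by blast
qed

section \<open>Ordinals represented by well-orders\<close>

lemma Restr_underS_ordLess: "Well_order r ==> a : Field r ==> Restr r (underS r a) <o r"
 using ordLess_iff_ordIso_Restr[of r "Restr r (underS r a)"] Well_order_Restr[of r "underS r a"]
  ordIso_reflexive by blast

text \<open>Being a cardinal, \<open>Omega\<close> exceeds a well-order as soon as it exceeds the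
  cardinality of its field; being the successor cardinal of the natural numbers, it exceeds exactly
  the countable cardinalities.\<close>

lemma ordLess_Omega_iff:
 assumes k: "Well_order k"
 shows "k <o Omega \<longleftrightarrow> countable (Field k)"
proof -
 have O: "Card_order Omega" unfolding Omega_def by (rule cardSuc_Card_order[OF natLeq_Card_order])
 have "countable (Field k) \<longleftrightarrow> |Field k| <=o |UNIV::nat set|"
  unfolding countable_def card_of_ordLeq[symmetric] by auto
 hence cnt: "countable (Field k) \<longleftrightarrow> |Field k| <=o natLeq"
  using card_of_nat ordLeq_ordIso_trans ordIso_symmetric by blast
 have less: "|Field k| <o Omega \<longleftrightarrow> |Field k| <=o natLeq"
  unfolding Omega_def by (rule cardSuc_ordLeq_ordLess[OF natLeq_Card_order card_of_Card_order])
 show ?thesis unfolding cnt less[symmetric]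
 proof
  assume "k <o Omega"
  moreover have "|Field k| <=o k" by (rule card_of_least[OF k])
  ultimately show "|Field k| <o Omega" by (rule ordLeq_ordLess_trans[rotated])
 next
  assume l: "|Field k| <o Omega"
  show "k <o Omega"
  proof (rule ccontr)
   assume "~ k <o Omega"
   hence "Omega <=o k" using ordLess_or_ordLeq[OF k] O card_order_on_well_order_on by blast
   hence "|Field Omega| <=o |Field k|" by (rule card_of_mono2)
   hence "Omega <=o |Field k|"
    using ordIso_ordLeq_trans[OF ordIso_symmetric[OF card_of_Field_ordIso[OF O]]] by blast
   thus False using l not_ordLess_ordLeq by blast
  qed
 qed
qed

section \<open>Trees\<close>

locale wtree =
 fixes T :: "'v tree"
 assumes irr: "p : verts T ==> (p, p) ~: prec T"
  and tr: "p : verts T ==> q : verts T ==> s : verts T ==> (p, q) : prec T ==> (q, s) : prec T ==> (p, s) : prec T"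
  and wo: "p : verts T ==> well_order_on (preds T p) (order_of T p)"
begin

abbreviation V where "V \<equiv> verts T"
abbreviation pr (infix \<open>\<lhd>\<close> 50) where "p \<lhd> q \<equiv> (p, q) : prec T"

lemma preds_iff: "q : preds T p \<longleftrightarrow> q : V & q \<lhd> p" unfolding preds_def by blast

lemma Field_order_of: "Field (order_of T p) = preds T p" unfolding order_of_def Field_def by blast

lemma WO: "p : V ==> Well_order (order_of T p)" using wo Field_order_of by metis

lemma asymT: "p : V ==> q : V ==> p \<lhd> q ==> ~ q \<lhd> p" using irr tr by blast

lemma preds_total:
 assumes "p : V" "q : V" "r : V" "q \<lhd> p" "r \<lhd> p"
 shows "q = r \<or> q \<lhd> r \<or> r \<lhd> q"
proof -
 have "total_on (preds T p) (order_of T p)" using wo[OF assms(1)] unfolding order_on_defs by blast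
 hence "q ~= r ==> (q, r) : order_of T p \<or> (r, q) : order_of T p"
  using assms preds_iff unfolding total_on_def by blast
 thus ?thesis unfolding order_of_def by blast
qed

lemma preds_least:
 assumes "p : V" "K <= preds T p" "K ~= {}"
 shows "EX m:K. ALL k:K. k = m \<or> m \<lhd> k"
proof -
 have "wf (order_of T p - Id)" using wo[OF assms(1)] unfolding order_on_defs by blast
 then obtain m where m: "m : K" "!!y. (y, m) : order_of T p - Id ==> y ~: K" using assms(3) wfE_min' by metis
 have "k = m \<or> m \<lhd> k" if k: "k : K" for k
 proof (rule ccontr)
  assume n: "~ (k = m \<or> m \<lhd> k)"
  have "k \<lhd> m" using preds_total[of p k m] assms(1,2) k m(1) n preds_iff by blast
  hence "(k, m) : order_of T p - Id" unfolding order_of_def using k m(1) assms(2) n by blast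
  thus False using m(2) k by blast
 qed
 thus ?thesis using m(1) by blast
qed

lemma order_of_Restr:
 assumes "p : V" "q : V" "p \<lhd> q"
 shows "order_of T p = Restr (order_of T q) (underS (order_of T q) p)"
proof -
 have "preds T p <= preds T q" using assms tr preds_iff by blast
 moreover have "underS (order_of T q) p = preds T p"
 proof (intro equalityI subsetI)
  fix r assume "r : underS (order_of T q) p"
  thus "r : preds T p" unfolding underS_def order_of_def by (auto simp: preds_iff)
 next
  fix r assume "r : preds T p"
  hence r: "r : V" "r \<lhd> p" using preds_iff by auto
  hence "r \<lhd> q" "r ~= p" using tr[OF r(1) assms(1,2)] irr[OF assms(1)] assms(3) by auto
  thus "r : underS (order_of T q) p" unfolding underS_def order_of_def using r assms by (auto simp: preds_iff)
 qed
 ultimately show ?thesis unfolding order_of_def by auto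
qed

lemma order_of_less: "p : V ==> q : V ==> p \<lhd> q ==> order_of T p <o order_of T q"
 using Restr_underS_ordLess[OF WO, of q p] order_of_Restr[of p q] Field_order_of preds_iff by auto

text \<open>Immediate successors expressed by the tree order alone. The ordinal description of
  successors is translated into this once, in \<open>succs_iff\<close>.\<close>

definition imm :: "'v => 'v => bool" where
 "imm p q \<longleftrightarrow> q : V & p \<lhd> q & (ALL r:V. p \<lhd> r --> ~ r \<lhd> q)"

lemma imm_ordIso:
 assumes p: "p : V" and q: "imm p q"
 shows "order_of T q =o osucc (order_of T p)"
proof -
 have qV: "q : V" "p \<lhd> q" using q unfolding imm_def by auto
 have Q: "preds T q = insert p (preds T p)"
 proof (intro equalityI subsetI)
  fix r assume "r : preds T q"
  hence r: "r : V" "r \<lhd> q" using preds_iff by auto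
  hence "r = p \<or> r \<lhd> p \<or> p \<lhd> r" using preds_total[OF qV(1) r(1) p] qV by blast
  moreover have "~ p \<lhd> r" using q r unfolding imm_def by blast
  ultimately show "r : insert p (preds T p)" using r preds_iff by blast
 next
  fix r assume "r : insert p (preds T p)"
  thus "r : preds T q" using tr[OF _ p qV(1) _ qV(2)] p qV preds_iff by blast
 qed
 \<comment> \<open>The last predecessor \<open>p\<close> of \<open>q\<close> takes the part of the
   new largest element \<open>None\<close>.\<close>
 define g where "g x = (if x = p then None else Some x)" for x
 have pp: "p ~: preds T p" using irr[OF p] preds_iff by blast
 have "osucc (order_of T p) = dir_image (order_of T q) g"
 proof (intro equalityI subrelI)
  fix a b assume "(a, b) : osucc (order_of T p)"
  then consider x y where "a = Some x" "b = Some y" "(x, y) : order_of T p"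
   | "a = None" "b = None" | x where "a = Some x" "b = None" "x : preds T p"
   unfolding osucc_def Field_order_of by auto
  thus "(a, b) : dir_image (order_of T q) g"
  proof cases
   case 1
   hence "(x, y) : order_of T q" "x ~= p" "y ~= p" using Q pp unfolding order_of_def by auto
   thus ?thesis unfolding dir_image_def g_def using 1 by force
  next
   case 2
   have "(p, p) : order_of T q" using Q unfolding order_of_def by auto
   thus ?thesis unfolding dir_image_def g_def using 2 by force
  next
   case 3
   have "(x, p) : order_of T q" "x ~= p" using Q pp 3 preds_iff unfolding order_of_def by auto
   thus ?thesis unfolding dir_image_def g_def using 3 by force
  qed
 next
  fix a b assume "(a, b) : dir_image (order_of T q) g"
  then obtain x y where xy: "a = g x" "b = g y" "(x, y) : order_of T q" unfolding dir_image_def by blast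
  have xQ: "x = p \<or> x : preds T p" "y = p \<or> y : preds T p" using xy(3) Q unfolding order_of_def by auto
  show "(a, b) : osucc (order_of T p)"
  proof (cases "y = p")
   case True
   thus ?thesis using xy xQ unfolding osucc_def Field_order_of g_def by auto
  next
   case False
   have "x ~= p"
   proof
    assume "x = p"
    hence "p \<lhd> y" "y \<lhd> p" using xy(3) False xQ preds_iff unfolding order_of_def by auto
    thus False using asymT p xQ False preds_iff by blast
   qed
   hence "(x, y) : order_of T p" using xy(3) xQ False unfolding order_of_def by auto
   thus ?thesis using xy False \<open>x ~= p\<close> unfolding osucc_def g_def by force
  qed
 qed
 moreover have "inj_on g (Field (order_of T q))" unfolding g_def inj_on_def by auto
 ultimately show ?thesis using dir_image_ordIso[OF WO[OF qV(1)]] by simp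
qed

lemma osucc_greater:
 assumes "Well_order r" "Well_order (osucc r)"
 shows "r <o osucc r"
proof -
 have u: "underS (osucc r) None = Some ` Field r" unfolding underS_def osucc_def by auto
 have "Restr (osucc r) (Some ` Field r) = dir_image r Some"
 proof (intro equalityI subrelI)
  fix a b assume "(a, b) : dir_image r Some"
  thus "(a, b) : Restr (osucc r) (Some ` Field r)"
   unfolding dir_image_def osucc_def by (auto intro: FieldI1 FieldI2)
 qed (auto simp: dir_image_def osucc_def)
 hence "r =o Restr (osucc r) (underS (osucc r) None)" using dir_image_ordIso[OF assms(1), of Some] u by simp
 moreover have "None : Field (osucc r)" unfolding osucc_def Field_def by blast
 ultimately show ?thesis using ordLess_iff_ordIso_Restr[OF assms(2,1)] by blast
qed

text \<open>If the order of \<open>q\<close> is one more than that of \<open>p\<close> but some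
  vertex lies between them, the least vertex above \<open>p\<close> on the way to \<open>q\<close>
  has the same order as \<open>q\<close>, although vertices further down have strictly smaller
  order.\<close>

lemma succs_iff:
 assumes p: "p : V"
 shows "q : succs T p \<longleftrightarrow> imm p q"
proof
 assume "imm p q"
 thus "q : succs T p" using imm_ordIso[OF p] unfolding succs_def tree_above_def imm_def by blast
next
 assume "q : succs T p"
 hence q: "q : V" "q = p \<or> p \<lhd> q" "order_of T q =o osucc (order_of T p)"
  unfolding succs_def tree_above_def by auto
 have wos: "Well_order (osucc (order_of T p))" using q(3) unfolding ordIso_def by auto
 have less: "order_of T p <o order_of T q"
  using osucc_greater[OF WO[OF p] wos] q(3) ordLess_ordIso_trans ordIso_symmetric by blast
 hence pq: "p \<lhd> q" using q(2) ordLess_irreflexive by blast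
 show "imm p q" unfolding imm_def
 proof (intro conjI ballI impI)
  fix r assume r: "r : V" "p \<lhd> r"
  show "~ r \<lhd> q"
  proof
   assume rq: "r \<lhd> q"
   let ?K = "{s:preds T q. p \<lhd> s}"
   have "r : ?K" using r rq preds_iff by blast
   then obtain m where m: "m : ?K" "ALL k:?K. k = m \<or> m \<lhd> k" using preds_least[OF q(1), of ?K] by blast
   have mV: "m : V" "m \<lhd> q" "p \<lhd> m" using m preds_iff by auto
   have "imm p m" unfolding imm_def
   proof (intro conjI ballI impI)
    fix s assume s: "s : V" "p \<lhd> s"
    show "~ s \<lhd> m"
    proof
     assume sm: "s \<lhd> m"
     hence "s : ?K" using s mV tr[of s m q] q(1) preds_iff by blast
     hence "s = m \<or> m \<lhd> s" using m(2) by blast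
     thus False using sm irr asymT mV s by blast
    qed
   qed (use mV in auto)
   hence "order_of T m =o osucc (order_of T p)" by (rule imm_ordIso[OF p])
   hence "order_of T m =o order_of T q" using q(3) ordIso_transitive ordIso_symmetric by blast
   thus False using order_of_less[OF mV(1) q(1) mV(2)] not_ordLess_ordIso by blast
  qed
 qed (use q pq in auto)
qed

lemma ordIso_leastI:
 assumes "p : V" "q : V" "p \<lhd> q"
 obtains m where "imm p m" "m = q \<or> m \<lhd> q"
proof -
 let ?K = "{s:preds T q. p \<lhd> s}"
 show ?thesis
 proof (cases "?K = {}")
  case True
  hence "imm p q" unfolding imm_def using assms preds_iff by blast
  thus ?thesis using that by blast
 next
  case False
  then obtain m where m: "m : ?K" "ALL k:?K. k = m \<or> m \<lhd> k"
   using preds_least[OF assms(2), of ?K] by blast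
  have mV: "m : V" "m \<lhd> q" "p \<lhd> m" using m preds_iff by auto
  have "imm p m" unfolding imm_def
  proof (intro conjI ballI impI)
   fix s assume s: "s : V" "p \<lhd> s"
   show "~ s \<lhd> m"
   proof
    assume sm: "s \<lhd> m"
    hence "s : ?K" using s mV tr[of s m q] assms(2) preds_iff by blast
    hence "s = m \<or> m \<lhd> s" using m(2) by blast
    thus False using sm irr asymT mV s by blast
   qed
  qed (use mV in auto)
  thus ?thesis using that mV by blast
 qed
qed

subsection \<open>Branches\<close>

lemma chain_iff:
 "pred_on.chain W (\<lambda>p q. p \<lhd> q) C \<longleftrightarrow> C <= W & (ALL p:C. ALL q:C. p = q \<or> p \<lhd> q \<or> q \<lhd> p)"
 unfolding pred_on.chain_def by auto

lemma chain_insert: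
 assumes "pred_on.chain W (\<lambda>p q. p \<lhd> q) C" "q : W" "ALL p:C. p = q \<or> p \<lhd> q \<or> q \<lhd> p"
 shows "pred_on.chain W (\<lambda>p q. p \<lhd> q) (insert q C)"
proof -
 have C: "C <= W" "ALL p:C. ALL q:C. p = q \<or> p \<lhd> q \<or> q \<lhd> p" using assms(1) unfolding chain_iff by simp_all
 have "a = b \<or> a \<lhd> b \<or> b \<lhd> a" if ab: "a : insert q C" "b : insert q C" for a b
 proof (cases "a = q")
  case True
  thus ?thesis using assms(3) ab(2) by (cases "b = q") auto
 next
  case False
  hence a: "a : C" using ab(1) by simp
  show ?thesis using assms(3) C(2) a ab(2) by (cases "b = q") simp_all
 qed
 thus ?thesis unfolding chain_iff using C(1) assms(2) by simp
qed

lemma branch_iff: "x : branches T \<longleftrightarrow> x <= V & (ALL p:x. ALL q:x. p = q \<or> p \<lhd> q \<or> q \<lhd> p) &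
  (ALL q:V. (ALL p:x. p = q \<or> p \<lhd> q \<or> q \<lhd> p) --> q : x)"
proof
 assume "x : branches T"
 hence x: "pred_on.chain V (\<lambda>p q. p \<lhd> q) x" "\<nexists>S. pred_on.chain V (\<lambda>p q. p \<lhd> q) S & x \<subset> S"
  unfolding branches_def pred_on.maxchain_def by auto
 have "q : x" if q: "q : V" "ALL p:x. p = q \<or> p \<lhd> q \<or> q \<lhd> p" for q
 proof (rule ccontr)
  assume "q ~: x"
  hence "x \<subset> insert q x" by blast
  thus False using x(2) chain_insert[OF x(1) q] by blast
 qed
 thus "x <= V & (ALL p:x. ALL q:x. p = q \<or> p \<lhd> q \<or> q \<lhd> p) &
   (ALL q:V. (ALL p:x. p = q \<or> p \<lhd> q \<or> q \<lhd> p) --> q : x)"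
  using x(1) unfolding chain_iff by simp
next
 assume x: "x <= V & (ALL p:x. ALL q:x. p = q \<or> p \<lhd> q \<or> q \<lhd> p) &
   (ALL q:V. (ALL p:x. p = q \<or> p \<lhd> q \<or> q \<lhd> p) --> q : x)"
 have "~ x \<subset> S" if S: "pred_on.chain V (\<lambda>p q. p \<lhd> q) S" for S
 proof
  assume "x \<subset> S"
  then obtain q where q: "q : S" "q ~: x" "x <= S" by blast
  have "p = q \<or> p \<lhd> q \<or> q \<lhd> p" if "p : x" for p using S q that unfolding chain_iff by blast
  moreover have "q : V" using S q unfolding chain_iff by blast
  ultimately show False using x q by blast
 qed
 moreover have "pred_on.chain V (\<lambda>p q. p \<lhd> q) x" using x unfolding chain_iff by simp
 ultimately show "x : branches T" unfolding branches_def pred_on.maxchain_def by blast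
qed

lemma branch_sub: "x : branches T ==> x <= V"
 and branch_total: "x : branches T ==> p : x ==> q : x ==> p = q \<or> p \<lhd> q \<or> q \<lhd> p"
 and branch_max: "x : branches T ==> q : V ==> (!!p. p : x ==> p = q \<or> p \<lhd> q \<or> q \<lhd> p) ==> q : x"
 unfolding branch_iff by blast+

lemma branch_down:
 assumes x: "x : branches T" "p : x" and q: "q : V" "q \<lhd> p"
 shows "q : x"
proof (rule branch_max[OF x(1) q(1)])
 fix s assume s: "s : x"
 have V: "s : V" "p : V" using branch_sub x s by blast+
 show "s = q \<or> s \<lhd> q \<or> q \<lhd> s"
  using branch_total[OF x(1) s x(2)] preds_total[OF V(2,1) q(1)] tr[OF q(1) V(2,1)] q(2) by blast
qed

lemma branch_incomparable: "x : branches T ==> y : branches T ==> x <= y ==> x = y"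
 using branch_max branch_total branch_sub by blast

text \<open>Hausdorff's principle is applied within the vertices comparable with all of
  \<open>K\<close>; a maximal chain there swallows \<open>K\<close> and is maximal in the whole
  tree.\<close>

lemma branch_extends:
 assumes "K <= V" "ALL p:K. ALL q:K. p = q \<or> p \<lhd> q \<or> q \<lhd> p"
 obtains x where "x : branches T" "K <= x"
proof -
 let ?W = "{p:V. ALL q:K. p = q \<or> p \<lhd> q \<or> q \<lhd> p}"
 obtain M where M: "pred_on.maxchain ?W (\<lambda>p q. p \<lhd> q) M" using pred_on.Hausdorff by blast
 hence Mc: "pred_on.chain ?W (\<lambda>p q. p \<lhd> q) M" "\<nexists>S. pred_on.chain ?W (\<lambda>p q. p \<lhd> q) S & M \<subset> S"
  unfolding pred_on.maxchain_def by auto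
 have M1: "M <= ?W" "ALL p:M. ALL q:M. p = q \<or> p \<lhd> q \<or> q \<lhd> p"
  using Mc(1) unfolding chain_iff by simp_all
 have ins: "q : M" if q: "q : ?W" "ALL p:M. p = q \<or> p \<lhd> q \<or> q \<lhd> p" for q
  using Mc(2) chain_insert[OF Mc(1) q] by blast
 have KM: "K <= M"
 proof
  fix k assume k: "k : K"
  show "k : M"
  proof (rule ins)
   show "k : ?W" using k assms by blast
   show "ALL p:M. p = k \<or> p \<lhd> k \<or> k \<lhd> p" using k M1(1) by blast
  qed
 qed
 have "M : branches T" unfolding branch_iff
 proof (intro conjI ballI impI)
  show "M <= V" using M1 by blast
  fix q assume q: "q : V" "ALL p:M. p = q \<or> p \<lhd> q \<or> q \<lhd> p"
  show "q : M"
  proof (rule ins)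
   have "q = k \<or> q \<lhd> k \<or> k \<lhd> q" if "k : K" for k using q(2) KM that by (metis subsetD)
   thus "q : ?W" using q(1) by blast
  qed (rule q(2))
 qed (use M1 in blast)
 thus ?thesis using KM that by blast
qed

lemma branch_least:
 assumes x: "x : branches T" and K: "K <= x" "K ~= {}"
 shows "EX m:K. ALL k:K. k = m \<or> m \<lhd> k"
proof -
 obtain k where k: "k : K" using K by blast
 have kV: "k : V" using k K branch_sub[OF x] by blast
 let ?L = "{l:K. l \<lhd> k}"
 show ?thesis
 proof (cases "?L = {}")
  case True
  hence "ALL l:K. l = k \<or> k \<lhd> l" using branch_total[OF x, of k] K k by blast
  thus ?thesis using k by blast
 next
  case False
  have "?L <= preds T k" using K branch_sub[OF x] preds_iff by blast
  then obtain m where m: "m : ?L" "ALL l:?L. l = m \<or> m \<lhd> l" using preds_least[OF kV _ False] by blast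
  have "l = m \<or> m \<lhd> l" if l: "l : K" for l
  proof (cases "l \<lhd> k")
   case True
   thus ?thesis using m(2) l by blast
  next
   case False
   hence "l = k \<or> k \<lhd> l" using branch_total[OF x, of k l] K k l by blast
   moreover have "m : V" "l : V" using m(1) l K branch_sub[OF x] by blast+
   ultimately show ?thesis using m(1) tr kV by blast
  qed
  thus ?thesis using m(1) by blast
 qed
qed

text \<open>The least vertex of the branch outside \<open>K\<close> works. At a limit level this
  identifies the vertex that continues a given chain.\<close>

lemma branch_next:
 assumes x: "x : branches T" "K <= x" "x ~= K" and K: "ALL p:K. ALL q:V. q \<lhd> p --> q : K"
 obtains q where "q : x" "q ~: K" "preds T q = K"
proof -
 have "x - K ~= {}" using x by blast
 then obtain q where q: "q : x - K" "ALL k:x - K. k = q \<or> q \<lhd> k" using branch_least[OF x(1)] by blast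
 have qV: "q : V" using q(1) branch_sub[OF x(1)] by blast
 have "preds T q = K"
 proof (intro equalityI subsetI)
  fix p assume "p : preds T q"
  hence p: "p : V" "p \<lhd> q" using preds_iff by auto
  have "p : x" using branch_down[OF x(1) _ p] q(1) by blast
  have "p ~= q" "~ q \<lhd> p" using p irr[OF qV] asymT[OF p(1) qV p(2)] by auto
  thus "p : K" using q(2) \<open>p : x\<close> by blast
 next
  fix p assume p: "p : K"
  hence "p : x" "p : V" using x(2) branch_sub[OF x(1)] by auto
  hence "p = q \<or> p \<lhd> q \<or> q \<lhd> p" using branch_total[OF x(1)] q(1) by blast
  thus "p : preds T q" using K qV q(1) p \<open>p : V\<close> preds_iff by blast
 qed
 thus ?thesis using q(1) that by blast
qed

definition otype :: "'v set => 'v rel" where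
 "otype x = {(p, q) : x \<times> x. p = q \<or> p \<lhd> q}"

lemma otype:
 assumes x: "x : branches T"
 shows "Well_order (otype x)" "Field (otype x) = x" "!!p. p : x ==> order_of T p = Restr (otype x) (underS (otype x) p)"
proof -
 have xV: "x <= V" by (rule branch_sub[OF x])
 show F: "Field (otype x) = x" unfolding otype_def Field_def by blast
 have "wf (otype x - Id)"
 proof (rule wfI_min)
  fix p :: 'v and Q :: "'v set" assume p: "p : Q"
  show "EX z:Q. ALL y. (y, z) : otype x - Id --> y ~: Q"
  proof (cases "Q \<inter> x = {}")
   case True
   thus ?thesis using p unfolding otype_def by blast
  next
   case False
   then obtain m where m: "m : Q \<inter> x" "ALL k:Q \<inter> x. k = m \<or> m \<lhd> k" using branch_least[OF x, of "Q \<inter> x"] by blast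
   have "y ~: Q" if "(y, m) : otype x - Id" for y using that m asymT xV unfolding otype_def by blast
   thus ?thesis using m(1) by blast
  qed
 qed
 moreover have "refl_on x (otype x)" unfolding refl_on_def otype_def by blast
 moreover have "trans (otype x)"
 proof (rule transI)
  fix a b c assume abc: "(a, b) : otype x" "(b, c) : otype x"
  hence "a : V" "b : V" "c : V" using xV unfolding otype_def by auto
  thus "(a, c) : otype x" using abc tr[of a b c] unfolding otype_def by auto
 qed
 moreover have "antisym (otype x)" unfolding antisym_def otype_def using asymT xV by blast
 moreover have "total_on x (otype x)" unfolding total_on_def otype_def using branch_total[OF x] by blast
 moreover have "otype x <= x \<times> x" unfolding otype_def by blast
 ultimately show "Well_order (otype x)" unfolding order_on_defs F by blast
 fix p assume p: "p : x"
 have u: "underS (otype x) p = preds T p"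
 proof (intro equalityI subsetI)
  fix q assume "q : underS (otype x) p"
  thus "q : preds T p" using xV unfolding underS_def otype_def preds_iff by blast
 next
  fix q assume "q : preds T p"
  hence q: "q : V" "q \<lhd> p" using preds_iff by auto
  hence "q : x" "q ~= p" using branch_down[OF x p] irr by blast+
  thus "q : underS (otype x) p" using q p unfolding underS_def otype_def by blast
 qed
 have "preds T p <= x" using branch_down[OF x p] preds_iff by blast
 thus "order_of T p = Restr (otype x) (underS (otype x) p)"
  unfolding u unfolding order_of_def otype_def by blast
qed

text \<open>\<open>height\<close> is a choice, so it is compared with the order type of the branch.
  A well-order shorter than that type is isomorphic to the order of some vertex of the branch and
  thus is no bound.\<close>

lemma height_branch:
 assumes x: "x : branches T"
 shows "height T x =o otype x" "Well_order (height T x)"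
proof -
 note W = otype(1)[OF x] and F = otype(2)[OF x] and R = otype(3)[OF x]
 let ?P = "\<lambda>h. Well_order h & (ALL p:x. order_of T p <o h) &
   (ALL k :: 'v rel. Well_order k & (ALL p:x. order_of T p <o k) --> h <=o k)"
 have less: "order_of T p <o otype x" if "p : x" for p
  using Restr_underS_ordLess[OF W, of p] R[OF that] F that by simp
 have "?P (otype x)"
 proof (intro conjI allI impI ballI)
  fix k :: "'v rel" assume k: "Well_order k & (ALL p:x. order_of T p <o k)"
  show "otype x <=o k"
  proof (rule ccontr)
   assume "~ otype x <=o k"
   hence "k <o otype x" using ordLess_or_ordLeq[of k "otype x"] k W by blast
   then obtain a where "a : x" "k =o Restr (otype x) (underS (otype x) a)"
    using ordLess_iff_ordIso_Restr[OF W, of k] k F by blast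
   hence "k =o order_of T a" "order_of T a <o k" using R k by auto
   thus False using not_ordLess_ordIso ordIso_symmetric by blast
  qed
 qed (use W less in auto)
 hence h: "?P (height T x)" unfolding height_def by (rule someI)
 have "height T x <=o otype x" using h W less by blast
 moreover have "otype x <=o height T x" using \<open>?P (otype x)\<close> h by blast
 ultimately show "height T x =o otype x" using ordIso_iff_ordLeq by blast
 show "Well_order (height T x)" using h by blast
qed

lemma Omega_bounded_iff: "Omega_bounded T \<longleftrightarrow> (ALL x:branches T. countable x)"
proof -
 have "height T x <o Omega \<longleftrightarrow> countable x" if x: "x : branches T" for x
 proof -
  have "height T x <o Omega \<longleftrightarrow> otype x <o Omega"
   using height_branch(1)[OF x] ordIso_ordLess_trans ordIso_symmetric by blast
  thus ?thesis using ordLess_Omega_iff[OF otype(1)[OF x]] otype(2)[OF x] by simp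
 qed
 thus ?thesis unfolding Omega_bounded_def by blast
qed

lemma branch_less_iff: "x : branches T ==> branch_less T x y \<longleftrightarrow>
  (EX p : x \<inter> y. EX a : x. EX b : y. imm p a & imm p b & a ~= b & (a, b) : sord T p)"
 unfolding branch_less_def succ_order_def using succs_iff branch_sub by blast

lemma Field_branch_space: "Field (branch_space T) = branches T"
 unfolding branch_space_def relation_of_def Field_def by blast

lemma branch_space_iff: "(x, y) : branch_space T \<longleftrightarrow> x : branches T & y : branches T & (x = y \<or> branch_less T x y)"
 unfolding branch_space_def relation_of_def by blast

end

section \<open>Orders all of whose open convex subsets are isomorphic\<close>

text \<open>A coinitial sequence each of whose gaps is empty or has neither a first nor a last
  element. In the integers the gaps are empty, in a dense order they are endless; for the reversed
  relation it describes a cofinal sequence.\<close>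

definition dseq :: "('a => 'a => bool) => 'a set => bool" where
 "dseq lt A \<longleftrightarrow> (EX c::nat => 'a. (ALL n. c n : A & lt (c (Suc n)) (c n) &
   (ALL t:A. lt (c (Suc n)) t & lt t (c n) -->
    (EX u:A. lt (c (Suc n)) u & lt u t) & (EX u:A. lt t u & lt u (c n)))) &
   (ALL t:A. EX n. lt (c n) t))"

text \<open>A common weakening of homogeneity and of being isomorphic to the integers.\<close>

definition nice :: "('a => 'a => bool) => 'a set => bool" where
 "nice lt A \<longleftrightarrow> A ~= {} & (ALL s:A. EX t:A. lt s t) & (ALL s:A. EX t:A. lt t s) &
  (ALL U. U <= A --> U ~= {} --> (ALL s:U. ALL t:U. ALL u:A. lt s u & lt u t --> u : U) -->
   (ALL s:U. EX t:U. lt s t) --> (ALL s:U. EX t:U. lt t s) --> (EX f. siso lt lt f A U)) &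
  dseq lt A & dseq (\<lambda>x y. lt y x) A"

lemma niceD:
 assumes "nice lt A"
 shows "A ~= {}" "ALL s:A. EX t:A. lt s t" "ALL s:A. EX t:A. lt t s" "dseq lt A" "dseq (\<lambda>x y. lt y x) A"
 using assms unfolding nice_def by blast+

lemma nice_isoD:
 assumes "nice lt A" "U <= A" "U ~= {}" "ALL s:U. ALL t:U. ALL u:A. lt s u & lt u t --> u : U"
  "ALL s:U. EX t:U. lt s t" "ALL s:U. EX t:U. lt t s"
 shows "EX f. siso lt lt f A U" using assms unfolding nice_def
 apply (elim conjE)
 apply (drule spec[of _ U])
 apply (drule (1) mp)+
 apply assumption
 done

lemma dseq_transfer:
 assumes g: "siso lt lt' g A B" and d: "dseq lt A"
 shows "dseq lt' B"
proof -
 obtain c where c: "!!n. c n : A" "!!n. lt (c (Suc n)) (c n)"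
  "!!n t. t : A ==> lt (c (Suc n)) t ==> lt t (c n) ==>
    (EX u:A. lt (c (Suc n)) u & lt u t) & (EX u:A. lt t u & lt u (c n))"
  "!!t. t : A ==> EX n. lt (c n) t" using d unfolding dseq_def by blast
 note gl = siso_less[OF g] and gm = siso_mem[OF g] and gs = siso_surj[OF g]
 show ?thesis unfolding dseq_def
 proof (intro exI[of _ "g \<circ> c"] conjI allI ballI impI; (elim conjE)?)
  show "(g \<circ> c) n : B" for n using gm c(1) by simp
  show "lt' ((g \<circ> c) (Suc n)) ((g \<circ> c) n)" for n using gl[OF c(1) c(1)] c(2) by simp
 next
  fix n t assume t: "t : B" "lt' ((g \<circ> c) (Suc n)) t" "lt' t ((g \<circ> c) n)"
  obtain t' where t': "t' : A" "g t' = t" using gs[OF t(1)] by blast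
  have l: "lt (c (Suc n)) t'" "lt t' (c n)" using t(2,3) t' gl[OF c(1) t'(1)] gl[OF t'(1) c(1)] by auto
  obtain u v where uv: "u : A" "lt (c (Suc n)) u" "lt u t'" "v : A" "lt t' v" "lt v (c n)"
   using c(3)[OF t'(1) l] by blast
  show "EX u:B. lt' ((g \<circ> c) (Suc n)) u & lt' u t"
   using gm[OF uv(1)] gl[OF c(1) uv(1)] gl[OF uv(1) t'(1)] uv t' by (intro bexI[of _ "g u"]) auto
  show "EX u:B. lt' t u & lt' u ((g \<circ> c) n)"
   using gm[OF uv(4)] gl[OF uv(4) c(1)] gl[OF t'(1) uv(4)] uv t' by (intro bexI[of _ "g v"]) auto
 next
  fix t assume t: "t : B"
  obtain t' where t': "t' : A" "g t' = t" using gs[OF t(1)] by blast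
  then obtain n where "lt (c n) t'" using c(4) by blast
  thus "EX n. lt' ((g \<circ> c) n) t" using gl[OF c(1) t'(1)] t'(2) by auto
 qed
qed

lemma nice_transfer:
 assumes g: "siso lt lt' g A B" and n: "nice lt A"
 shows "nice lt' B"
proof -
 note gl = siso_less[OF g] and gm = siso_mem[OF g] and gs = siso_surj[OF g]
 note n1 = niceD[OF n] and n2 = nice_isoD[OF n]
 have g': "siso (\<lambda>x y. lt y x) (\<lambda>x y. lt' y x) g A B" using g unfolding siso_def by simp
 show ?thesis unfolding nice_def
 proof (intro conjI allI impI ballI)
  show "B ~= {}" using n1(1) gm by blast
  show "dseq lt' B" "dseq (\<lambda>x y. lt' y x) B" using dseq_transfer g g' n1 by blast+
 next
  fix s assume "s : B"
  then obtain s' where s': "s' : A" "g s' = s" using gs by blast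
  obtain t u where "t : A" "lt s' t" "u : A" "lt u s'" using n1(2,3) s'(1) by blast
  thus "EX t:B. lt' s t" "EX t:B. lt' t s" using gl gm s' by blast+
 next
  fix U assume U: "U <= B" "U ~= {}" "ALL s:U. ALL t:U. ALL u:B. lt' s u & lt' u t --> u : U"
   "ALL s:U. EX t:U. lt' s t" "ALL s:U. EX t:U. lt' t s"
  define U' where "U' = {a:A. g a : U}"
  have ex: "EX a:U'. g a = t" if "t : U" for t using gs[of t] U(1) that unfolding U'_def by blast
  have U'A: "U' <= A" unfolding U'_def by blast
  have gU: "g ` U' = U" using ex unfolding U'_def by blast
  have "EX f. siso lt lt f A U'"
  proof (rule n2[OF U'A])
   show "U' ~= {}" using U(2) gU by blast
   show "ALL s:U'. ALL t:U'. ALL u:A. lt s u & lt u t --> u : U'"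
   proof (intro ballI impI)
    fix s t u assume a: "s : U'" "t : U'" "u : A" "lt s u & lt u t"
    hence "lt' (g s) (g u) & lt' (g u) (g t)" using gl U'A by blast
    moreover have "g s : U" "g t : U" "g u : B" using a gm unfolding U'_def by auto
    ultimately show "u : U'" using U(3) a(3) unfolding U'_def by blast
   qed
   show "ALL s:U'. EX t:U'. lt s t"
   proof
    fix s assume s: "s : U'"
    then obtain t where t: "t : U" "lt' (g s) t" using U(4) unfolding U'_def by blast
    then obtain a where "a : U'" "g a = t" using ex by blast
    thus "EX t:U'. lt s t" using t gl s U'A by blast
   qed
   show "ALL s:U'. EX t:U'. lt t s"
   proof
    fix s assume s: "s : U'"
    then obtain t where t: "t : U" "lt' t (g s)" using U(5) unfolding U'_def by blast
    then obtain a where "a : U'" "g a = t" using ex by blast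
    thus "EX t:U'. lt t s" using t gl s U'A by blast
   qed
  qed
  then obtain f where f: "siso lt lt f A U'" by blast
  have gU': "siso lt lt' g U' U" using siso_subset[OF g U'A] gU by simp
  show "EX f. siso lt' lt' f B U" using siso_comp[OF siso_comp[OF siso_inv[OF g] f] gU'] by blast
 qed
qed

lemma (in lots) HLOTS_nice:
 assumes H: "HLOTS r"
 shows "nice (<.) (Field r)"
proof -
 note d = HLOTS_dense[OF H]
 obtain c :: "nat => 'a" where c: "!!n. c n : Field r" "!!n. c (Suc n) <. c n" "!!x. x : Field r ==> EX n. c n <. x"
  using HLOTS_coinitial[OF H] by metis
 obtain b :: "nat => 'a" where b: "!!n. b n : Field r" "!!n. b n <. b (Suc n)" "!!x. x : Field r ==> EX n. x <. b n"
  using HLOTS_cofinal[OF H] by metis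
 show ?thesis unfolding nice_def
 proof (intro conjI allI impI)
  fix U assume UU: "U <= Field r" "U ~= {}" "ALL s:U. ALL t:U. ALL u:Field r. s <. u & u <. t --> u : U"
   "ALL s:U. EX t:U. s <. t" "ALL s:U. EX t:U. t <. s"
  hence en: "endless U" unfolding endless_def by (intro conjI)
  thus "EX f. siso (<.) (<.) f (Field r) U"
   using H endless_openin[OF en] iso_siso[of U] UU(1,2) unfolding HLOTS_def by blast
 next
  show "dseq (<.) (Field r)" unfolding dseq_def using c d by (intro exI[of _ c]) auto
  show "dseq (\<lambda>x y. y <. x) (Field r)"
  proof -
   have d': "EX z:Field r. z <. y & x <. z" if "x : Field r" "y : Field r" "x <. y" for x y
    using d that by blast
   show ?thesis unfolding dseq_def using b d d' by (intro exI[of _ b]) auto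
  qed
 next
  show "Field r ~= {}" "ALL s:Field r. EX t:Field r. s <. t" "ALL s:Field r. EX t:Field r. t <. s"
   using c b by blast+
 qed
qed

text \<open>A nonempty convex set of integers without first and last element is unbounded in both
  directions, hence everything. The sequences run through consecutive integers, so there is nothing
  in the gaps.\<close>

lemma nice_int: "nice (<) (UNIV :: int set)" unfolding nice_def
proof (intro conjI allI impI)
 fix U :: "int set" assume U: "U ~= {}" "ALL s:U. ALL t:U. ALL u:UNIV. s < u & u < t --> u : U"
  "ALL s:U. EX t:U. s < t" "ALL s:U. EX t:U. t < s"
 obtain s0 where s0: "s0 : U" using U(1) by blast
 have up: "EX t:U. s0 + int n <= t" for n
 proof (induction n)
  case (Suc n)
  then obtain t where "t : U" "s0 + int n <= t" by blast
  moreover then obtain u where "u : U" "t < u" using U(3) by blast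
  ultimately show ?case by (intro bexI[of _ u]) auto
 qed (use s0 in auto)
 have dn: "EX t:U. t <= s0 - int n" for n
 proof (induction n)
  case (Suc n)
  then obtain t where "t : U" "t <= s0 - int n" by blast
  moreover then obtain u where "u : U" "u < t" using U(4) by blast
  ultimately show ?case by (intro bexI[of _ u]) auto
 qed (use s0 in auto)
 have "x : U" for x
 proof -
  obtain t where t: "t : U" "s0 + int (nat (x - s0 + 1)) <= t" using up by blast
  obtain u where u: "u : U" "u <= s0 - int (nat (s0 - x + 1))" using dn by blast
  have "u < x" "x < t" using t(2) u(2) by linarith+
  thus ?thesis using U(2) t(1) u(1) by blast
 qed
 hence "U = UNIV" by blast
 thus "EX f. siso (<) (<) f (UNIV :: int set) U" by (intro exI[of _ "\<lambda>x. x"]) (simp add: siso_id)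
next
 show "dseq (<) (UNIV :: int set)" unfolding dseq_def
 proof (intro exI[of _ "\<lambda>n. - int n"] conjI allI ballI)
  fix t :: int
  show "EX n. - int n < t" by (intro exI[of _ "nat (1 - t)"]) auto
 qed auto
 show "dseq (\<lambda>x y. y < x) (UNIV :: int set)" unfolding dseq_def
 proof (intro exI[of _ "\<lambda>n. int n"] conjI allI ballI)
  fix t :: int
  show "EX n. t < int n" by (intro exI[of _ "nat (t + 1)"]) auto
 qed auto
qed (auto intro: gt_ex lt_ex)

section \<open>Reproductive trees\<close>

text \<open>\<open>lim_uniq\<close> is semi-normality at limit levels, a limit being recognised by
  having predecessors but no last one. The map \<open>e\<close> is the dense embedding of the branch
  space into its completion.\<close>

locale rtree = wtree T + clo less_eq less A
 for T :: "'v tree" and less_eq :: "'a => 'a => bool" (infix \<open><=.\<close> 50) and less (infix \<open><.\<close> 50) and A +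
 fixes rt :: 'v and e :: "'v set => 'a"
 assumes rt: "rt : verts T" "p : verts T ==> p ~= rt ==> (rt, p) : prec T"
  and lim_uniq: "p : verts T ==> q : verts T ==> preds T p = preds T q ==> preds T p ~= {} ==>
    (ALL r:preds T p. EX s:preds T p. (r, s) : prec T) ==> p = q"
  and cntb: "x : branches T ==> countable x"
  and rep: "p : verts T ==> EX f. bij_betw f (verts T) (tree_above T p) &
    (ALL q:verts T. ALL q':verts T. (q, q') : prec T \<longleftrightarrow> (f q, f q') : prec T) &
    (ALL q:verts T. ALL a:succs T q. ALL b:succs T q. (a, b) : succ_order T q \<longleftrightarrow> (f a, f b) : succ_order T (f q))"
  and nc: "nice (\<lambda>a b. a ~= b & (a, b) : sord T rt) (succs T rt)"
  and tot: "s : succs T rt ==> t : succs T rt ==> s ~= t ==> (s, t) : sord T rt \<or> (t, s) : sord T rt"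
  and e: "x : branches T ==> e x : A"
   "x : branches T ==> y : branches T ==> branch_less T x y ==> e x <. e y"
   "x : branches T ==> y : branches T ==> x ~= y ==> branch_less T x y \<or> branch_less T y x"
   "a : A ==> b : A ==> a <. b ==> EX x:branches T. a <. e x & e x <. b"
begin

section \<open>Vertices as convex sets of points of the completion\<close>

lemma e_less: "x : branches T ==> y : branches T ==> e x <. e y \<longleftrightarrow> branch_less T x y"
 using e(2)[of x y] e(2)[of y x] e(3)[of x y] by (cases "x = y") auto

lemma e_inj: "x : branches T ==> y : branches T ==> e x = e y ==> x = y"
 using e(2)[of x y] e(2)[of y x] e(3)[of x y] by auto

lemma rt_branch: "x : branches T ==> rt : x" using branch_max[of x rt] branch_sub[of x] rt by blast

definition Br where "Br p = {x:branches T. p : x}"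
definition E where "E p = e ` Br p"

lemma Br_ne:
 assumes "p : V" shows "Br p ~= {}"
proof -
 obtain x where "x : branches T" "{p} <= x" by (rule branch_extends[of "{p}"]) (use assms in auto)
 thus ?thesis unfolding Br_def by blast
qed

lemma E_mem: "x : branches T ==> e x : E p \<longleftrightarrow> p : x"
 unfolding E_def Br_def using e_inj by blast

lemma E_rt: "E rt = e ` branches T" unfolding E_def Br_def using rt_branch by blast

lemma E_sub_rt: "E p <= E rt" unfolding E_rt unfolding E_def Br_def by blast

lemma E_mono: "p : V ==> q : V ==> p = q \<or> p \<lhd> q ==> E q <= E p"
 unfolding E_def Br_def using branch_down by blast

lemma E_meet: "u : E p ==> u : E q ==> p = q \<or> p \<lhd> q \<or> q \<lhd> p"
proof -
 assume "u : E p" "u : E q"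
 then obtain x where x: "x : branches T" "u = e x" "p : x" unfolding E_def Br_def by blast
 hence "q : x" using \<open>u : E q\<close> E_mem by blast
 thus ?thesis using branch_total x by blast
qed

lemma two_imm_rt: "EX a b. imm rt a & imm rt b & a ~= b"
proof -
 obtain s where s: "s : succs T rt" using nc unfolding nice_def by blast
 then obtain t where "t : succs T rt" "s ~= t" using nc unfolding nice_def by meson
 thus ?thesis using s succs_iff[OF rt(1)] by blast
qed

text \<open>The least vertex must go to the least vertex, so the root goes to \<open>p\<close>. A
  vertex between the images of immediate successors would lie above \<open>p\<close> and therefore
  be an image itself, so immediate successors are preserved.\<close>

lemma rep_iso:
 assumes p: "p : V"
 obtains f where "!!q. q : V ==> f q : V & (f q = p \<or> p \<lhd> f q)"
  "!!r. r : V ==> r = p \<or> p \<lhd> r ==> EX q:V. f q = r"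
  "!!q q'. q : V ==> q' : V ==> f q = f q' \<longleftrightarrow> q = q'"
  "!!q q'. q : V ==> q' : V ==> f q \<lhd> f q' \<longleftrightarrow> q \<lhd> q'"
  "f rt = p" "!!q a. q : V ==> imm q a ==> imm (f q) (f a)"
  "!!q a b. q : V ==> imm q a ==> imm q b ==> (a, b) : sord T q ==> (f a, f b) : sord T (f q)"
proof -
 obtain f where f: "bij_betw f V (tree_above T p)" "ALL q:V. ALL q':V. q \<lhd> q' \<longleftrightarrow> f q \<lhd> f q'"
  "ALL q:V. ALL a:succs T q. ALL b:succs T q. (a, b) : succ_order T q \<longleftrightarrow> (f a, f b) : succ_order T (f q)"
  using rep[OF p] by blast
 have 1: "f q : V & (f q = p \<or> p \<lhd> f q)" if "q : V" for q
  using bij_betwE[OF f(1)] that unfolding tree_above_def by blast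
 have 2: "EX q:V. f q = r" if "r : V" "r = p \<or> p \<lhd> r" for r
 proof -
  have "r : f ` V" using bij_betw_imp_surj_on[OF f(1)] that unfolding tree_above_def by blast
  thus ?thesis by blast
 qed
 have 3: "f q = f q' \<longleftrightarrow> q = q'" if "q : V" "q' : V" for q q'
  using bij_betw_imp_inj_on[OF f(1)] that unfolding inj_on_def by blast
 have 5: "f rt = p"
 proof (rule ccontr)
  assume n: "f rt ~= p"
  hence l: "p \<lhd> f rt" "f rt : V" using 1[OF rt(1)] by auto
  obtain t where t: "t : V" "f t = p" using 2[OF p] by blast
  hence "rt \<lhd> t" using rt(2) n by blast
  hence "f rt \<lhd> p" using f(2) t rt(1) by blast
  thus False using asymT[OF p l(2) l(1)] by blast
 qed
 have 6: "imm (f q) (f a)" if q: "q : V" "imm q a" for q a unfolding imm_def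
 proof (intro conjI ballI impI)
  have a: "a : V" "q \<lhd> a" using q(2) unfolding imm_def by auto
  show "f a : V" "f q \<lhd> f a" using 1 a q(1) f(2) by blast+
  fix r assume r: "r : V" "f q \<lhd> r"
  have "p \<lhd> r" using 1[OF q(1)] tr[OF p _ r(1) _ r(2)] r(2) by blast
  then obtain r' where r': "r' : V" "f r' = r" using 2 r(1) by blast
  hence "q \<lhd> r'" using f(2) r(2) q(1) by blast
  hence "~ r' \<lhd> a" using q(2) r'(1) unfolding imm_def by blast
  thus "~ r \<lhd> f a" using f(2) r' a(1) by blast
 qed
 show ?thesis
 proof (rule that[of f, OF 1 2 3 _ 5 6])
  show "f q \<lhd> f q' \<longleftrightarrow> q \<lhd> q'" if "q : V" "q' : V" for q q' using f(2) that by blast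
  fix q a b assume q: "q : V" "imm q a" "imm q b" "(a, b) : sord T q"
  hence s: "a : succs T q" "b : succs T q" using succs_iff by blast+
  hence "(a, b) : succ_order T q" using q(4) unfolding succ_order_def by blast
  thus "(f a, f b) : sord T (f q)" using f(3) q(1) s unfolding succ_order_def by blast
 qed
qed

lemma two_imm:
 assumes p: "p : V"
 shows "EX a b. imm p a & imm p b & a ~= b"
proof -
 obtain a b where ab: "imm rt a" "imm rt b" "a ~= b" using two_imm_rt by blast
 show ?thesis
 proof (rule rep_iso[OF p])
  fix f assume f: "f rt = p" "!!q a. q : V ==> imm q a ==> imm (f q) (f a)"
   "!!q q'. q : V ==> q' : V ==> f q = f q' \<longleftrightarrow> q = q'"
  have "f a ~= f b" using f(3)[of a b] ab unfolding imm_def by simp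
  thus ?thesis using f(1) f(2)[OF rt(1) ab(1)] f(2)[OF rt(1) ab(2)] by auto
 qed
qed

text \<open>If \<open>p\<close> were strictly above \<open>q\<close>, a branch could leave
  \<open>q\<close> through an immediate successor other than the one towards \<open>p\<close>; it
  would pass through \<open>q\<close> but miss \<open>p\<close>.\<close>

lemma E_subD:
 assumes p: "p : V" and q: "q : V" and sub: "E q <= E p"
 shows "p = q \<or> p \<lhd> q"
proof (rule ccontr)
 assume n: "~ ?thesis"
 obtain x where x: "x : Br q" using Br_ne[OF q] by blast
 hence "e x : E q" "e x : E p" using sub unfolding E_def by blast+
 hence qp: "q \<lhd> p" using E_meet n by blast
 obtain m where m: "imm q m" "m = p \<or> m \<lhd> p" using ordIso_leastI[OF q p qp] .
 obtain b where b: "imm q b" "b ~= m" using two_imm[OF q] by metis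
 have mb: "m : V" "b : V" "q \<lhd> m" "q \<lhd> b" using m b unfolding imm_def by auto
 obtain y where y: "y : branches T" "b : y" using Br_ne[OF mb(2)] unfolding Br_def by blast
 have "q : y" using branch_down[OF y q mb(4)] .
 hence "e y : E p" using sub E_mem[OF y(1)] by blast
 hence "p : y" using E_mem[OF y(1)] by blast
 hence "m : y" using branch_down[OF y(1) _ mb(1)] m(2) by blast
 hence "m \<lhd> b \<or> b \<lhd> m" using branch_total[OF y(1) _ y(2)] b(2) by blast
 thus False using m(1) b(1) mb unfolding imm_def by blast
qed

text \<open>If the middle branch misses \<open>p\<close>, it leaves \<open>x\<close> at a vertex
  below \<open>p\<close>. The branch \<open>z\<close> still follows \<open>x\<close> there, so
  \<open>y\<close> lies on the same side of \<open>z\<close> as of \<open>x\<close>.\<close>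

lemma E_conv:
 assumes p: "p : V" and x: "x : branches T" "p : x" and z: "z : branches T" "p : z" and y: "y : branches T"
  and l: "e x <. e y" "e y <. e z"
 shows "p : y"
proof (rule ccontr)
 assume n: "p ~: y"
 have "branch_less T x y" using e_less l x(1) y by blast
 then obtain r a b where r: "r : x" "r : y" "a : x" "b : y" "imm r a" "imm r b" "a ~= b" "(a, b) : sord T r"
  unfolding branch_less_iff[OF x(1)] by blast
 have rV: "r : V" "a : V" "r \<lhd> a" using r branch_sub[OF x(1)] unfolding imm_def by auto
 have rp: "r \<lhd> p" using branch_total[OF x(1) r(1) x(2)] branch_down[OF y r(2) p] n r(2) by blast
 have "a = p \<or> a \<lhd> p" using branch_total[OF x(1) r(3) x(2)] r(5) rp p unfolding imm_def by blast
 hence az: "a : z" using branch_down[OF z rV(2)] z(2) by blast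
 have "r : z" using branch_down[OF z(1) az rV(1,3)] .
 hence "branch_less T z y" unfolding branch_less_iff[OF z(1)] using az r by blast
 hence "e z <. e y" using e(2) z(1) y by blast
 thus False using l(2) by order
qed

text \<open>The reproduction of the tree above \<open>p\<close> induces a bijection from all
  branches to those through \<open>p\<close>. It preserves the order, and it maps the branches
  through \<open>q\<close> to those through \<open>f q\<close>.\<close>

lemma E_iso:
 assumes p: "p : V"
 shows "EX g. siso (<.) (<.) g (E rt) (E p) & (ALL q:V. EX q':V. g ` E q = E q')"
proof (rule rep_iso[OF p])
 fix f assume f0: "!!q. q : V ==> f q : V & (f q = p \<or> p \<lhd> f q)"
  and f2: "!!r. r : V ==> r = p \<or> p \<lhd> r ==> EX q:V. f q = r"
  and f3: "!!q q'. q : V ==> q' : V ==> f q = f q' \<longleftrightarrow> q = q'"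
  and f4: "!!q q'. q : V ==> q' : V ==> f q \<lhd> f q' \<longleftrightarrow> q \<lhd> q'"
  and f5: "f rt = p" and f6: "!!q a. q : V ==> imm q a ==> imm (f q) (f a)"
  and f7: "!!q a b. q : V ==> imm q a ==> imm q b ==> (a, b) : sord T q ==> (f a, f b) : sord T (f q)"
 have f1: "!!q. q : V ==> f q : V" "!!q. q : V ==> f q = p \<or> p \<lhd> f q" using f0 by simp_all
 \<comment> \<open>The image of a branch starts only at \<open>p\<close>; closing it downwards adds
   the predecessors of \<open>p\<close> and makes it a branch of the whole tree.\<close>
 define F where "F x = {q:V. EX r:x. q = f r \<or> q \<lhd> f r}" for x
 have memF: "f q : F x \<longleftrightarrow> q : x" if x: "x : branches T" and q: "q : V" for x q
 proof
  assume "f q : F x"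
  then obtain r where r: "r : x" "f q = f r \<or> f q \<lhd> f r" unfolding F_def by blast
  hence "q = r \<or> q \<lhd> r" using f3[OF q] f4[OF q] branch_sub[OF x] by blast
  thus "q : x" using branch_down[OF x r(1) q] r(1) by blast
 qed (use f1 q F_def in blast)
 have Fp: "p : F x" if "x : branches T" for x using memF[OF that rt(1)] rt_branch[OF that] f5 by simp
 have above: "EX t:x. f t = s" if x: "x : branches T" and s: "s : V" "s = p \<or> p \<lhd> s" "s : F x" for x s
  using f2[OF s(1,2)] memF[OF x] s(3) by blast
 have Fbr: "F x : branches T" if x: "x : branches T" for x unfolding branch_iff
 proof (intro conjI ballI impI)
  show "F x <= V" unfolding F_def by blast
 next
  fix a b assume "a : F x" "b : F x"
  then obtain r s where rs: "a : V" "b : V" "r : x" "s : x" "a = f r \<or> a \<lhd> f r" "b = f s \<or> b \<lhd> f s"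
   unfolding F_def by blast
  have rsV: "r : V" "s : V" using rs branch_sub[OF x] by auto
  obtain t where t: "t : V" "a = f t \<or> a \<lhd> f t" "b = f t \<or> b \<lhd> f t"
  proof (cases "r \<lhd> s")
   case True
   hence "f r \<lhd> f s" using f4 rsV by blast
   hence "a \<lhd> f s" using rs tr[OF rs(1) f1(1)[OF rsV(1)] f1(1)[OF rsV(2)]] by blast
   thus ?thesis using that[OF rsV(2)] rs by blast
  next
   case False
   hence "s = r \<or> s \<lhd> r" using branch_total[OF x rs(3,4)] by blast
   hence "f s = f r \<or> f s \<lhd> f r" using f4 rsV by blast
   hence "b = f r \<or> b \<lhd> f r" using rs tr[OF rs(2) f1(1)[OF rsV(2)] f1(1)[OF rsV(1)]] by auto
   thus ?thesis using that[OF rsV(1)] rs by blast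
  qed
  thus "a = b \<or> a \<lhd> b \<or> b \<lhd> a" using preds_total[OF f1(1)[OF t(1)] rs(1,2)] by auto
 next
  fix q assume q: "q : V" "ALL s:F x. s = q \<or> s \<lhd> q \<or> q \<lhd> s"
  have pq: "p = q \<or> p \<lhd> q \<or> q \<lhd> p" using q(2) Fp[OF x] by blast
  show "q : F x"
  proof (cases "q \<lhd> p")
   case True
   thus ?thesis using q(1) f5 rt_branch[OF x] unfolding F_def by blast
  next
   case False
   then obtain t where t: "t : V" "f t = q" using f2[OF q(1)] pq by blast
   have "t : x"
   proof (rule branch_max[OF x t(1)])
    fix s assume s: "s : x"
    hence sV: "s : V" using branch_sub[OF x] by blast
    hence "f s = f t \<or> f s \<lhd> f t \<or> f t \<lhd> f s" using q(2) memF[OF x sV] s t(2) by blast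
    thus "s = t \<or> s \<lhd> t \<or> t \<lhd> s" using f3[OF sV t(1)] f4[OF sV t(1)] f4[OF t(1) sV] by simp
   qed
   thus ?thesis using memF[OF x t(1)] t(2) by blast
  qed
 qed
 have Fsurj: "EX x:branches T. F x = y" if y: "y : branches T" "p : y" for y
 proof -
  define x where "x = {t:V. f t : y}"
  have x: "x : branches T" unfolding branch_iff
  proof (intro conjI ballI impI)
   show "x <= V" unfolding x_def by blast
   show "a = b \<or> a \<lhd> b \<or> b \<lhd> a" if "a : x" "b : x" for a b
    using branch_total[OF y(1), of "f a" "f b"] that f3 f4 unfolding x_def by blast
   fix q assume q: "q : V" "ALL s:x. s = q \<or> s \<lhd> q \<or> q \<lhd> s"
   have "f q : y"
   proof (rule branch_max[OF y(1) f1(1)[OF q(1)]])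
    fix s assume s: "s : y"
    have sV: "s : V" using s branch_sub[OF y(1)] by blast
    show "s = f q \<or> s \<lhd> f q \<or> f q \<lhd> s"
    proof (cases "s \<lhd> p")
     case True
     thus ?thesis using f1[OF q(1)] tr[OF sV p] by blast
    next
     case False
     hence "s = p \<or> p \<lhd> s" using branch_total[OF y(1) s y(2)] by blast
     then obtain t where t: "t : V" "f t = s" using f2[OF sV] by blast
     hence "t : x" using s unfolding x_def by blast
     hence "t = q \<or> t \<lhd> q \<or> q \<lhd> t" using q(2) by blast
     thus ?thesis using f4[OF t(1) q(1)] f4[OF q(1) t(1)] t(2) by auto
    qed
   qed
   thus "q : x" unfolding x_def using q(1) by blast
  qed
  have "F x <= y"
  proof
   fix q assume "q : F x"
   then obtain r where r: "q : V" "r : x" "q = f r \<or> q \<lhd> f r" unfolding F_def by blast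
   thus "q : y" using branch_down[OF y(1) _ r(1)] unfolding x_def by blast
  qed
  thus ?thesis using branch_incomparable[OF Fbr[OF x] y(1)] x by blast
 qed
 have Fless: "branch_less T (F x) (F y)" if x: "x : branches T" and y: "y : branches T" and l: "branch_less T x y" for x y
 proof -
  obtain r a b where r: "r : x" "r : y" "a : x" "b : y" "imm r a" "imm r b" "a ~= b" "(a, b) : sord T r"
   using l unfolding branch_less_iff[OF x] by blast
  have V: "r : V" "a : V" "b : V" using r branch_sub[OF x] branch_sub[OF y] by auto
  have "f r : F x" "f r : F y" "f a : F x" "f b : F y" using memF x y V r by blast+
  moreover have "imm (f r) (f a)" "imm (f r) (f b)" "f a ~= f b" "(f a, f b) : sord T (f r)"
   using f6 f7 f3 V r by blast+
  ultimately show ?thesis unfolding branch_less_iff[OF Fbr[OF x]] by blast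
 qed
 define g where "g u = e (F (inv_into (branches T) e u))" for u
 have ie: "inj_on e (branches T)" using e_inj unfolding inj_on_def by blast
 have g: "g (e x) = e (F x)" if "x : branches T" for x unfolding g_def inv_into_f_f[OF ie that] ..
 have img: "g ` E q = E (f q)" if q: "q : V" for q
 proof (intro equalityI subsetI)
  fix u assume "u : g ` E q"
  then obtain x where x: "x : branches T" "q : x" "u = g (e x)" unfolding E_def Br_def by blast
  thus "u : E (f q)" using g memF[OF x(1) q] Fbr[OF x(1)] unfolding E_def Br_def by simp
 next
  fix u assume "u : E (f q)"
  then obtain y where y: "y : branches T" "f q : y" "u = e y" unfolding E_def Br_def by blast
  have "p : y" using f1(2)[OF q] branch_down[OF y(1,2) p] y(2) by auto
  then obtain x where x: "x : branches T" "F x = y" using Fsurj y(1) by blast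
  hence "q : x" using memF[OF x(1) q] y(2) by blast
  hence "e x : E q" using x unfolding E_def Br_def by blast
  thus "u : g ` E q" using g[OF x(1)] x(2) y(3) by (metis imageI)
 qed
 have gl: "g u <. g v" if uv: "u : E rt" "v : E rt" "u <. v" for u v
 proof -
  obtain x y where xy: "x : branches T" "y : branches T" "u = e x" "v = e y" using uv unfolding E_rt by blast
  hence "branch_less T (F x) (F y)" using e_less uv(3) Fless by blast
  thus ?thesis using xy g e(2) Fbr by auto
 qed
 have "siso (<.) (<.) g (E rt) (E p)"
 proof (rule siso_mono[OF _ gl])
  have "inj_on g (E rt)" using gl by (metis inj_onI less_irrefl neqE)
  thus "bij_betw g (E rt) (E p)" unfolding bij_betw_def using img[OF rt(1)] f5 by simp
 qed
 thus ?thesis using img f1(1) by blast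
qed

lemma slt_E:
 assumes s: "s : succs T rt" and t: "t : succs T rt"
 shows "slt (E s) (E t) \<longleftrightarrow> s ~= t & (s, t) : sord T rt"
proof -
 have V: "s : V" "t : V" using s t unfolding succs_def tree_above_def by auto
 have lt: "slt (E s) (E t)" if st: "s ~= t" "(s, t) : sord T rt" "s : succs T rt" "t : succs T rt" for s t
  unfolding slt_def
 proof (intro ballI)
  fix u v assume "u : E s" "v : E t"
  then obtain x y where xy: "x : branches T" "s : x" "u = e x" "y : branches T" "t : y" "v = e y"
   unfolding E_def Br_def by blast
  have "branch_less T x y"
   unfolding branch_less_iff[OF xy(1)] using xy rt_branch st succs_iff[OF rt(1)] by blast
  thus "u <. v" using xy e(2) by blast
 qed
 show ?thesis
 proof
  assume l: "slt (E s) (E t)"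
  have ne: "E s ~= {}" "E t ~= {}" using Br_ne V unfolding E_def by auto
  have "~ slt (E t) (E s)" using l ne unfolding slt_def by (meson all_not_in_conv less_asym)
  moreover have "s ~= t" using l ne unfolding slt_def by (meson all_not_in_conv less_irrefl)
  ultimately show "s ~= t & (s, t) : sord T rt" using tot[OF s t] lt[of t s] s t by blast
 qed (use lt s t in blast)
qed

lemma nice_slt: "nice slt (E ` succs T rt)"
proof (rule nice_transfer[OF _ nc])
 have "inj_on E (succs T rt)"
 proof (rule inj_onI)
  fix s t assume st: "s : succs T rt" "t : succs T rt" "E s = E t"
  hence V: "s : V" "t : V" unfolding succs_def tree_above_def by auto
  thus "s = t" using E_subD[OF V] E_subD[OF V(2,1)] st(3) asymT[OF V] by blast
 qed
 thus "siso (\<lambda>a b. a ~= b & (a, b) : sord T rt) slt E (succs T rt) (E ` succs T rt)"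
  unfolding siso_def bij_betw_def using slt_E by blast
qed

sublocale esys less_eq less A "E ` verts T" "E ` succs T rt" "E rt"
proof -
 have succs_V: "s : V" if "s : succs T rt" for s using that unfolding succs_def tree_above_def by auto
 have Vs: "EX P. P <= V & K = E ` P" if "K <= E ` V" for K using that by (meson subset_imageE)
 have inj: "p = q" if "p : V" "q : V" "E p = E q" for p q
  using E_subD[of p q] E_subD[of q p] asymT[of p q] that by blast
 have subs: "E q <= E p \<longleftrightarrow> p = q \<or> p \<lhd> q" if "p : V" "q : V" for p q
  using E_subD that E_mono by blast
 note N = nice_slt[unfolded nice_def]
 show "esys (<=.) (<.) A (E ` V) (E ` succs T rt) (E rt)"
 proof (unfold_locales, goal_cases)
  case 1 show ?case using rt(1) by blast
 next
  case 2 show ?case unfolding E_rt using e(1) by blast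
 next
  case (3 x y) thus ?case unfolding E_rt using e(4) by blast
 next
  case (4 U) thus ?case using Br_ne unfolding E_def by blast
 next
  case (5 U) thus ?case using E_sub_rt by blast
 next
  case (6 U x z y)
  then obtain p where p: "p : V" "U = E p" by blast
  obtain x' y' z' where b: "x' : branches T" "x = e x'" "y' : branches T" "y = e y'" "z' : branches T" "z = e z'"
   "p : x'" "p : z'" using 6 p unfolding E_rt unfolding E_def Br_def by blast
  have "p : y'" using E_conv[OF p(1) b(1,7,5,8,3)] 6 b by blast
  thus ?case using b p E_mem by blast
 next
  case (7 U)
  then obtain p where p: "p : V" "U = E p" by blast
  obtain g where g: "siso (<.) (<.) g (E rt) (E p)" "ALL q:V. EX q':V. g ` E q = E q'"
   using E_iso[OF p(1)] by blast
  have "ALL W:E ` V. g ` W : E ` V"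
  proof
   fix W assume "W : E ` V"
   then obtain q where "q : V" "W = E q" by blast
   then obtain q' where "q' : V" "g ` W = E q'" using g(2) by blast
   thus "g ` W : E ` V" by simp
  qed
  thus ?case using g(1) p(2) by blast
 next
  case (8 U W x)
  then obtain p q where pq: "p : V" "U = E p" "q : V" "W = E q" by blast
  hence "p = q \<or> p \<lhd> q \<or> q \<lhd> p" using E_meet[of x p q] 8 by simp
  thus ?case using subs[OF pq(1,3)] subs[OF pq(3,1)] pq(2,4) by auto
 next
  case (9 K x)
  then obtain P where P: "P <= V" "K = E ` P" using Vs[OF 9(1)] by blast
  hence Pne: "P ~= {}" using 9 by blast
  then obtain p0 where "p0 : P" by blast
  have xP: "x : E p" if "p : P" for p using 9(3) P(2) that by simp
  then obtain y where y: "y : branches T" "x = e y" using \<open>p0 : P\<close> unfolding E_def Br_def by blast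
  hence "P <= y" using xP E_mem by blast
  obtain m where m: "m : P" "ALL k:P. k = m \<or> m \<lhd> k"
   using branch_least[OF y(1) \<open>P <= y\<close> Pne] by (elim bexE)
  have "E k <= E m" if k: "k : P" for k
  proof -
   have "m = k \<or> m \<lhd> k" using m(2) k by auto
   moreover have "m : V" "k : V" using P(1) k m(1) by auto
   ultimately show ?thesis using subs by simp
  qed
  thus ?case using P(2) m(1) by blast
 next
  case (10 K)
  then obtain P where P: "P <= V" "K = E ` P" using Vs[OF 10(1)] by blast
  have ch: "ALL p:P. ALL q:P. p = q \<or> p \<lhd> q \<or> q \<lhd> p"
  proof (intro ballI)
   fix p q assume pq: "p : P" "q : P"
   hence "E p <= E q \<or> E q <= E p" using 10(2) P(2) by simp
   moreover have "p : V" "q : V" using pq P(1) by auto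
   ultimately show "p = q \<or> p \<lhd> q \<or> q \<lhd> p" using subs[of p q] subs[of q p] by auto
  qed
  obtain x where x: "x : branches T" "P <= x" using branch_extends[OF P(1) ch] by metis
  show ?case using countable_subset[OF x(2) cntb[OF x(1)]] P(2) by simp
 next
  case (11 K u v)
  then obtain P where P: "P <= V" "K = E ` P" using Vs[OF 11(1)] by blast
  have "P ~= {}" using 11(2) P(2) by simp
  then obtain p0 where p0: "p0 : P" by blast
  have inE: "w : E p" if "w : \<Inter>K" "p : P" for w p using that P(2) by simp
  have chP: "p = q \<or> p \<lhd> q \<or> q \<lhd> p" if "p : P" "q : P" for p q
   using E_meet[OF inE[OF 11(5) that(1)] inE[OF 11(5) that(2)]] .
  have nol: "EX q:P. p \<lhd> q" if p: "p : P" for p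
  proof -
   have "EX W:K. ~ E p <= W" by (rule 11(4)) (use p P(2) in simp)
   then obtain q where q: "q : P" "~ E p <= E q" using P(2) by auto
   moreover have "q : V" "p : V" using q(1) p P(1) by auto
   ultimately have "~ (q = p \<or> q \<lhd> p)" using subs[of q p] by simp
   thus ?thesis using chP[OF p q(1)] q(1) by blast
  qed
  have br: "EX x:branches T. w = e x & P <= x" if w: "w : \<Inter>K" for w
  proof -
   have "w : E p0" using inE[OF w p0] .
   then obtain x where x: "x : branches T" "w = e x" unfolding E_def Br_def by blast
   hence "P <= x" using inE[OF w] E_mem[OF x(1)] by blast
   thus ?thesis using x by blast
  qed
  obtain x where x: "x : branches T" "u = e x" "P <= x" using br[OF 11(5)] by blast
  obtain y where y: "y : branches T" "v = e y" "P <= y" using br[OF 11(6)] by blast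
  have xy: "x ~= y" using x y 11(7) by auto
  \<comment> \<open>The chain closed downwards. A branch equal to \<open>D\<close> would coincide
    with both \<open>x\<close> and \<open>y\<close> by maximality, so every branch through
    \<open>P\<close> goes beyond \<open>D\<close>. Its first vertex there sits at a limit level with
    predecessors \<open>D\<close>, hence is the same for all these branches.\<close>
  define D where "D = {q:V. EX p:P. q = p \<or> q \<lhd> p}"
  have Dsub: "D <= z" if "z : branches T" "P <= z" for z
   using branch_down[OF that(1)] that(2) unfolding D_def by blast
  have Ddown: "q : D" if pD: "p : D" and q: "q : V" "q \<lhd> p" for p q
  proof -
   obtain p' where p': "p' : P" "p = p' \<or> p \<lhd> p'" "p : V" using pD unfolding D_def by blast
   hence "q \<lhd> p'" using tr[of q p p'] q P(1) by blast
   thus ?thesis unfolding D_def using q(1) p'(1) by blast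
  qed
  have Dd: "ALL p:D. ALL q:V. q \<lhd> p --> q : D" using Ddown by simp
  have nD: "z ~= D" if z: "z : branches T" for z
  proof
   assume "z = D"
   hence "z = x" "z = y" using branch_incomparable[OF z] Dsub x y by blast+
   thus False using xy by blast
  qed
  obtain q where q: "q : x" "q ~: D" "preds T q = D"
   using branch_next[OF x(1) Dsub[OF x(1,3)] nD[OF x(1)] Dd] by blast
  have qV: "q : V" using q(1) branch_sub[OF x(1)] by blast
  have PD: "P <= D" unfolding D_def using P(1) by blast
  have Dlim: "EX s:D. r \<lhd> s" if r: "r : D" for r
  proof -
   obtain p where p: "p : P" "r = p \<or> r \<lhd> p" "r : V" using r unfolding D_def by blast
   obtain p' where p': "p' : P" "p \<lhd> p'" using nol p(1) by blast
   have "r \<lhd> p'" using p p' tr[of r p p'] P(1) by blast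
   thus ?thesis using p'(1) PD by blast
  qed
  have "E q = \<Inter>K"
  proof (intro equalityI subsetI)
   fix w assume "w : E q"
   then obtain z where z: "z : branches T" "w = e z" "q : z" unfolding E_def Br_def by blast
   have "P <= z" using branch_down[OF z(1,3)] q(3) PD preds_iff by blast
   hence "w : E p" if "p : P" for p using z(2) E_mem[OF z(1)] that by auto
   thus "w : \<Inter>K" using P(2) by simp
  next
   fix w assume "w : \<Inter>K"
   then obtain z where z: "z : branches T" "w = e z" "P <= z" using br by blast
   obtain q' where q': "q' : z" "q' ~: D" "preds T q' = D"
    using branch_next[OF z(1) Dsub[OF z(1,3)] nD[OF z(1)] Dd] by blast
   have "q' : V" using q'(1) branch_sub[OF z(1)] by blast
   hence "q = q'" using lim_uniq[OF qV, of q'] q(3) q'(3) Dlim p0 PD by auto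
   thus "w : E q" using q'(1) z E_mem by blast
  qed
  thus ?case using qV by blast
 next
  case 12 show ?case using succs_V by blast
 next
  case 13
  show ?case
  proof (intro equalityI subsetI)
   fix u assume "u : \<Union>(E ` succs T rt)"
   thus "u : E rt" using E_sub_rt by blast
  next
   fix u assume "u : E rt"
   then obtain x where x: "x : branches T" "u = e x" unfolding E_rt by blast
   obtain a where a: "imm rt a" using two_imm_rt by blast
   have "x ~= {rt}"
   proof
    assume "x = {rt}"
    hence "a : x" using branch_max[OF x(1), of a] a unfolding imm_def by blast
    thus False using \<open>x = {rt}\<close> a irr rt(1) unfolding imm_def by blast
   qed
   then obtain q where q: "q : x" "q ~= rt" using rt_branch[OF x(1)] by blast
   hence qV: "q : V" using branch_sub[OF x(1)] by blast
   then obtain m where m: "imm rt m" "m = q \<or> m \<lhd> q" using ordIso_leastI[OF rt(1) qV rt(2)[OF qV q(2)]] by blast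
   have "m : x" using m branch_down[OF x(1) q(1)] q(1) unfolding imm_def by blast
   hence "u : E m" using x E_mem by blast
   thus "u : \<Union>(E ` succs T rt)" using m(1) succs_iff[OF rt(1)] by blast
  qed
 next
  case 14
  show ?case
  proof
   assume "E rt : E ` succs T rt"
   then obtain s where s: "s : succs T rt" "E rt = E s" by blast
   hence "rt = s" using inj rt(1) succs_V by blast
   thus False using s(1) succs_iff[OF rt(1)] irr rt(1) unfolding imm_def by blast
  qed
 next
  case (15 U)
  then obtain p where p: "p : V" "U = E p" "p ~= rt" by blast
  obtain m where m: "imm rt m" "m = p \<or> m \<lhd> p" using ordIso_leastI[OF rt(1) p(1) rt(2)[OF p(1,3)]] by blast
  hence "E p <= E m" using E_mono[of m p] p(1) unfolding imm_def by blast
  thus ?case using p(2) m(1) succs_iff[OF rt(1)] by blast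
 next
  case (16 s t)
  then obtain a b where ab: "a : succs T rt" "s = E a" "b : succs T rt" "t = E b" by blast
  thus ?case using slt_E[of a b] slt_E[of b a] tot[of a b] 16 by blast
 next
  case (17 s) thus ?case using N by blast
 next
  case (18 s) thus ?case using N by blast
 next
  case (19 Q)
  have "ALL s:Q. ALL t:Q. ALL u:E ` succs T rt. slt s u & slt u t --> u : Q" using 19(3) by blast
  thus ?case using N 19(1,2,4,5) by simp
 next
  case 20 show ?case using N unfolding dseq_def by simp
 next
  case 21 show ?case using N unfolding dseq_def by simp
 qed
qed

end

text \<open>The successors of the root are only asked to be \<open>nice\<close>, so that integer
  trees and trees over homogeneous orders are treated at once.\<close>

theorem tree_CHLOTS:
 fixes T :: "'v tree" and X :: "'a rel"
 assumes bi: "bi_ordered_tree T" and Om: "Omega_bounded T" and re: "reproductive T"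
  and nc: "nice (\<lambda>a b. a ~= b & (a, b) : succ_order T (tree_root T)) (succs T (tree_root T))"
  and co: "completion_isomorphic (branch_space T) X" and X: "Linear_order X"
 shows "CHLOTS X"
proof -
 let ?V = "verts T" and ?rt = "tree_root T"
 note sn = bi[unfolded bi_ordered_tree_def semi_normal_tree_def]
 have irr: "irrefl (Restr (prec T) ?V)" and trn: "trans (Restr (prec T) ?V)" using sn by simp_all
 interpret W: wtree T
 proof
  show "(p, p) ~: prec T" if "p : ?V" for p using irr that unfolding irrefl_def by blast
  show "(p, s) : prec T" if "p : ?V" "q : ?V" "s : ?V" "(p, q) : prec T" "(q, s) : prec T" for p q s
   using transD[OF trn, of p q s] that by blast
  show "well_order_on (preds T p) (order_of T p)" if "p : ?V" for p using sn that by simp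
 qed
 have exr: "EX! r. r : ?V & order_of T r = {}" using sn by simp
 hence rt: "?rt : ?V & order_of T ?rt = {}" unfolding tree_root_def by (rule theI')
 have empty: "order_of T p = {} \<longleftrightarrow> preds T p = {}" for p unfolding order_of_def by blast
 have rt2: "(?rt, p) : prec T" if p: "p : ?V" "p ~= ?rt" for p
 proof -
  have "preds T p ~= {}" using exr rt p empty by metis
  then obtain m where m: "m : preds T p" "ALL k:preds T p. k = m \<or> (m, k) : prec T"
   using W.preds_least[OF p(1), of "preds T p"] by blast
  have mV: "m : ?V" "(m, p) : prec T" using m(1) W.preds_iff by auto
  have "preds T m = {}"
  proof (rule ccontr)
   assume "preds T m ~= {}"
   then obtain k where k: "k : ?V" "(k, m) : prec T" using W.preds_iff by blast
   hence "k : preds T p" using W.tr[of k m p] mV p W.preds_iff by blast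
   hence "k = m \<or> (m, k) : prec T" using m(2) by simp
   thus False using k W.irr[OF mV(1)] W.asymT[OF k(1) mV(1) k(2)] by auto
  qed
  hence "m = ?rt" using exr rt mV empty by metis
  thus ?thesis using mV by simp
 qed
 have sne: "succs T ?rt ~= {}" by (rule niceD(1)[OF nc])
 hence lin: "linear_order_on (succs T ?rt) (succ_order T ?rt)"
  using bi rt unfolding bi_ordered_tree_def by blast
 have nc': "nice (\<lambda>a b. a ~= b & (a, b) : sord T ?rt) (succs T ?rt)"
  by (rule nice_transfer[OF _ nc, of _ "\<lambda>x. x"]) (auto simp: siso_def succ_order_def bij_betw_def)
 obtain le lt where L: "lin le lt" "!!x y. x : Field X ==> y : Field X ==> (x, y) : X \<longleftrightarrow> le x y"
  using linear_order_extend[OF X] by blast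
 interpret X: lots le lt X using L X by (intro lots.intro lots_axioms.intro)
 show ?thesis
 proof (rule completion_isomorphicD[OF X.lots_axioms co])
 fix e assume e: "e ` Field (branch_space T) <= Field X"
  "!!x y. x : Field (branch_space T) ==> y : Field (branch_space T) ==> x ~= y ==> (x, y) : branch_space T \<longleftrightarrow> lt (e x) (e y)"
  "!!a b. a : Field X ==> b : Field X ==> lt a b ==> EX y:Field (branch_space T). lt a (e y) & lt (e y) b"
  and cX: "complete_lots X" "order_dense X" "has_max X \<longleftrightarrow> has_max (branch_space T)"
   "has_min X \<longleftrightarrow> has_min (branch_space T)" "Linear_order (branch_space T)"
 note e = e[unfolded W.Field_branch_space]
 have linB: "trans (branch_space T)" "antisym (branch_space T)" "total_on (branches T) (branch_space T)"
  using cX(5) unfolding order_on_defs W.Field_branch_space by blast+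
 have rtb: "?rt : x" if "x : branches T" for x
  using W.branch_max[OF that, of ?rt] W.branch_sub[OF that] rt rt2 by blast
 have succ_ne: "EX a. W.imm ?rt a" using sne W.succs_iff rt by blast
 have through: "EX s:succs T ?rt. s : x" if x: "x : branches T" for x
 proof -
  obtain a where a: "W.imm ?rt a" using succ_ne by blast
  have "x ~= {?rt}"
  proof
   assume "x = {?rt}"
   hence "a : x" using W.branch_max[OF x(1), of a] a unfolding W.imm_def by blast
   thus False using \<open>x = {?rt}\<close> a W.irr rt unfolding W.imm_def by blast
  qed
  then obtain q where q: "q : x" "q ~= ?rt" using rtb[OF x(1)] by blast
  hence qV: "q : ?V" using W.branch_sub[OF x(1)] by blast
  obtain m where m: "W.imm ?rt m" "m = q \<or> (m, q) : prec T"
   using W.ordIso_leastI[OF _ qV rt2[OF qV q(2)]] rt by blast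
  have "m : x" using m W.branch_down[OF x(1) q(1)] q(1) unfolding W.imm_def by blast
  thus ?thesis using m(1) W.succs_iff rt by blast
 qed
 have sless: "branch_less T x y" if "x : branches T" "y : branches T" "s : x" "t : y" "s : succs T ?rt" "t : succs T ?rt"
  "s ~= t" "(s, t) : succ_order T ?rt" for x y s t unfolding branch_less_def using that rtb by blast
 have thr: "EX y:branches T. s : y" if s: "s : succs T ?rt" for s
 proof -
  have "s : ?V" using s unfolding succs_def tree_above_def by blast
  then obtain y where "y : branches T" "{s} <= y" using W.branch_extends[of "{s}"] by blast
  thus ?thesis by blast
 qed
 have e_lt: "branch_less T x y ==> lt (e x) (e y)" if xy: "x : branches T" "y : branches T" "x ~= y" for x y
  using e(2)[OF xy] xy W.branch_space_iff by blast
 \<comment> \<open>A branch through a larger or smaller successor of the root lies beyond a given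
   one. So the branch space has no ends, and a completion has ends exactly where the branch space
   has.\<close>
 have ends: "EX y:branches T. x ~= y & (x, y) : branch_space T" "EX y:branches T. x ~= y & (y, x) : branch_space T"
  if x: "x : branches T" for x
 proof -
  obtain s where s: "s : succs T ?rt" "s : x" using through[OF x] by blast
  have antisS: "antisym (succ_order T ?rt)" using lin unfolding order_on_defs by blast
  have sx: "s = s'" if "s' : succs T ?rt" "s' : x" for s'
  proof (rule ccontr)
   assume "s ~= s'"
   hence "(s, s') : prec T \<or> (s', s) : prec T" using W.branch_total[OF x s(2) that(2)] by blast
   moreover have "W.imm ?rt s" "W.imm ?rt s'" using s that W.succs_iff rt by blast+
   ultimately show False unfolding W.imm_def by blast
  qed
  obtain t where t: "t : succs T ?rt" "s ~= t" "(s, t) : succ_order T ?rt" using nc s(1) unfolding nice_def by meson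
  obtain y where y: "y : branches T" "t : y" using thr[OF t(1)] by blast
  have "branch_less T x y" using sless[OF x y(1) s(2) y(2) s(1) t] .
  moreover have "x ~= y" using sx y(2) t by blast
  ultimately show "EX y:branches T. x ~= y & (x, y) : branch_space T" using x y W.branch_space_iff by blast
  obtain t where t: "t : succs T ?rt" "t ~= s" "(t, s) : succ_order T ?rt" using nc s(1) unfolding nice_def by meson
  obtain y where y: "y : branches T" "t : y" using thr[OF t(1)] by blast
  have "branch_less T y x" using sless[OF y(1) x y(2) s(2) t(1) s(1) t(2,3)] .
  moreover have "x ~= y" using sx y(2) t by blast
  ultimately show "EX y:branches T. x ~= y & (y, x) : branch_space T" using x y W.branch_space_iff by blast
 qed
 have noB: "~ has_max (branch_space T)" "~ has_min (branch_space T)"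
  unfolding has_max_def has_min_def W.Field_branch_space using ends antisymD[OF linB(2)] by blast+
 have Bne: "branches T ~= {}" using thr sne by blast
 have FX: "Field X ~= {}" using Bne e(1) by blast
 have X1: "ALL x:Field X. EX y:Field X. lt x y" "ALL x:Field X. EX y:Field X. lt y x"
  using noB cX(3,4) unfolding X.has_max_iff X.has_min_iff by (meson X.not_le)+
 have X2: "ALL x:Field X. ALL y:Field X. lt x y --> (EX z:Field X. lt x z & lt z y)"
 proof (intro ballI impI)
  fix x y assume "x : Field X" "y : Field X" "lt x y"
  then obtain z where "z : branches T" "lt x (e z)" "lt (e z) y" using e(3) by blast
  thus "EX z:Field X. lt x z & lt z y" using e(1) by blast
 qed
 have clo: "clo le lt (Field X)" using X.complete_lots_iff[OF FX X1 X2] cX(1) by blast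
 interpret rtree T le lt "Field X" ?rt e
 proof (intro rtree.intro W.wtree_axioms clo rtree_axioms.intro)
  show "?rt : ?V" using rt by blast
  show "!!p. p : ?V ==> p ~= ?rt ==> (?rt, p) : prec T" by (rule rt2)
  show "nice (\<lambda>a b. a ~= b & (a, b) : sord T ?rt) (succs T ?rt)" by (rule nc')
 next
  fix p q assume pq: "p : ?V" "q : ?V" "preds T p = preds T q" "preds T p ~= {}"
   "ALL r:preds T p. EX s:preds T p. (r, s) : prec T"
  have oo: "order_of T p = order_of T q" unfolding order_of_def pq(3) ..
  have "limit_ordinal (order_of T p)" unfolding limit_ordinal_def has_max_def W.Field_order_of
  proof (intro conjI notI)
   show "well_order_on (preds T p) (order_of T p)" by (rule W.wo[OF pq(1)])
   show "order_of T p = {} ==> False" using empty pq(4) by blast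
   assume "EX m:preds T p. ALL a:preds T p. (a, m) : order_of T p"
   then obtain m where m: "m : preds T p" "ALL a:preds T p. (a, m) : order_of T p" by blast
   obtain s where s: "s : preds T p" "(m, s) : prec T" using pq(5) m(1) by blast
   have "s = m \<or> (s, m) : prec T" using m(2) s(1) unfolding order_of_def by auto
   thus False using s m(1) W.irr W.asymT W.preds_iff by blast
  qed
  moreover have "order_of T p =o order_of T q" using oo ordIso_reflexive[OF W.WO[OF pq(1)]] by simp
  ultimately show "p = q" using sn pq(1-3) by simp
 next
  show "!!x. x : branches T ==> countable x" using Om W.Omega_bounded_iff by blast
 next
  show "!!p. p : ?V ==> EX f. bij_betw f ?V (tree_above T p) &
    (ALL q:?V. ALL q':?V. (q, q') : prec T \<longleftrightarrow> (f q, f q') : prec T) &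
    (ALL q:?V. ALL a:succs T q. ALL b:succs T q. (a, b) : succ_order T q \<longleftrightarrow> (f a, f b) : succ_order T (f q))"
   using re unfolding reproductive_def by blast
 next
  fix s t assume st: "s : succs T ?rt" "t : succs T ?rt" "s ~= t"
  have "total_on (succs T ?rt) (succ_order T ?rt)" using lin unfolding order_on_defs by blast
  thus "(s, t) : sord T ?rt \<or> (t, s) : sord T ?rt" using st unfolding total_on_def succ_order_def by blast
 next
  show "!!x. x : branches T ==> e x : Field X" using e(1) by blast
  fix x y assume xy: "x : branches T" "y : branches T"
  show "x ~= y ==> branch_less T x y \<or> branch_less T y x"
   using linB(3) xy W.branch_space_iff unfolding total_on_def by blast
  assume l: "branch_less T x y"
  have "x ~= y"
  proof
   assume "x = y"
   then obtain p a b where "a : x" "b : x" "W.imm p a" "W.imm p b" "a ~= b"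
    using l unfolding W.branch_less_iff[OF xy(1)] by blast
   moreover hence "(a, b) : prec T \<or> (b, a) : prec T" using W.branch_total[OF xy(1)] by blast
   ultimately show False unfolding W.imm_def by blast
  qed
  thus "lt (e x) (e y)" using e_lt xy l by blast
 next
  show "!!a b. a : Field X ==> b : Field X ==> lt a b ==> EX x:branches T. lt a (e x) & lt (e x) b"
   by (rule e(3))
 qed
 have "EX f. siso lt lt f (Field X) U" if U: "X.endless U" for U
 proof -
  have "X.sim {} (Field X) U"
   by (rule sim_convex[OF Up_good Dn_good]) (use U in \<open>unfold X.endless_def, blast+\<close>)
  thus ?thesis unfolding X.sim_def by blast
 qed
 thus ?thesis using X.CHLOTS_iff clo by blast
qed
qed

section \<open>Countable ordinals\<close>

lemma Omega_Card: "Card_order Omega" unfolding Omega_def by (rule cardSuc_Card_order[OF natLeq_Card_order])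

lemma countable_lessThan_omega1: "countable {..<i::omega1}"
proof -
 have "|underS Omega (Rep_omega1 i)| <o Omega" by (rule card_of_underS[OF Omega_Card Rep_omega1])
 hence "countable (underS Omega (Rep_omega1 i))"
  using ordLess_Omega_iff[OF card_of_Well_order, of "underS Omega (Rep_omega1 i)"]
  unfolding Field_card_of by blast
 moreover have "Rep_omega1 ` {..<i} <= underS Omega (Rep_omega1 i)"
  unfolding underS_def using Rep_omega1_inject by (auto simp: less_le less_eq_omega1_def)
 ultimately have "countable (Rep_omega1 ` {..<i})" using countable_subset by blast
 moreover have "inj_on Rep_omega1 {..<i}" using Rep_omega1_inject by (auto intro: inj_onI)
 ultimately show ?thesis by (rule countable_image_inj_on)
qed

lemma uncountable_omega1: "uncountable (UNIV :: omega1 set)"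
proof
 assume "countable (UNIV :: omega1 set)"
 hence "countable (range Rep_omega1)" by simp
 hence "countable (Field Omega)" using type_definition.Rep_range[OF type_definition_omega1] by simp
 hence "Omega <o Omega" using ordLess_Omega_iff[of Omega] Omega_Card card_order_on_well_order_on by blast
 thus False using ordLess_irreflexive by blast
qed

lemma omega1_bound:
 assumes "countable (C :: omega1 set)"
 shows "EX b. ALL c:C. c < b"
proof (rule ccontr)
 assume "~ ?thesis"
 hence "UNIV = (\<Union>c\<in>C. insert c {..<c})" by (auto simp: not_less) (metis le_less)
 moreover have "countable (\<Union>c\<in>C. insert c {..<c})"
  using assms countable_lessThan_omega1 by (intro countable_UN) auto
 ultimately show False using uncountable_omega1 by simp
qed

lemma omega1_gt: "EX j. (i::omega1) < j" using omega1_bound[of "{i}"] by auto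

lemma omega1_eqI: "{..<i} = {..<j} ==> (i::omega1) = j" by (metis lessThan_iff linorder_neqE order_less_irrefl)

text \<open>The least ordinal in the recursion exists because \<open>{..<j}\<close> is countable and
  countable sets of countable ordinals are bounded. These three facts characterise addition from
  here on.\<close>

lemma oplus_prop:
 "i <= i \<oplus>\<^sub>o j" "d < j ==> i \<oplus>\<^sub>o d < i \<oplus>\<^sub>o j" "i <= c ==> (!!d. d < j ==> i \<oplus>\<^sub>o d < c) ==> i \<oplus>\<^sub>o j <= c"
proof -
 have "countable (insert i ((\<lambda>d. i \<oplus>\<^sub>o d) ` {..<j}))" using countable_lessThan_omega1 by simp
 then obtain b where "ALL c:insert i ((\<lambda>d. i \<oplus>\<^sub>o d) ` {..<j}). c < b" using omega1_bound by blast
 hence "EX c. i <= c & (ALL d:{..<j}. i \<oplus>\<^sub>o d < c)" by (intro exI[of _ b]) (auto intro: less_imp_le)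
 hence *: "i <= i \<oplus>\<^sub>o j & (ALL d:{..<j}. i \<oplus>\<^sub>o d < i \<oplus>\<^sub>o j)"
  unfolding oplus.simps[of i j] by (rule LeastI_ex)
 show "i <= i \<oplus>\<^sub>o j" "d < j ==> i \<oplus>\<^sub>o d < i \<oplus>\<^sub>o j" using * by auto
 show "i \<oplus>\<^sub>o j <= c" if "i <= c" "!!d. d < j ==> i \<oplus>\<^sub>o d < c"
  unfolding oplus.simps[of i j] by (rule Least_le) (use that in auto)
qed

lemma oplus_less: "i \<oplus>\<^sub>o d < i \<oplus>\<^sub>o j \<longleftrightarrow> d < j"
 using oplus_prop(2) by (metis not_less_iff_gr_or_eq)

lemma oplus_le: "i \<oplus>\<^sub>o d <= i \<oplus>\<^sub>o j \<longleftrightarrow> d <= j"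
 using oplus_less by (metis not_le)

lemma oplus_cancel: "i \<oplus>\<^sub>o d = i \<oplus>\<^sub>o j \<longleftrightarrow> d = j"
 using oplus_less by (metis less_irrefl neqE)

lemma le_oplus: "l <= i \<oplus>\<^sub>o l"
proof (induction l rule: less_induct)
 case (less l)
 show ?case
 proof (rule ccontr)
  assume "~ l <= i \<oplus>\<^sub>o l"
  hence "i \<oplus>\<^sub>o l < l" by simp
  hence "i \<oplus>\<^sub>o l <= i \<oplus>\<^sub>o (i \<oplus>\<^sub>o l)" "i \<oplus>\<^sub>o (i \<oplus>\<^sub>o l) < i \<oplus>\<^sub>o l" using less oplus_prop(2) by auto
  thus False by simp
 qed
qed

lemma odiff_ex: "i <= l ==> EX k. i \<oplus>\<^sub>o k = l"
proof -
 assume il: "i <= l"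
 define k where "k = (LEAST k. l <= i \<oplus>\<^sub>o k)"
 have 1: "l <= i \<oplus>\<^sub>o k" unfolding k_def by (rule LeastI[of _ l]) (rule le_oplus)
 have "i \<oplus>\<^sub>o k <= l"
 proof (rule oplus_prop(3)[OF il])
  fix d assume "d < k"
  thus "i \<oplus>\<^sub>o d < l" using not_less_Least[of d "\<lambda>k. l <= i \<oplus>\<^sub>o k"] k_def by auto
 qed
 thus ?thesis using 1 by auto
qed

lemma oplus_assoc: "(i \<oplus>\<^sub>o j) \<oplus>\<^sub>o k = i \<oplus>\<^sub>o (j \<oplus>\<^sub>o k)"
proof (induction k rule: less_induct)
 case (less k)
 show ?case
 proof (rule antisym)
  show "(i \<oplus>\<^sub>o j) \<oplus>\<^sub>o k <= i \<oplus>\<^sub>o (j \<oplus>\<^sub>o k)"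
   by (rule oplus_prop(3)) (simp_all add: oplus_le oplus_prop(1) less oplus_less)
  show "i \<oplus>\<^sub>o (j \<oplus>\<^sub>o k) <= (i \<oplus>\<^sub>o j) \<oplus>\<^sub>o k"
  proof (rule oplus_prop(3))
   show "i <= (i \<oplus>\<^sub>o j) \<oplus>\<^sub>o k" using oplus_prop(1) order_trans by blast
   fix d assume d: "d < j \<oplus>\<^sub>o k"
   show "i \<oplus>\<^sub>o d < (i \<oplus>\<^sub>o j) \<oplus>\<^sub>o k"
   proof (cases "d < j")
    case True
    hence "i \<oplus>\<^sub>o d < i \<oplus>\<^sub>o j" by (simp add: oplus_less)
    thus ?thesis using oplus_prop(1) less_le_trans by blast
   next
    case False
    then obtain d' where d': "d = j \<oplus>\<^sub>o d'" using odiff_ex[of j d] by (auto simp: not_less)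
    hence "d' < k" using d by (simp add: oplus_less)
    thus ?thesis using less[of d'] d' oplus_prop(2) by metis
   qed
  qed
 qed
qed

definition ozero :: omega1 where "ozero = (LEAST i. True)"
definition osuc :: "omega1 => omega1" where "osuc i = (LEAST j. i < j)"

lemma ozero_le [simp]: "ozero <= i" unfolding ozero_def by (rule Least_le) simp

lemma not_less_ozero [simp]: "~ i < ozero" by (simp add: not_less)

lemma ozero_less: "ozero < i \<longleftrightarrow> i ~= ozero" using ozero_le[of i] by (metis less_le)

lemma lessThan_ozero [simp]: "{..<ozero} = {}" by auto

lemma less_osuc [simp]: "i < osuc i" unfolding osuc_def by (rule LeastI_ex) (rule omega1_gt)

lemma less_osuc_iff: "j < osuc i \<longleftrightarrow> j <= i"
proof
 show "j < osuc i ==> j <= i" unfolding osuc_def using not_less_Least[of j "\<lambda>j. i < j"] by auto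
 show "j <= i ==> j < osuc i" using less_osuc[of i] by (rule le_less_trans[rotated])
qed

lemma osuc_le_iff: "osuc i <= j \<longleftrightarrow> i < j" using less_osuc_iff[of j i] by auto

lemma osuc_not_ozero [simp]: "osuc i ~= ozero" "ozero < osuc i"
 using less_osuc[of i] ozero_le[of i] by (metis not_less_ozero, simp add: less_osuc_iff)

lemma osuc_inj [simp]: "osuc i = osuc j \<longleftrightarrow> i = j" by (metis antisym less_osuc less_osuc_iff)

lemma osuc_mono: "i < j ==> osuc i < osuc j" using less_osuc_iff osuc_le_iff by simp

lemma oplus_ozero [simp]: "i \<oplus>\<^sub>o ozero = i" by (rule antisym) (auto intro: oplus_prop)

lemma ozero_oplus [simp]: "ozero \<oplus>\<^sub>o i = i"
 by (rule antisym[OF _ le_oplus], induction i rule: less_induct, rule oplus_prop(3)) (auto intro: le_less_trans)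

lemma oplus_osuc: "i \<oplus>\<^sub>o osuc j = osuc (i \<oplus>\<^sub>o j)"
proof (rule antisym)
 show "i \<oplus>\<^sub>o osuc j <= osuc (i \<oplus>\<^sub>o j)"
 proof (rule oplus_prop(3))
  show "i <= osuc (i \<oplus>\<^sub>o j)" using oplus_prop(1)[of i j] less_osuc[of "i \<oplus>\<^sub>o j"] by (meson le_less_trans less_imp_le)
 qed (simp add: less_osuc_iff oplus_le)
 show "osuc (i \<oplus>\<^sub>o j) <= i \<oplus>\<^sub>o osuc j" by (simp add: osuc_le_iff oplus_less)
qed

definition olimit :: "omega1 => bool" where
 "olimit i \<longleftrightarrow> i ~= ozero & (ALL j<i. osuc j < i)"

lemma omega1_cases:
 obtains "i = ozero" | j where "i = osuc j" | "olimit i"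
proof (cases "i = ozero \<or> olimit i")
 case False
 then obtain j where j: "j < i" "~ osuc j < i" unfolding olimit_def by blast
 hence "i = osuc j" using osuc_le_iff[of j i] by auto
 thus ?thesis using that by blast
qed (use that in blast)

lemma oplus_eq_zero: "i \<oplus>\<^sub>o j = ozero \<longleftrightarrow> i = ozero & j = ozero"
 by (metis antisym oplus_prop(1) ozero_le ozero_oplus)

lemma olimit_oplus: "olimit j ==> olimit (i \<oplus>\<^sub>o j)" unfolding olimit_def
proof (intro conjI allI impI; elim conjE)
 assume j: "j ~= ozero" "ALL d<j. osuc d < j"
 show "i \<oplus>\<^sub>o j ~= ozero" using j by (simp add: oplus_eq_zero)
 fix d assume d: "d < i \<oplus>\<^sub>o j"
 show "osuc d < i \<oplus>\<^sub>o j"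
 proof (cases "d < i")
  case True
  hence "osuc d <= i" by (simp add: osuc_le_iff)
  also have "i < i \<oplus>\<^sub>o j" using oplus_less[of i ozero j] j(1) by (simp add: ozero_less)
  finally show ?thesis .
 next
  case False
  then obtain k where k: "d = i \<oplus>\<^sub>o k" using odiff_ex[of i d] by (auto simp: not_less)
  hence "k < j" using d by (simp add: oplus_less)
  thus ?thesis using j(2) k oplus_less[of i "osuc k" j] by (simp add: oplus_osuc)
 qed
qed

lemma well_order_on_image:
 fixes L :: "'b :: wellorder set"
 assumes r: "r <= P \<times> P" and P: "P = c ` L" and c: "!!i j. i : L ==> j : L ==> (c i, c j) : r \<longleftrightarrow> i <= j"
 shows "well_order_on (P :: 'c set) r" unfolding order_on_defs
proof (intro conjI r)
 have ex: "EX i:L. u = c i" if "u : P" for u using that unfolding P by blast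
 show "refl_on P r" unfolding refl_on_def P using c by auto
 show "trans r"
 proof (rule transI)
  fix x y z assume xyz: "(x, y) : r" "(y, z) : r"
  hence "x : P" "y : P" "z : P" using r by auto
  then obtain i j k where "i : L" "x = c i" "j : L" "y = c j" "k : L" "z = c k" using ex by meson
  thus "(x, z) : r" using xyz c by auto
 qed
 show "antisym r"
 proof (rule antisymI)
  fix x y assume xy: "(x, y) : r" "(y, x) : r"
  hence "x : P" "y : P" using r by auto
  then obtain i j where "i : L" "x = c i" "j : L" "y = c j" using ex by meson
  thus "x = y" using xy c by auto
 qed
 show "total_on P r" unfolding total_on_def P using c linear by auto
 show "wf (r - Id)"
 proof (rule wfI_min)
  fix u and Q :: "'c set" assume u: "u : Q"
  show "EX z:Q. ALL y. (y, z) : r - Id --> y ~: Q"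
  proof (cases "EX i. i : L & c i : Q")
   case False
   hence "u ~: P" using ex u by metis
   thus ?thesis using u r by auto
  next
   case True
   hence m: "(LEAST i. i : L & c i : Q) : L & c (LEAST i. i : L & c i : Q) : Q" (is "?m : _ & _")
    by (rule LeastI_ex)
   have "y ~: Q" if y: "(y, c ?m) : r - Id" for y
   proof
    assume yQ: "y : Q"
    have "y : P" using y r by auto
    then obtain j where j: "j : L" "y = c j" using ex by meson
    have "c j : Q" using yQ j(2) by simp
    hence mj: "?m <= j" using j(1) by (intro Least_le) simp
    from j have "j <= ?m" using y c m by simp
    thus False using mj y j by simp
   qed
   thus ?thesis using conjunct2[OF m] by (intro bexI[of _ "c ?m"] allI impI)
  qed
 qed
qed

section \<open>Vertices of the simple tree\<close>

lemma vlen_eq: "dom p = {..<i} ==> vlen p = i" unfolding vlen_def by (rule the_equality) (auto dest: omega1_eqI)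

lemma simple_dom: "p : simple_verts Y ==> dom p = {..<vlen p}" unfolding simple_verts_def using vlen_eq by auto

lemma simple_ran: "p : simple_verts Y ==> ran p <= Field Y" unfolding simple_verts_def by auto

lemma simpleI: "dom p = {..<i} ==> ran p <= Field Y ==> p : simple_verts Y" unfolding simple_verts_def by auto

lemma simple_None: "p : simple_verts Y ==> p l = None \<longleftrightarrow> ~ l < vlen p"
 using simple_dom[of p Y] by (metis domIff lessThan_iff)

lemma vlen_empty [simp]: "vlen Map.empty = ozero" by (rule vlen_eq) simp

lemma simple_empty [simp]: "Map.empty : simple_verts Y" by (rule simpleI[of _ ozero]) auto

lemma vlen_zero: "p : simple_verts Y ==> vlen p = ozero \<longleftrightarrow> p = Map.empty"
 using simple_None[of p Y] by (metis ext not_less_ozero vlen_empty)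

definition cut :: "(omega1 \<rightharpoonup> 'y) => omega1 => (omega1 \<rightharpoonup> 'y)" where
 "cut p i = p |` {..<i}"

lemma cut_simple: "p : simple_verts Y ==> i <= vlen p ==> cut p i : simple_verts Y"
 and vlen_cut: "p : simple_verts Y ==> i <= vlen p ==> vlen (cut p i) = i"
proof -
 assume p: "p : simple_verts Y" "i <= vlen p"
 have d: "dom (cut p i) = {..<i}" unfolding cut_def using simple_dom[OF p(1)] p(2) by auto
 thus "vlen (cut p i) = i" by (rule vlen_eq)
 have "ran (cut p i) <= ran p" unfolding cut_def ran_def restrict_map_def by auto
 thus "cut p i : simple_verts Y" using simpleI[OF d] simple_ran[OF p(1)] by blast
qed

lemma map_le_cut:
 assumes p: "p : simple_verts Y" and q: "q : simple_verts Y"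
 shows "q \<subseteq>\<^sub>m p \<longleftrightarrow> vlen q <= vlen p & q = cut p (vlen q)"
proof
 assume le: "q \<subseteq>\<^sub>m p"
 have "dom q <= dom p" using le by (rule map_le_implies_dom_le)
 hence l: "vlen q <= vlen p" using simple_dom[OF p] simple_dom[OF q] by (metis lessThan_subset_iff)
 have "q l = cut p (vlen q) l" for l
  unfolding cut_def restrict_map_def using le simple_dom[OF q] unfolding map_le_def by auto
 thus "vlen q <= vlen p & q = cut p (vlen q)" using l by blast
next
 assume "vlen q <= vlen p & q = cut p (vlen q)"
 thus "q \<subseteq>\<^sub>m p" unfolding cut_def by (metis map_le_def restrict_in dom_restrict IntE)
qed

lemma map_less_cut:
 assumes p: "p : simple_verts Y" and q: "q : simple_verts Y"
 shows "q \<subseteq>\<^sub>m p & q ~= p \<longleftrightarrow> vlen q < vlen p & q = cut p (vlen q)"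
proof -
 have "cut p (vlen p) = p" using map_le_cut[OF p p] by simp
 thus ?thesis using map_le_cut[OF p q] by (metis le_less less_irrefl)
qed

lemma cut_self: "p : simple_verts Y ==> cut p (vlen p) = p" using map_le_cut[of p Y p] by simp

lemma cut_cut: "i <= j ==> cut (cut p j) i = cut p i"
 unfolding cut_def restrict_map_def by (auto simp: fun_eq_iff)

definition push :: "(omega1 \<rightharpoonup> 'y) => 'y => (omega1 \<rightharpoonup> 'y)" where
 "push p y = p(vlen p \<mapsto> y)"

lemma push_simple: "p : simple_verts Y ==> y : Field Y ==> push p y : simple_verts Y"
 and vlen_push: "p : simple_verts Y ==> vlen (push p y) = osuc (vlen p)"
 and cut_push: "p : simple_verts Y ==> cut (push p y) (vlen p) = p"
 and push_last: "push p y (vlen p) = Some y"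
proof -
 assume p: "p : simple_verts Y"
 have d: "dom (push p y) = {..<osuc (vlen p)}"
  unfolding push_def using simple_dom[OF p] by (auto simp: less_osuc_iff le_less)
 thus "vlen (push p y) = osuc (vlen p)" by (rule vlen_eq)
 show "y : Field Y ==> push p y : simple_verts Y"
 proof (rule simpleI[OF d])
  assume "y : Field Y"
  moreover have "ran (push p y) <= insert y (ran p)" unfolding push_def ran_def by auto
  ultimately show "ran (push p y) <= Field Y" using simple_ran[OF p] by blast
 qed
 show "cut (push p y) (vlen p) = p"
  unfolding cut_def push_def restrict_map_def by (rule ext) (use simple_None[OF p, symmetric] in auto)
next
 show "push p y (vlen p) = Some y" unfolding push_def by simp
qed

lemma push_cases:
 assumes p: "p : simple_verts Y" and l: "vlen p = osuc i"
 obtains y where "y : Field Y" "p = push (cut p i) y"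
proof -
 have il: "i <= vlen p" "i < vlen p" unfolding l by (simp_all add: less_imp_le)
 obtain y where y: "p i = Some y" using simple_None[OF p, of i] il by (metis not_None_eq)
 hence yF: "y : Field Y" using simple_ran[OF p] by (auto intro: ranI)
 have e: "push (cut p i) y = (cut p i)(i \<mapsto> y)" unfolding push_def vlen_cut[OF p il(1)] ..
 have "p l = push (cut p i) y l" for l
 proof (cases "l < vlen p")
  case True
  hence "l < i \<or> l = i" using l by (simp add: less_osuc_iff le_less)
  thus ?thesis unfolding e using y by (auto simp: cut_def)
 next
  case False
  hence "~ l < i" "l ~= i" using il by auto
  thus ?thesis unfolding e using False simple_None[OF p, of l] by (simp add: cut_def)
 qed
 hence "p = push (cut p i) y" by (rule ext)
 thus ?thesis using that[OF yF] by blast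
qed

definition odiff :: "omega1 => omega1 => omega1" where
 "odiff l i = (THE k. i \<oplus>\<^sub>o k = l)"

lemma odiff_oplus [simp]: "odiff (i \<oplus>\<^sub>o k) i = k"
 unfolding odiff_def by (rule the_equality) (auto simp: oplus_cancel)

lemma oplus_odiff: "i <= l ==> i \<oplus>\<^sub>o odiff l i = l" using odiff_ex[of i l] by auto

lemma vertex_sum_low: "l < vlen p ==> vertex_sum p q l = p l" unfolding vertex_sum_def by simp

lemma vertex_sum_high: "vertex_sum p q (vlen p \<oplus>\<^sub>o k) = q k"
proof -
 have "~ vlen p \<oplus>\<^sub>o k < vlen p" using oplus_prop(1)[of "vlen p" k] by (rule leD)
 thus ?thesis unfolding vertex_sum_def odiff_def[symmetric] by simp
qed

lemma vertex_sum_dom: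
 assumes p: "p : simple_verts Y" and q: "q : simple_verts Y"
 shows "dom (vertex_sum p q) = {..<vlen p \<oplus>\<^sub>o vlen q}"
proof (intro equalityI subsetI)
 fix l assume "l : dom (vertex_sum p q)"
 hence l: "vertex_sum p q l ~= None" by blast
 show "l : {..<vlen p \<oplus>\<^sub>o vlen q}"
 proof (cases "l < vlen p")
  case True
  thus ?thesis using oplus_prop(1)[of "vlen p" "vlen q"] by auto
 next
  case False
  then obtain k where k: "l = vlen p \<oplus>\<^sub>o k" using odiff_ex[of "vlen p" l] by (auto simp: not_less)
  hence "k < vlen q" using l simple_None[OF q, of k] by (simp add: vertex_sum_high)
  thus ?thesis using k by (simp add: oplus_less)
 qed
next
 fix l assume l: "l : {..<vlen p \<oplus>\<^sub>o vlen q}"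
 show "l : dom (vertex_sum p q)"
 proof (cases "l < vlen p")
  case True
  thus ?thesis using simple_None[OF p, of l] by (auto simp: vertex_sum_low)
 next
  case False
  then obtain k where k: "l = vlen p \<oplus>\<^sub>o k" using odiff_ex[of "vlen p" l] by (auto simp: not_less)
  hence "k < vlen q" using l by (simp add: oplus_less)
  thus ?thesis using k simple_None[OF q, of k] by (auto simp: vertex_sum_high)
 qed
qed

lemma vertex_sum_simple: "p : simple_verts Y ==> q : simple_verts Y ==> vertex_sum p q : simple_verts Y"
 and vlen_vertex_sum: "p : simple_verts Y ==> q : simple_verts Y ==> vlen (vertex_sum p q) = vlen p \<oplus>\<^sub>o vlen q"
proof -
 assume p: "p : simple_verts Y" and q: "q : simple_verts Y"
 show "vlen (vertex_sum p q) = vlen p \<oplus>\<^sub>o vlen q" by (rule vlen_eq[OF vertex_sum_dom[OF p q]])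
 have "ran (vertex_sum p q) <= ran p \<union> ran q" unfolding ran_def vertex_sum_def by (auto split: if_splits)
 thus "vertex_sum p q : simple_verts Y"
  using simpleI[OF vertex_sum_dom[OF p q]] simple_ran[OF p] simple_ran[OF q] by blast
qed

lemma vertex_sum_empty: "p : simple_verts Y ==> vertex_sum p Map.empty = p"
proof
 fix l assume p: "p : simple_verts Y"
 show "vertex_sum p Map.empty l = p l"
  using simple_None[OF p, of l] by (cases "l < vlen p") (simp_all add: vertex_sum_def)
qed

lemma vertex_sum_push:
 assumes p: "p : simple_verts Y" and q: "q : simple_verts Y"
 shows "vertex_sum p (push q y) = push (vertex_sum p q) y"
proof
 fix l
 show "vertex_sum p (push q y) l = push (vertex_sum p q) y l"
 proof (cases "l < vlen p")
  case True
  hence "l ~= vlen p \<oplus>\<^sub>o vlen q" using oplus_prop(1)[of "vlen p" "vlen q"] by auto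
  thus ?thesis using True unfolding push_def vlen_vertex_sum[OF p q] by (simp add: vertex_sum_low)
 next
  case False
  then obtain k where k: "l = vlen p \<oplus>\<^sub>o k" using odiff_ex[of "vlen p" l] by (auto simp: not_less)
  thus ?thesis unfolding push_def vlen_vertex_sum[OF p q] by (simp add: vertex_sum_high oplus_cancel)
 qed
qed

lemma vertex_sum_cut:
 assumes p: "p : simple_verts Y" and q: "q : simple_verts Y"
 shows "cut (vertex_sum p q) (vlen p \<oplus>\<^sub>o i) = vertex_sum p (cut q i)"
proof
 fix l
 show "cut (vertex_sum p q) (vlen p \<oplus>\<^sub>o i) l = vertex_sum p (cut q i) l"
 proof (cases "l < vlen p")
  case True
  hence "l < vlen p \<oplus>\<^sub>o i" using oplus_prop(1)[of "vlen p" i] by auto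
  thus ?thesis using True unfolding cut_def by (simp add: vertex_sum_low)
 next
  case False
  then obtain k where k: "l = vlen p \<oplus>\<^sub>o k" using odiff_ex[of "vlen p" l] by (auto simp: not_less)
  thus ?thesis unfolding cut_def restrict_map_def by (simp add: vertex_sum_high oplus_less)
 qed
qed

lemma vertex_sum_cancel:
 "vertex_sum p q = vertex_sum p q' \<longleftrightarrow> q = q'"
 using vertex_sum_high[of p q] vertex_sum_high[of p q'] by (metis ext)

definition tail :: "(omega1 \<rightharpoonup> 'y) => omega1 => (omega1 \<rightharpoonup> 'y)" where
 "tail p i = (\<lambda>k. p (i \<oplus>\<^sub>o k))"

lemma tail_simple:
 assumes p: "p : simple_verts Y" and i: "i <= vlen p"
 shows "tail p i : simple_verts Y" "vlen (tail p i) = odiff (vlen p) i" "vertex_sum (cut p i) (tail p i) = p"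
proof -
 have d: "dom (tail p i) = {..<odiff (vlen p) i}"
 proof -
  have "tail p i k ~= None \<longleftrightarrow> k < odiff (vlen p) i" for k
   unfolding tail_def using simple_None[OF p, of "i \<oplus>\<^sub>o k"] oplus_odiff[OF i] oplus_less[of i k "odiff (vlen p) i"] by auto
  thus ?thesis by (auto simp: dom_def)
 qed
 show "vlen (tail p i) = odiff (vlen p) i" by (rule vlen_eq[OF d])
 have "ran (tail p i) <= ran p" unfolding ran_def tail_def by auto
 thus "tail p i : simple_verts Y" using simpleI[OF d] simple_ran[OF p] by blast
 show "vertex_sum (cut p i) (tail p i) = p"
 proof
  fix l
  show "vertex_sum (cut p i) (tail p i) l = p l"
  proof (cases "l < i")
   case True
   thus ?thesis using vertex_sum_low[of l "cut p i"] unfolding vlen_cut[OF p i] by (simp add: cut_def)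
  next
   case False
   then obtain k where k: "l = i \<oplus>\<^sub>o k" using odiff_ex[of i l] by (auto simp: not_less)
   thus ?thesis using vertex_sum_high[of "cut p i" "tail p i" k] unfolding vlen_cut[OF p i] by (simp add: tail_def)
  qed
 qed
qed

section \<open>Additive subtrees\<close>

text \<open>The vertices may be renamed by \<open>\<phi>\<close>, so that a tree on another vertex type can be treated as well.\<close>

locale coded =
 fixes Y :: "'y rel" and T1 :: "(omega1 \<rightharpoonup> 'y) set" and T :: "'w tree" and \<phi> :: "(omega1 \<rightharpoonup> 'y) => 'w"
 assumes Y: "Linear_order Y" "EX a:Field Y. EX b:Field Y. a ~= b"
  and sub: "T1 <= simple_verts Y" "!!p i. p : T1 ==> i <= vlen p ==> cut p i : T1"
  and emp: "Map.empty : T1"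
  and one: "!!y. y : Field Y ==> push Map.empty y : T1"
  and add: "!!p q. p : simple_verts Y ==> q : simple_verts Y ==> vertex_sum p q : T1 \<longleftrightarrow> p : T1 & q : T1"
  and inj: "inj_on \<phi> T1" and verts: "verts T = \<phi> ` T1"
  and prec: "!!p q. p : T1 ==> q : T1 ==> (\<phi> p, \<phi> q) : prec T \<longleftrightarrow> p \<subseteq>\<^sub>m q & p ~= q"
  and sord: "!!p a b. p : T1 ==> a : Field Y ==> b : Field Y ==>
    (\<phi> (push p a), \<phi> (push p b)) : sord T (\<phi> p) \<longleftrightarrow> (a, b) : Y"
begin

lemma simp1: "p : T1 ==> p : simple_verts Y" using sub(1) by blast

lemma phi_eq: "p : T1 ==> q : T1 ==> \<phi> p = \<phi> q \<longleftrightarrow> p = q"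
 using inj unfolding inj_on_def by blast

lemma prec_cut: "p : T1 ==> q : T1 ==> (\<phi> p, \<phi> q) : prec T \<longleftrightarrow> vlen p < vlen q & p = cut q (vlen p)"
 using prec map_less_cut simp1 by metis

text \<open>Appending a letter is adding a word of length one, so closure under letters is a case of
  additivity.\<close>

lemma push1: "p : T1 ==> y : Field Y ==> push p y : T1"
proof -
 assume p: "p : T1" and y: "y : Field Y"
 have "vertex_sum p (push Map.empty y) = push p y"
  using vertex_sum_push[OF simp1[OF p] simple_empty] vertex_sum_empty[OF simp1[OF p]] by simp
 thus ?thesis using add[OF simp1[OF p] simp1[OF one[OF y]]] p one[OF y] by simp
qed

lemma preds_eq: "p : T1 ==> preds T (\<phi> p) = (\<lambda>i. \<phi> (cut p i)) ` {..<vlen p}"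
proof (intro equalityI subsetI)
 fix v assume p: "p : T1" and "v : preds T (\<phi> p)"
 then obtain q where q: "q : T1" "v = \<phi> q" "(\<phi> q, \<phi> p) : prec T" unfolding preds_def verts by blast
 hence "vlen q < vlen p" "v = \<phi> (cut p (vlen q))" using prec_cut[OF q(1) p] by auto
 thus "v : (\<lambda>i. \<phi> (cut p i)) ` {..<vlen p}" by blast
next
 fix v assume p: "p : T1" and "v : (\<lambda>i. \<phi> (cut p i)) ` {..<vlen p}"
 then obtain i where i: "i < vlen p" "v = \<phi> (cut p i)" by blast
 have c: "cut p i : T1" "vlen (cut p i) = i" using sub(2)[OF p] vlen_cut[OF simp1[OF p]] i(1) by simp_all
 thus "v : preds T (\<phi> p)" unfolding preds_def verts using prec_cut[OF c(1) p] i by auto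
qed

lemma order_of_iff:
 assumes p: "p : T1" and ij: "i < vlen p" "j < vlen p"
 shows "(\<phi> (cut p i), \<phi> (cut p j)) : order_of T (\<phi> p) \<longleftrightarrow> i <= j"
proof -
 have c: "cut p i : T1" "vlen (cut p i) = i" "cut p j : T1" "vlen (cut p j) = j"
  using sub(2)[OF p] vlen_cut[OF simp1[OF p]] ij by simp_all
 have "\<phi> (cut p i) = \<phi> (cut p j) \<longleftrightarrow> i = j" using phi_eq c by metis
 moreover have "(\<phi> (cut p i), \<phi> (cut p j)) : prec T \<longleftrightarrow> i < j"
  unfolding prec_cut[OF c(1,3)] c(2,4) using cut_cut[of i j p] less_imp_le by auto
 ultimately show ?thesis unfolding order_of_def preds_eq[OF p] using ij by auto
qed

sublocale wtree T
proof
 fix v assume "v : verts T"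
 then obtain p where p: "p : T1" "v = \<phi> p" unfolding verts by blast
 show "(v, v) ~: prec T" using prec_cut[OF p(1) p(1)] p(2) by simp
 show "well_order_on (preds T v) (order_of T v)"
 proof (rule well_order_on_image)
  show "order_of T v <= preds T v \<times> preds T v" unfolding order_of_def by auto
  show "preds T v = (\<lambda>i. \<phi> (cut p i)) ` {..<vlen p}" using preds_eq[OF p(1)] p(2) by simp
  show "(\<phi> (cut p i), \<phi> (cut p j)) : order_of T v \<longleftrightarrow> i <= j" if "i : {..<vlen p}" "j : {..<vlen p}" for i j
   using order_of_iff[OF p(1)] that p(2) by simp
 qed
 fix u w assume "u : verts T" "w : verts T"
 then obtain q r where q: "q : T1" "u = \<phi> q" and r: "r : T1" "w = \<phi> r" unfolding verts by blast
 assume "(v, u) : prec T" "(u, w) : prec T"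
 hence "p \<subseteq>\<^sub>m q" "q \<subseteq>\<^sub>m r" "vlen p < vlen q" "vlen q < vlen r"
  using prec[OF p(1) q(1)] prec[OF q(1) r(1)] prec_cut[OF p(1) q(1)] prec_cut[OF q(1) r(1)] p q r by auto
 moreover from this have "p \<subseteq>\<^sub>m r" "p ~= r" using map_le_trans by (blast, auto)
 ultimately show "(v, w) : prec T" using prec[OF p(1) r(1)] p r by simp
qed

lemma imm_iff: "p : T1 ==> imm (\<phi> p) v \<longleftrightarrow> (EX y:Field Y. v = \<phi> (push p y))"
proof
 assume p: "p : T1" and "imm (\<phi> p) v"
 hence i: "v : verts T" "(\<phi> p, v) : prec T" "ALL r:verts T. (\<phi> p, r) : prec T --> (r, v) ~: prec T"
  unfolding imm_def by auto
 obtain q where q: "q : T1" "v = \<phi> q" using i(1) unfolding verts by blast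
 have pq: "vlen p < vlen q" "p = cut q (vlen p)" using i(2) prec_cut[OF p q(1)] q(2) by auto
 have le: "osuc (vlen p) <= vlen q" using pq(1) by (simp add: osuc_le_iff)
 let ?r = "cut q (osuc (vlen p))"
 have r: "?r : T1" "vlen ?r = osuc (vlen p)" using sub(2)[OF q(1) le] vlen_cut[OF simp1[OF q(1)] le] by auto
 have "cut ?r (vlen p) = p" using cut_cut[of "vlen p" "osuc (vlen p)" q] pq(2) by (simp add: less_imp_le)
 hence "(\<phi> p, \<phi> ?r) : prec T" using prec_cut[OF p r(1)] r(2) by simp
 hence "(\<phi> ?r, v) ~: prec T" using i(3) r(1) verts by blast
 hence "~ vlen ?r < vlen q" using prec_cut[OF r(1) q(1)] q(2) r(2) by simp
 hence "vlen q = osuc (vlen p)" using le r(2) by simp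
 then obtain y where "y : Field Y" "q = push (cut q (vlen p)) y" using push_cases[OF simp1[OF q(1)]] by blast
 thus "EX y:Field Y. v = \<phi> (push p y)" using pq(2) q(2) by auto
next
 assume p: "p : T1" and "EX y:Field Y. v = \<phi> (push p y)"
 then obtain y where y: "y : Field Y" "v = \<phi> (push p y)" by blast
 note pp = push1[OF p y(1)] and vl = vlen_push[OF simp1[OF p], of y]
 show "imm (\<phi> p) v" unfolding imm_def
 proof (intro conjI ballI impI)
  show "v : verts T" using y pp verts by blast
  show "(\<phi> p, v) : prec T" using prec_cut[OF p pp] y(2) vl cut_push[OF simp1[OF p]] by simp
  fix r assume "r : verts T" "(\<phi> p, r) : prec T"
  then obtain q where q: "q : T1" "r = \<phi> q" "vlen p < vlen q" using prec_cut[OF p] unfolding verts by blast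
  show "(r, v) ~: prec T" using prec_cut[OF q(1) pp] q y(2) vl less_osuc_iff by auto
 qed
qed

lemma succs_eq: "p : T1 ==> succs T (\<phi> p) = (\<lambda>y. \<phi> (push p y)) ` Field Y"
 using succs_iff[of "\<phi> p"] imm_iff[of p] verts by blast

lemma push_eq: "push p a = push p b \<longleftrightarrow> a = b"
 unfolding push_def by (metis fun_upd_same option.inject)

lemma phi_push_eq: "p : T1 ==> a : Field Y ==> b : Field Y ==> \<phi> (push p a) = \<phi> (push p b) \<longleftrightarrow> a = b"
 using phi_eq[OF push1 push1] push_eq by metis

lemma succ_order_iff: "p : T1 ==> a : Field Y ==> b : Field Y ==>
  (\<phi> (push p a), \<phi> (push p b)) : succ_order T (\<phi> p) \<longleftrightarrow> (a, b) : Y"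
 unfolding succ_order_def using sord succs_eq by auto

lemma order_of_empty: "p : T1 ==> order_of T (\<phi> p) = {} \<longleftrightarrow> p = Map.empty"
proof -
 assume p: "p : T1"
 have "order_of T (\<phi> p) = {} \<longleftrightarrow> preds T (\<phi> p) = {}" unfolding order_of_def by blast
 also have "\<dots> \<longleftrightarrow> {..<vlen p} = {}" unfolding preds_eq[OF p] by simp
 also have "\<dots> \<longleftrightarrow> vlen p = ozero" using omega1_eqI[of "vlen p" ozero] by auto
 finally show ?thesis using vlen_zero[OF simp1[OF p]] by simp
qed

lemma root_eq: "tree_root T = \<phi> Map.empty" unfolding tree_root_def
proof (rule the_equality)
 show "\<phi> Map.empty : verts T & order_of T (\<phi> Map.empty) = {}" using order_of_empty[OF emp] emp verts by simp
 fix v assume v: "v : verts T & order_of T v = {}"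
 then obtain p where "p : T1" "v = \<phi> p" unfolding verts by blast
 thus "v = \<phi> Map.empty" using order_of_empty v by simp
qed

lemma succ_order_root_siso:
 "siso (\<lambda>a b. a ~= b & (a, b) : Y) (\<lambda>a b. a ~= b & (a, b) : succ_order T (tree_root T))
   (\<lambda>y. \<phi> (push Map.empty y)) (Field Y) (succs T (tree_root T))"
 unfolding siso_def root_eq succs_eq[OF emp] bij_betw_def
 using phi_push_eq[OF emp] succ_order_iff[OF emp] by (auto simp: inj_on_def)

lemma linear_succ_order: "p : T1 ==> linear_order_on (succs T (\<phi> p)) (succ_order T (\<phi> p))"
proof -
 assume p: "p : T1"
 let ?S = "succs T (\<phi> p)" and ?o = "succ_order T (\<phi> p)"
 note io = succ_order_iff[OF p] and eq = phi_push_eq[OF p]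
 have ex: "EX y:Field Y. u = \<phi> (push p y)" if "u : ?S" for u using that unfolding succs_eq[OF p] by blast
 have oS: "?o <= ?S \<times> ?S" unfolding succ_order_def by blast
 have Y': "refl_on (Field Y) Y" "trans Y" "antisym Y" "total_on (Field Y) Y" using Y(1) unfolding order_on_defs by auto
 show ?thesis unfolding order_on_defs
 proof (intro conjI oS)
  show "refl_on ?S ?o" unfolding refl_on_def
  proof
   fix u assume "u : ?S"
   then obtain y where "y : Field Y" "u = \<phi> (push p y)" using ex by blast
   thus "(u, u) : ?o" using io Y'(1) unfolding refl_on_def by auto
  qed
  show "trans ?o"
  proof (rule transI)
   fix a b c assume abc: "(a, b) : ?o" "(b, c) : ?o"
   hence "a : ?S" "b : ?S" "c : ?S" using oS by auto
   then obtain x y z where "x : Field Y" "a = \<phi> (push p x)" "y : Field Y" "b = \<phi> (push p y)" "z : Field Y" "c = \<phi> (push p z)"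
    using ex by meson
   thus "(a, c) : ?o" using abc io transD[OF Y'(2)] by auto
  qed
  show "antisym ?o"
  proof (rule antisymI)
   fix a b assume ab: "(a, b) : ?o" "(b, a) : ?o"
   hence "a : ?S" "b : ?S" using oS by auto
   then obtain x y where "x : Field Y" "a = \<phi> (push p x)" "y : Field Y" "b = \<phi> (push p y)" using ex by meson
   thus "a = b" using ab io antisymD[OF Y'(3)] by auto
  qed
  show "total_on ?S ?o" unfolding total_on_def
  proof (intro ballI impI)
   fix a b assume "a : ?S" "b : ?S" "a ~= b"
   then obtain x y where "x : Field Y" "a = \<phi> (push p x)" "y : Field Y" "b = \<phi> (push p y)" "x ~= y" using ex by metis
   thus "(a, b) : ?o \<or> (b, a) : ?o" using io Y'(4) unfolding total_on_def by simp
  qed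
 qed
qed

lemma semi_normal: "semi_normal_tree T" unfolding semi_normal_tree_def
proof (intro conjI ballI)
 show "verts T ~= {}" using emp verts by blast
 show "irrefl (Restr (prec T) (verts T))" using irr unfolding irrefl_def by blast
 show "trans (Restr (prec T) (verts T))" by (rule transI) (use tr in blast)
 show "well_order_on (preds T p) (order_of T p)" if "p : verts T" for p using wo that .
 show "EX! r. r : verts T & order_of T r = {}"
  by (rule ex1I[of _ "\<phi> Map.empty"]) (use order_of_empty emp verts in auto)
next
 fix v assume "v : verts T"
 then obtain p where p: "p : T1" "v = \<phi> p" unfolding verts by blast
 obtain a b where ab: "a : Field Y" "b : Field Y" "a ~= b" using Y(2) by blast
 have "\<phi> (push p a) : succs T v" "\<phi> (push p b) : succs T v" using ab p succs_eq[OF p(1)] by auto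
 moreover have "\<phi> (push p a) ~= \<phi> (push p b)" using phi_push_eq[OF p(1)] ab by simp
 ultimately show "\<nexists>q. succs T v = {q}" by auto
next
 fix v w assume "v : verts T" "w : verts T"
 then obtain p q where p: "p : T1" "v = \<phi> p" and q: "q : T1" "w = \<phi> q" unfolding verts by blast
 show "preds T v = preds T w & order_of T v =o order_of T w & limit_ordinal (order_of T v) --> v = w"
 proof (intro impI; elim conjE)
  assume eq: "preds T v = preds T w" and lim: "limit_ordinal (order_of T v)"
  have sub2: "i < vlen q & cut p i = cut q i" if i: "i < vlen p" and e: "preds T (\<phi> p) = preds T (\<phi> q)"
   and p: "p : T1" and q: "q : T1" for i p q
  proof -
   have "\<phi> (cut p i) : (\<lambda>i. \<phi> (cut q i)) ` {..<vlen q}" using e i unfolding preds_eq[OF p] preds_eq[OF q] by blast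
   then obtain j where j: "j < vlen q" "\<phi> (cut p i) = \<phi> (cut q j)" by blast
   have "cut p i : T1" "cut q j : T1" using sub(2) p q i j less_imp_le by blast+
   hence e': "cut p i = cut q j" using j(2) phi_eq by blast
   hence "i = j" using vlen_cut[OF simp1[OF p], of i] vlen_cut[OF simp1[OF q], of j] i j by (metis less_imp_le)
   thus ?thesis using j(1) e' by simp
  qed
  have vl: "vlen p = vlen q"
  proof (rule antisym)
   show "vlen p <= vlen q" using sub2[of "vlen q" p q] p q eq by (metis less_irrefl not_le)
   show "vlen q <= vlen p" using sub2[of "vlen p" q p] p q eq by (metis less_irrefl not_le)
  qed
  have limp: "EX j. i < j & j < vlen p" if i: "i < vlen p" for i
  proof (rule ccontr)
   assume n: "~ ?thesis"
   have "\<phi> (cut p i) : Field (order_of T v)" unfolding Field_order_of p(2) preds_eq[OF p(1)] using i by blast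
   moreover have "ALL a:Field (order_of T v). (a, \<phi> (cut p i)) : order_of T v"
   proof
    fix a assume "a : Field (order_of T v)"
    then obtain j where "j < vlen p" "a = \<phi> (cut p j)" unfolding Field_order_of p(2) preds_eq[OF p(1)] by blast
    thus "(a, \<phi> (cut p i)) : order_of T v" using order_of_iff[OF p(1) _ i] n p(2) by (metis not_le)
   qed
   ultimately show False using lim unfolding limit_ordinal_def has_max_def by blast
  qed
  have "p l = q l" for l
  proof (cases "l < vlen p")
   case True
   then obtain j where j: "l < j" "j < vlen p" using limp by blast
   hence "cut p j l = cut q j l" using sub2[of j p q] p q eq by simp
   thus ?thesis unfolding cut_def using j(1) by simp
  next
   case False
   thus ?thesis using simple_None[OF simp1[OF p(1)], of l] simple_None[OF simp1[OF q(1)], of l] vl by simp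
  qed
  thus "v = w" using p(2) q(2) by (metis ext)
 qed
qed

text \<open>The map is addition of \<open>p\<close> from the left. One direction of additivity keeps
  sums in the tree; the other puts the tail of every vertex above \<open>p\<close> into the tree,
  which gives surjectivity.\<close>

lemma rep: "reproductive T" unfolding reproductive_def
proof
 fix v assume "v : verts T"
 then obtain p where p: "p : T1" "v = \<phi> p" unfolding verts by blast
 define f where "f u = \<phi> (vertex_sum p (inv_into T1 \<phi> u))" for u
 have f: "f (\<phi> q) = \<phi> (vertex_sum p q)" if "q : T1" for q unfolding f_def using inv_into_f_f[OF inj that] by simp
 have s1: "vertex_sum p q : T1" if "q : T1" for q using add[OF simp1[OF p(1)] simp1[OF that]] that p(1) by simp
 have vl: "vlen (vertex_sum p q) = vlen p \<oplus>\<^sub>o vlen q" if "q : T1" for q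
  using vlen_vertex_sum[OF simp1[OF p(1)] simp1[OF that]] .
 have pr: "(f (\<phi> q), f (\<phi> q')) : prec T \<longleftrightarrow> (\<phi> q, \<phi> q') : prec T" if q: "q : T1" "q' : T1" for q q'
  unfolding f[OF q(1)] f[OF q(2)] prec_cut[OF s1[OF q(1)] s1[OF q(2)]] prec_cut[OF q] vl[OF q(1)] vl[OF q(2)]
   vertex_sum_cut[OF simp1[OF p(1)] simp1[OF q(2)]] oplus_less vertex_sum_cancel ..
 have "bij_betw f (verts T) (tree_above T v)" unfolding bij_betw_def
 proof
  show "inj_on f (verts T)" unfolding verts
  proof (rule inj_onI; elim imageE; clarify)
   fix q q' assume q: "q : T1" "q' : T1" "f (\<phi> q) = f (\<phi> q')"
   hence "vertex_sum p q = vertex_sum p q'" using f phi_eq s1 by metis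
   thus "\<phi> q = \<phi> q'" by (simp add: vertex_sum_cancel)
  qed
  show "f ` verts T = tree_above T v"
  proof (intro equalityI subsetI)
   fix u assume "u : f ` verts T"
   then obtain q where q: "q : T1" "u = \<phi> (vertex_sum p q)" unfolding verts using f by auto
   have "p = vertex_sum p q \<or> (v, u) : prec T"
   proof (cases "q = Map.empty")
    case True
    thus ?thesis using vertex_sum_empty[OF simp1[OF p(1)]] by simp
   next
    case False
    hence "vlen p < vlen p \<oplus>\<^sub>o vlen q"
     using oplus_less[of "vlen p" ozero "vlen q"] vlen_zero[OF simp1[OF q(1)]] by (simp add: ozero_less)
    moreover have "cut (vertex_sum p q) (vlen p \<oplus>\<^sub>o ozero) = vertex_sum p (cut q ozero)"
     by (rule vertex_sum_cut[OF simp1[OF p(1)] simp1[OF q(1)]])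
    moreover have "cut q ozero = Map.empty" unfolding cut_def by simp
    ultimately show ?thesis
     using prec_cut[OF p(1) s1[OF q(1)]] p(2) q(2) vl[OF q(1)] vertex_sum_empty[OF simp1[OF p(1)]] by simp
   qed
   thus "u : tree_above T v" unfolding tree_above_def verts using s1[OF q(1)] q p by auto
  next
   fix u assume "u : tree_above T v"
   then obtain r where r: "r : T1" "u = \<phi> r" "u = v \<or> (v, u) : prec T" unfolding tree_above_def verts by blast
   have c: "vlen p <= vlen r" "cut r (vlen p) = p"
    using r(3) prec_cut[OF p(1) r(1)] phi_eq[OF p(1) r(1)] p(2) r(2) cut_self[OF simp1[OF p(1)]] by auto
   note t = tail_simple[OF simp1[OF r(1)] c(1)]
   have e: "vertex_sum p (tail r (vlen p)) = r" using t(3) c(2) by simp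
   hence "tail r (vlen p) : T1" using add[OF simp1[OF p(1)] t(1)] r(1) by simp
   thus "u : f ` verts T" unfolding verts using f e r(2) by force
  qed
 qed
 moreover have "ALL q:verts T. ALL q':verts T. (q, q') : prec T \<longleftrightarrow> (f q, f q') : prec T"
  unfolding verts using pr by blast
 moreover have "ALL q:verts T. ALL a:succs T q. ALL b:succs T q. (a, b) : succ_order T q \<longleftrightarrow> (f a, f b) : succ_order T (f q)"
 proof (intro ballI)
  fix u a b assume u: "u : verts T" "a : succs T u" "b : succs T u"
  then obtain q where q: "q : T1" "u = \<phi> q" unfolding verts by blast
  obtain x y where xy: "x : Field Y" "a = \<phi> (push q x)" "y : Field Y" "b = \<phi> (push q y)"
   using u(2,3) unfolding q(2) succs_eq[OF q(1)] by blast
  have "f a = \<phi> (push (vertex_sum p q) x)" "f b = \<phi> (push (vertex_sum p q) y)"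
   using f push1[OF q(1)] xy vertex_sum_push[OF simp1[OF p(1)] simp1[OF q(1)]] by simp_all
  thus "(a, b) : succ_order T u \<longleftrightarrow> (f a, f b) : succ_order T (f u)"
   using succ_order_iff[OF q(1) xy(1,3)] succ_order_iff[OF s1[OF q(1)] xy(1,3)] f[OF q(1)] xy q(2) by simp
 qed
 ultimately show "EX f. bij_betw f (verts T) (tree_above T v) &
    (ALL q:verts T. ALL q':verts T. (q, q') : prec T \<longleftrightarrow> (f q, f q') : prec T) &
    (ALL q:verts T. ALL a:succs T q. ALL b:succs T q.
      (a, b) : succ_order T q \<longleftrightarrow> (f a, f b) : succ_order T (f q))" by blast
qed

text \<open>A well-order above all \<open>o(p)\<close>: choose one vertex of each length.\<close>

lemma height_exists: "EX k :: 'w rel. Well_order k & (ALL p:verts T. order_of T p <o k)"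
proof -
 let ?L = "vlen ` T1"
 define c where "c i = \<phi> (SOME p. p : T1 & vlen p = i)" for i
 define k where "k = {(c i, c j) | i j. i : ?L & j : ?L & i <= j}"
 have some: "(SOME p. p : T1 & vlen p = i) : T1 & vlen (SOME p. p : T1 & vlen p = i) = i" if "i : ?L" for i
 proof -
  have "EX p. p : T1 & vlen p = i" using that by auto
  thus ?thesis by (rule someI_ex)
 qed
 have cinj: "c i = c j \<longleftrightarrow> i = j" if "i : ?L" "j : ?L" for i j
  unfolding c_def phi_eq[OF conjunct1[OF some[OF that(1)]] conjunct1[OF some[OF that(2)]]]
 proof
  assume "(SOME p. p : T1 & vlen p = i) = (SOME p. p : T1 & vlen p = j)"
  thus "i = j" using conjunct2[OF some[OF that(1)]] conjunct2[OF some[OF that(2)]] by (metis (no_types))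
 qed simp
 have kiff: "(c i, c j) : k \<longleftrightarrow> i <= j" if "i : ?L" "j : ?L" for i j
  unfolding k_def using cinj that by auto
 have Fk: "Field k = c ` ?L" unfolding k_def Field_def by auto
 have kk: "k <= Field k \<times> Field k" by (auto intro: FieldI1 FieldI2)
 have W: "Well_order k" by (rule well_order_on_image[OF kk Fk]) (rule kiff)
 have "order_of T v <o k" if vT: "v : verts T" for v
 proof -
  obtain p where p: "p : T1" "v = \<phi> p" using vT unfolding verts by blast
  define g where "g u = c (vlen (inv_into T1 \<phi> u))" for u
  have g: "g (\<phi> (cut p i)) = c i" if "i < vlen p" for i
   unfolding g_def using inv_into_f_f[OF inj sub(2)[OF p(1)]] vlen_cut[OF simp1[OF p(1)]] that by simp
  have iL: "i : ?L" if "i <= vlen p" for i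
   using sub(2)[OF p(1) that] vlen_cut[OF simp1[OF p(1)] that] by (metis imageI)
  have u: "underS k (c (vlen p)) = c ` {..<vlen p}"
  proof (intro equalityI subsetI)
   fix a assume "a : underS k (c (vlen p))"
   hence a: "a ~= c (vlen p)" "(a, c (vlen p)) : k" unfolding underS_def by auto
   then obtain i where i: "i : ?L" "a = c i" using kk Fk by blast
   hence "i <= vlen p" "i ~= vlen p" using a kiff iL by auto
   thus "a : c ` {..<vlen p}" using i by auto
  next
   fix a assume "a : c ` {..<vlen p}"
   then obtain i where i: "i < vlen p" "a = c i" by blast
   hence "(a, c (vlen p)) : k" "a ~= c (vlen p)" using kiff iL cinj by (simp_all add: less_imp_le)
   thus "a : underS k (c (vlen p))" unfolding underS_def by blast
  qed
  have "dir_image (order_of T v) g = Restr k (underS k (c (vlen p)))"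
  proof (intro equalityI subrelI)
   fix a b assume "(a, b) : dir_image (order_of T v) g"
   then obtain x y where xy: "a = g x" "b = g y" "(x, y) : order_of T v" unfolding dir_image_def by blast
   hence "x : preds T v" "y : preds T v" unfolding order_of_def by auto
   then obtain i j where ij: "i < vlen p" "x = \<phi> (cut p i)" "j < vlen p" "y = \<phi> (cut p j)"
    unfolding p(2) preds_eq[OF p(1)] by blast
   hence "i <= j" using order_of_iff[OF p(1)] xy(3) p(2) by blast
   thus "(a, b) : Restr k (underS k (c (vlen p)))" unfolding u using xy(1,2) ij g kiff iL by (simp add: less_imp_le)
  next
   fix a b assume "(a, b) : Restr k (underS k (c (vlen p)))"
   then obtain i j where ij: "i < vlen p" "a = c i" "j < vlen p" "b = c j" "(a, b) : k" unfolding u by blast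
   hence "i <= j" using kiff iL less_imp_le by simp
   hence "(\<phi> (cut p i), \<phi> (cut p j)) : order_of T v" using order_of_iff[OF p(1) ij(1,3)] p(2) by blast
   thus "(a, b) : dir_image (order_of T v) g" unfolding dir_image_def using g[OF ij(1)] g[OF ij(3)] ij(2,4) by force
  qed
  moreover have "inj_on g (Field (order_of T v))" unfolding Field_order_of p(2) preds_eq[OF p(1)]
  proof (rule inj_onI; elim imageE)
   fix x y i j assume "i : {..<vlen p}" "j : {..<vlen p}" "x = \<phi> (cut p i)" "y = \<phi> (cut p j)" "g x = g y"
   thus "x = y" using g cinj iL less_imp_le by auto
  qed
  ultimately have "order_of T v =o Restr k (underS k (c (vlen p)))"
   using dir_image_ordIso[OF WO[OF vT], of g] by simp
  moreover have "c (vlen p) : Field k" unfolding Fk using p(1) by blast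
  ultimately show ?thesis using ordLess_iff_ordIso_Restr[OF W WO[OF vT]] by blast
 qed
 thus ?thesis using W by blast
qed

lemma order_of_one:
 assumes "y : Field Y"
 shows "order_of T (\<phi> (push Map.empty y)) =o natLeq_on 1"
proof -
 note p = one[OF assms]
 have v: "vlen (push Map.empty y) = osuc ozero" using vlen_push[OF simple_empty, of y] by simp
 have L: "{..<osuc ozero} = {ozero}" by (auto simp: less_osuc_iff intro: antisym)
 define g where "g = (\<lambda>_ :: nat. \<phi> (cut (push Map.empty y) ozero))"
 have "order_of T (\<phi> (push Map.empty y)) = dir_image (natLeq_on 1) g"
  unfolding order_of_def preds_eq[OF p] v L dir_image_def g_def by auto
 moreover have "inj_on g (Field (natLeq_on 1))" unfolding inj_on_def Field_natLeq_on by simp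
 hence "natLeq_on 1 =o dir_image (natLeq_on 1) g" by (rule dir_image_ordIso[OF natLeq_on_Well_order])
 ultimately have "natLeq_on 1 =o order_of T (\<phi> (push Map.empty y))" by (simp only:)
 thus ?thesis by (rule ordIso_symmetric)
qed

text \<open>To know anything about \<open>height\<close>, a least bound must exist:
  \<open>height_exists\<close> provides a bound on the vertex type, and well-foundedness of
  \<open><o\<close> a least one.\<close>

lemma bi_ordered: "bi_ordered_tree T" unfolding bi_ordered_tree_def
proof (intro conjI ballI impI semi_normal)
 define U where "U = {k :: 'w rel. Well_order k & (ALL p:verts T. order_of T p <o k)}"
 obtain k0 where k0: "k0 : U" using height_exists unfolding U_def by auto
 obtain h where h': "h : U" "!!k. (k, h) : ordLess ==> k ~: U" using wfE_min[OF wf_ordLess k0] by metis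
 note h = h'[unfolded U_def]
 have "EX h :: 'w rel. Well_order h & (ALL p:verts T. order_of T p <o h) &
   (ALL k :: 'w rel. Well_order k & (ALL p:verts T. order_of T p <o k) --> h <=o k)"
 proof (intro exI[of _ h] conjI allI impI)
  fix k :: "'w rel" assume k: "Well_order k & (ALL p:verts T. order_of T p <o k)"
  hence "~ k <o h" using h(2) by blast
  thus "h <=o k" using ordLess_or_ordLeq[of k h] k h(1) by blast
 qed (use h in auto)
 hence H: "Well_order (height T (verts T)) & (ALL p:verts T. order_of T p <o height T (verts T)) &
   (ALL k :: 'w rel. Well_order k & (ALL p:verts T. order_of T p <o k) --> height T (verts T) <=o k)"
  unfolding height_def by (rule someI_ex)
 obtain y where y: "y : Field Y" using Y(2) by blast
 have "order_of T (\<phi> (push Map.empty y)) <o height T (verts T)"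
  using conjunct1[OF conjunct2[OF H]] one[OF y] verts by (metis (no_types) imageI)
 thus "natLeq_on 1 <o height T (verts T)"
  by (rule ordIso_ordLess_trans[OF ordIso_symmetric[OF order_of_one[OF y]]])
next
 fix v assume "v : verts T"
 then obtain p where "p : T1" "v = \<phi> p" unfolding verts by blast
 thus "linear_order_on (succs T v) (succ_order T v)" using linear_succ_order by simp
qed

end

section \<open>From trees to homogeneous orders\<close>

lemma (in lots) less_iff: "x : Field r ==> y : Field r ==> x <. y \<longleftrightarrow> x ~= y & (x, y) : r"
 using r_le by (auto simp: less_le)

lemma HLOTS_transfer:
 fixes r :: "'a rel" and s :: "'b rel"
 assumes H: "HLOTS r" and Ls: "Linear_order s"
  and g: "siso (\<lambda>a b. a ~= b & (a, b) : r) (\<lambda>a b. a ~= b & (a, b) : s) g (Field r) (Field s)"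
 shows "HLOTS s"
proof -
 have Lr: "Linear_order r" using H unfolding HLOTS_def by blast
 obtain le lt where 1: "lin le lt" "!!x y. x : Field r ==> y : Field r ==> (x, y) : r \<longleftrightarrow> le x y"
  using linear_order_extend[OF Lr] by metis
 obtain le' lt' where 2: "lin le' lt'" "!!x y. x : Field s ==> y : Field s ==> (x, y) : s \<longleftrightarrow> le' x y"
  using linear_order_extend[OF Ls] by metis
 interpret R: lots le lt r using 1 Lr by (simp add: lots_def lots_axioms_def)
 interpret S: lots le' lt' s using 2 Ls by (simp add: lots_def lots_axioms_def)
 have gm: "g x : Field s" if "x : Field r" for x using siso_mem[OF g that] .
 have gs: "EX x:Field r. g x = y" if "y : Field s" for y using siso_surj[OF g that] .
 have gl: "lt' (g x) (g y) \<longleftrightarrow> lt x y" if "x : Field r" "y : Field r" for x y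
  unfolding S.less_iff[OF gm[OF that(1)] gm[OF that(2)]] R.less_iff[OF that] using siso_less[OF g that] .
 have g': "siso lt lt' g (Field r) (Field s)" using g gl unfolding siso_def by blast
 have R1: "Field r ~= {}" and R2: "ALL x:Field r. EX y:Field r. lt x y" and R3: "ALL x:Field r. EX y:Field r. lt y x"
  and R4: "ALL x:Field r. ALL y:Field r. lt x y --> (EX z:Field r. lt x z & lt z y)"
  and R5: "ALL U. R.endless U --> (EX f. siso lt lt f (Field r) U)"
  using H[unfolded R.HLOTS_iff] by (fast, fast, fast, fast, fast)
 show ?thesis unfolding S.HLOTS_iff
 proof (intro conjI ballI allI impI)
  show "Field s ~= {}" using R1 gm by blast
  fix y assume "y : Field s"
  then obtain x where x: "x : Field r" "g x = y" using gs by blast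
  obtain u where u: "u : Field r" "lt x u" using R2 x(1) by blast
  hence "g u : Field s" "lt' y (g u)" using gm gl[OF x(1) u(1)] x(2) by simp_all
  thus "EX z:Field s. lt' y z" by blast
  obtain v where v: "v : Field r" "lt v x" using R3 x(1) by blast
  hence "g v : Field s" "lt' (g v) y" using gm gl[OF v(1) x(1)] x(2) by simp_all
  thus "EX z:Field s. lt' z y" by blast
  fix z assume "z : Field s" and yz: "lt' y z"
  then obtain w where w: "w : Field r" "g w = z" using gs by blast
  hence "lt x w" using yz gl[OF x(1) w(1)] x(2) by simp
  then obtain m where m: "m : Field r" "lt x m" "lt m w" using R4 x(1) w(1) by blast
  hence "g m : Field s" "lt' y (g m)" "lt' (g m) z" using gm gl[OF x(1) m(1)] gl[OF m(1) w(1)] x(2) w(2) by simp_all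
  thus "EX u:Field s. lt' y u & lt' u z" by blast
 next
  fix U assume U: "S.endless U"
  have U1: "U <= Field s" and U2: "U ~= {}" and U3: "ALL x:U. ALL y:U. ALL z:Field s. lt' x z & lt' z y --> z : U"
   and U4: "ALL x:U. EX y:U. lt' x y" and U5: "ALL x:U. EX y:U. lt' y x"
   using U unfolding S.endless_def by (fast, fast, fast, fast, fast)
  define W where "W = {x:Field r. g x : U}"
  have Wg: "EX x:W. g x = y" if "y : U" for y using gs[of y] U1 that unfolding W_def by blast
  have "R.endless W" unfolding R.endless_def
  proof (intro conjI ballI impI; (elim conjE)?)
   show "W <= Field r" unfolding W_def by blast
   show "W ~= {}" using U2 Wg by blast
   fix x assume x: "x : W"
   hence xr: "x : Field r" "g x : U" unfolding W_def by auto
   obtain u where u: "u : U" "lt' (g x) u" using U4 xr(2) by blast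
   obtain u' where u': "u' : W" "g u' = u" using Wg[OF u(1)] by blast
   have "u' : Field r" using u'(1) unfolding W_def by simp
   thus "EX y:W. lt x y" using u' u(2) gl[OF xr(1), of u'] by metis
   obtain v where v: "v : U" "lt' v (g x)" using U5 xr(2) by blast
   obtain v' where v': "v' : W" "g v' = v" using Wg[OF v(1)] by blast
   have "v' : Field r" using v'(1) unfolding W_def by simp
   thus "EX y:W. lt y x" using v' v(2) gl[OF _ xr(1), of v'] by metis
   fix y z assume y: "y : W" and z: "z : Field r" "lt x z" "lt z y"
   have yr: "y : Field r" "g y : U" using y unfolding W_def by auto
   have "lt' (g x) (g z)" "lt' (g z) (g y)" using gl[OF xr(1) z(1)] gl[OF z(1) yr(1)] z(2,3) by simp_all
   hence "g z : U" using U3 xr(2) yr(2) gm[OF z(1)] by blast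
   thus "z : W" unfolding W_def using z(1) by simp
  qed
  then obtain f where f: "siso lt lt f (Field r) W" using R5 by blast
  have W: "W <= Field r" unfolding W_def by blast
  have "siso lt lt' g W (g ` W)" by (rule siso_subset[OF g' W])
  moreover have "g ` W = U" using Wg unfolding W_def by auto
  ultimately have "siso lt' lt' ((g \<circ> f) \<circ> inv_into (Field r) g) (Field s) U"
   using siso_comp[OF siso_inv[OF g'] siso_comp[OF f]] by simp
  thus "EX f. siso lt' lt' f (Field s) U" by blast
 qed
qed

lemma Field_relation_of: "Field (relation_of (<=) (A :: 'a :: linorder set)) = A"
 unfolding relation_of_def Field_def by auto

lemma relation_of_le: "(x, y) : relation_of (<=) (A :: 'a :: linorder set) \<longleftrightarrow> x : A & y : A & x <= y"
 unfolding relation_of_def by auto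

lemma Linear_order_relation_of: "Linear_order (relation_of (<=) (A :: 'a :: linorder set))"
 unfolding order_on_defs Field_relation_of
 by (auto simp: relation_of_le refl_on_def trans_def antisym_def total_on_def)

lemma lin_linorder: "lin (<=) ((<) :: 'a :: linorder => 'a => bool)" by unfold_locales

lemma lots_relation_of: "lots (<=) (<) (relation_of (<=) (A :: 'a :: linorder set))"
proof -
 interpret lin "(<=)" "(<) :: 'a => 'a => bool" by (rule lin_linorder)
 show ?thesis by unfold_locales (auto simp: Linear_order_relation_of[unfolded Field_relation_of] relation_of_le Field_relation_of)
qed

lemma coded_simple:
 assumes Y: "Linear_order Y" "EX a:Field Y. EX b:Field Y. a ~= b"
  and sub: "T1 <= simple_verts Y" "!!p i. p : T1 ==> i <= vlen p ==> cut p i : T1"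
  and emp: "Map.empty : T1"
  and one: "!!y. y : Field Y ==> push Map.empty y : T1"
  and add: "!!p q. p : simple_verts Y ==> q : simple_verts Y ==> vertex_sum p q : T1 \<longleftrightarrow> p : T1 & q : T1"
 shows "coded Y T1 (simple_tree Y\<lparr>verts := T1\<rparr>) (\<lambda>p. p)"
proof
 show "EX a:Field Y. EX b:Field Y. a ~= b" by (rule Y(2))
 show "inj_on (\<lambda>p. p) T1" by simp
 show "verts (simple_tree Y\<lparr>verts := T1\<rparr>) = (\<lambda>p. p) ` T1" by simp
 show "((p, q) : prec (simple_tree Y\<lparr>verts := T1\<rparr>)) \<longleftrightarrow> p \<subseteq>\<^sub>m q & p ~= q" for p q
  by (simp add: simple_tree_def)
 show "(push p a, push p b) : sord (simple_tree Y\<lparr>verts := T1\<rparr>) p \<longleftrightarrow> (a, b) : Y" for p a b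
  by (simp add: simple_tree_def push_last)
qed (fact assms)+

lemma coded_simple_tree:
 assumes Y: "Linear_order Y" "EX a:Field Y. EX b:Field Y. a ~= b"
 shows "coded Y (simple_verts Y) (simple_tree Y) (\<lambda>p. p)"
proof -
 have "simple_tree Y\<lparr>verts := simple_verts Y\<rparr> = simple_tree Y" by (simp add: simple_tree_def)
 moreover have "coded Y (simple_verts Y) (simple_tree Y\<lparr>verts := simple_verts Y\<rparr>) (\<lambda>p. p)"
  by (rule coded_simple[OF Y]) (auto intro: cut_simple push_simple vertex_sum_simple)
 ultimately show ?thesis by simp
qed

lemma order_of_simple_one:
 assumes Y: "Linear_order Y" "EX a:Field Y. EX b:Field Y. a ~= b" and p: "p : simple_verts Y"
 shows "order_of (simple_tree Y) p =o natLeq_on 1 \<longleftrightarrow> (EX y:Field Y. p = push Map.empty y)"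
proof
 interpret coded Y "simple_verts Y" "simple_tree Y" "\<lambda>p. p" by (rule coded_simple_tree[OF Y])
 show "EX y:Field Y. p = push Map.empty y ==> order_of (simple_tree Y) p =o natLeq_on 1" using order_of_one by blast
 assume "order_of (simple_tree Y) p =o natLeq_on 1"
 then obtain f where "iso (order_of (simple_tree Y) p) (natLeq_on 1) f" unfolding ordIso_def by blast
 hence "bij_betw f (cut p ` {..<vlen p}) {0::nat}"
  unfolding iso_def Field_order_of preds_eq[OF p] Field_natLeq_on by (simp add: lessThan_Suc)
 hence fi: "inj_on f (cut p ` {..<vlen p})" and fr: "f ` cut p ` {..<vlen p} = {0}" unfolding bij_betw_def by auto
 have "{..<vlen p} ~= {}" using fr by auto
 hence z: "ozero < vlen p" by (auto intro: le_less_trans[OF ozero_le])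
 have "i = ozero" if i: "i < vlen p" for i
 proof -
  have "f (cut p i) = 0" "f (cut p ozero) = 0" using fr i z by auto
  hence "cut p i = cut p ozero" using inj_onD[OF fi, of "cut p i" "cut p ozero"] i z by simp
  thus ?thesis using vlen_cut[OF p less_imp_le[OF i]] vlen_cut[OF p less_imp_le[OF z]] by simp
 qed
 hence "~ osuc ozero < vlen p" using osuc_not_ozero(1) by metis
 hence "vlen p = osuc ozero" using z osuc_le_iff[of ozero "vlen p"] by simp
 then obtain y where "y : Field Y" "p = push (cut p ozero) y" using push_cases[OF p] by blast
 moreover have "cut p ozero = Map.empty" by (simp add: cut_def)
 ultimately show "EX y:Field Y. p = push Map.empty y" by auto
qed

lemma additive_subtree_iff:
 assumes Y: "Linear_order Y" "EX a:Field Y. EX b:Field Y. a ~= b"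
 shows "subtree (simple_tree Y) T1 & additive Y T1 \<longleftrightarrow>
  T1 <= simple_verts Y & (ALL p:T1. ALL i<=vlen p. cut p i : T1) & Map.empty : T1 &
  (ALL y:Field Y. push Map.empty y : T1) &
  (ALL p:simple_verts Y. ALL q:simple_verts Y. vertex_sum p q : T1 \<longleftrightarrow> p : T1 & q : T1)"
  (is "?L \<longleftrightarrow> ?R")
proof -
 interpret coded Y "simple_verts Y" "simple_tree Y" "\<lambda>p. p" by (rule coded_simple_tree[OF Y])
 have S: "verts (simple_tree Y) = simple_verts Y" by (simp add: simple_tree_def)
 have A: "subtree (simple_tree Y) T1 \<longleftrightarrow> T1 <= simple_verts Y & (ALL p:T1. ALL i<=vlen p. cut p i : T1)"
 proof -
  have "preds (simple_tree Y) p <= T1 \<longleftrightarrow> (ALL i<=vlen p. cut p i : T1)" if p: "p : simple_verts Y" "p : T1" for p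
   unfolding preds_eq[OF p(1)] using cut_self[OF p(1)] p(2) by (auto simp: le_less)
  thus ?thesis unfolding subtree_def S by blast
 qed
 have B: "(ALL p:simple_verts Y. order_of (simple_tree Y) p =o natLeq_on 1 --> p : T1) \<longleftrightarrow>
   (ALL y:Field Y. push Map.empty y : T1)"
  using order_of_simple_one[OF Y] push_simple[OF simple_empty, of _ Y] by auto
 show ?thesis unfolding A additive_def B root_eq by blast
qed

lemma strict_relation_of:
 "(\<lambda>a b. a ~= b & (a, b) : relation_of (<=) (A :: 'a :: linorder set)) = (\<lambda>a b. a : A & b : A & a < b)"
 by (auto simp: relation_of_le fun_eq_iff)

lemma coded_CHLOTS:
 assumes "coded Y T1 T \<phi>" and n: "nice (\<lambda>a b. a ~= b & (a, b) : Y) (Field Y)" and "Omega_bounded T"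
  and "completion_isomorphic (branch_space T) X" and "Linear_order X"
 shows "CHLOTS X"
proof -
 interpret coded Y T1 T \<phi> by fact
 show ?thesis
  by (rule tree_CHLOTS[OF bi_ordered assms(3) rep nice_transfer[OF succ_order_root_siso n] assms(4,5)])
qed

lemma has_additive_tree_CHLOTS:
 assumes Y: "Linear_order Y" and n: "nice (\<lambda>a b. a ~= b & (a, b) : Y) (Field Y)"
  and T: "has_additive_tree Y X" and X: "Linear_order X"
 shows "CHLOTS X"
proof -
 obtain T1 where T1: "subtree (simple_tree Y) T1" "additive Y T1" "Omega_bounded (simple_tree Y\<lparr>verts := T1\<rparr>)"
  "completion_isomorphic (branch_space (simple_tree Y\<lparr>verts := T1\<rparr>)) X"
  using T unfolding has_additive_tree_def by blast
 have Y2: "EX a:Field Y. EX b:Field Y. a ~= b" using niceD(1)[OF n] niceD(2)[OF n] by (metis equals0I)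
 have "T1 <= simple_verts Y & (ALL p:T1. ALL i<=vlen p. cut p i : T1) & Map.empty : T1 &
  (ALL y:Field Y. push Map.empty y : T1) &
  (ALL p:simple_verts Y. ALL q:simple_verts Y. vertex_sum p q : T1 \<longleftrightarrow> p : T1 & q : T1)"
  by (rule iffD1[OF additive_subtree_iff[OF Y Y2] conjI[OF T1(1,2)]])
 hence "coded Y T1 (simple_tree Y\<lparr>verts := T1\<rparr>) (\<lambda>p. p)"
  using coded_simple[OF Y Y2, of T1] by simp
 thus ?thesis by (rule coded_CHLOTS[OF _ n T1(3,4) X])
qed

lemma nice_cong_Field:
 assumes "nice lt A" "!!x y. x : A ==> y : A ==> lt x y \<longleftrightarrow> lt' x y"
 shows "nice lt' A"
 by (rule nice_transfer[OF _ assms(1), of _ "\<lambda>x. x"]) (simp add: siso_def assms(2) bij_betw_def)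

lemma nice_HLOTS:
 assumes "HLOTS r"
 shows "nice (\<lambda>a b. a ~= b & (a, b) : r) (Field r)"
proof -
 have L: "Linear_order r" using assms unfolding HLOTS_def by blast
 obtain le lt where 1: "lin le lt" "!!x y. x : Field r ==> y : Field r ==> (x, y) : r \<longleftrightarrow> le x y"
  using linear_order_extend[OF L] by metis
 interpret lots le lt r using 1 L by (simp add: lots_def lots_axioms_def)
 show ?thesis by (rule nice_cong_Field[OF HLOTS_nice[OF assms]]) (rule less_iff)
qed

lemma nice_int_rel: "nice (\<lambda>a b. a ~= b & (a, b) : relation_of (<=) (UNIV :: int set)) (Field (relation_of (<=) (UNIV :: int set)))"
 unfolding Field_relation_of strict_relation_of using nice_int by simp

section \<open>Indecomposable ordinals\<close>

definition odecomp :: "omega1 => bool" where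
 "odecomp i \<longleftrightarrow> (EX j<i. EX k<i. j \<oplus>\<^sub>o k = i)"

text \<open>For decomposable \<open>i\<close> this is the leading power of omega in the Cantor
  normal form, taken once, and \<open>odiff i (lp i)\<close> is the rest. With a shorter left
  summand the right summand would be all of \<open>i\<close>.\<close>

definition lp :: "omega1 => omega1" where
 "lp i = (LEAST a. EX b<i. a \<oplus>\<^sub>o b = i)"

lemma lp_le: "b < i ==> a \<oplus>\<^sub>o b = i ==> lp i <= a" unfolding lp_def by (rule Least_le) blast

lemma lp:
 assumes "odecomp i"
 shows "lp i < i" "odiff i (lp i) < i" "lp i \<oplus>\<^sub>o odiff i (lp i) = i" "ozero < lp i" "ozero < odiff i (lp i)"
proof -
 obtain j k where jk: "j < i" "k < i" "j \<oplus>\<^sub>o k = i" using assms unfolding odecomp_def by blast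
 have "EX b<i. lp i \<oplus>\<^sub>o b = i" unfolding lp_def by (rule LeastI_ex) (use jk in blast)
 then obtain b where b: "b < i" "lp i \<oplus>\<^sub>o b = i" by blast
 have o: "odiff i (lp i) = b" using odiff_oplus[of "lp i" b] b(2) by simp
 show 1: "lp i < i" using lp_le[OF jk(2,3)] jk(1) by simp
 show "odiff i (lp i) < i" "lp i \<oplus>\<^sub>o odiff i (lp i) = i" using o b by simp_all
 show "ozero < lp i" using b by (auto simp: ozero_less)
 show "ozero < odiff i (lp i)" using o b 1 by (auto simp: ozero_less)
qed

text \<open>A nonzero initial part of the rest keeps the leading term: if \<open>c\<close> absorbed
  \<open>a\<close> from the left, so would \<open>b\<close>, which begins with \<open>c\<close>; a
  shorter leading term of \<open>a + c\<close> would serve \<open>a + b\<close> as well.\<close>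

lemma lp_restrict:
 assumes i: "odecomp (a \<oplus>\<^sub>o b)" "lp (a \<oplus>\<^sub>o b) = a" and c: "ozero < c" "c <= b"
 shows "odecomp (a \<oplus>\<^sub>o c)" "lp (a \<oplus>\<^sub>o c) = a"
proof -
 have bi: "b < a \<oplus>\<^sub>o b" using lp(2)[OF i(1)] i(2) by simp
 obtain b' where b': "b = c \<oplus>\<^sub>o b'" using odiff_ex[OF c(2)] by metis
 have ci: "c < a \<oplus>\<^sub>o c"
 proof (rule ccontr)
  assume "~ c < a \<oplus>\<^sub>o c"
  hence "a \<oplus>\<^sub>o c = c" using le_oplus[of c a] by simp
  hence "a \<oplus>\<^sub>o b = b" using b' oplus_assoc by metis
  thus False using bi by simp
 qed
 moreover have "a < a \<oplus>\<^sub>o c" using oplus_less[of a ozero c] c(1) by simp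
 ultimately show d: "odecomp (a \<oplus>\<^sub>o c)" unfolding odecomp_def by blast
 show "lp (a \<oplus>\<^sub>o c) = a"
 proof (rule ccontr)
  assume "lp (a \<oplus>\<^sub>o c) ~= a"
  hence less: "lp (a \<oplus>\<^sub>o c) < a" using lp_le[OF ci refl] by simp
  let ?a = "lp (a \<oplus>\<^sub>o c)" and ?c = "odiff (a \<oplus>\<^sub>o c) (lp (a \<oplus>\<^sub>o c))"
  obtain d where d': "?a \<oplus>\<^sub>o d = a" using odiff_ex[OF less_imp_le[OF less]] by blast
  have "?a \<oplus>\<^sub>o ?c = ?a \<oplus>\<^sub>o (d \<oplus>\<^sub>o c)" using lp(3)[OF d] d' oplus_assoc by metis
  hence c': "?c = d \<oplus>\<^sub>o c" by (simp add: oplus_cancel)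
  have e: "?a \<oplus>\<^sub>o (d \<oplus>\<^sub>o b) = a \<oplus>\<^sub>o b" using d' oplus_assoc by metis
  have "d \<oplus>\<^sub>o b = a \<oplus>\<^sub>o b"
  proof (rule ccontr)
   assume "d \<oplus>\<^sub>o b ~= a \<oplus>\<^sub>o b"
   moreover have "d \<oplus>\<^sub>o b <= a \<oplus>\<^sub>o b" using le_oplus[of "d \<oplus>\<^sub>o b" ?a] e by simp
   ultimately have "lp (a \<oplus>\<^sub>o b) <= ?a" using lp_le[OF _ e] by simp
   thus False using i(2) less by simp
  qed
  hence "a <= d" using lp_le[OF bi] i(2) by metis
  moreover have "d <= a" using le_oplus[of d ?a] d' by simp
  ultimately have "?c = a \<oplus>\<^sub>o c" using c' by simp
  thus False using lp(2)[OF d] by simp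
 qed
qed

text \<open>The alternative to absorption: an indecomposable \<open>a\<close> that is not swallowed
  by \<open>m\<close> is the leading term of the sum.\<close>

lemma indecomp_lp:
 assumes a: "~ odecomp a" "ozero < a" and m: "ozero < m" "a \<oplus>\<^sub>o m ~= m"
 shows "odecomp (a \<oplus>\<^sub>o m)" "lp (a \<oplus>\<^sub>o m) = a"
proof -
 have mi: "m < a \<oplus>\<^sub>o m" using m(2) le_oplus[of m a] by simp
 moreover have "a < a \<oplus>\<^sub>o m" using oplus_less[of a ozero m] m(1) by simp
 ultimately show d: "odecomp (a \<oplus>\<^sub>o m)" unfolding odecomp_def by blast
 show "lp (a \<oplus>\<^sub>o m) = a"
 proof (rule ccontr)
  assume "lp (a \<oplus>\<^sub>o m) ~= a"
  hence less: "lp (a \<oplus>\<^sub>o m) < a" using lp_le[OF mi refl] by simp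
  let ?a = "lp (a \<oplus>\<^sub>o m)" and ?c = "odiff (a \<oplus>\<^sub>o m) (lp (a \<oplus>\<^sub>o m))"
  obtain d where d': "?a \<oplus>\<^sub>o d = a" using odiff_ex[OF less_imp_le[OF less]] by blast
  have "d <= a" using le_oplus[of d ?a] d' by simp
  hence "d = a" using a(1) d' less unfolding odecomp_def by (metis le_less)
  hence "?a \<oplus>\<^sub>o ?c = ?a \<oplus>\<^sub>o (a \<oplus>\<^sub>o m)" using lp(3)[OF d] d' oplus_assoc by metis
  hence "?c = a \<oplus>\<^sub>o m" by (simp add: oplus_cancel)
  thus False using lp(2)[OF d] by simp
 qed
qed

lemma osuc_eq: "osuc i = i \<oplus>\<^sub>o osuc ozero" by (simp add: oplus_osuc)

lemma not_odecomp_ozero: "~ odecomp ozero" unfolding odecomp_def by simp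

lemma not_odecomp_one: "~ odecomp (osuc ozero)"
proof
 assume "odecomp (osuc ozero)"
 then obtain j k where "j < osuc ozero" "k < osuc ozero" "j \<oplus>\<^sub>o k = osuc ozero" unfolding odecomp_def by blast
 hence "j = ozero" "k = ozero" by (auto simp: less_osuc_iff intro: antisym)
 thus False using \<open>j \<oplus>\<^sub>o k = osuc ozero\<close> by (metis oplus_ozero osuc_not_ozero(1))
qed

lemma indecomp_cases:
 assumes "~ odecomp i"
 obtains "i = ozero" | "i = osuc ozero" | "olimit i"
proof (cases i rule: omega1_cases)
 case (2 j)
 have "j = ozero"
 proof (rule ccontr)
  assume "j ~= ozero"
  hence "osuc ozero < osuc j" by (intro osuc_mono) (simp add: ozero_less)
  hence "odecomp i" unfolding odecomp_def 2 using less_osuc[of j] osuc_eq[of j] by metis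
  thus False using assms by simp
 qed
 thus ?thesis using that 2 by blast
qed (use that in blast)+

lemma le_ozero [simp]: "i <= ozero \<longleftrightarrow> i = ozero" by (auto intro: order_antisym)

lemma omega1_bound3: "k < i ==> k' < i ==> k0 < i ==> EX m<i. k <= m & k' <= m & k0 <= (m :: omega1)"
 by (intro exI[of _ "max k0 (max k k')"]) (auto simp: le_max_iff_disj)

section \<open>Intervals\<close>

context clo
begin

definition cvx :: "'a set => bool" where
 "cvx U \<longleftrightarrow> U <= A & (ALL x:U. ALL y:U. ALL z:A. x <. z & z <. y --> z : U)"

definition endl :: "'a set => bool" where
 "endl U \<longleftrightarrow> cvx U & U ~= {} & (ALL x:U. EX y:U. x <. y) & (ALL x:U. EX y:U. y <. x)"

definition nondeg :: "'a set => bool" where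
 "nondeg U \<longleftrightarrow> (EX u:U. EX v:U. u <. v)"

lemma cvxD: "cvx U ==> x : U ==> y : U ==> z : A ==> x <. z ==> z <. y ==> z : U" unfolding cvx_def by blast

lemma cvx_sub: "cvx U ==> U <= A" unfolding cvx_def by blast

lemma endlD:
 assumes "endl U"
 shows "cvx U" "U <= A" "U ~= {}" "x : U ==> EX y:U. x <. y" "x : U ==> EX y:U. y <. x"
 using assms unfolding endl_def cvx_def by blast+

lemma cvx_A: "cvx A" unfolding cvx_def by blast

lemma endl_A: "endl A" unfolding endl_def using cvx_A ne no_top no_bot by blast

lemma nondeg_endl: "endl U ==> nondeg U" unfolding nondeg_def using endlD(3,4) by (metis ex_in_conv)

lemma chull_sub: "cvx U ==> chull U <= U" unfolding chull_def using cvxD by blast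

lemma endl_chull:
 assumes U: "cvx U" and n: "nondeg U"
 shows "endl (chull U)" unfolding endl_def
proof (intro conjI ballI)
 show "cvx (chull U)" unfolding cvx_def
 proof (intro conjI ballI impI)
  show "chull U <= A" unfolding chull_def by blast
  fix x y z assume x: "x : chull U" and y: "y : chull U" and z: "z : A" "x <. z & z <. y"
  obtain u where u: "u : U" "u <. x" using x unfolding chull_def by blast
  obtain v where v: "v : U" "y <. v" using y unfolding chull_def by blast
  have "u <. z" "z <. v" using u v z less_trans by blast+
  thus "z : chull U" unfolding chull_def using z(1) u(1) v(1) by blast
 qed
 obtain u v where uv: "u : U" "v : U" "u <. v" using n unfolding nondeg_def by blast
 have UA: "!!x. x : U ==> x : A" using cvx_sub[OF U] by blast
 obtain z where "z : A" "u <. z" "z <. v" using dense[OF UA[OF uv(1)] UA[OF uv(2)] uv(3)] by blast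
 hence "z : chull U" unfolding chull_def using uv by blast
 thus "chull U ~= {}" by blast
 fix x assume "x : chull U"
 then obtain u v where x: "x : A" "u : U" "v : U" "u <. x" "x <. v" unfolding chull_def by blast
 obtain z where z: "z : A" "x <. z" "z <. v" using dense[OF x(1) UA[OF x(3)] x(5)] by blast
 have "z : chull U" unfolding chull_def using z x less_trans by blast
 thus "EX y:chull U. x <. y" using z(2) by blast
 obtain w where w: "w : A" "u <. w" "w <. x" using dense[OF UA[OF x(2)] x(1,4)] by blast
 have "w : chull U" unfolding chull_def using w x less_trans by blast
 thus "EX y:chull U. y <. x" using w(3) by blast
qed

lemma siso_cvx:
 assumes f: "siso (<.) (<.) f U V" and U: "cvx U" and V: "cvx V" and W: "W <= U" "cvx W"
 shows "cvx (f ` W)" unfolding cvx_def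
proof (intro conjI ballI impI)
 show "f ` W <= A" using siso_mem[OF f] W(1) cvx_sub[OF V] by blast
 fix x y z assume "x : f ` W" "y : f ` W" and z: "z : A" "x <. z & z <. y"
 then obtain u v where u: "u : W" "x = f u" and v: "v : W" "y = f v" by blast
 have uv: "u : U" "v : U" using u v W(1) by auto
 have "z : V" using cvxD[OF V siso_mem[OF f uv(1)] siso_mem[OF f uv(2)] z(1)] z(2) u v by blast
 then obtain w where w: "w : U" "z = f w" using siso_surj[OF f] by metis
 have "u <. w" "w <. v" using z(2) u(2) v(2) w siso_less[OF f] uv by auto
 hence "w : W" using cvxD[OF W(2) u(1) v(1)] w(1) cvx_sub[OF U] by blast
 thus "z : f ` W" using w(2) by blast
qed

lemma siso_chull:
 assumes f: "siso (<.) (<.) f U V" and U: "cvx U" and V: "cvx V" and W: "W <= U"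
 shows "f ` chull W = chull (f ` W)"
proof (intro equalityI subsetI)
 fix y assume "y : f ` chull W"
 then obtain x u v where x: "y = f x" "x : A" "u : W" "v : W" "u <. x" "x <. v" unfolding chull_def by blast
 have uv: "u : U" "v : U" using x W by auto
 have xU: "x : U" using cvxD[OF U uv x(2,5,6)] .
 have "f u <. y" "y <. f v" using siso_less[OF f] x uv xU by auto
 moreover have "y : A" using siso_mem[OF f xU] x(1) cvx_sub[OF V] by blast
 ultimately show "y : chull (f ` W)" unfolding chull_def using x by blast
next
 fix y assume "y : chull (f ` W)"
 then obtain u v where y: "y : A" "u : W" "v : W" "f u <. y" "y <. f v" unfolding chull_def by blast
 have uv: "u : U" "v : U" using y W by auto
 have "y : V" using cvxD[OF V siso_mem[OF f uv(1)] siso_mem[OF f uv(2)] y(1,4,5)] .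
 then obtain x where x: "x : U" "y = f x" using siso_surj[OF f] by metis
 have "u <. x" "x <. v" using y x siso_less[OF f] uv by auto
 hence "x : chull W" unfolding chull_def using x(1) y cvx_sub[OF U] by blast
 thus "y : f ` chull W" using x(2) by blast
qed

lemma siso_nondeg:
 assumes f: "siso (<.) (<.) f U V" and W: "W <= U"
 shows "nondeg (f ` W) \<longleftrightarrow> nondeg W"
proof -
 have "f x <. f y \<longleftrightarrow> x <. y" if "x : W" "y : W" for x y using siso_less[OF f] that W by blast
 thus ?thesis unfolding nondeg_def by auto
qed

lemma siso_endl:
 assumes f: "siso (<.) (<.) f U V" and U: "cvx U" and V: "cvx V" and W: "W <= U" "endl W"
 shows "endl (f ` W)"
proof -
 have "f x <. f y \<longleftrightarrow> x <. y" if "x : W" "y : W" for x y using siso_less[OF f] that W(1) by blast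
 moreover have "cvx (f ` W)" by (rule siso_cvx[OF f U V W(1) endlD(1)[OF W(2)]])
 ultimately show ?thesis unfolding endl_def using endlD(3-5)[OF W(2)] by auto
qed

lemma endl_Ivl:
 assumes "a : A" "b : A" "a <. b"
 shows "endl (Ivl a b)"
proof -
 have "Ivl a b = chull {x:A. a <=. x & x <=. b}"
  unfolding Ivl_def chull_def using assms by (auto intro: le_less_trans less_le_trans less_imp_le)
 moreover have "cvx {x:A. a <=. x & x <=. b}" unfolding cvx_def by (auto intro: less_imp_le order_trans)
 moreover have "nondeg {x:A. a <=. x & x <=. b}" unfolding nondeg_def using assms by (auto intro: less_imp_le)
 ultimately show ?thesis using endl_chull by simp
qed

end

section \<open>Interval systems\<close>

definition shift :: "(omega1 => 'y) => omega1 => omega1 => 'y" where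
 "shift p a = (\<lambda>k. p (a \<oplus>\<^sub>o k))"

lemma shift_shift: "shift (shift p a) b = shift p (a \<oplus>\<^sub>o b)"
 unfolding shift_def by (simp add: oplus_assoc)

lemma shift_ozero [simp]: "shift p ozero = p" unfolding shift_def by simp

definition agr :: "omega1 => omega1 => (omega1 => 'y) => (omega1 => 'y) => bool" where
 "agr k i p r \<longleftrightarrow> k < i & (ALL x. k <= x --> x < i --> p x = r x)"

lemma agr_mono: "agr k i p r ==> k <= l ==> l < i ==> agr l i p r" unfolding agr_def by (meson order_trans)

lemma agr_trans: "agr k i p q ==> agr k i q r ==> agr k i p r" unfolding agr_def by simp

lemma agr_sym: "agr k i p q ==> agr k i q p" unfolding agr_def by simp

locale isys = clo less_eq less A
 for less_eq :: "'a => 'a => bool" (infix \<open><=.\<close> 50) and less (infix \<open><.\<close> 50) and A +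
 fixes S :: "'y set" and g :: "'y => 'a => 'a" and al be :: "'y => 'a"
 assumes homog: "endl U ==> EX f. siso less less f A U"
  and gI: "s : S ==> siso less less (g s) A (Ivl (al s) (be s))"
  and ab: "s : S ==> al s : A" "s : S ==> be s : A" "s : S ==> al s <. be s"
begin

text \<open>The family \<open>H\<close> of maps is a parameter here and below because
  \<open>h\<close> is obtained by well-founded recursion through \<open>step\<close>. The factor
  \<open>A\<close> gives the empty intersection at length zero its value.\<close>

definition KK :: "(omega1 => (omega1 => 'y) => 'a => 'a) => omega1 => (omega1 => 'y) => 'a set" where
 "KK H i p = A \<inter> (\<Inter>l\<in>{..<i}. H l p ` A)"

definition TT :: "(omega1 => (omega1 => 'y) => 'a => 'a) => omega1 => (omega1 => 'y) => bool" where
 "TT H i p \<longleftrightarrow> (ALL l<i. p l : S) & (ALL j<=i. nondeg (KK H j p))"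

text \<open>The condition on \<open>r\<close> depends on \<open>p\<close> only up to equality from
  some position on, so eventually equal words receive the same representative.\<close>

definition repr :: "(omega1 => (omega1 => 'y) => 'a => 'a) => omega1 => (omega1 => 'y) => omega1 => 'y" where
 "repr H i p = (SOME r. (ALL j<i. TT H j r) & (EX k. agr k i p r))"

definition theta :: "(omega1 => (omega1 => 'y) => 'a => 'a) => omega1 => (omega1 => 'y) => 'a => 'a" where
 "theta H i r = (SOME f. siso (<.) (<.) f A (chull (KK H i r)))"

text \<open>
  At an indecomposable limit \<open>i\<close> the isomorphism onto the interior of the nested intersection is
  chosen for one representative \<open>r\<close> of each class of eventually equal sequences and transported
  from there, so that eventually equal sequences get compatible isomorphisms.
\<close>

definition step :: "(omega1 => (omega1 => 'y) => 'a => 'a) => omega1 => (omega1 => 'y) => 'a => 'a" where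
 "step H i p =
  (if i = ozero then (\<lambda>x. x)
   else if i = osuc ozero then g (p ozero)
   else if odecomp i then H (lp i) p \<circ> H (odiff i (lp i)) (shift p (lp i))
   else if EX k. agr k i p (repr H i p) then
    H (LEAST k. agr k i p (repr H i p)) p \<circ>
    inv_into A (H (LEAST k. agr k i p (repr H i p)) (repr H i p)) \<circ> theta H i (repr H i p)
   else (\<lambda>x. x))"

lemma KK_cong: "(!!j. j < i ==> H j p = H' j p') ==> KK H i p = KK H' i p'" unfolding KK_def by auto

lemma step_cong:
 assumes "!!j. j < i ==> H j = H' j"
 shows "step H i p = step H' i p"
proof -
 have K: "KK H j r = KK H' j r" if "j <= i" for j r by (rule KK_cong) (use assms that in simp)
 have "TT H j r \<longleftrightarrow> TT H' j r" if "j < i" for j r unfolding TT_def using K that by auto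
 hence r: "repr H i p = repr H' i p" unfolding repr_def by meson
 have t: "theta H i r = theta H' i r" for r unfolding theta_def K[OF preorder_class.order_refl] ..
 have k: "H (LEAST k. agr k i p r) = H' (LEAST k. agr k i p r)" if "EX k. agr k i p r" for r
  using LeastI_ex[OF that] assms unfolding agr_def by blast
 have l: "H (lp i) = H' (lp i)" "H (odiff i (lp i)) = H' (odiff i (lp i))" if "odecomp i"
  using assms lp(1,2)[OF that] by simp_all
 show ?thesis unfolding step_def r t using k l by simp
qed

definition h :: "omega1 => (omega1 => 'y) => 'a => 'a" where
 "h = wfrec {(j, i). j < i} step"

lemma h_eq: "h i p = step h i p"
proof -
 have "h i = step (Wfrec.cut h {(j, i). j < i} i) i" by (rule def_wfrec) (simp_all add: h_def wf)
 moreover have "step (Wfrec.cut h {(j, i). j < i} i) i p = step h i p" by (rule step_cong) (simp add: cut_apply)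
 ultimately show ?thesis by simp
qed

abbreviation I where "I i p \<equiv> h i p ` A"
abbreviation K where "K i p \<equiv> KK h i p"
abbreviation T where "T i p \<equiv> TT h i p"

lemma h_ozero [simp]: "h ozero p = (\<lambda>x. x)" unfolding h_eq[of ozero] step_def by simp

lemma h_one: "h (osuc ozero) p = g (p ozero)" unfolding h_eq[of "osuc ozero"] step_def by simp

lemma h_decomp: "odecomp i ==> h i p = h (lp i) p \<circ> h (odiff i (lp i)) (shift p (lp i))"
 using not_odecomp_ozero not_odecomp_one unfolding h_eq[of i] step_def by auto

lemma h_limit:
 assumes i: "olimit i" "~ odecomp i" and p: "ALL j<i. T j p"
 obtains k where "agr k i p (repr h i p)" "ALL j<i. T j (repr h i p)"
  "h i p = h k p \<circ> inv_into A (h k (repr h i p)) \<circ> theta h i (repr h i p)"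
proof -
 have iz: "i ~= ozero" "i ~= osuc ozero" using i(1) unfolding olimit_def by (auto simp: less_osuc_iff)
 \<comment> \<open>The word \<open>p\<close> itself shows that its class contains a word all of
   whose proper prefixes are vertices, so the choice in \<open>repr\<close> is meaningful.\<close>
 have "agr ozero i p p" unfolding agr_def using iz by (simp add: ozero_less)
 hence "(ALL j<i. T j p) & (EX k. agr k i p p)" using p by blast
 hence r: "(ALL j<i. T j (repr h i p)) & (EX k. agr k i p (repr h i p))"
  unfolding repr_def by (rule someI[of "\<lambda>r. (ALL j<i. T j r) & (EX k. agr k i p r)"])
 have a: "agr (LEAST k. agr k i p (repr h i p)) i p (repr h i p)"  by (rule LeastI_ex[OF conjunct2[OF r]])
 show ?thesis by (rule that[OF a]) (use r in simp, use r iz i in \<open>simp add: h_eq[of i p] step_def\<close>)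
qed

lemma repr_cong:
 assumes "agr k i p p'"
 shows "repr H i p = repr H i p'"
proof -
 have "(EX k. agr k i p r) \<longleftrightarrow> (EX k. agr k i p' r)" for r
 proof
  assume "EX k. agr k i p r"
  then obtain l where l: "agr l i p r" by blast
  have m: "max k l < i" using assms l unfolding agr_def by simp
  show "EX k. agr k i p' r" using agr_trans[OF agr_sym[OF agr_mono[OF assms _ m]] agr_mono[OF l _ m]] by auto
 next
  assume "EX k. agr k i p' r"
  then obtain l where l: "agr l i p' r" by blast
  have m: "max k l < i" using assms l unfolding agr_def by simp
  show "EX k. agr k i p r" using agr_trans[OF agr_mono[OF assms _ m] agr_mono[OF l _ m]] by auto
 qed
 thus ?thesis unfolding repr_def by simp
qed

lemma h_cong: "(!!x. x < i ==> p x = p' x) ==> h i p = h i p'"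
proof (induction i arbitrary: p p' rule: less_induct)
 case (less i)
 show ?case
 proof (cases "i = ozero \<or> i = osuc ozero \<or> odecomp i")
  case True
  then consider "i = ozero" | "i = osuc ozero" | "odecomp i" by blast
  thus ?thesis
  proof cases
   case 2
   thus ?thesis using less.prems[of ozero] by (simp add: h_one)
  next
   case 3
   have "h (lp i) p = h (lp i) p'" by (rule less.IH[OF lp(1)[OF 3]]) (use less.prems lp(1)[OF 3] in simp)
   moreover have "h (odiff i (lp i)) (shift p (lp i)) = h (odiff i (lp i)) (shift p' (lp i))"
   proof (rule less.IH[OF lp(2)[OF 3]])
    fix x assume "x < odiff i (lp i)"
    hence "lp i \<oplus>\<^sub>o x < i" using oplus_less[of "lp i" x] lp(3)[OF 3] by metis
    thus "shift p (lp i) x = shift p' (lp i) x" unfolding shift_def by (rule less.prems)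
   qed
   ultimately show ?thesis unfolding h_decomp[OF 3] by simp
  qed simp
 next
  case False
  hence iz: "ozero < i" by (simp add: ozero_less)
  have "agr ozero i p p'" unfolding agr_def using iz less.prems by blast
  hence r: "repr h i p = repr h i p'" by (rule repr_cong)
  have a: "agr k i p r \<longleftrightarrow> agr k i p' r" for k r unfolding agr_def using less.prems by auto
  have "h (LEAST k. agr k i p' r) p = h (LEAST k. agr k i p' r) p'" if "EX k. agr k i p' r" for r
  proof -
   have "(LEAST k. agr k i p' r) < i" using LeastI_ex[OF that] unfolding agr_def by blast
   thus ?thesis by (rule less.IH) (use less.prems \<open>(LEAST k. agr k i p' r) < i\<close> in simp)
  qed
  thus ?thesis unfolding h_eq[of i] step_def r a using False by (simp add: comp_def)
 qed
qed

lemma K_cong: "(!!x. x < i ==> p x = p' x) ==> K i p = K i p'" by (rule KK_cong, rule h_cong) simp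

lemma T_cong:
 assumes "!!x. x < i ==> p x = p' x"
 shows "T i p \<longleftrightarrow> T i p'"
proof -
 have "K j p = K j p'" if "j <= i" for j by (rule K_cong) (use assms that in simp)
 thus ?thesis unfolding TT_def using assms by auto
qed

lemma T_mono: "T i p ==> j <= i ==> T j p" unfolding TT_def by auto

lemma T_S: "T i p ==> l < i ==> p l : S" unfolding TT_def by blast

lemma K_ozero [simp]: "K ozero p = A" unfolding KK_def by simp

lemma T_ozero [simp]: "T ozero p"
proof -
 show ?thesis unfolding TT_def using nondeg_endl[OF endl_A] by simp
qed

lemma T_limit: "olimit i ==> T i p \<longleftrightarrow> (ALL l<i. T l p) & nondeg (K i p)"
proof
 assume i: "olimit i" and "(ALL l<i. T l p) & nondeg (K i p)"
 hence T: "!!l. l < i ==> T l p" and n: "nondeg (K i p)" by auto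
 have "p l : S" if "l < i" for l using T_S[OF T[of "osuc l"], of l] i that unfolding olimit_def by simp
 moreover have "nondeg (K j p)" if "j <= i" for j using that T[of j] n unfolding TT_def by (cases "j = i") auto
 ultimately show "T i p" unfolding TT_def by blast
qed (use T_mono in \<open>auto simp: TT_def\<close>)

text \<open>The last clause is coherence: what \<open>h i p\<close> adds to \<open>h k p\<close>
  depends only on the letters from position \<open>k\<close> on. It is stated through a common point
  \<open>y\<close> instead of an equation between composed inverses. The case \<open>k = i\<close>
  is included trivially, which spares a case distinction later.\<close>

definition good :: "omega1 => bool" where
 "good i \<longleftrightarrow> (ALL p. T i p --> siso (<.) (<.) (h i p) A (I i p) & endl (I i p) & (ALL l<i. I i p <= I l p) &
   (olimit i --> I i p = chull (K i p)) & (ALL j. i = osuc j --> h i p = h j p \<circ> g (p j)) &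
   (ALL p' k. T i p' --> k <= i --> (ALL x. k <= x --> x < i --> p x = p' x) -->
    (ALL x:A. EX y:A. h i p x = h k p y & h i p' x = h k p' y)))"

lemma goodD:
 assumes "good i" "T i p"
 shows "siso (<.) (<.) (h i p) A (I i p)" "endl (I i p)" "l <= i ==> I i p <= I l p"
  "olimit i ==> I i p = chull (K i p)" "i = osuc j ==> h i p = h j p \<circ> g (p j)"
  "T i p' ==> k <= i ==> ALL x. k <= x --> x < i --> p x = p' x ==> x : A ==> EX y:A. h i p x = h k p y & h i p' x = h k p' y"
 using assms unfolding good_def by (blast, blast, metis order_le_less subset_refl, blast, blast, meson)

lemma h_comp:
 assumes "odecomp (a \<oplus>\<^sub>o l)" "lp (a \<oplus>\<^sub>o l) = a"
 shows "h (a \<oplus>\<^sub>o l) p = h a p \<circ> h l (shift p a)" using h_decomp[OF assms(1)] assms(2) by simp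

text \<open>The first \<open>a\<close> positions impose nothing beyond membership in
  \<open>I a p\<close>; from there on multiplicativity turns each interval into an image under
  \<open>h a p\<close>, and injectivity lets the image commute with the intersection.\<close>

lemma K_comp:
 assumes a: "good a" "T a p" and c: "ALL l. ozero < l --> l < j --> h (a \<oplus>\<^sub>o l) p = h a p \<circ> h l (shift p a)"
  and j: "ozero < j" and A: "ALL l<j. I l (shift p a) <= A"
 shows "K (a \<oplus>\<^sub>o j) p = h a p ` K j (shift p a)"
proof -
 note s = goodD(1)[OF a]
 have c': "h (a \<oplus>\<^sub>o l) p x = h a p (h l (shift p a) x)" if "l < j" for l x
  using c that by (cases "l = ozero") (auto simp: ozero_less)
 have aj: "a < a \<oplus>\<^sub>o j" using oplus_less[of a ozero j] j by simp
 show ?thesis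
 proof (intro equalityI subsetI)
  fix x assume x: "x : K (a \<oplus>\<^sub>o j) p"
  hence xI: "x : I l p" if "l < a \<oplus>\<^sub>o j" for l using that unfolding KK_def by blast
  obtain y where y: "y : A" "x = h a p y" using xI[OF aj] by blast
  have "y : I l (shift p a)" if l: "l < j" for l
  proof -
   obtain z where z: "z : A" "x = h (a \<oplus>\<^sub>o l) p z" using xI[of "a \<oplus>\<^sub>o l"] l by (auto simp: oplus_less)
   have "h l (shift p a) z : A" using A l z(1) by blast
   moreover have "h a p y = h a p (h l (shift p a) z)" using y(2) z(2) c'[OF l] by simp
   ultimately have "y = h l (shift p a) z" using siso_eq[OF s y(1)] by blast
   thus ?thesis using z(1) by blast
  qed
  thus "x : h a p ` K j (shift p a)" using y unfolding KK_def by blast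
 next
  fix x assume "x : h a p ` K j (shift p a)"
  then obtain y where y: "y : A" "!!l. l < j ==> y : I l (shift p a)" "x = h a p y" unfolding KK_def by blast
  have xa: "x : I a p" using y by blast
  have "x : I l p" if l: "l < a \<oplus>\<^sub>o j" for l
  proof (cases "l <= a")
   case True
   thus ?thesis using goodD(3)[OF a True] xa by blast
  next
   case False
   then obtain m where m: "l = a \<oplus>\<^sub>o m" using odiff_ex[of a l] by (auto simp: linorder_not_le order_less_imp_le)
   hence mj: "m < j" using l by (simp add: oplus_less)
   obtain z where z: "z : A" "y = h m (shift p a) z" using y(2)[OF mj] by blast
   hence "x = h l p z" using y(3) c'[OF mj] m by simp
   thus ?thesis using z(1) by blast
  qed
  moreover have "x : A" using xa endlD(2)[OF goodD(2)[OF a]] by blast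
  ultimately show "x : K (a \<oplus>\<^sub>o j) p" unfolding KK_def by blast
 qed
qed

lemma T_I_sub: "good i ==> T i p ==> I i p <= A" by (rule endlD(2)[OF goodD(2)])

lemma K_sub: "K i p <= A" unfolding KK_def by blast

lemma T_shift:
 assumes a: "good a" and gd: "ALL l<b. good l" and T: "T (a \<oplus>\<^sub>o b) p"
  and c: "ALL l. ozero < l --> l < b --> h (a \<oplus>\<^sub>o l) p = h a p \<circ> h l (shift p a)"
 shows "T b (shift p a)"
proof -
 have Ta: "T a p" by (rule T_mono[OF T oplus_prop(1)])
 have S: "shift p a l : S" if "l < b" for l unfolding shift_def using T_S[OF T] that by (simp add: oplus_less)
 have "j <= b ==> T j (shift p a)" for j
 proof (induction j rule: less_induct)
  case (less j)
  have "nondeg (K l (shift p a))" if l: "l <= j" for l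
  proof (cases "l < j")
   case True
   thus ?thesis using less l unfolding TT_def by auto
  next
   case False
   hence l: "l = j" using l by simp
   show ?thesis
   proof (cases "j = ozero")
    case True
    thus ?thesis using l nondeg_endl[OF endl_A] by simp
   next
    case False
    have A: "ALL l<j. I l (shift p a) <= A"
    proof (intro allI impI)
     fix l assume lj: "l < j"
     hence "l < b" using less.prems by simp
     hence "good l" using gd by blast
     moreover have "T l (shift p a)" by (rule less.IH[OF lj]) (use \<open>l < b\<close> in simp)
     ultimately show "I l (shift p a) <= A" by (rule T_I_sub)
    qed
    have c': "ALL l. ozero < l --> l < j --> h (a \<oplus>\<^sub>o l) p = h a p \<circ> h l (shift p a)"
     using c less.prems by auto
    have "K (a \<oplus>\<^sub>o j) p = h a p ` K j (shift p a)"
     by (rule K_comp[OF a Ta c' _ A]) (use False in \<open>simp add: ozero_less\<close>)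
    moreover have "nondeg (K (a \<oplus>\<^sub>o j) p)" using T less.prems unfolding TT_def by (simp add: oplus_le)
    ultimately show ?thesis unfolding l using siso_nondeg[OF goodD(1)[OF a Ta] K_sub] by simp
   qed
  qed
  thus ?case unfolding TT_def using S less.prems by auto
 qed
 thus ?thesis by blast
qed

text \<open>Every position between \<open>a\<close> and \<open>i\<close> is some
  \<open>a + l\<close> with the same leading term \<open>a\<close>, by \<open>lp_restrict\<close>.
  So the composition formula holds at all of them, and each clause splits into the clause for
  \<open>a\<close> and the one for \<open>b\<close>.\<close>

lemma good_decomp:
 assumes i: "odecomp i" and IH: "ALL j<i. good j"
 shows "good i"
proof -
 define a where "a = lp i" define b where "b = odiff i (lp i)"
 have ab: "a < i" "b < i" "ozero < a" "ozero < b" "i = a \<oplus>\<^sub>o b" unfolding a_def b_def by (fact lp(1)[OF i] lp(2)[OF i] lp(4)[OF i] lp(5)[OF i] lp(3)[OF i, symmetric])+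
 have ga: "good a" and gb: "good b" and gd: "ALL l<b. good l" using IH ab order_less_trans by blast+
 have c: "h (a \<oplus>\<^sub>o l) p = h a p \<circ> h l (shift p a)" if "ozero < l" "l <= b" for l p
 proof (rule h_comp)
  have 1: "odecomp (a \<oplus>\<^sub>o b)" "lp (a \<oplus>\<^sub>o b) = a" using i by (simp_all only: ab(5)[symmetric] a_def[symmetric])
  show "odecomp (a \<oplus>\<^sub>o l)" "lp (a \<oplus>\<^sub>o l) = a" by (rule lp_restrict[OF 1 that])+
 qed
 have c': "h (a \<oplus>\<^sub>o l) p x = h a p (h l (shift p a) x)" if "l <= b" for l p x
  using c[of l p] that by (cases "l = ozero") (auto simp: ozero_less)
 have Ta: "T a p" and Tb: "T b (shift p a)" if "T i p" for p
 proof -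
  show "T a p" by (rule T_mono[OF that]) (use ab in simp)
  show "T b (shift p a)" by (rule T_shift[OF ga gd]) (use that ab c in \<open>auto simp: order_less_imp_le\<close>)
 qed
 show ?thesis unfolding good_def
 proof (intro allI impI conjI)
  fix p assume T: "T i p"
  note A = goodD[OF ga Ta[OF T]] and B = goodD[OF gb Tb[OF T]]
  have hi: "h i p x = h a p (h b (shift p a) x)" for x using c'[OF preorder_class.order_refl] ab(5) by simp
  have BA: "I b (shift p a) <= A" using endlD(2)[OF B(2)] .
  have Ii: "I i p = h a p ` I b (shift p a)" using hi by (auto simp: image_iff)
  have "siso (<.) (<.) (h a p \<circ> h b (shift p a)) A (h a p ` I b (shift p a))"
   by (rule siso_comp[OF B(1) siso_subset[OF A(1) BA]])
  thus "siso (<.) (<.) (h i p) A (I i p)" unfolding Ii by (rule siso_cong) (simp add: hi)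
  show "endl (I i p)" unfolding Ii by (rule siso_endl[OF A(1) cvx_A endlD(1)[OF A(2)] BA B(2)])
  show "I i p <= I l p" if l: "l < i" for l
  proof (cases "l <= a")
   case True
   have "I i p <= I a p" unfolding Ii using BA by blast
   thus ?thesis using A(3)[OF True] by blast
  next
   case False
   then obtain m where m: "l = a \<oplus>\<^sub>o m" using odiff_ex[of a l] by (auto simp: linorder_not_le order_less_imp_le)
   hence mb: "m <= b" using l ab(5) by (simp add: oplus_less)
   have "I l p = h a p ` I m (shift p a)" unfolding m using c'[OF mb] by (auto simp: image_iff)
   thus ?thesis unfolding Ii using B(3)[OF mb] by blast
  qed
  show "I i p = chull (K i p)" if lim: "olimit i"
  proof -
   have bl: "olimit b"
   proof (cases b rule: omega1_cases)
    case (2 d)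
    hence "i = osuc (a \<oplus>\<^sub>o d)" using ab(5) by (simp add: oplus_osuc)
    thus ?thesis using lim unfolding olimit_def by (metis order_less_irrefl less_osuc)
   qed (use ab(4) in auto)
   have "K (a \<oplus>\<^sub>o b) p = h a p ` K b (shift p a)"
   proof (rule K_comp[OF ga Ta[OF T] _ ab(4)])
    show "ALL l<b. I l (shift p a) <= A" using gd T_I_sub T_mono[OF Tb[OF T]] order_less_imp_le by blast
   qed (use c in \<open>auto simp: order_less_imp_le\<close>)
   thus ?thesis unfolding Ii B(4)[OF bl] using siso_chull[OF A(1) cvx_A endlD(1)[OF A(2)] K_sub] ab(5) by simp
  qed
  show "h i p = h j p \<circ> g (p j)" if j: "i = osuc j" for j
  proof -
   have "a <= j" using ab(1) j by (simp add: less_osuc_iff)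
   then obtain d where d: "j = a \<oplus>\<^sub>o d" using odiff_ex by metis
   hence bd: "b = osuc d" using j ab(5) oplus_cancel[of a b "osuc d"] by (simp add: oplus_osuc)
   have "h i p x = h j p (g (p j) x)" for x
   proof -
    have "h i p x = h a p (h d (shift p a) (g (shift p a d) x))" unfolding hi B(5)[OF bd] by simp
    also have "\<dots> = h j p (g (p j) x)" using c'[of d p] d bd by (simp add: order_less_imp_le shift_def)
    finally show ?thesis .
   qed
   thus ?thesis by auto
  qed
  fix p' k assume T': "T i p'" and k: "k <= i" and ag: "ALL x. k <= x --> x < i --> p x = p' x"
  have hi': "h i p' x = h a p' (h b (shift p' a) x)" for x using c'[OF preorder_class.order_refl] ab(5) by simp
  show "ALL x:A. EX y:A. h i p x = h k p y & h i p' x = h k p' y"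
  proof
   fix x assume x: "x : A"
   show "EX y:A. h i p x = h k p y & h i p' x = h k p' y"
   proof (cases "k <= a")
    case True
    have "h b (shift p a) = h b (shift p' a)"
     by (rule h_cong) (use ag True ab(5) in \<open>auto simp: shift_def oplus_less intro: preorder_class.order_trans[OF True oplus_prop(1)]\<close>)
    hence "h i p x = h a p (h b (shift p a) x)" "h i p' x = h a p' (h b (shift p a) x)" using hi hi' by simp_all
    moreover have "h b (shift p a) x : A" using BA x by blast
    moreover have "ALL x. k <= x --> x < a --> p x = p' x" using ag ab(1) by auto
    ultimately show ?thesis using A(6)[OF Ta[OF T'] True] by metis
   next
    case False
    then obtain m where m: "k = a \<oplus>\<^sub>o m" using odiff_ex[of a k] by (auto simp: linorder_not_le order_less_imp_le)
    hence mb: "m <= b" using k ab(5) by (simp add: oplus_le)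
    have "ALL x. m <= x --> x < b --> shift p a x = shift p' a x"
     unfolding shift_def using ag m ab(5) by (simp add: oplus_le oplus_less)
    then obtain y where "y : A" "h b (shift p a) x = h m (shift p a) y" "h b (shift p' a) x = h m (shift p' a) y"
     using B(6)[OF Tb[OF T'] mb _ x] by blast
    thus ?thesis using hi hi' c'[OF mb] m by metis
   qed
  qed
 qed
qed

text \<open>The transition map from the interval of \<open>r\<close> at level \<open>k\<close> to
  that of \<open>p\<close>. As long as the words agree from \<open>k\<close> on, it carries all
  later intervals of \<open>r\<close> to those of \<open>p\<close>, see
  \<open>phi_h\<close>.\<close>

definition phi :: "omega1 => (omega1 => 'y) => (omega1 => 'y) => 'a => 'a" where
 "phi k p r = h k p \<circ> inv_into A (h k r)"

lemma siso_phi: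
 assumes "good k" "T k p" "T k r"
 shows "siso (<.) (<.) (phi k p r) (I k r) (I k p)"
 unfolding phi_def by (rule siso_comp[OF siso_inv[OF goodD(1)[OF assms(1,3)]] goodD(1)[OF assms(1,2)]])

lemma phi_h:
 assumes k: "good k" "T k r" and l: "good l" "T l p" "T l r" "k <= l" and ag: "ALL x. k <= x --> x < l --> p x = r x"
  and x: "x : A"
 shows "phi k p r (h l r x) = h l p x"
proof -
 obtain y where y: "y : A" "h l p x = h k p y" "h l r x = h k r y" using goodD(6)[OF l(1-3) l(4) ag x] by blast
 have "inv_into A (h k r) (h k r y) = y"
  using goodD(1)[OF k] y(1) unfolding siso_def bij_betw_def by (simp add: inv_into_f_f)
 thus ?thesis unfolding phi_def using y by simp
qed

text \<open>Eventually equal words meet the same fate at a limit: one transition map matches their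
  nested intervals, hence also the intersections.\<close>

lemma K_agree:
 assumes gd: "ALL l<i. good l" and Tp: "ALL l<i. T l p" and Tr: "ALL l<i. T l r" and a: "agr k i p r"
 shows "K i p = phi k p r ` K i r"
proof -
 have ki: "k < i" and ag: "!!l. l < i ==> ALL x. k <= x --> x < l --> p x = r x" using a unfolding agr_def by auto
 have gk: "good k" "T k p" "T k r" using gd Tp Tr ki by auto
 note s = siso_phi[OF gk]
 have ph: "phi k p r (h l r x) = h l p x" if "k <= l" "l < i" "x : A" for l x
  using phi_h[OF gk(1,3) _ _ _ that(1) ag[OF that(2)] that(3)] gd Tp Tr that(2) by blast
 show ?thesis
 proof (intro equalityI subsetI)
  fix y assume "y : K i p"
  hence y: "y : I l p" if "l < i" for l using that unfolding KK_def by blast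
  obtain x where x: "x : I k r" "phi k p r x = y" using siso_surj[OF s y[OF ki]] by blast
  have "x : I l r" if l: "l < i" for l
  proof (cases "l <= k")
   case True
   thus ?thesis using goodD(3)[OF gk(1,3) True] x(1) by blast
  next
   case False
   hence kl: "k <= l" by simp
   have gl: "good l" "T l r" using gd Tr l by auto
   obtain z where z: "z : A" "y = h l p z" using y[OF l] by blast
   have "h l r z : I k r" using goodD(3)[OF gl kl] z(1) by blast
   moreover have "phi k p r (h l r z) = phi k p r x" using ph[OF kl l z(1)] z(2) x(2) by simp
   ultimately have "x = h l r z" using siso_eq[OF s _ x(1)] by metis
   thus ?thesis using z(1) by blast
  qed
  moreover have "x : A" using x(1) T_I_sub[OF gk(1,3)] by blast
  ultimately show "y : phi k p r ` K i r" unfolding KK_def using x(2) by blast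
 next
  fix y assume "y : phi k p r ` K i r"
  then obtain x where x: "!!l. l < i ==> x : I l r" "y = phi k p r x" unfolding KK_def by blast
  have yk: "y : I k p" using siso_mem[OF s x(1)[OF ki]] x(2) by simp
  have "y : I l p" if l: "l < i" for l
  proof (cases "l <= k")
   case True
   thus ?thesis using goodD(3)[OF gk(1,2) True] yk by blast
  next
   case False
   then obtain z where z: "z : A" "x = h l r z" using x(1)[OF l] by blast
   hence "y = h l p z" using ph[of l z] False l x(2) by simp
   thus ?thesis using z(1) by blast
  qed
  moreover have "y : A" using yk T_I_sub[OF gk(1,2)] by blast
  ultimately show "y : K i p" unfolding KK_def by blast
 qed
qed

lemma K_sub_I: "l < i ==> K i p <= I l p" unfolding KK_def by blast

lemma cvx_K:
 assumes "ALL l<i. good l" "ALL l<i. T l p"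
 shows "cvx (K i p)"
proof -
 have c: "cvx (I l p)" if l: "l < i" for l
 proof -
  have "good l" "T l p" using assms l by auto
  thus ?thesis by (rule endlD(1)[OF goodD(2)])
 qed
 show ?thesis unfolding cvx_def
 proof (intro conjI ballI impI K_sub)
  fix x y z assume xy: "x : K i p" "y : K i p" and z: "z : A" "x <. z & z <. y"
  have "z : I l p" if l: "l < i" for l
   by (rule cvxD[OF c[OF l] subsetD[OF K_sub_I[OF l] xy(1)] subsetD[OF K_sub_I[OF l] xy(2)] z(1)
      conjunct1[OF z(2)] conjunct2[OF z(2)]])
  thus "z : K i p" unfolding KK_def using z(1) by blast
 qed
qed

text \<open>The map is a transition from the representative after the isomorphism chosen for it.
  Since a transition maps intersections to intersections, the image is the interior of the
  intersection for the given word.\<close>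

lemma good_limit:
 assumes i: "olimit i" "~ odecomp i" and IH: "ALL j<i. good j"
 shows "good i"
proof -
 have iz: "ozero < i" using i(1) unfolding olimit_def by (simp add: ozero_less)
 have main: "EX k. agr k i p (repr h i p) & (ALL j<i. T j (repr h i p)) &
   siso (<.) (<.) (theta h i (repr h i p)) A (chull (K i (repr h i p))) &
   h i p = phi k p (repr h i p) \<circ> theta h i (repr h i p)" if T: "T i p" for p
 proof -
  have Tp: "ALL j<i. T j p" using T_mono[OF T] order_less_imp_le by blast
  obtain k where k: "agr k i p (repr h i p)" "ALL j<i. T j (repr h i p)"
   "h i p = h k p \<circ> inv_into A (h k (repr h i p)) \<circ> theta h i (repr h i p)"
   by (rule h_limit[OF i Tp])
  let ?r = "repr h i p"
  have ki: "k < i" using k(1) unfolding agr_def by blast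
  have gk: "good k" "T k p" "T k ?r" using IH Tp k(2) ki by auto
  have "nondeg (K i p)" using T unfolding TT_def by blast
  hence "nondeg (K i ?r)"
   unfolding K_agree[OF IH Tp k(2,1)] using siso_nondeg[OF siso_phi[OF gk] K_sub_I[OF ki]] by blast
  hence "endl (chull (K i ?r))" using endl_chull[OF cvx_K[OF IH k(2)]] by blast
  hence "siso (<.) (<.) (theta h i ?r) A (chull (K i ?r))" unfolding theta_def by (rule someI_ex[OF homog])
  thus ?thesis using k unfolding phi_def by blast
 qed
 show ?thesis unfolding good_def
 proof (intro allI impI conjI)
  fix p assume T: "T i p"
  have Tp: "ALL j<i. T j p" using T_mono[OF T] order_less_imp_le by blast
  obtain r where r: "r = repr h i p" by blast
  obtain k where k: "agr k i p r" "ALL j<i. T j r" "siso (<.) (<.) (theta h i r) A (chull (K i r))"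
   "h i p = phi k p r \<circ> theta h i r" using main[OF T] r by blast
  have ki: "k < i" using k(1) unfolding agr_def by blast
  have gk: "good k" "T k p" "T k r" using IH Tp k(2) ki by auto
  note s = siso_phi[OF gk]
  have cr: "cvx (I k r)" and cp: "cvx (I k p)" using endlD(1)[OF goodD(2)] gk by blast+
  have KI: "K i r <= I k r" by (rule K_sub_I[OF ki])
  have CK: "chull (K i r) <= K i r" by (rule chull_sub[OF cvx_K[OF IH k(2)]])
  have im: "phi k p r ` chull (K i r) = chull (K i p)"
   unfolding K_agree[OF IH Tp k(2,1)] by (rule siso_chull[OF s cr cp KI])
  have "siso (<.) (<.) (phi k p r \<circ> theta h i r) A (phi k p r ` chull (K i r))"
   by (rule siso_comp[OF k(3) siso_subset[OF s]]) (use CK KI in blast)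
  hence S: "siso (<.) (<.) (h i p) A (chull (K i p))" unfolding im k(4) .
  hence Ii: "I i p = chull (K i p)" by (rule siso_image)
  show "siso (<.) (<.) (h i p) A (I i p)" unfolding Ii by (rule S)
  show "I i p = chull (K i p)" by (rule Ii)
  have "nondeg (K i p)" using T unfolding TT_def by blast
  thus "endl (I i p)" unfolding Ii by (rule endl_chull[OF cvx_K[OF IH Tp]])
  show "I i p <= I l p" if "l < i" for l
   unfolding Ii using chull_sub[OF cvx_K[OF IH Tp]] K_sub_I[OF that] by blast
  show "h i p = h j p \<circ> g (p j)" if "i = osuc j" for j
   using i(1) that less_osuc[of j] unfolding olimit_def by blast
  fix p' k0 assume T': "T i p'" and k0: "k0 <= i" and ag: "ALL x. k0 <= x --> x < i --> p x = p' x"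
  have Tp': "ALL j<i. T j p'" using T_mono[OF T'] order_less_imp_le by blast
  show "ALL x:A. EX y:A. h i p x = h k0 p y & h i p' x = h k0 p' y"
  proof (cases "k0 = i")
   case True
   thus ?thesis by blast
  next
   case False
   hence k0i: "k0 < i" using k0 by simp
   have r': "r = repr h i p'" unfolding r by (rule repr_cong[of k0]) (use ag k0i in \<open>simp add: agr_def\<close>)
   obtain k' where k': "agr k' i p' r" "h i p' = phi k' p' r \<circ> theta h i r" using main[OF T'] r' by blast
   have k'i: "k' < i" using k'(1) unfolding agr_def by blast
   \<comment> \<open>A level past all three thresholds: there \<open>p\<close> and \<open>p'\<close>
     agree with the representative and with each other. The value of \<open>theta\<close> is written
     through level \<open>M\<close>, and coherence at \<open>M\<close> brings it down to
     \<open>k0\<close>.\<close>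
   obtain M where M: "M < i" "k <= M" "k' <= M" "k0 <= M" using omega1_bound3[OF ki k'i k0i] by blast
   have gM: "good M" "T M p" "T M p'" "T M r" using IH Tp Tp' k(2) M(1) by blast+
   have gk': "good k'" "T k' r" using IH k(2) k'i by blast+
   have agM: "ALL x. k <= x --> x < M --> p x = r x" "ALL x. k' <= x --> x < M --> p' x = r x"
    "ALL x. k0 <= x --> x < M --> p x = p' x"
    using k(1) k'(1) ag order_less_trans[OF _ M(1)] unfolding agr_def by simp_all
   show ?thesis
   proof
    fix x assume x: "x : A"
    have "theta h i r x : I M r" using siso_mem[OF k(3) x] CK K_sub_I[OF M(1)] by blast
    then obtain z where z: "z : A" "theta h i r x = h M r z" by blast
    have "h i p x = h M p z" unfolding k(4) using z phi_h[OF gk(1,3) gM(1,2,4) M(2) agM(1) z(1)] by simp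
    moreover have "h i p' x = h M p' z" unfolding k'(2) using z phi_h[OF gk' gM(1,3,4) M(3) agM(2) z(1)] by simp
    ultimately show "EX y:A. h i p x = h k0 p y & h i p' x = h k0 p' y"
     using goodD(6)[OF gM(1,2,3) M(4) agM(3) z(1)] by simp
   qed
  qed
 qed
qed

lemma good_ozero: "good ozero"
proof -
 have "siso (<.) (<.) (\<lambda>x. x) A A" by (rule siso_id)
 thus ?thesis unfolding good_def using endl_A osuc_not_ozero(1)[symmetric] by (auto simp: olimit_def)
qed

lemma good_one: "good (osuc ozero)" unfolding good_def
proof (intro allI impI conjI)
 let ?o = "osuc ozero"
 fix p assume T: "T ?o p"
 hence s: "p ozero : S" using T_S by simp
 have I1: "I ?o p = Ivl (al (p ozero)) (be (p ozero))" unfolding h_one by (rule siso_image[OF gI[OF s]])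
 show "siso (<.) (<.) (h ?o p) A (I ?o p)" unfolding I1 unfolding h_one by (rule gI[OF s])
 show "endl (I ?o p)" unfolding I1 by (rule endl_Ivl[OF ab[OF s]])
 hence sub: "I ?o p <= A" by (rule endlD)
 show "I ?o p <= I l p" if "l < ?o" for l
 proof -
  have "l = ozero" using that by (simp add: less_osuc_iff)
  thus ?thesis using sub by simp
 qed
 show "I ?o p = chull (K ?o p)" if "olimit ?o" using that less_osuc[of ozero] unfolding olimit_def by blast
 show "h ?o p = h j p \<circ> g (p j)" if "?o = osuc j" for j using that h_one by auto
 fix p' k assume k: "k <= ?o" and ag: "ALL x. k <= x --> x < ?o --> p x = p' x"
 show "ALL x:A. EX y:A. h ?o p x = h k p y & h ?o p' x = h k p' y"
 proof (cases "k = ?o")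
  case False
  hence "k < ?o" using k by simp
  hence "k = ozero" by (simp add: less_osuc_iff)
  moreover from this have "p ozero = p' ozero" using ag by simp
  ultimately show ?thesis using sub by (auto simp: h_one)
 qed blast
qed

lemma good: "good i"
proof (induction i rule: less_induct)
 case (less i)
 hence IH: "ALL j<i. good j" by blast
 show ?case
 proof (cases "odecomp i")
  case True
  thus ?thesis using good_decomp IH by blast
 next
  case False
  thus ?thesis using good_ozero good_one good_limit[OF _ False IH] by (cases i rule: indecomp_cases) auto
 qed
qed

lemmas goods = goodD[OF good]

lemma T_osuc: "T (osuc i) p \<longleftrightarrow> T i p & p i : S"
proof
 assume T: "T i p & p i : S"
 have "K (osuc i) p = I i p"
 proof
  show "K (osuc i) p <= I i p" by (rule K_sub_I) simp
  have "I i p <= I l p" if "l < osuc i" for l using goods(3) T that by (simp add: less_osuc_iff)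
  thus "I i p <= K (osuc i) p" unfolding KK_def using T_I_sub[OF good conjunct1[OF T]] by blast
 qed
 hence n: "nondeg (K (osuc i) p)" using nondeg_endl[OF goods(2)] T by simp
 have "nondeg (K j p)" if "j <= osuc i" for j
 proof (cases "j = osuc i")
  case False
  hence "j < osuc i" using that by simp
  hence "j <= i" by (simp add: less_osuc_iff)
  thus ?thesis using T unfolding TT_def by blast
 qed (use n in simp)
 thus "T (osuc i) p" unfolding TT_def using T less_osuc_iff T_S[of i p] by (metis order_le_less)
next
 assume T: "T (osuc i) p"
 show "T i p & p i : S" using T_mono[OF T, of i] T_S[OF T, of i] by (simp add: order_less_imp_le)
qed

text \<open>Induction on the length of the tail; only the limit step compares intersections. An
  absorbed \<open>a\<close> is handled by coherence, an \<open>a\<close> absorbed by no smaller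
  \<open>m\<close> by multiplicativity, and in both cases an injective monotone map relates the two
  intersections.\<close>

lemma T_add_indecomp:
 assumes a: "~ odecomp a" "ozero < a" and Ta: "T a p"
 shows "T (a \<oplus>\<^sub>o k) p \<longleftrightarrow> T k (shift p a)"
proof (induction k rule: less_induct)
 case (less k)
 show ?case
 proof (cases k rule: omega1_cases)
  case 1
  thus ?thesis using Ta by simp
 next
  case (2 l)
  thus ?thesis using less[of l] by (simp add: oplus_osuc T_osuc shift_def)
 next
  case 3
  have lim: "olimit (a \<oplus>\<^sub>o k)" by (rule olimit_oplus[OF 3])
  have kz: "ozero < k" using 3 unfolding olimit_def by (simp add: ozero_less)
  have ak: "a < a \<oplus>\<^sub>o k" using oplus_less[of a ozero k] kz by simp
  have eq: "(ALL l<a \<oplus>\<^sub>o k. T l p) \<longleftrightarrow> (ALL l<k. T l (shift p a))"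
  proof
   assume L: "ALL l<a \<oplus>\<^sub>o k. T l p"
   show "ALL l<k. T l (shift p a)" using L less by (auto simp: oplus_less)
  next
   assume R: "ALL l<k. T l (shift p a)"
   show "ALL l<a \<oplus>\<^sub>o k. T l p"
   proof (intro allI impI)
    fix l assume l: "l < a \<oplus>\<^sub>o k"
    show "T l p"
    proof (cases "l <= a")
     case True
     thus ?thesis using T_mono[OF Ta] by blast
    next
     case False
     then obtain m where m: "l = a \<oplus>\<^sub>o m" using odiff_ex[of a l] by (auto simp: linorder_not_le order_less_imp_le)
     hence "m < k" using l by (simp add: oplus_less)
     thus ?thesis using R less m by blast
    qed
   qed
  qed
  have n: "nondeg (K (a \<oplus>\<^sub>o k) p) \<longleftrightarrow> nondeg (K k (shift p a))"
   if L: "ALL l<a \<oplus>\<^sub>o k. T l p" and R: "ALL l<k. T l (shift p a)"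
  proof (cases "EX m. ozero < m & m < k & a \<oplus>\<^sub>o m = m")
   case True
   \<comment> \<open>From \<open>m\<close> on, left addition of \<open>a\<close> changes no ordinal.
     So \<open>a + k\<close> is \<open>k\<close>, and the shifted word agrees with the original one
     from \<open>m\<close> on.\<close>
   then obtain m where m: "m < k" "a \<oplus>\<^sub>o m = m" by blast
   obtain d where d: "k = m \<oplus>\<^sub>o d" using odiff_ex[OF order_less_imp_le[OF m(1)]] by metis
   have akk: "a \<oplus>\<^sub>o k = k" unfolding d using m(2) oplus_assoc by metis
   have "agr m k p (shift p a)" unfolding agr_def
   proof (intro conjI allI impI m(1))
    fix x assume "m <= x" "x < k"
    then obtain y where y: "x = m \<oplus>\<^sub>o y" using odiff_ex by metis
    have "a \<oplus>\<^sub>o x = x" unfolding y using m(2) oplus_assoc by metis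
    thus "p x = shift p a x" unfolding shift_def by simp
   qed
   moreover have Lk: "ALL l<k. T l p" using L akk by simp
   ultimately have "K k p = phi m p (shift p a) ` K k (shift p a)" using K_agree[of k] good R by blast
   moreover have "siso (<.) (<.) (phi m p (shift p a)) (I m (shift p a)) (I m p)"
    using siso_phi[OF good] Lk R m(1) by blast
   ultimately show ?thesis using siso_nondeg[OF _ K_sub_I[OF m(1)]] akk by simp
  next
   case False
   have c: "ALL l. ozero < l --> l < k --> h (a \<oplus>\<^sub>o l) p = h a p \<circ> h l (shift p a)"
   proof (intro allI impI)
    fix l assume l: "ozero < l" "l < k"
    hence ne: "a \<oplus>\<^sub>o l ~= l" using False by blast
    show "h (a \<oplus>\<^sub>o l) p = h a p \<circ> h l (shift p a)" by (rule h_comp[OF indecomp_lp[OF a l(1) ne]])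
   qed
   have "K (a \<oplus>\<^sub>o k) p = h a p ` K k (shift p a)"
    by (rule K_comp[OF good Ta c kz]) (use R T_I_sub[OF good] in blast)
   thus ?thesis using siso_nondeg[OF goods(1)[OF Ta] K_sub] by simp
  qed
  show ?thesis unfolding T_limit[OF lim] T_limit[OF 3] using eq n by blast
 qed
qed

text \<open>Leading terms are split off \<open>i\<close> one after the other; associativity and
  composition of shifts reduce everything to an indecomposable first summand.\<close>

theorem T_add: "T (i \<oplus>\<^sub>o k) p \<longleftrightarrow> T i p & T k (shift p i)"
proof (induction i arbitrary: k p rule: less_induct)
 case (less i)
 show ?case
 proof (cases "odecomp i")
  case True
  define a where "a = lp i" define b where "b = odiff i (lp i)"
  have ab: "a < i" "b < i" "i = a \<oplus>\<^sub>o b" unfolding a_def b_def by (fact lp(1)[OF True] lp(2)[OF True] lp(3)[OF True, symmetric])+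
  have "T (i \<oplus>\<^sub>o k) p \<longleftrightarrow> T a p & T (b \<oplus>\<^sub>o k) (shift p a)"
   using less[OF ab(1), of "b \<oplus>\<^sub>o k" p] ab(3) by (simp add: oplus_assoc)
  also have "\<dots> \<longleftrightarrow> T a p & T b (shift p a) & T k (shift p i)"
   using less[OF ab(2), of k "shift p a"] ab(3) by (simp add: shift_shift)
  also have "\<dots> \<longleftrightarrow> T i p & T k (shift p i)" using less[OF ab(1), of b p] ab(3) by simp
  finally show ?thesis .
 next
  case False
  show ?thesis
  proof (cases "i = ozero")
   case True
   thus ?thesis by simp
  next
   case iz: False
   have "T (i \<oplus>\<^sub>o k) p ==> T i p" by (rule T_mono[OF _ oplus_prop(1)])
   thus ?thesis using T_add_indecomp[OF False, of p k] iz by (auto simp: ozero_less)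
  qed
 qed
qed

end

section \<open>The tree of an interval system\<close>

lemma cut_osuc:
 assumes p: "p : simple_verts Y" and l: "l < vlen p"
 shows "cut p (osuc l) = push (cut p l) (the (p l))" "the (p l) : Field Y"
proof -
 obtain y where y: "p l = Some y" using simple_None[OF p, of l] l by (metis not_None_eq)
 show "the (p l) : Field Y" using y simple_ran[OF p] by (auto intro: ranI)
 have v: "vlen (cut p l) = l" by (rule vlen_cut[OF p]) (use l in simp)
 show "cut p (osuc l) = push (cut p l) (the (p l))"
 proof
  fix x
  have e: "push (cut p l) (the (p l)) = (cut p l)(l \<mapsto> the (p l))" unfolding push_def v ..
  show "cut p (osuc l) x = push (cut p l) (the (p l)) x"
   unfolding e using y by (cases "x = l") (auto simp: cut_def restrict_map_def less_osuc_iff order_le_less)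
 qed
qed

text \<open>A chain of words closed under initial segments, as given by a branch or by all vertices
  whose interval contains a fixed nonempty set.\<close>

definition coherent :: "(omega1 \<rightharpoonup> 'y) set => bool" where
 "coherent Q \<longleftrightarrow> (ALL p:Q. ALL i<=vlen p. cut p i : Q) & (ALL p:Q. ALL q:Q. vlen p <= vlen q --> p = cut q (vlen p))"

lemma coherent_limit:
 assumes Q: "coherent Q" "Q <= simple_verts Y"
 obtains f where "!!q l. q : Q ==> l < vlen q ==> q l = Some (f l)"
proof -
 define f where "f l = the ((SOME q. q : Q & l < vlen q) l)" for l
 have "q l = Some (f l)" if q: "q : Q" "l < vlen q" for q l
 proof -
  define r where "r = (SOME q. q : Q & l < vlen q)"
  have "r : Q & l < vlen r" unfolding r_def by (rule someI[of _ q]) (use q in simp)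
  hence r: "r : Q" "l < vlen r" by auto
  have "r l = q l"
  proof (cases "vlen r <= vlen q")
   case True
   hence "r = cut q (vlen r)" using Q(1) r q unfolding coherent_def by blast
   hence "r l = cut q (vlen r) l" by simp
   thus ?thesis using r(2) by (simp add: cut_def)
  next
   case False
   hence "q = cut r (vlen q)" using Q(1) r q unfolding coherent_def by simp
   hence "q l = cut r (vlen q) l" by simp
   thus ?thesis using q(2) by (simp add: cut_def)
  qed
  moreover have "r l ~= None" using simple_None[of r Y l] Q(2) r by auto
  ultimately show ?thesis unfolding f_def r_def[symmetric] by auto
 qed
 thus ?thesis using that by blast
qed

lemma coherent_lengths:
 assumes Q: "coherent Q" "Q <= simple_verts Y" and ne: "vlen ` Q ~= UNIV"
 obtains i where "vlen ` Q = {..<i}"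
proof -
 have down: "j : vlen ` Q" if k: "k : vlen ` Q" and jk: "j <= k" for j k
 proof -
  obtain q where q: "q : Q" "vlen q = k" using k by blast
  have "cut q j : Q" using Q(1) q jk unfolding coherent_def by blast
  moreover have "vlen (cut q j) = j" by (rule vlen_cut[of _ Y]) (use Q(2) q jk in auto)
  ultimately show ?thesis by (metis imageI)
 qed
 define i where "i = (LEAST i. i ~: vlen ` Q)"
 have "EX i. i ~: vlen ` Q" using ne by blast
 hence i: "i ~: vlen ` Q" unfolding i_def by (rule LeastI_ex)
 have "vlen ` Q = {..<i}"
 proof (intro equalityI subsetI)
  fix k assume "k : vlen ` Q"
  thus "k : {..<i}" using down i by (metis lessThan_iff linorder_not_less)
 next
  fix k assume "k : {..<i}"
  thus "k : vlen ` Q" using not_less_Least[of k "\<lambda>i. i ~: vlen ` Q"] unfolding i_def by auto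
 qed
 thus ?thesis using that by blast
qed

context clo
begin

text \<open>The supremum of the lower bounds of the members works: closed intervals are squeezed between them.\<close>

lemma chain_Inter:
 assumes J: "ALL U:\<J>. cvx U & U ~= {}" and ch: "ALL U:\<J>. ALL V:\<J>. U <= V \<or> V <= U"
  and sq: "ALL U:\<J>. EX V:\<J>. EX u:U. EX v:U. ALL x:V. u <. x & x <. v"
 shows "EX a:A. ALL U:\<J>. a : U"
proof (cases "\<J> = {}")
 case True
 thus ?thesis using ne by blast
next
 case False
 then obtain U0 where U0: "U0 : \<J>" by blast
 define L where "L = {u:A. EX U:\<J>. ALL x:U. u <. x}"
 have bd: "u <=. v" if u: "u : L" and V: "V : \<J>" and v: "ALL x:V. x <. v" for u v V
 proof -
  obtain U where U: "U : \<J>" "ALL x:U. u <. x" using u unfolding L_def by blast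
  obtain W where W: "W : \<J>" "W <= U" "W <= V" using ch U(1) V by blast
  obtain z where "z : W" using J W(1) by blast
  hence "u <. z" "z <. v" using U(2) v W by auto
  thus ?thesis using less_trans less_imp_le by blast
 qed
 have mem: "u : A" if "u : U" "U : \<J>" for u U using J that cvx_sub by blast
 obtain V u v where uv: "V : \<J>" "u : U0" "v : U0" "ALL x:V. u <. x & x <. v" using sq U0 by blast
 have uL: "u : L" unfolding L_def using uv mem[OF uv(2) U0] by blast
 have "EX s:A. (ALL x:L. x <=. s) & (ALL v:A. (ALL x:L. x <=. v) --> s <=. v)"
 proof (rule complete)
  show "L <= A" unfolding L_def by blast
  show "L ~= {}" using uL by blast
  show "v : A" by (rule mem[OF uv(3) U0])
  show "x <=. v" if "x : L" for x by (rule bd[OF that uv(1)]) (use uv(4) in blast)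
 qed
 then obtain s where s: "s : A" "ALL x:L. x <=. s" "ALL v:A. (ALL x:L. x <=. v) --> s <=. v" by blast
 have "s : U" if U: "U : \<J>" for U
 proof -
  obtain V u v where V: "V : \<J>" "u : U" "v : U" "ALL x:V. u <. x & x <. v" using sq U by blast
  have "u : L" unfolding L_def using V mem[OF V(2) U] by blast
  hence us: "u <=. s" using s(2) by blast
  have "ALL x:L. x <=. v" using bd[OF _ V(1)] V(4) by blast
  hence sv: "s <=. v" using s(3) mem[OF V(3) U] by blast
  have cU: "cvx U" using J U by blast
  show ?thesis
  proof (cases "u = s \<or> s = v")
   case True
   thus ?thesis using V by blast
  next
   case False
   thus ?thesis using cvxD[OF cU V(2,3) s(1)] us sv by (simp add: less_le)
  qed
 qed
 thus ?thesis using s(1) by blast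
qed

text \<open>The points below some member of an increasing sequence indexed by all countable ordinals
  form an endless convex set, hence a copy of \<open>A\<close> with countable cofinality. But
  countably many indices are bounded, a contradiction.\<close>

lemma no_long_chain:
 assumes homog: "!!U. endl U ==> EX f. siso (<.) (<.) f A U"
  and cof: "ALL n. c n : A" "ALL x:A. EX n::nat. x <. c n"
  and u: "ALL i :: omega1. u i : A" "ALL i j. i < j --> u i <. u j"
 shows False
proof -
 define U where "U = {x:A. EX l. x <. u l}"
 have uU: "u i : U" for i unfolding U_def using u less_osuc[of i] by blast
 have "endl U" unfolding endl_def cvx_def
 proof (intro conjI ballI impI)
  show "U <= A" unfolding U_def by blast
  show "U ~= {}" using uU by blast
  fix x assume "x : U"
  then obtain l where l: "x : A" "x <. u l" unfolding U_def by blast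
  show "EX y:U. x <. y" using uU l(2) by blast
  obtain y where y: "y : A" "y <. x" using no_bot[OF l(1)] by blast
  hence "y : U" unfolding U_def using l(2) less_trans by blast
  thus "EX y:U. y <. x" using y(2) by blast
 next
  fix x y z assume "y : U" and z: "z : A" "x <. z & z <. y"
  then obtain l where "y <. u l" unfolding U_def by blast
  thus "z : U" unfolding U_def using z less_trans by blast
 qed
 then obtain f where f: "siso (<.) (<.) f A U" using homog by blast
 have "ALL n. EX l. f (c n) <. u l" using siso_mem[OF f] cof(1) unfolding U_def by blast
 then obtain l where l: "ALL n. f (c n) <. u (l n)" by metis
 obtain b where b: "ALL i:range l. i < b" using omega1_bound[of "range l"] by auto
 obtain y where y: "y : A" "f y = u b" using siso_surj[OF f uU] by blast
 obtain n where n: "y <. c n" using cof(2) y(1) by blast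
 hence "u b <. f (c n)" using siso_less[OF f y(1), of "c n"] cof(1) y(2) by simp
 moreover have "u (l n) <. u b" using u(2) b by blast
 ultimately show False using l less_trans less_irrefl by blast
qed

end

text \<open>The points \<open>c n\<close> record countable cofinality, which keeps branches
  countable. The condition \<open>sub_or_end\<close> is the source of density: an endless convex set
  that fits into no letter reaches an end point of a letter, and next to such a point there are
  small vertices.\<close>

locale build = isys less_eq less A "Field Y" g al be
 for less_eq :: "'a => 'a => bool" (infix \<open><=.\<close> 50) and less (infix \<open><.\<close> 50) and A
  and Y :: "'y rel" and g :: "'y => 'a => 'a" and al be :: "'y => 'a" +
 fixes c :: "nat => 'a"
 assumes cof: "ALL n. c n : A" "ALL x:A. EX n. less x (c n)"
  and Ylin: "Linear_order Y"
  and sep: "(s, t) : Y ==> s ~= t ==> less_eq (be s) (al t)"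
  and high: "y : A ==> EX s:Field Y. less y (al s)" and low: "y : A ==> EX s:Field Y. less (be s) y"
  and sub_or_end: "endl U ==> (EX s:Field Y. U <= Ivl (al s) (be s)) \<or> (EX s:Field Y. al s : U \<or> be s : U)"
begin

definition sq :: "(omega1 \<rightharpoonup> 'y) => omega1 => 'y" where
 "sq p = (\<lambda>l. the (p l))"

definition VV :: "(omega1 \<rightharpoonup> 'y) set" where
 "VV = {p:simple_verts Y. T (vlen p) (sq p)}"

definition hh :: "(omega1 \<rightharpoonup> 'y) => 'a => 'a" where
 "hh p = h (vlen p) (sq p)"

definition J :: "(omega1 \<rightharpoonup> 'y) => 'a set" where
 "J p = hh p ` A"

lemma VV_simple: "VV <= simple_verts Y" "p : VV ==> p : simple_verts Y" "p : VV ==> T (vlen p) (sq p)"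
 unfolding VV_def by blast+

lemma cut_sq: "l < i ==> sq (cut p i) l = sq p l" unfolding sq_def cut_def by simp

lemma VV_cut:
 assumes p: "p : VV" and i: "i <= vlen p"
 shows "cut p i : VV" "J p <= J (cut p i)"
proof -
 note ps = VV_simple(2,3)[OF p]
 have v: "vlen (cut p i) = i" by (rule vlen_cut[OF ps(1) i])
 have "T i (sq p)" by (rule T_mono[OF ps(2) i])
 hence "T i (sq (cut p i))" using T_cong[of i "sq p" "sq (cut p i)"] cut_sq by metis
 thus "cut p i : VV" unfolding VV_def using cut_simple[OF ps(1) i] v by simp
 have "h i (sq (cut p i)) = h i (sq p)" by (rule h_cong) (rule cut_sq)
 thus "J p <= J (cut p i)" unfolding J_def hh_def v using goods(3)[OF ps(2) i] by simp
qed

lemma hh_siso: "p : VV ==> siso (<.) (<.) (hh p) A (J p)"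
 unfolding hh_def J_def by (rule goods(1)[OF VV_simple(3)])

lemma J_endl: "p : VV ==> endl (J p)" unfolding hh_def J_def by (rule goods(2)[OF VV_simple(3)])

lemma J_sub: "p : VV ==> J p <= A" by (rule endlD(2)[OF J_endl])

lemma VV_empty: "Map.empty : VV" unfolding VV_def by simp

lemma J_empty: "J Map.empty = A" unfolding J_def hh_def by simp

lemma VV_push:
 assumes p: "p : VV" and y: "y : Field Y"
 shows "push p y : VV" "hh (push p y) = hh p \<circ> g y" "J (push p y) = hh p ` Ivl (al y) (be y)"
proof -
 note ps = VV_simple(2,3)[OF p]
 have v: "vlen (push p y) = osuc (vlen p)" by (rule vlen_push[OF ps(1)])
 have e: "sq (push p y) l = sq p l" if "l < vlen p" for l unfolding sq_def push_def using that by auto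
 have l: "sq (push p y) (vlen p) = y" unfolding sq_def push_last by simp
 have Tp: "T (vlen p) (sq (push p y))" using T_cong[of "vlen p" "sq (push p y)" "sq p"] e ps(2) by simp
 hence Tq: "T (osuc (vlen p)) (sq (push p y))" using T_osuc l y by simp
 thus "push p y : VV" unfolding VV_def using push_simple[OF ps(1) y] v by simp
 have "h (osuc (vlen p)) (sq (push p y)) = h (vlen p) (sq (push p y)) \<circ> g y" using goods(5)[OF Tq refl] l by simp
 moreover have "h (vlen p) (sq (push p y)) = h (vlen p) (sq p)" by (rule h_cong) (rule e)
 ultimately show hp: "hh (push p y) = hh p \<circ> g y" unfolding hh_def v by simp
 show "J (push p y) = hh p ` Ivl (al y) (be y)" 
  using siso_image[OF gI[OF y]] unfolding J_def hp image_comp[symmetric] by simp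
qed

lemma VV_sum:
 assumes p: "p : simple_verts Y" and q: "q : simple_verts Y"
 shows "vertex_sum p q : VV \<longleftrightarrow> p : VV & q : VV"
proof -
 have "T (vlen p) (sq (vertex_sum p q)) \<longleftrightarrow> T (vlen p) (sq p)"
  by (rule T_cong) (simp add: sq_def vertex_sum_low)
 moreover have "shift (sq (vertex_sum p q)) (vlen p) = sq q"
  unfolding shift_def sq_def by (simp add: vertex_sum_high)
 ultimately show ?thesis
  unfolding VV_def using vertex_sum_simple[OF p q] p q T_add by (simp add: vlen_vertex_sum[OF p q])
qed

lemma ltY: "s : Field Y ==> t : Field Y ==> s ~= t ==> (s, t) : Y \<or> (t, s) : Y"
 using Ylin unfolding order_on_defs total_on_def by blast

lemma J_push_less:
 assumes r: "r : VV" and st: "(s, t) : Y" "s ~= t" and x: "x : J (push r s)" and y: "y : J (push r t)"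
 shows "x <. y"
proof -
 have S: "s : Field Y" "t : Field Y" using st(1) by (auto intro: FieldI1 FieldI2)
 obtain u where u: "u : Ivl (al s) (be s)" "x = hh r u" using x unfolding VV_push(3)[OF r S(1)] by blast
 obtain v where v: "v : Ivl (al t) (be t)" "y = hh r v" using y unfolding VV_push(3)[OF r S(2)] by blast
 have "u <. be s" "al t <. v" and uv: "u : A" "v : A" using u v unfolding Ivl_def by auto
 hence "u <. v" using sep[OF st] by (metis less_le_trans less_trans le_less_trans)
 thus ?thesis using siso_less[OF hh_siso[OF r] uv] u v by simp
qed

text \<open>At the first difference two words continue a common prefix by different letters, and the
  intervals of different letters are disjoint.\<close>

lemma J_meet:
 assumes p: "p : VV" and q: "q : VV" and x: "x : J p" "x : J q" and l: "vlen p <= vlen q"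
 shows "p = cut q (vlen p)"
proof (rule ccontr)
 assume ne: "p ~= cut q (vlen p)"
 note ps = VV_simple(2)[OF p] and qs = VV_simple(2)[OF q]
 have "EX l. l < vlen p & p l ~= q l"
 proof (rule ccontr)
  assume "~ ?thesis"
  hence "p l = cut q (vlen p) l" for l using simple_None[OF ps, of l] by (auto simp: cut_def restrict_map_def)
  thus False using ne by blast
 qed
 hence "(LEAST l. l < vlen p & p l ~= q l) < vlen p & p (LEAST l. l < vlen p & p l ~= q l) ~= q (LEAST l. l < vlen p & p l ~= q l)"
  by (rule LeastI_ex)
 then obtain m where m: "m < vlen p" "p m ~= q m" and ml: "m = (LEAST l. l < vlen p & p l ~= q l)" by blast
 have lt: "p l = q l" if "l < m" for l
  using not_less_Least[OF that[unfolded ml]] that m(1) order_less_trans by blast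
 have mq: "m < vlen q" using m(1) l by simp
 have c: "cut p m = cut q m" unfolding cut_def restrict_map_def using lt by auto
 have le: "osuc m <= vlen p" "osuc m <= vlen q" using m(1) mq by (simp_all add: osuc_le_iff)
 have V: "cut p m : VV" using VV_cut(1)[OF p] m(1) by simp
 have xp: "x : J (push (cut p m) (the (p m)))" using VV_cut(2)[OF p le(1)] x(1) cut_osuc(1)[OF ps m(1)] by auto
 have xq: "x : J (push (cut p m) (the (q m)))" using VV_cut(2)[OF q le(2)] x(2) cut_osuc(1)[OF qs mq] c by auto
 have "p m ~= None" "q m ~= None" using simple_None[OF ps, of m] simple_None[OF qs, of m] m(1) mq by auto
 hence "the (p m) ~= the (q m)" using m(2) by auto
 hence "(the (p m), the (q m)) : Y \<or> (the (q m), the (p m)) : Y"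
  using ltY cut_osuc(2)[OF ps m(1)] cut_osuc(2)[OF qs mq] by blast
 thus False using J_push_less[OF V _ _ xp xq] J_push_less[OF V _ _ xq xp] \<open>the (p m) ~= the (q m)\<close> less_irrefl by metis
qed

text \<open>Along a word of uncountable length the left end points of the successive letter
  intervals would increase strictly through all countable ordinals.\<close>

lemma coherent_bounded:
 assumes Q: "coherent Q" "Q <= VV"
 shows "vlen ` Q ~= UNIV"
proof
 assume U: "vlen ` Q = UNIV"
 have Qs: "Q <= simple_verts Y" using Q(2) VV_simple(1) by blast
 obtain f where f: "!!q l. q : Q ==> l < vlen q ==> q l = Some (f l)" by (rule coherent_limit[OF Q(1) Qs]) blast
 have Tf: "T l f" for l
 proof -
  obtain q where q: "q : Q" "vlen q = l" using U by (metis UNIV_I imageE)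
  have "T (vlen q) (sq q)" using Q(2) q(1) VV_simple(3) by blast
  thus ?thesis using T_cong[of l "sq q" f] f[OF q(1)] q(2) unfolding sq_def by simp
 qed
 define u where "u l = h l f (al (f l))" for l
 have fS: "f l : Field Y" for l using T_S[OF Tf[of "osuc l"], of l] by simp
 have uI: "u l : I l f" for l unfolding u_def using ab(1)[OF fS] by blast
 have uA: "u l : A" for l using uI endlD(2)[OF goods(2)[OF Tf]] by blast
 have "u i <. u j" if "i < j" for i j
 proof -
  have "u j : I (osuc i) f" using uI[of j] goods(3)[OF Tf, of "osuc i" j] that by (auto simp: osuc_le_iff)
  moreover have "I (osuc i) f = h i f ` Ivl (al (f i)) (be (f i))"
   using siso_image[OF gI[OF fS, of i]] unfolding goods(5)[OF Tf refl, of i] image_comp[symmetric] by simp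
  ultimately obtain z where z: "z : Ivl (al (f i)) (be (f i))" "u j = h i f z" by auto
  hence "z : A" "al (f i) <. z" unfolding Ivl_def by auto
  thus ?thesis unfolding z(2) unfolding u_def using siso_less[OF goods(1)[OF Tf] ab(1)[OF fS]] by blast
 qed
 thus False using no_long_chain[OF homog cof, of u] uA by blast
qed

lemma coherent_cases:
 assumes Q: "coherent Q" "Q <= VV"
 obtains "Q = {}" | q where "q : Q" "!!p. p : Q ==> vlen p <= vlen q" |
  i f where "olimit i" "vlen ` Q = {..<i}" "!!q l. q : Q ==> l < vlen q ==> q l = Some (f l)"
proof -
 have Qs: "Q <= simple_verts Y" using Q(2) VV_simple(1) by blast
 obtain i where i: "vlen ` Q = {..<i}" by (rule coherent_lengths[OF Q(1) Qs coherent_bounded[OF Q]])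
 show ?thesis
 proof (cases i rule: omega1_cases)
  case 1
  thus ?thesis using i that(1) by auto
 next
  case (2 j)
  hence "j : vlen ` Q" using i by simp
  then obtain q where q: "q : Q" "vlen q = j" by blast
  have "vlen p <= vlen q" if "p : Q" for p
  proof -
   have "vlen p : {..<i}" using i that by blast
   thus ?thesis using 2 q(2) by (simp add: less_osuc_iff)
  qed
  thus ?thesis using that(2)[OF q(1)] by blast
 next
  case 3
  obtain f where "!!q l. q : Q ==> l < vlen q ==> q l = Some (f l)" by (rule coherent_limit[OF Q(1) Qs]) blast
  thus ?thesis using that(3)[OF 3 i] by blast
 qed
qed

text \<open>Without a longest word, each interval contains the closed hull of the next one, because
  the ends of a letter interval belong to \<open>A\<close> and are mapped into the interval above;
  \<open>chain_Inter\<close> applies.\<close>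

lemma coherent_Inter:
 assumes Q: "coherent Q" "Q <= VV"
 shows "EX a:A. ALL p:Q. a : J p"
proof -
 have sub: "J q <= J p" if "p : Q" "q : Q" "vlen p <= vlen q" for p q
 proof -
  have "q : VV" "p = cut q (vlen p)" using Q that unfolding coherent_def by blast+
  thus ?thesis using VV_cut(2)[of q "vlen p"] that(3) by simp
 qed
 show ?thesis
 proof (cases rule: coherent_cases[OF Q])
  case 1
  thus ?thesis using ne by blast
 next
  case (2 q)
  have qV: "q : VV" using 2(1) Q(2) by blast
  obtain a where a: "a : J q" using endlD(3)[OF J_endl[OF qV]] by blast
  hence "ALL p:Q. a : J p" using sub[OF _ 2(1) 2(2)] by blast
  thus ?thesis using a J_sub[OF qV] by blast
 next
  case (3 i f)
  have "EX a:A. ALL U:J ` Q. a : U"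
  proof (rule chain_Inter)
   show "ALL U:J ` Q. cvx U & U ~= {}" using endlD(1,3)[OF J_endl] Q(2) by blast
   show "ALL U:J ` Q. ALL V:J ` Q. U <= V \<or> V <= U" 
   proof (intro ballI; elim imageE; hypsubst)
    fix p q assume "p : Q" "q : Q"
    thus "J p <= J q \<or> J q <= J p" using sub[of p q] sub[of q p] linorder_linear[of "vlen p" "vlen q"] by blast
   qed
   show "ALL U:J ` Q. EX V:J ` Q. EX u:U. EX v:U. ALL x:V. u <. x & x <. v"
   proof
    fix U assume "U : J ` Q"
    then obtain q where q: "q : Q" "U = J q" by blast
    have qV: "q : VV" using q(1) Q(2) by blast
    have "vlen q : {..<i}" using q(1) 3(2) by blast
    hence "osuc (vlen q) : vlen ` Q" using 3(1,2) unfolding olimit_def by simp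
    then obtain r where r: "r : Q" "vlen r = osuc (vlen q)" by (metis imageE)
    have rV: "r : VV" using r(1) Q(2) by blast
    have "q = cut r (vlen q)" using Q(1) q(1) r unfolding coherent_def by (simp add: order_less_imp_le)
    moreover obtain s where s: "s : Field Y" "r = push (cut r (vlen q)) s" by (rule push_cases[OF VV_simple(2)[OF rV] r(2)])
    ultimately have "r = push q s" by simp
    hence Jr: "J r = hh q ` Ivl (al s) (be s)" using VV_push(3)[OF qV s(1)] by simp
    note S = hh_siso[OF qV]
    have "hh q (al s) : U" "hh q (be s) : U" unfolding q(2) using siso_mem[OF S] ab[OF s(1)] by auto
    moreover have "ALL x:J r. hh q (al s) <. x & x <. hh q (be s)"
    proof
     fix x assume "x : J r"
     then obtain z where z: "z : A" "al s <. z" "z <. be s" "x = hh q z" unfolding Jr Ivl_def by blast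
     thus "hh q (al s) <. x & x <. hh q (be s)"
      using siso_less[OF S ab(1)[OF s(1)] z(1)] siso_less[OF S z(1) ab(2)[OF s(1)]] by simp
    qed
    ultimately show "EX V:J ` Q. EX u:U. EX v:U. ALL x:V. u <. x & x <. v" using r(1) by blast
   qed
  qed
  thus ?thesis by blast
 qed
qed

text \<open>Take the longest vertex \<open>q\<close> whose interval contains \<open>(a, b)\<close>
  and pull \<open>(a, b)\<close> back along its isomorphism. The result fits into no letter, so it
  contains an end of some letter interval, and a vertex with two more letters fits next to that
  end.\<close>

lemma J_dense:
 assumes ab': "a : A" "b : A" "a <. b"
 shows "EX p:VV. J p <= Ivl a b"
proof -
 define W where "W = Ivl a b"
 have W: "endl W" unfolding W_def by (rule endl_Ivl[OF ab'])
 obtain w where w: "w : W" using endlD(3)[OF W] by blast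
 define Q where "Q = {p:VV. W <= J p}"
 have QV: "Q <= VV" unfolding Q_def by blast
 have Q: "coherent Q" unfolding coherent_def
 proof (intro conjI ballI allI impI)
  fix p i assume "p : Q" "i <= vlen p"
  thus "cut p i : Q" unfolding Q_def using VV_cut[of p i] by blast
 next
  fix p q assume "p : Q" "q : Q" "vlen p <= vlen q"
  thus "p = cut q (vlen p)" unfolding Q_def using J_meet[of p q w] w by blast
 qed
 have top: "EX q:Q. ALL p:Q. vlen p <= vlen q"
 proof (cases rule: coherent_cases[OF Q QV])
  case 1
  have "Map.empty : Q" unfolding Q_def using VV_empty J_empty endlD(2)[OF W] by blast
  thus ?thesis using 1 by blast
 next
  case (2 q)
  thus ?thesis by blast
 next
  case (3 i f)
  have Tf: "T l f" "W <= I l f" if "l < i" for l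
  proof -
   have "l : vlen ` Q" using 3(2) that by simp
   then obtain q where q: "q : Q" "vlen q = l" by blast
   have e: "sq q x = f x" if "x < l" for x using 3(3)[OF q(1)] that q(2) unfolding sq_def by simp
   have "T (vlen q) (sq q)" using QV q(1) VV_simple(3) by blast
   thus "T l f" using T_cong[OF e] q(2) by simp
   have "W <= h (vlen q) (sq q) ` A" using q(1) unfolding Q_def J_def hh_def by blast
   thus "W <= I l f" using h_cong[OF e] q(2) by simp
  qed
  \<comment> \<open>At a limit the intersection contains \<open>W\<close> and is nondegenerate, so
    the limit word is a vertex as well; its interval still contains \<open>W\<close> because
    \<open>W\<close> has no ends. Its length contradicts the assumed set of lengths.\<close>
  have WK: "W <= K i f" unfolding KK_def using Tf(2) endlD(2)[OF W] by blast
  hence "nondeg (K i f)" using nondeg_endl[OF W] unfolding nondeg_def by blast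
  hence Ti: "T i f" using T_limit[OF 3(1)] Tf(1) by blast
  have "chull W <= I i f" unfolding goods(4)[OF Ti 3(1)] by (rule chull_mono[OF WK])
  moreover have "W <= chull W" unfolding chull_def using endlD(2,4,5)[OF W] by blast
  ultimately have WI: "W <= I i f" by blast
  define p where "p = (\<lambda>l. if l < i then Some (f l) else None)"
  have d: "dom p = {..<i}" unfolding p_def dom_def by auto
  have v: "vlen p = i" by (rule vlen_eq[OF d])
  have "ran p <= Field Y" unfolding p_def ran_def using T_S[OF Ti] by auto
  hence ps: "p : simple_verts Y" by (rule simpleI[OF d])
  have e: "sq p x = f x" if "x < i" for x unfolding sq_def p_def using that by simp
  have "p : VV" unfolding VV_def using ps T_cong[OF e] Ti v by simp
  moreover have "W <= J p" unfolding J_def hh_def v using h_cong[OF e] WI by simp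
  ultimately have "p : Q" unfolding Q_def by blast
  hence "i : {..<i}" using 3(2) v by blast
  thus ?thesis by simp
 qed
 then obtain q where q: "q : Q" and mx: "ALL p:Q. vlen p <= vlen q" by blast
 have qV: "q : VV" and WJ: "W <= J q" using q unfolding Q_def by auto
 note S = hh_siso[OF qV]
 define U where "U = inv_into A (hh q) ` W"
 have Ue: "endl U" unfolding U_def by (rule siso_endl[OF siso_inv[OF S] endlD(1)[OF J_endl[OF qV]] cvx_A WJ W])
 have hU: "hh q ` U = W"
 proof -
  have "hh q (inv_into A (hh q) x) = x" if "x : W" for x using that WJ unfolding J_def by (intro f_inv_into_f) blast
  thus ?thesis unfolding U_def by (auto simp: image_iff)
 qed
 have UA: "U <= A" by (rule endlD(2)[OF Ue])
 have no: "~ U <= Ivl (al s) (be s)" if s: "s : Field Y" for s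
 proof
  assume "U <= Ivl (al s) (be s)"
  hence "W <= J (push q s)" unfolding VV_push(3)[OF qV s] hU[symmetric] by blast
  hence "push q s : Q" unfolding Q_def using VV_push(1)[OF qV s] by blast
  hence "vlen (push q s) <= vlen q" using mx by blast
  thus False using vlen_push[OF VV_simple(2)[OF qV], of s] less_osuc[of "vlen q"] linorder_not_less by metis
 qed
 have fin: "EX p:VV. J p <= W" if s: "s : Field Y" and t: "t : Field Y" and sub: "!!z. z : Ivl (al t) (be t) ==> g s z : U" for s t
 proof
  have V: "push q s : VV" by (rule VV_push(1)[OF qV s])
  show "push (push q s) t : VV" by (rule VV_push(1)[OF V t])
  show "J (push (push q s) t) <= W"
   unfolding VV_push(3)[OF V t] VV_push(2)[OF qV s] hU[symmetric] using sub by auto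
 qed
 obtain s where s: "s : Field Y" "al s : U \<or> be s : U" using sub_or_end[OF Ue] no by blast
 note G = gI[OF s(1)]
 have gA: "g s z : A & al s <. g s z & g s z <. be s" if "z : A" for z using siso_mem[OF G that] unfolding Ivl_def by blast
 from s(2) have "EX p:VV. J p <= W"
 proof
  assume al: "al s : U"
  obtain u where u: "u : U" "al s <. u" using endlD(4)[OF Ue al] by blast
  \<comment> \<open>Room to the right of \<open>al s\<close> inside both the set and the letter
    \<open>s\<close>. The point \<open>v\<close> in it is the image of some \<open>y\<close>, and a
    letter \<open>t\<close> lying entirely below \<open>y\<close> is mapped between
    \<open>al s\<close> and \<open>v\<close>.\<close>
  define m where "m = (if u <. be s then u else be s)"
  have m: "m : A" "al s <. m" "m <=. u" "m <=. be s" unfolding m_def using u UA ab[OF s(1)] by (auto simp: not_less)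
  obtain v where v: "v : A" "al s <. v" "v <. m" using dense[OF ab(1)[OF s(1)] m(1,2)] by blast
  hence "v : Ivl (al s) (be s)" unfolding Ivl_def using m(4) less_le_trans by blast
  then obtain y where y: "y : A" "g s y = v" using siso_surj[OF G] by blast
  obtain t where t: "t : Field Y" "be t <. y" using low[OF y(1)] by blast
  show ?thesis
  proof (rule fin[OF s(1) t(1)])
   fix z assume "z : Ivl (al t) (be t)"
   hence z: "z : A" "z <. y" unfolding Ivl_def using t(2) less_trans by auto
   hence "g s z <. v" using siso_less[OF G z(1) y(1)] y(2) by simp
   hence "g s z <. u" using v(3) m(3) less_trans less_le_trans by blast
   thus "g s z : U" using cvxD[OF endlD(1)[OF Ue] al u(1)] gA[OF z(1)] by blast
  qed
 next
  assume be: "be s : U"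
  obtain u where u: "u : U" "u <. be s" using endlD(5)[OF Ue be] by blast
  define m where "m = (if al s <. u then u else al s)"
  have m: "m : A" "m <. be s" "u <=. m" "al s <=. m" unfolding m_def using u UA ab[OF s(1)] by (auto simp: not_less)
  obtain v where v: "v : A" "m <. v" "v <. be s" using dense[OF m(1) ab(2)[OF s(1)] m(2)] by blast
  hence "v : Ivl (al s) (be s)" unfolding Ivl_def using m(4) le_less_trans by blast
  then obtain y where y: "y : A" "g s y = v" using siso_surj[OF G] by blast
  obtain t where t: "t : Field Y" "y <. al t" using high[OF y(1)] by blast
  show ?thesis
  proof (rule fin[OF s(1) t(1)])
   fix z assume "z : Ivl (al t) (be t)"
   hence z: "z : A" "y <. z" unfolding Ivl_def using t(2) less_trans by auto
   hence "v <. g s z" using siso_less[OF G y(1) z(1)] y(2) by simp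
   hence "u <. g s z" using v(2) m(3) less_trans le_less_trans by blast
   thus "g s z : U" using cvxD[OF endlD(1)[OF Ue] u(1) be] gA[OF z(1)] by blast
  qed
 qed
 thus ?thesis unfolding W_def .
qed

lemma VV_additive:
 "VV <= simple_verts Y & (ALL p:VV. ALL i<=vlen p. cut p i : VV) & Map.empty : VV &
  (ALL y:Field Y. push Map.empty y : VV) &
  (ALL p:simple_verts Y. ALL q:simple_verts Y. vertex_sum p q : VV \<longleftrightarrow> p : VV & q : VV)"
 using VV_simple(1) VV_cut(1) VV_empty VV_push(1)[OF VV_empty] VV_sum by blast

text \<open>A branch is sent to a point common to its intervals. Different branches pass through
  intervals of different letters after a common prefix, which makes the map strictly monotone; its
  image is dense because every interval contains the interval of a vertex.\<close>

theorem branches_VV: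
 fixes X :: "'a rel"
 assumes cd: "coded Y VV TR \<phi>" and X: "lots (<=.) (<.) X" "Field X = A"
 shows "Omega_bounded TR" "completion_isomorphic (branch_space TR) X"
proof -
 interpret C: coded Y VV TR \<phi> by fact
 define Q where "Q x = {p:VV. \<phi> p : x}" for x
 have QV: "Q x <= VV" for x unfolding Q_def by blast
 have Qx: "\<phi> ` Q x = x" if x: "x : branches TR" for x
  using C.branch_sub[OF x] unfolding Q_def C.verts by blast
 have cmp: "p = cut q (vlen p)" if x: "x : branches TR" and p: "p : Q x" and q: "q : Q x" and l: "vlen p <= vlen q" for x p q
 proof -
  have V: "p : VV" "q : VV" "\<phi> p : x" "\<phi> q : x" using p q unfolding Q_def by auto
  have "\<phi> p = \<phi> q \<or> (\<phi> p, \<phi> q) : prec TR \<or> (\<phi> q, \<phi> p) : prec TR" using C.branch_total[OF x V(3,4)] .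
  thus ?thesis unfolding C.phi_eq[OF V(1,2)] C.prec_cut[OF V(1,2)] C.prec_cut[OF V(2,1)]
   using l cut_self[OF VV_simple(2)[OF V(2)]] by auto
 qed
 have coh: "coherent (Q x)" if x: "x : branches TR" for x unfolding coherent_def
 proof (intro conjI ballI allI impI)
  fix p i assume p: "p : Q x" and i: "i <= vlen p"
  have pV: "p : VV" "\<phi> p : x" using p unfolding Q_def by auto
  have cV: "cut p i : VV" by (rule VV_cut(1)[OF pV(1) i])
  have v: "vlen (cut p i) = i" by (rule vlen_cut[OF VV_simple(2)[OF pV(1)] i])
  show "cut p i : Q x"
  proof (cases "i = vlen p")
   case True
   thus ?thesis using p cut_self[OF VV_simple(2)[OF pV(1)]] by simp
  next
   case False
   hence "(\<phi> (cut p i), \<phi> p) : prec TR" using C.prec_cut[OF cV pV(1)] v i by simp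
   hence "\<phi> (cut p i) : x" using C.branch_down[OF x pV(2)] cV C.verts by blast
   thus ?thesis unfolding Q_def using cV by blast
  qed
 qed (rule cmp[OF x])
 show "Omega_bounded TR" unfolding C.Omega_bounded_iff
 proof
  fix x assume x: "x : branches TR"
  obtain i where i: "vlen ` Q x = {..<i}"
   using coherent_lengths[OF coh[OF x] _ coherent_bounded[OF coh[OF x] QV]] QV VV_simple(1) by blast
  have "inj_on vlen (Q x)"
  proof (rule inj_onI)
   fix p q assume pq: "p : Q x" "q : Q x" "vlen p = vlen q"
   hence "p = cut q (vlen q)" using cmp[OF x pq(1,2)] by simp
   thus "p = q" using cut_self[of q Y] VV_simple(2) QV pq(2) by auto
  qed
  hence "countable (Q x)" using countable_image_inj_on[of vlen "Q x"] i countable_lessThan_omega1 by simp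
  hence "countable (\<phi> ` Q x)" by simp
  thus "countable x" using Qx[OF x] by simp
 qed
 define e where "e x = (SOME a. a : A & (ALL p:Q x. a : J p))" for x
 have e: "e x : A & (ALL p:Q x. e x : J p)" if "x : branches TR" for x
  unfolding e_def by (rule someI_ex) (use coherent_Inter[OF coh[OF that] QV] in blast)
 have eA: "e x : A" and eJ: "!!p. p : VV ==> \<phi> p : x ==> e x : J p" if "x : branches TR" for x
  using e[OF that] unfolding Q_def by auto
 have less: "e x <. e y" if x: "x : branches TR" and y: "y : branches TR" and l: "branch_less TR x y" for x y
 proof -
  obtain v a b where v: "v : x \<inter> y" "a : x" "b : y" "C.imm v a" "C.imm v b" "a ~= b" "(a, b) : sord TR v"
   using l unfolding C.branch_less_iff[OF x] by blast
  obtain r where r: "r : VV" "v = \<phi> r" using v(1) C.branch_sub[OF x] unfolding C.verts by blast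
  obtain s where s: "s : Field Y" "a = \<phi> (push r s)" using v(4) C.imm_iff[OF r(1)] r(2) by auto
  obtain t where t: "t : Field Y" "b = \<phi> (push r t)" using v(5) C.imm_iff[OF r(1)] r(2) by auto
  have "(s, t) : Y" using C.sord[OF r(1) s(1) t(1)] v(7) r(2) s(2) t(2) by simp
  moreover have "s ~= t" using v(6) s t by blast
  ultimately show ?thesis
   by (rule J_push_less[OF r(1) _ _ eJ[OF x VV_push(1)[OF r(1) s(1)]] eJ[OF y VV_push(1)[OF r(1) t(1)]]])
    (use v s t in simp_all)
 qed
 have tot: "branch_less TR x y \<or> branch_less TR y x" if x: "x : branches TR" and y: "y : branches TR" and ne: "x ~= y" for x y
 proof -
  have ex: "EX p. p : Q x & p ~: Q y & (ALL l<vlen p. cut p l : Q y)"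
   if x: "x : branches TR" and y: "y : branches TR" and ne: "x ~= y" for x y
  proof -
   have "~ x <= y" using C.branch_incomparable[OF x y] ne by blast
   then obtain q where q: "q : Q x" "q ~: Q y" using Qx[OF x] Qx[OF y] by blast
   define i where "i = (LEAST i. EX p. p : Q x & p ~: Q y & vlen p = i)"
   have "EX i p. p : Q x & p ~: Q y & vlen p = i" using q by blast
   hence "EX p. p : Q x & p ~: Q y & vlen p = i" unfolding i_def by (rule LeastI_ex)
   then obtain p where p: "p : Q x" "p ~: Q y" "vlen p = i" by blast
   have "cut p l : Q y" if l: "l < vlen p" for l
   proof (rule ccontr)
    assume n: "cut p l ~: Q y"
    have "cut p l : Q x" using coh[OF x] p(1) l unfolding coherent_def by (simp add: order_less_imp_le)
    moreover have "vlen (cut p l) = l" by (rule vlen_cut[of _ Y]) (use p(1) QV VV_simple(2) l in auto)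
    ultimately have "i <= l" unfolding i_def using n by (intro Least_le) blast
    thus False using l p(3) by simp
   qed
   thus ?thesis using p by blast
  qed
  \<comment> \<open>The shortest vertices at which each branch leaves the other. Were their lengths
    different, the shorter would be a prefix of the longer and lie on both branches.\<close>
  obtain p where p: "p : Q x" "p ~: Q y" "ALL l<vlen p. cut p l : Q y" using ex[OF x y ne] by blast
  obtain q where q: "q : Q y" "q ~: Q x" "ALL l<vlen q. cut q l : Q x" using ex[OF y x] ne by blast
  have pV: "p : VV" "\<phi> p : x" and qV: "q : VV" "\<phi> q : y" using p(1) q(1) unfolding Q_def by auto
  note ps = VV_simple(2)[OF pV(1)] and qs = VV_simple(2)[OF qV(1)]
  have ve: "vlen p = vlen q"
  proof (rule ccontr)
   assume "vlen p ~= vlen q"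
   then consider "vlen p < vlen q" | "vlen q < vlen p" by (metis linorder_neqE)
   thus False
   proof cases
    case 1
    hence c: "cut q (vlen p) : Q x" using q(3) by blast
    have v: "vlen (cut q (vlen p)) = vlen p" by (rule vlen_cut[OF qs]) (use 1 in simp)
    have "p = cut (cut q (vlen p)) (vlen p)" using cmp[OF x p(1) c] v by simp
    hence "p = cut q (vlen p)" using cut_cut[of "vlen p" "vlen p" q] by simp
    thus False using p(2) coh[OF y] q(1) 1 unfolding coherent_def by (metis order_less_imp_le)
   next
    case 2
    hence c: "cut p (vlen q) : Q y" using p(3) by blast
    have v: "vlen (cut p (vlen q)) = vlen q" by (rule vlen_cut[OF ps]) (use 2 in simp)
    have "q = cut (cut p (vlen q)) (vlen q)" using cmp[OF y q(1) c] v by simp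
    hence "q = cut p (vlen q)" using cut_cut[of "vlen q" "vlen q" p] by simp
    thus False using q(2) coh[OF x] p(1) 2 unfolding coherent_def by (metis order_less_imp_le)
   qed
  qed
  have cc: "cut p l = cut q l" if l: "l < vlen p" for l
  proof -
   have 1: "cut p l : Q y" using p(3) l by blast
   have 2: "cut q l : Q y" using coh[OF y] q(1) l ve unfolding coherent_def by (simp add: order_less_imp_le)
   have 3: "vlen (cut p l) = l" by (rule vlen_cut[OF ps]) (use l in simp)
   have 4: "vlen (cut q l) = l" by (rule vlen_cut[OF qs]) (use l ve in simp)
   show ?thesis using cmp[OF y 1 2] 3 4 cut_cut[of l l q] by simp
  qed
  have pq: "p ~= q" using p q by blast
  show ?thesis
  proof (cases "vlen p" rule: omega1_cases)
   case 1
   hence "p = Map.empty" "q = Map.empty" using vlen_zero[OF ps] vlen_zero[OF qs] ve by auto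
   thus ?thesis using pq by simp
  next
   case (2 j)
   define r where "r = cut p j"
   have j: "j < vlen p" using 2 by simp
   have r: "r : VV" "r = cut q j" unfolding r_def using VV_cut(1)[OF pV(1), of j] cc[OF j] order_less_imp_le[OF j] by auto
   obtain s where s: "s : Field Y" "p = push r s" using push_cases[OF ps 2] r_def by metis
   have "vlen q = osuc j" using 2 ve by simp
   then obtain t where t: "t : Field Y" "q = push r t" using push_cases[OF qs] r(2) by metis
   have st: "s ~= t" using pq s t by blast
   have rx: "\<phi> r : x" using coh[OF x] p(1) j unfolding coherent_def r_def Q_def by (simp add: order_less_imp_le)
   have ry: "\<phi> r : y" using p(3) j unfolding r_def Q_def by blast
   have im: "C.imm (\<phi> r) (\<phi> p)" "C.imm (\<phi> r) (\<phi> q)" using C.imm_iff[OF r(1)] s t by auto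
   have ne': "\<phi> p ~= \<phi> q" using C.phi_eq[OF pV(1) qV(1)] pq by simp
   have "(s, t) : Y \<or> (t, s) : Y" using ltY[OF s(1) t(1) st] .
   hence "(\<phi> p, \<phi> q) : sord TR (\<phi> r) \<or> (\<phi> q, \<phi> p) : sord TR (\<phi> r)"
    using C.sord[OF r(1) s(1) t(1)] C.sord[OF r(1) t(1) s(1)] s(2) t(2) by simp
   thus ?thesis
    unfolding C.branch_less_iff[OF x] C.branch_less_iff[OF y] using rx ry im ne' pV(2) qV(2) by (metis IntI)
  next
   case 3
   \<comment> \<open>A word of limit length is determined by its proper prefixes, which are common
     to both branches; so the first difference occurs at a successor length.\<close>
   have "p l = q l" for l
   proof (cases "l < vlen p")
    case True
    hence "osuc l < vlen p" using 3 unfolding olimit_def by blast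
    hence "cut p (osuc l) l = cut q (osuc l) l" using cc by simp
    thus ?thesis by (simp add: cut_def)
   next
    case False
    thus ?thesis using simple_None[OF ps, of l] simple_None[OF qs, of l] ve by simp
   qed
   thus ?thesis using pq by blast
  qed
 qed
 have elt: "branch_less TR x y \<longleftrightarrow> e x <. e y" if "x : branches TR" "y : branches TR" "x ~= y" for x y
  using less[OF that(1,2)] less[OF that(2,1)] tot[OF that] less_trans less_irrefl by blast
 show "completion_isomorphic (branch_space TR) X"
 proof (rule completion_isomorphicI[OF X(1), where e = e])
  show "clo (<=.) (<.) (Field X)" unfolding X(2) by (rule clo_axioms)
  show "e ` Field (branch_space TR) <= Field X" unfolding C.Field_branch_space X(2) using eA by blast
  show "refl_on (Field (branch_space TR)) (branch_space TR)"
   unfolding refl_on_def C.Field_branch_space by (simp add: C.branch_space_iff)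
  fix x y assume "x : Field (branch_space TR)" "y : Field (branch_space TR)" and ne: "x ~= y"
  hence xy: "x : branches TR" "y : branches TR" unfolding C.Field_branch_space by auto
  show "e x ~= e y" using tot[OF xy ne] less[OF xy] less[OF xy(2,1)] less_irrefl by metis
  show "(x, y) : branch_space TR \<longleftrightarrow> e x <. e y" unfolding C.branch_space_iff using elt[OF xy ne] xy ne by blast
 next
  fix a b assume ab': "a : Field X" "b : Field X" "a <. b"
  then obtain p where p: "p : VV" "J p <= Ivl a b" using J_dense unfolding X(2) by blast
  obtain x where x: "x : branches TR" "{\<phi> p} <= x"
   by (rule C.branch_extends[of "{\<phi> p}"]) (use p(1) C.verts in auto)
  have "e x : Ivl a b" using eJ[OF x(1) p(1)] x(2) p(2) by blast
  thus "EX y:Field (branch_space TR). a <. e y & e y <. b"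
   unfolding C.Field_branch_space Ivl_def using x(1) by blast
 qed
qed

end

section \<open>Iterated interval maps\<close>

text \<open>The newest map acts innermost: \<open>iter f d n\<close> is \<open>f (d 0)\<close> after
  \<open>f (d 1)\<close> and so on up to \<open>f (d (n - 1))\<close>. Thus the images of
  \<open>A\<close> shrink as \<open>n\<close> grows.\<close>

primrec iter :: "('i => 'x => 'x) => (nat => 'i) => nat => 'x => 'x" where
 "iter f d 0 x = x"
| "iter f d (Suc n) x = iter f d n (f (d n) x)"

lemma iter_Suc: "iter f d (Suc n) x = f (d 0) (iter f (\<lambda>k. d (Suc k)) n x)"
 by (induction n arbitrary: x) simp_all

lemma iter_cong: "(!!k. k < n ==> d k = d' k) ==> iter f d n x = iter f d' n x"
 by (induction n arbitrary: x) simp_all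

lemma iter_chain:
 assumes b: "ALL k. b k = f (d k) (b (Suc k))"
 shows "b 0 = iter f d n (b n)"
proof (induction n)
 case (Suc n)
 have "iter f d n (b n) = iter f d (Suc n) (b (Suc n))"
  unfolding iter.simps using arg_cong[OF b[rule_format, of n], of "iter f d n"] .
 thus ?case using Suc by (rule trans[rotated])
qed simp

context clo
begin

lemma Ivl_image:
 assumes f: "siso (<.) (<.) f A (Ivl l r)" and x: "x : A" and y: "y : A"
 shows "f ` Ivl x y = Ivl (f x) (f y)"
proof (intro equalityI subsetI)
 fix w assume "w : f ` Ivl x y"
 then obtain v where v: "v : A" "x <. v" "v <. y" "w = f v" unfolding Ivl_def by blast
 have "w : A" using siso_mem[OF f v(1)] v(4) unfolding Ivl_def by blast
 thus "w : Ivl (f x) (f y)" unfolding Ivl_def using siso_less[OF f x v(1)] siso_less[OF f v(1) y] v by simp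
next
 fix w assume w: "w : Ivl (f x) (f y)"
 have "f x : Ivl l r" "f y : Ivl l r" using siso_mem[OF f] x y by auto
 hence "w : Ivl l r" using w less_trans unfolding Ivl_def by blast
 then obtain v where v: "v : A" "f v = w" using siso_surj[OF f] by blast
 hence "x <. v" "v <. y" using w siso_less[OF f x v(1)] siso_less[OF f v(1) y] unfolding Ivl_def by auto
 thus "w : f ` Ivl x y" unfolding Ivl_def using v by blast
qed

lemma Up_image:
 assumes f: "siso (<.) (<.) f A (Ivl l r)" and x: "x : A"
 shows "f ` Up x = Ivl (f x) r"
proof (intro equalityI subsetI)
 fix w assume "w : f ` Up x"
 then obtain v where v: "v : A" "x <. v" "w = f v" unfolding Up_def by blast
 have "w : A" "w <. r" using siso_mem[OF f v(1)] v(3) unfolding Ivl_def by auto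
 thus "w : Ivl (f x) r" unfolding Ivl_def using siso_less[OF f x v(1)] v by simp
next
 fix w assume w: "w : Ivl (f x) r"
 have "f x : Ivl l r" using siso_mem[OF f] x by auto
 hence "w : Ivl l r" using w less_trans unfolding Ivl_def by blast
 then obtain v where v: "v : A" "f v = w" using siso_surj[OF f] by blast
 hence "x <. v" using w siso_less[OF f x v(1)] unfolding Ivl_def by auto
 thus "w : f ` Up x" unfolding Up_def using v by blast
qed

lemma iter_siso:
 assumes f: "ALL z. siso (<.) (<.) (f z) A (Ivl (l z) (r z))" and lr: "ALL z. l z : A & r z : A & l z <. r z"
 shows "x : A ==> iter f d n x : A"
  "x : A ==> y : A ==> iter f d n x <. iter f d n y \<longleftrightarrow> x <. y"
  "x : A ==> y : A ==> iter f d n ` Ivl x y = Ivl (iter f d n x) (iter f d n y)"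
  "siso (<.) (<.) (iter f d n) A (iter f d n ` A)" "endl (iter f d n ` A)"
proof -
 have fA: "f z x : A" if "x : A" for z x using siso_mem[OF f[rule_format] that] unfolding Ivl_def by blast
 show 1: "x : A ==> iter f d n x : A" for x n by (induction n arbitrary: x) (simp_all add: fA)
 show 2: "x : A ==> y : A ==> iter f d n x <. iter f d n y \<longleftrightarrow> x <. y" for x y n
  by (induction n arbitrary: x y) (simp_all add: fA siso_less[OF f[rule_format]])
 show 3: "x : A ==> y : A ==> iter f d n ` Ivl x y = Ivl (iter f d n x) (iter f d n y)" for x y n
 proof (induction n arbitrary: x y)
  case (Suc n)
  have "iter f d (Suc n) ` Ivl x y = iter f d n ` (f (d n) ` Ivl x y)" by (simp add: image_image)
  thus ?case using Suc fA Ivl_image[OF f[rule_format] Suc.prems] by simp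
 qed simp
 have "bij_betw (iter f d n) A (iter f d n ` A)" unfolding bij_betw_def
 proof
  show "inj_on (iter f d n) A"
  proof (rule inj_onI)
   fix x y assume "x : A" "y : A" "iter f d n x = iter f d n y"
   thus "x = y" using 2[of x y n] 2[of y x n] by (metis less_irrefl neqE)
  qed
 qed simp
 thus "siso (<.) (<.) (iter f d n) A (iter f d n ` A)" unfolding siso_def using 2 by simp
 show "endl (iter f d n ` A)"
 proof (cases n)
  case (Suc m)
  have "iter f d n ` A = iter f d m ` (f (d m) ` A)" unfolding Suc by (simp add: image_image)
  also have "\<dots> = Ivl (iter f d m (l (d m))) (iter f d m (r (d m)))"
   using siso_image[OF f[rule_format]] 3 lr by simp
  finally have "iter f d n ` A = Ivl (iter f d m (l (d m))) (iter f d m (r (d m)))" .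
  moreover have "iter f d m (l (d m)) : A" "iter f d m (r (d m)) : A" using 1 lr by blast+
  moreover have "iter f d m (l (d m)) <. iter f d m (r (d m))" using 2 lr by blast
  ultimately show ?thesis using endl_Ivl by simp
 qed (simp add: endl_A)
qed

text \<open>
  A point \<open>b\<close> with \<open>Up b\<close> not similar to \<open>A\<close> lies in the image of some \<open>f z\<close>, and its preimage is
  again such a point. This produces a sequence \<open>d\<close> of indices, and the right end points of the nested
  images decrease to \<open>b\<close>, which makes \<open>Up b\<close> similar to \<open>A\<close> after all.
\<close>

lemma contracting_Up:
 assumes co: "coin C"
  and f: "ALL z. siso (<.) (<.) (f z) A (Ivl (l z) (r z))"
  and lr: "ALL z. l z : A & r z : A & l z <. r z" and rC: "ALL z. r z ~: C"
  and col: "ALL z. ALL x:A. f z x : C \<longleftrightarrow> x : C"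
  and nxt: "ALL z. EX w. r z = l w"
  and part: "ALL a:A. (EX z. a = l z) \<or> (EX z. a : Ivl (l z) (r z))"
  and contr: "ALL d b. (ALL n. b n : A & b n = f (d n) (b (Suc n))) -->
   (ALL x:A. b 0 <. x --> (EX n. iter f d n (r (d n)) <. x))"
  and a: "a : A"
 shows "sim C A (Up a)"
proof (rule ccontr)
 assume bad: "~ sim C A (Up a)"
 have sI: "sim C A (Ivl (l z) (r z))" for z unfolding sim_def using f col by blast
 have Ul: "sim C A (Up (l z))" for z by (rule sim_Up[OF sI]) (use lr in auto)
 have step: "EX z b'. b' : A & ~ sim C A (Up b') & b = f z b'" if b: "b : A" "~ sim C A (Up b)" for b
 proof -
  have "b ~= l z" for z using Ul b(2) by metis
  then obtain z where z: "b : Ivl (l z) (r z)" using part b(1) by blast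
  obtain b' where b': "b' : A" "f z b' = b" using siso_surj[OF f[rule_format] z] by blast
  have "~ sim C A (Up b')"
  proof
   assume "sim C A (Up b')"
   moreover have "sim C (Up b') (Ivl b (r z))" unfolding sim_def
   proof (intro exI[of _ "f z"] conjI ballI)
    have UA: "Up b' <= A" unfolding Up_def by blast
    show "siso (<.) (<.) (f z) (Up b') (Ivl b (r z))"
     using siso_subset[OF f[rule_format] UA] Up_image[OF f[rule_format] b'(1)] b'(2) by metis
    show "f z x : C \<longleftrightarrow> x : C" if "x : Up b'" for x using col UA that by blast
   qed
   ultimately have "sim C A (Ivl b (r z))" by (rule sim_trans)
   hence "sim C A (Up b)" by (rule sim_Up) (use b(1) lr z in \<open>auto simp: Ivl_def\<close>)
   thus False using b(2) by simp
  qed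
  thus ?thesis using b' by blast
 qed
 \<comment> \<open>The clause for \<open>n = 0\<close> makes the sequence of bad points start at
   \<open>a\<close> itself.\<close>
 define P where "P n b \<longleftrightarrow> b : A & ~ sim C A (Up b) & (n = 0 --> b = a)" for n :: nat and b
 have "EX b. ALL n. P n (b n) & (EX z. b n = f z (b (Suc n)))"
 proof (rule dependent_nat_choice)
  show "EX x. P 0 x" unfolding P_def using a bad by blast
  show "EX y. P (Suc n) y & (EX z. x = f z y)" if "P n x" for x n using step[of x] that unfolding P_def by auto
 qed
 then obtain b where b: "ALL n. P n (b n)" "ALL n. EX z. b n = f z (b (Suc n))" by blast
 then obtain d where d: "ALL n. b n = f (d n) (b (Suc n))" by metis
 have bA: "b n : A" for n using b(1) unfolding P_def by blast
 have b0: "b 0 = a" using b(1) unfolding P_def by blast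
 have bi: "b 0 = iter f d n (b n)" for n by (rule iter_chain[of b f d, OF d])
 define R where "R n = iter f d n (r (d n))" for n
 note I = iter_siso[OF f lr]
 have ci: "iter f d n x : C \<longleftrightarrow> x : C" if "x : A" for n x using that
 proof (induction n arbitrary: x)
  case (Suc n)
  have "f (d n) x : A" using siso_mem[OF f[rule_format] Suc.prems] unfolding Ivl_def by blast
  thus ?case using Suc col by simp
 qed simp
 have fr: "f (d n) x : A" "l (d n) <. f (d n) x" "f (d n) x <. r (d n)" if "x : A" for n x
  using siso_mem[OF f[rule_format] that] unfolding Ivl_def by auto
 have br: "b n <. r (d n)" for n
  using fr(3)[OF bA[of "Suc n"], of n] unfolding d[rule_format, of n, symmetric] .
 have "sim C A (Ivl a (R 0))"
 proof (rule sim_decseq[OF co])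
  fix n
  show "R (Suc n) <. R n" unfolding R_def using I(2) fr(1,3) lr by simp
  show "R n : A" unfolding R_def using I(1) lr by simp
  have "b n <. r (d n)" using br .
  hence "iter f d n (b n) <. R n" unfolding R_def using I(2)[OF bA] lr by blast
  thus "a <. R n" using bi[of n] b0 by metis
  show "R n ~: C" unfolding R_def using ci lr rC by simp
  \<comment> \<open>The iterate maps \<open>Up ?w\<close> onto the gap between consecutive right
    ends. By \<open>nxt\<close> the point \<open>?w\<close> is also a left end, and above left ends
    similarity is already known.\<close>
  let ?w = "r (d (Suc n))"
  have w: "?w : A" using lr by blast
  obtain w' where "?w = l w'" using nxt by blast
  hence "sim C A (Up ?w)" using Ul by simp
  moreover have "sim C (Up ?w) (Ivl (R (Suc n)) (R n))" unfolding sim_def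
  proof (intro exI[of _ "iter f d (Suc n)"] conjI ballI)
   have UA: "Up ?w <= A" unfolding Up_def by blast
   have "iter f d (Suc n) ` Up ?w = iter f d n ` (f (d n) ` Up ?w)" by (simp add: image_image)
   also have "\<dots> = Ivl (R (Suc n)) (R n)"
    unfolding Up_image[OF f[rule_format] w] R_def using I(3) fr(1)[OF w] lr by simp
   finally have "iter f d (Suc n) ` Up ?w = Ivl (R (Suc n)) (R n)" .
   thus "siso (<.) (<.) (iter f d (Suc n)) (Up ?w) (Ivl (R (Suc n)) (R n))"
    using siso_subset[OF I(4) UA] by metis
   show "iter f d (Suc n) x : C \<longleftrightarrow> x : C" if "x : Up ?w" for x
    by (rule ci) (use UA that in blast)
  qed
  ultimately show "sim C A (Ivl (R (Suc n)) (R n))" by (rule sim_trans)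
 next
  fix x assume "x : A" "a <. x"
  thus "EX n. R n <. x" unfolding R_def using contr[rule_format, of b d x] bA d b0 by blast
 qed
 hence "sim C A (Up a)"
 proof (rule sim_Up)
  show "a : A" by (rule a)
  show "R 0 : A" unfolding R_def using lr by simp
  show "a <. R 0" unfolding R_def b0[symmetric] using br[of 0] by simp
 qed
 thus False using bad by simp
qed

lemma dense_below:
 assumes "a : A" "b : A" "c : A" "a <. b" "a <. c"
 shows "EX x:A. a <. x & x <. b & x <. c"
proof (cases "b <=. c")
 case True
 thus ?thesis using dense[OF assms(1,2,4)] less_le_trans by blast
next
 case False
 hence "c <=. b" using linear by blast
 thus ?thesis using dense[OF assms(1,3,5)] less_le_trans by blast
qed

lemma dense_above:
 assumes "a : A" "b : A" "c : A" "b <. a" "c <. a"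
 shows "EX x:A. x <. a & b <. x & c <. x"
proof (cases "b <=. c")
 case True
 thus ?thesis using dense[OF assms(3,1,5)] le_less_trans by blast
next
 case False
 hence "c <=. b" using linear by blast
 thus ?thesis using dense[OF assms(2,1,4)] le_less_trans by blast
qed

lemma Ivl_sub:
 assumes "Ivl a b <= Ivl p q" "a : A" "b : A" "a <. b" "p : A" "q : A"
 shows "p <=. a" "b <=. q"
proof -
 show "p <=. a"
 proof (rule ccontr)
  assume "~ p <=. a"
  hence "a <. p" by (simp add: not_le)
  then obtain x where x: "x : A" "a <. x" "x <. p" "x <. b" using dense_below[of a p b] assms by blast
  hence "x : Ivl p q" using assms(1) unfolding Ivl_def by blast
  thus False using x(3) less_trans less_irrefl unfolding Ivl_def by blast
 qed
 show "b <=. q"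
 proof (rule ccontr)
  assume "~ b <=. q"
  hence "q <. b" by (simp add: not_le)
  then obtain x where x: "x : A" "x <. b" "q <. x" "a <. x" using dense_above[of b q a] assms by blast
  hence "x : Ivl p q" using assms(1) unfolding Ivl_def by blast
  thus False using x(3) less_trans less_irrefl unfolding Ivl_def by blast
 qed
qed

lemma Ivl_less:
 assumes "a : A" "b : A" "a <. b" "p : A" "q : A" "p <. q"
  and l: "!!x y. x : Ivl a b ==> y : Ivl p q ==> x <. y"
 shows "b <=. p"
proof (rule ccontr)
 assume "~ b <=. p"
 hence "p <. b" by (simp add: not_le)
 then obtain x where x: "x : A" "x <. b" "p <. x" "a <. x" using dense_above[of b p a] assms by blast
 obtain y where y: "y : A" "p <. y" "y <. x" "y <. q" using dense_below[of p x q] x assms by blast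
 have "x <. y" by (rule l) (use x y in \<open>simp_all add: Ivl_def\<close>)
 thus False using y(3) less_trans less_irrefl by blast
qed

lemma endl_bounded:
 assumes U: "endl U" "U <= Ivl p q" and pq: "p : A" "q : A"
 shows "EX a b. a : A & b : A & a <. b & U = Ivl a b"
proof -
 have bd: "!!x. x : U ==> p <=. x" "!!x. x : U ==> x <=. q" using U(2) unfolding Ivl_def by (auto intro: less_imp_le)
 note E = endlD[OF U(1)]
 obtain b where b: "b : A" "ALL x:U. x <=. b" "ALL v:A. (ALL x:U. x <=. v) --> b <=. v"
  using complete[OF E(2,3) pq(2) bd(2)] by blast
 obtain a where a: "a : A" "ALL x:U. a <=. x" "ALL v:A. (ALL x:U. v <=. x) --> v <=. a"
  using complete_inf[OF E(2,3) pq(1) bd(1)] by blast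
 have in1: "a <. x" "x <. b" if "x : U" for x
  using E(4)[OF that] E(5)[OF that] a(2) b(2) less_le_trans le_less_trans by blast+
 obtain x where "x : U" using E(3) by blast
 hence "a <. b" using in1 less_trans by blast
 moreover have "U = Ivl a b"
 proof (intro equalityI subsetI)
  fix x assume "x : U"
  thus "x : Ivl a b" unfolding Ivl_def using in1 E(2) by blast
 next
  fix x assume x: "x : Ivl a b"
  hence x': "x : A" "a <. x" "x <. b" unfolding Ivl_def by auto
  obtain y where y: "y : U" "x <. y" using b(3) x' by (meson not_le)
  obtain z where z: "z : U" "z <. x" using a(3) x' by (meson not_le)
  show "x : U" by (rule cvxD[OF E(1) z(1) y(1) x'(1) z(2) y(2)])
 qed
 ultimately show ?thesis using a(1) b(1) by blast
qed

end

section \<open>Integer indexed systems\<close>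

locale zsys = clo less_eq less A
 for less_eq :: "'a => 'a => bool" (infix \<open><=.\<close> 50) and less (infix \<open><.\<close> 50) and A +
 fixes cz :: "int => 'a" and hz :: "int => 'a => 'a" and u0 v0 :: 'a
 assumes homog: "endl U ==> EX f. siso less less f A U"
  and cz: "cz z : A" "less (cz z) (cz (z + 1))" "x : A ==> EX z. less (cz z) x" "x : A ==> EX z. less x (cz z)"
  and hz: "siso less less (hz z) A (Ivl (cz z) (cz (z + 1)))"
  and uv: "u0 : A" "v0 : A" "less u0 v0"
  and hz_id: "x : A ==> less_eq u0 x ==> less_eq x v0 ==> hz 0 x = x"
begin

lemma cz_less: "z < w ==> cz z <. cz w"
proof (induction w rule: int_gr_induct)
 case base
 show ?case by (rule cz(2))
next
 case (step i)
 thus ?case using cz(2) less_trans by blast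
qed

lemma cz_le: "z <= w ==> cz z <=. cz w" using cz_less[of z w] less_imp_le by (cases "z = w") auto

lemma cz_loc:
 assumes x: "x : A"
 shows "EX z. cz z <=. x & x <. cz (z + 1)"
proof -
 obtain z0 where z0: "cz z0 <. x" using cz(3)[OF x] by blast
 obtain z1 where z1: "x <. cz z1" using cz(4)[OF x] by blast
 have "z0 < z1" using z0 z1 cz_le[of z1 z0] by (metis less_trans linorder_not_less not_less)
 hence "x <. cz (z0 + int (nat (z1 - z0)))" using z1 by simp
 hence k: "x <. cz (z0 + int (LEAST k. x <. cz (z0 + int k)))" by (rule LeastI)
 define k where "k = (LEAST k. x <. cz (z0 + int k))"
 have "k ~= 0" using k z0 unfolding k_def[symmetric] by (auto dest: less_trans)
 then obtain m where m: "k = Suc m" using not0_implies_Suc by blast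
 hence "~ x <. cz (z0 + int m)" using not_less_Least[of m "\<lambda>k. x <. cz (z0 + int k)"] unfolding k_def by simp
 hence "cz (z0 + int m) <=. x" by (simp add: not_less)
 moreover have "x <. cz (z0 + int m + 1)" using k unfolding k_def[symmetric] m by (simp add: algebra_simps)
 ultimately show ?thesis by blast
qed

lemma endl_cz:
 assumes U: "endl U"
 shows "(EX z. U <= Ivl (cz z) (cz (z + 1))) \<or> (EX z. cz z : U)"
proof (cases "EX z. cz z : U")
 case False
 note E = endlD[OF U]
 obtain x where x: "x : U" using E(3) by blast
 obtain z where z: "cz z <=. x" "x <. cz (z + 1)" using cz_loc E(2) x by blast
 have zx: "cz z <. x" using z(1) False x by (metis le_less)
 have "y : Ivl (cz z) (cz (z + 1))" if y: "y : U" for y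
 proof -
  have "cz z <. y"
  proof (rule ccontr)
   assume "~ cz z <. y"
   hence "y <. cz z" using False y by (metis neqE)
   thus False using cvxD[OF E(1) y x cz(1) _ zx] False by blast
  qed
  moreover have "y <. cz (z + 1)"
  proof (rule ccontr)
   assume "~ y <. cz (z + 1)"
   hence "cz (z + 1) <. y" using False y by (metis neqE)
   thus False using cvxD[OF E(1) x y cz(1) z(2)] False by blast
  qed
  ultimately show ?thesis unfolding Ivl_def using E(2) y by blast
 qed
 thus ?thesis by blast
qed blast

lemma cz_cof: "ALL n. cz (int n) : A" "ALL x:A. EX n. x <. cz (int n)"
proof -
 show "ALL n. cz (int n) : A" using cz(1) by blast
 show "ALL x:A. EX n. x <. cz (int n)"
 proof
  fix x assume "x : A"
  then obtain z where z: "x <. cz z" using cz(4) by blast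
  have "cz z <=. cz (int (nat z))" by (rule cz_le) simp
  thus "EX n. x <. cz (int n)" using z less_le_trans by blast
 qed
qed

lemma build_int: "build (<=.) (<.) A (relation_of (<=) UNIV) hz cz (\<lambda>z. cz (z + 1)) (\<lambda>n. cz (int n))"
proof unfold_locales
 show "cz (s + 1) <=. cz t" if "(s, t) : relation_of (<=) UNIV" "s ~= t" for s t
  by (rule cz_le) (use that in \<open>simp add: relation_of_le\<close>)
 show "EX s:Field (relation_of (<=) UNIV). y <. cz s" if "y : A" for y
  using cz(4)[OF that] unfolding Field_relation_of by simp
 show "EX s:Field (relation_of (<=) UNIV). cz (s + 1) <. y" if y: "y : A" for y
 proof -
  obtain z where "cz z <. y" using cz(3)[OF y] by blast
  thus ?thesis unfolding Field_relation_of by (intro bexI[of _ "z - 1"]) auto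
 qed
 show "(EX s:Field (relation_of (<=) UNIV). U <= Ivl (cz s) (cz (s + 1))) \<or>
   (EX s:Field (relation_of (<=) UNIV). cz s : U \<or> cz (s + 1) : U)" if "endl U" for U
  using endl_cz[OF that] unfolding Field_relation_of by blast
qed (use homog hz cz cz_cof Linear_order_relation_of in auto)

definition JJ :: "(nat => int) => 'a set" where
 "JJ d = (\<Inter>n. iter hz d n ` A)"

lemma hz': "ALL z. siso (<.) (<.) (hz z) A (Ivl (cz z) (cz (z + 1)))"
 and cz': "ALL z. cz z : A & cz (z + 1) : A & cz z <. cz (z + 1)" using hz cz by auto

lemmas hz_iter = iter_siso[OF hz' cz']

lemma hz_A: "x : A ==> hz z x : A" "x : A ==> cz z <. hz z x" "x : A ==> hz z x <. cz (z + 1)"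
 using siso_mem[OF hz, of x z] unfolding Ivl_def by auto

lemma JJ_A: "JJ d <= A" unfolding JJ_def using INT_lower[of 0 UNIV "\<lambda>n. iter hz d n ` A"] by simp

lemma cvx_JJ: "cvx (JJ d)" unfolding cvx_def
proof (intro conjI ballI impI JJ_A)
 fix x y z assume x: "x : JJ d" and y: "y : JJ d" and z: "z : A" "x <. z & z <. y"
 have "z : iter hz d n ` A" for n
 proof -
  have "x : iter hz d n ` A" "y : iter hz d n ` A" using x y unfolding JJ_def by blast+
  thus ?thesis by (rule cvxD[OF endlD(1)[OF hz_iter(5)] _ _ z(1) conjunct1[OF z(2)] conjunct2[OF z(2)]])
 qed
 thus "z : JJ d" unfolding JJ_def by blast
qed

lemma JJ_cons: "JJ d = hz (d 0) ` JJ (\<lambda>k. d (Suc k))"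
proof (intro equalityI subsetI)
 fix x assume "x : JJ d"
 hence x: "x : iter hz d n ` A" for n unfolding JJ_def by blast
 obtain y where y: "y : A" "x = hz (d 0) y" using x[of 1] by auto
 have "y : iter hz (\<lambda>k. d (Suc k)) n ` A" for n
 proof -
  obtain w where w: "w : A" "x = iter hz d (Suc n) w" using x[of "Suc n"] by blast
  have "hz (d 0) y = hz (d 0) (iter hz (\<lambda>k. d (Suc k)) n w)" using y w(2) by (simp only: iter_Suc)
  hence "y = iter hz (\<lambda>k. d (Suc k)) n w" using siso_eq[OF hz y(1) hz_iter(1)[OF w(1)]] by blast
  thus ?thesis using w(1) by blast
 qed
 thus "x : hz (d 0) ` JJ (\<lambda>k. d (Suc k))" unfolding JJ_def using y(2) by blast
next
 fix x assume "x : hz (d 0) ` JJ (\<lambda>k. d (Suc k))"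
 then obtain y where y: "y : JJ (\<lambda>k. d (Suc k))" "x = hz (d 0) y" by blast
 have "x : iter hz d n ` A" for n
 proof (cases n)
  case 0
  thus ?thesis using y JJ_A hz_A(1) by auto
 next
  case (Suc m)
  obtain w where w: "w : A" "y = iter hz (\<lambda>k. d (Suc k)) m w" using y(1) unfolding JJ_def by blast
  have "x = iter hz d (Suc m) w" by (simp only: iter_Suc y(2) w(2))
  thus ?thesis unfolding Suc using w(1) by (rule image_eqI)
 qed
 thus "x : JJ d" unfolding JJ_def by blast
qed

lemma JJ_Ivl: "JJ d <= Ivl (cz (d 0)) (cz (d 0 + 1))"
proof
 fix x assume "x : JJ d"
 hence "x : hz (d 0) ` JJ (\<lambda>k. d (Suc k))" unfolding JJ_cons[of d] .
 then obtain y where "y : JJ (\<lambda>k. d (Suc k))" "x = hz (d 0) y" by (rule imageE)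
 thus "x : Ivl (cz (d 0)) (cz (d 0 + 1))" using siso_mem[OF hz, of y "d 0"] subsetD[OF JJ_A] by metis
qed

lemma nondeg_JJ: "nondeg (JJ d) \<longleftrightarrow> nondeg (JJ (\<lambda>k. d (Suc k)))"
 unfolding JJ_cons[of d] by (rule siso_nondeg[OF hz JJ_A])

lemma nondeg_JJ_0: "nondeg (JJ (\<lambda>_. 0))"
proof -
 have "iter hz (\<lambda>_. 0) n x = x" if "x : A" "u0 <=. x" "x <=. v0" for n x
  using that hz_id by (induction n) auto
 note it = this
 have "x : JJ (\<lambda>_. 0)" if "x : A" "u0 <=. x" "x <=. v0" for x unfolding JJ_def using that
 proof (intro INT_I)
  fix n
  show "x : iter hz (\<lambda>_. 0) n ` A" by (rule image_eqI[of _ _ x]) (use that it in simp_all)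
 qed
 hence "u0 : JJ (\<lambda>_. 0)" "v0 : JJ (\<lambda>_. 0)" using uv by (simp_all add: less_imp_le)
 thus ?thesis unfolding nondeg_def using uv(3) by blast
qed

lemma JJ_less:
 assumes "!!k. k < n ==> d k = d' k" "d n < d' n" "x : JJ d" "y : JJ d'"
 shows "x <. y" using assms
proof (induction n arbitrary: d d' x y)
 case 0
 have "x <. cz (d 0 + 1)" "cz (d' 0) <. y" using JJ_Ivl 0(3,4) unfolding Ivl_def by blast+
 moreover have "cz (d 0 + 1) <=. cz (d' 0)" using 0(2) by (intro cz_le) simp
 ultimately show ?case using less_le_trans less_trans by blast
next
 case (Suc n)
 have e: "d 0 = d' 0" using Suc.prems(1) by simp
 obtain x' where x': "x' : JJ (\<lambda>k. d (Suc k))" "x = hz (d 0) x'" using Suc.prems(3) JJ_cons by blast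
 obtain y' where y': "y' : JJ (\<lambda>k. d' (Suc k))" "y = hz (d' 0) y'" using Suc.prems(4) JJ_cons by blast
 have "x' <. y'" by (rule Suc.IH[OF _ _ x'(1) y'(1)]) (use Suc.prems in auto)
 thus ?case unfolding x'(2) y'(2) e using siso_less[OF hz] x'(1) y'(1) JJ_A by blast
qed

text \<open>Keep pulling \<open>U\<close> back. As long as no division point \<open>cz z\<close>
  turns up, the current set lies in a single unit and yields one more digit; if this never stops,
  the digits form an infinite word whose intersection contains \<open>U\<close>.\<close>

lemma endl_JJ_cases:
 assumes U: "endl U"
 shows "(EX d. U <= JJ d) \<or> (EX d n W z. endl W & U = iter hz d n ` W & cz z : W)"
proof (rule ccontr)
 assume no: "~ ?thesis"
 define P where "P n W \<longleftrightarrow> endl W & (EX d. U = iter hz d n ` W) & (n = 0 --> W = U)" for n W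
 have "EX W. ALL n. P n (W n) & (EX z. W n = hz z ` W (Suc n))"
 proof (rule dependent_nat_choice)
  show "EX W. P 0 W" unfolding P_def using U by auto
  fix W n assume W: "P n W"
  obtain d where d: "endl W" "U = iter hz d n ` W" using W unfolding P_def by blast
  have "~ (EX z. cz z : W)" using no d by blast
  then obtain z where z: "W <= Ivl (cz z) (cz (z + 1))" using endl_cz[OF d(1)] by blast
  define W' where "W' = inv_into A (hz z) ` W"
  have "cvx (Ivl (cz z) (cz (z + 1)))" by (rule endlD(1)[OF endl_Ivl[OF cz(1,1,2)]])
  hence e: "endl W'" unfolding W'_def by (rule siso_endl[OF siso_inv[OF hz] _ cvx_A z d(1)])
  have "hz z (inv_into A (hz z) x) = x" if "x : W" for x
   by (rule f_inv_into_f) (use that z siso_image[OF hz] in blast)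
  hence W': "W = hz z ` W'" unfolding W'_def by (auto simp: image_iff)
  have "U = iter hz (d(n := z)) (Suc n) ` W'"
  proof -
   have "iter hz (d(n := z)) n x = iter hz d n x" for x by (rule iter_cong) simp
   hence "iter hz (d(n := z)) (Suc n) x = iter hz d n (hz z x)" for x by simp
   thus ?thesis unfolding d(2) W' by (auto simp: image_iff)
  qed
  thus "EX W'. P (Suc n) W' & (EX z. W = hz z ` W')" unfolding P_def using e W' by blast
 qed
 then obtain W where W: "ALL n. P n (W n)" "ALL n. EX z. W n = hz z ` W (Suc n)" by blast
 then obtain d where d: "ALL n. W n = hz (d n) ` W (Suc n)" by metis
 have W0: "W 0 = U" using W(1) unfolding P_def by blast
 have "U = iter hz d n ` W n" for n
 proof (induction n)
  case (Suc n)
  thus ?case using d[rule_format, of n] by (auto simp: image_iff)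
 qed (simp add: W0)
 moreover have "W n <= A" for n using W(1) endlD(2) unfolding P_def by blast
 ultimately have "U <= JJ d" unfolding JJ_def by blast
 thus False using no by blast
qed

end

context lots
begin

lemma endless_iff_endl: "clo (<=.) (<.) (Field r) ==> clo.endl (<.) (Field r) U \<longleftrightarrow> endless U"
 unfolding clo.endl_def clo.cvx_def endless_def by blast

text \<open>A cofinal and a coinitial sequence are spliced into division points indexed by the
  integers. Homogeneity supplies the unit maps; only the one for unit 0 is built by hand so as to
  fix a nondegenerate interval.\<close>

lemma CHLOTS_zsys:
 assumes H: "CHLOTS r"
 obtains cz hz u v where "zsys (<=.) (<.) (Field r) cz hz u v"
proof -
 have HL: "HLOTS r" using H unfolding CHLOTS_def by blast
 have clo: "clo (<=.) (<.) (Field r)" and iso: "ALL U. endless U --> (EX f. siso (<.) (<.) f (Field r) U)"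
  using H unfolding CHLOTS_iff by auto
 interpret C: clo "(<=.)" "(<.)" "Field r" by (rule clo)
 have homog: "EX f. siso (<.) (<.) f (Field r) U" if "C.endl U" for U
  using iso that endless_iff_endl[OF clo] by blast
 obtain p :: "nat => 'a" where p: "!!n. p n : Field r" "!!n. p n <. p (Suc n)" "!!x. x : Field r ==> EX n. x <. p n"
  using HLOTS_cofinal[OF HL] by metis
 obtain m :: "nat => 'a" where m: "!!n. m n : Field r" "!!n. m (Suc n) <. m n" "!!x. x : Field r ==> EX n. m n <. x"
  using HLOTS_coinitial[OF HL] by metis
 obtain N where N: "m N <. p 0" using m(3)[OF p(1)] by blast
 \<comment> \<open>The index -1 gets \<open>m N\<close>, which \<open>N\<close> places below
   \<open>p 0\<close>; further negative indices continue down the coinitial sequence.\<close>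
 define cz where "cz z = (if 0 <= z then p (nat z) else m (N + nat (- z - 1)))" for z :: int
 have cz1: "cz z : Field r" for z unfolding cz_def using p(1) m(1) by simp
 have cz2: "cz z <. cz (z + 1)" for z
 proof -
  consider "0 <= z" | "z = -1" | "z < -1" by linarith
  thus ?thesis
  proof cases
   case 1
   hence "nat (z + 1) = Suc (nat z)" by simp
   thus ?thesis unfolding cz_def using 1 p(2) by simp
  next
   case 2
   thus ?thesis unfolding cz_def using N by simp
  next
   case 3
   hence "nat (- z - 1) = Suc (nat (- (z + 1) - 1))" by simp
   thus ?thesis unfolding cz_def using 3 m(2) by simp
  qed
 qed
 have cz3: "EX z. cz z <. x" if x: "x : Field r" for x
 proof -
  obtain n where n: "m n <. x" using m(3)[OF x] by blast
  have "m (N + n) <=. m n"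
  proof (induction N)
   case (Suc N)
   thus ?case using m(2)[of "N + n"] by (simp add: less_imp_le order_trans[OF less_imp_le])
  qed simp
  hence "cz (- int n - 1) <. x" unfolding cz_def using n le_less_trans by simp
  thus ?thesis by blast
 qed
 have cz4: "EX z. x <. cz z" if x: "x : Field r" for x
 proof -
  obtain n where "x <. p n" using p(3)[OF x] by blast
  hence "x <. cz (int n)" unfolding cz_def by simp
  thus ?thesis by blast
 qed
 obtain u where u: "u : Field r" "cz 0 <. u" "u <. cz 1" using C.dense[OF cz1 cz1, of 0 1] cz2[of 0] by auto
 obtain v where v: "v : Field r" "u <. v" "v <. cz 1" using C.dense[OF u(1) cz1 u(3)] by blast
 have eI: "C.endl (C.Ivl a b)" if "a : Field r" "b : Field r" "a <. b" for a b by (rule C.endl_Ivl[OF that])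
 have iso2: "EX f. siso (<.) (<.) f U W" if U: "C.endl U" and W: "C.endl W" for U W
  using siso_comp[OF siso_inv] homog[OF U] homog[OF W] by blast
 have eDn: "C.endl (C.Dn u)" unfolding C.endl_def C.cvx_def
 proof (intro conjI ballI impI)
  show "C.Dn u <= Field r" unfolding C.Dn_def by blast
  show "C.Dn u ~= {}" unfolding C.Dn_def using C.no_bot[OF u(1)] by blast
  show "z : C.Dn u" if "y : C.Dn u" "z : Field r" "x <. z & z <. y" for x y z
   using that less_trans unfolding C.Dn_def by blast
  fix x assume "x : C.Dn u"
  hence x: "x : Field r" "x <. u" unfolding C.Dn_def by auto
  show "EX y:C.Dn u. x <. y" unfolding C.Dn_def using C.dense[OF x(1) u(1) x(2)] by blast
  show "EX y:C.Dn u. y <. x" unfolding C.Dn_def using C.no_bot[OF x(1)] x(2) less_trans by blast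
 qed
 have eUp: "C.endl (C.Up v)" unfolding C.endl_def C.cvx_def
 proof (intro conjI ballI impI)
  show "C.Up v <= Field r" unfolding C.Up_def by blast
  show "C.Up v ~= {}" unfolding C.Up_def using C.no_top[OF v(1)] by blast
  show "z : C.Up v" if "x : C.Up v" "z : Field r" "x <. z & z <. y" for x y z
   using that less_trans unfolding C.Up_def by blast
  fix x assume "x : C.Up v"
  hence x: "x : Field r" "v <. x" unfolding C.Up_def by auto
  show "EX y:C.Up v. x <. y" unfolding C.Up_def using C.no_top[OF x(1)] x(2) less_trans by blast
  show "EX y:C.Up v. y <. x" unfolding C.Up_def using C.dense[OF v(1) x(1,2)] by blast
 qed
 obtain f1 where f1: "siso (<.) (<.) f1 (C.Dn u) (C.Ivl (cz 0) u)" using iso2[OF eDn eI[OF cz1 u(1,2)]] by blast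
 obtain f3 where f3: "siso (<.) (<.) f3 (C.Up v) (C.Ivl v (cz 1))" using iso2[OF eUp eI[OF v(1) cz1 v(3)]] by blast
 \<comment> \<open>The map for unit 0 is glued from three pieces: the part below \<open>u\<close> is
   compressed into \<open>(cz 0, u)\<close>, the closed interval from \<open>u\<close> to
   \<open>v\<close> stays fixed, and the part above \<open>v\<close> is compressed into
   \<open>(v, cz 1)\<close>.\<close>
 define M where "M = {x:Field r. u <=. x & x <=. v}"
 define F where "F i = (if i = 0 then f1 else if i = 1 then (\<lambda>x. x) else f3)" for i :: nat
 define UU where "UU i = (if i = 0 then C.Dn u else if i = 1 then M else C.Up v)" for i :: nat
 define WW where "WW i = (if i = 0 then C.Ivl (cz 0) u else if i = 1 then M else C.Ivl v (cz 1))" for i :: nat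
 have "EX g. siso (<.) (<.) g (\<Union>i\<in>{0,1,2}. UU i) (\<Union>i\<in>{0,1,2}. WW i) & (ALL i:{0,1,2}. ALL x:UU i. g x = F i x)"
 proof (rule siso_glue[where lti = "(<)"])
  show "siso (<.) (<.) (F i) (UU i) (WW i)" if "i : {0,1,2}" for i
   unfolding F_def UU_def WW_def using f1 f3 siso_id[of "(<.)" M] by simp
  show "x <. y" if "i : {0,1,2}" "j : {0,1,2}" "i < j" "x : UU i" "y : UU j" for i j x y
   using that v(2) unfolding UU_def C.Dn_def C.Up_def M_def
   by (auto split: if_splits intro: less_le_trans le_less_trans less_trans)
  show "x <. y" if "i : {0,1,2}" "j : {0,1,2}" "i < j" "x : WW i" "y : WW j" for i j x y
   using that v(2) unfolding WW_def C.Ivl_def M_def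
   by (auto split: if_splits intro: less_le_trans le_less_trans less_trans)
 qed auto
 then obtain h0 where h0: "siso (<.) (<.) h0 (\<Union>i\<in>{0,1,2}. UU i) (\<Union>i\<in>{0,1,2}. WW i)"
  and h0F: "ALL i:{0,1,2}. ALL x:UU i. h0 x = F i x" by blast
 have "(\<Union>i\<in>{0,1,2}. UU i) = Field r"
  unfolding UU_def C.Dn_def C.Up_def M_def by (auto simp: not_less not_le)
 moreover have "(\<Union>i\<in>{0,1,2}. WW i) = C.Ivl (cz 0) (cz 1)" unfolding WW_def C.Ivl_def M_def using u v
  by (auto simp: not_less not_le intro: less_le_trans le_less_trans less_trans)
 ultimately have h0': "siso (<.) (<.) h0 (Field r) (C.Ivl (cz 0) (cz 1))" using h0 by simp
 have h0id: "h0 x = x" if "x : M" for x using h0F that unfolding UU_def F_def by force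
 have "ALL z. EX f. siso (<.) (<.) f (Field r) (C.Ivl (cz z) (cz (z + 1)))" using homog eI[OF cz1 cz1 cz2] by blast
 then obtain H where H: "ALL z. siso (<.) (<.) (H z) (Field r) (C.Ivl (cz z) (cz (z + 1)))" by metis
 have "zsys (<=.) (<.) (Field r) cz (H(0 := h0)) u v"
 proof unfold_locales
  show "siso (<.) (<.) ((H(0 := h0)) z) (Field r) (C.Ivl (cz z) (cz (z + 1)))" for z using H h0' by simp
  show "(H(0 := h0)) 0 x = x" if "x : Field r" "u <=. x" "x <=. v" for x using h0id that unfolding M_def by simp
 qed (use homog cz1 cz2 cz3 cz4 u v in auto)
 thus ?thesis using that by blast
qed

end

section \<open>Coding integer sequences by reals\<close>

lemma clo_real: "clo (<=) (<) (UNIV :: real set)"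
proof -
 interpret lin "(<=)" "(<) :: real => real => bool" by (rule lin_linorder)
 show ?thesis
 proof
  fix S and u :: real assume S: "S ~= {}" and u: "!!x. x : S ==> x <= u"
  have "bdd_above S" using u by (rule bdd_aboveI)
  hence "ALL x:S. x <= Sup S" using cSup_upper by blast
  moreover have "ALL v. (ALL x:S. x <= v) --> Sup S <= v" using cSup_least[OF S] by blast
  ultimately show "EX s:UNIV. (ALL x:S. x <= s) & (ALL v:UNIV. (ALL x:S. x <= v) --> s <= v)" by blast
 qed (simp_all add: gt_ex lt_ex Orderings.dense)
qed

interpretation R: clo "(<=)" "(<)" "UNIV :: real set" by (rule clo_real)

text \<open>The arctangent scaled to total length 1 and centred in \<open>(z, z + 1)\<close>. Its
  slope is at most \<open>1 / pi\<close>, hence at most 1/2, which makes iterates contract.\<close>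

definition gr :: "int => real => real" where
 "gr z t = of_int z + 1 / 2 + arctan t / pi"

lemma gr_bounds: "of_int z < gr z t" "gr z t < of_int z + 1"
proof -
 have "- (1 / 2) < arctan t / pi" "arctan t / pi < 1 / 2"
  using arctan_lbound[of t] arctan_ubound[of t] pi_gt_zero by (simp_all add: field_simps)
 thus "of_int z < gr z t" "gr z t < of_int z + 1" unfolding gr_def by linarith+
qed

lemma gr_less: "gr z s < gr z t \<longleftrightarrow> s < t"
 unfolding gr_def by (simp add: divide_less_cancel arctan_less_iff)

lemma gr_surj:
 assumes "of_int z < y" "y < of_int z + 1"
 shows "EX t. gr z t = y"
proof -
 have "- (pi / 2) < pi * (y - of_int z - 1 / 2)" "pi * (y - of_int z - 1 / 2) < pi / 2"
  using mult_strict_left_mono[of "- (1 / 2)" "y - of_int z - 1 / 2" pi]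
   mult_strict_left_mono[of "y - of_int z - 1 / 2" "1 / 2" pi] assms pi_gt_zero by simp_all
 hence "arctan (tan (pi * (y - of_int z - 1 / 2))) = pi * (y - of_int z - 1 / 2)" by (rule arctan_tan)
 hence "gr z (tan (pi * (y - of_int z - 1 / 2))) = y" unfolding gr_def by simp
 thus ?thesis by blast
qed

lemma gr_eq: "gr z s = gr w t \<longleftrightarrow> z = w & s = t"
proof
 assume e: "gr z s = gr w t"
 have "real_of_int z < of_int w + 1" "real_of_int w < of_int z + 1"
  using gr_bounds[of z s] gr_bounds[of w t] e by linarith+
 hence "z = w" by linarith
 moreover from this have "s = t" using e gr_less[of z s t] gr_less[of z t s] by (metis less_irrefl linorder_neqE)
 ultimately show "z = w & s = t" by blast
qed simp

lemma gr_lip: "\<bar>gr z s - gr z t\<bar> <= \<bar>s - t\<bar> / 2"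
proof -
 have *: "\<bar>arctan s - arctan t\<bar> <= \<bar>s - t\<bar>" if "s < t" for s t
 proof -
  have "EX x>s. x < t & arctan t - arctan s = (t - s) * inverse (1 + x\<^sup>2)"
   by (rule MVT2[OF \<open>s < t\<close>]) (rule DERIV_arctan)
  then obtain x where x: "arctan t - arctan s = (t - s) * inverse (1 + x\<^sup>2)" by blast
  have "inverse (1 + x\<^sup>2) <= 1" by (simp add: inverse_le_1_iff)
  hence "(t - s) * inverse (1 + x\<^sup>2) <= t - s" using that by (simp add: mult_left_le)
  moreover have "arctan s < arctan t" using that by (simp add: arctan_less_iff)
  ultimately show ?thesis using x that by simp
 qed
 have a: "\<bar>arctan s - arctan t\<bar> <= \<bar>s - t\<bar>"
  using *[of s t] *[of t s] by (cases s t rule: linorder_cases) (simp_all add: abs_minus_commute)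
 have "\<bar>gr z s - gr z t\<bar> = \<bar>arctan s - arctan t\<bar> / pi"
  unfolding gr_def by (simp add: diff_divide_distrib[symmetric] abs_divide)
 also have "\<dots> <= \<bar>s - t\<bar> / 2" using a pi_ge_two by (intro frac_le) auto
 finally show ?thesis .
qed

lemma siso_gr: "ALL z. siso (<) (<) (gr z) UNIV (R.Ivl (of_int z) (of_int z + 1))"
proof
 fix z
 have "bij_betw (gr z) UNIV (R.Ivl (of_int z) (of_int z + 1))" unfolding bij_betw_def
 proof
  show "inj (gr z)" by (rule injI) (simp add: gr_eq)
  show "range (gr z) = R.Ivl (of_int z) (of_int z + 1)"
  proof (intro equalityI subsetI)
   fix y assume "y : R.Ivl (of_int z) (of_int z + 1)"
   then obtain t where "gr z t = y" using gr_surj[of z y] unfolding R.Ivl_def by blast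
   thus "y : range (gr z)" by blast
  next
   fix y assume "y : range (gr z)"
   then obtain t where "y = gr z t" by blast
   thus "y : R.Ivl (of_int z) (of_int z + 1)" unfolding R.Ivl_def using gr_bounds[of z t] by simp
  qed
 qed
 thus "siso (<) (<) (gr z) UNIV (R.Ivl (of_int z) (of_int z + 1))" unfolding siso_def by (simp add: gr_less)
qed

lemma int_ends: "ALL z. real_of_int z : UNIV & real_of_int z + 1 : UNIV & real_of_int z < real_of_int z + 1"
 by simp

lemmas gr_iter = R.iter_siso[OF siso_gr int_ends]

lemma iter_gr_lip: "\<bar>iter gr d n s - iter gr d n t\<bar> <= \<bar>s - t\<bar> / 2 ^ n"
proof (induction n arbitrary: s t)
 case (Suc n)
 have "\<bar>iter gr d (Suc n) s - iter gr d (Suc n) t\<bar> <= \<bar>gr (d n) s - gr (d n) t\<bar> / 2 ^ n" using Suc by simp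
 also have "\<dots> <= (\<bar>s - t\<bar> / 2) / 2 ^ n" by (rule divide_right_mono[OF gr_lip]) simp
 finally show ?case by simp
qed simp

text \<open>\<open>d\<close> is the digit expansion of \<open>t\<close>; the witness
  \<open>b\<close> lists the successive remainders. Integers lie in the range of no
  \<open>gr z\<close> and so have no expansion.\<close>

definition rep :: "real => (nat => int) => bool" where
 "rep t d \<longleftrightarrow> (EX b. b 0 = t & (ALL n. b n = gr (d n) (b (Suc n))))"

lemma rep_cons: "rep (gr z t) d \<longleftrightarrow> d 0 = z & rep t (\<lambda>k. d (Suc k))"
proof
 assume "rep (gr z t) d"
 then obtain b where b: "b 0 = gr z t" "ALL n. b n = gr (d n) (b (Suc n))" unfolding rep_def by blast
 have "gr z t = gr (d 0) (b (Suc 0))" using b(1) b(2)[rule_format, of 0] by (rule trans[OF sym])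
 hence "d 0 = z" "b (Suc 0) = t" unfolding gr_eq by auto
 moreover have "ALL n. b (Suc n) = gr (d (Suc n)) (b (Suc (Suc n)))" using b(2) by blast
 ultimately have "EX c. c 0 = t & (ALL n. c n = gr (d (Suc n)) (c (Suc n)))" by (intro exI[of _ "\<lambda>n. b (Suc n)"] conjI)
 thus "d 0 = z & rep t (\<lambda>k. d (Suc k))" unfolding rep_def using \<open>d 0 = z\<close> by blast
next
 assume "d 0 = z & rep t (\<lambda>k. d (Suc k))"
 then obtain b where b: "d 0 = z" "b 0 = t" "ALL n. b n = gr (d (Suc n)) (b (Suc n))" unfolding rep_def by blast
 have "case_nat (gr z t) b n = gr (d n) (case_nat (gr z t) b (Suc n))" for n
 proof (cases n)
  case (Suc m)
  thus ?thesis using b(3)[rule_format, of m] by simp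
 qed (use b(1,2) in simp)
 thus "rep (gr z t) d" unfolding rep_def by (intro exI[of _ "case_nat (gr z t) b"]) simp
qed

lemma repE:
 assumes "rep t d"
 obtains s where "t = gr (d 0) s" "rep s (\<lambda>k. d (Suc k))"
proof -
 obtain b where b: "b 0 = t" "ALL n. b n = gr (d n) (b (Suc n))" using assms unfolding rep_def by blast
 have t: "t = gr (d 0) (b (Suc 0))" using b(1) b(2)[rule_format, of 0] by simp
 hence "rep (b (Suc 0)) (\<lambda>k. d (Suc k))" using assms rep_cons by metis
 thus ?thesis using that t by blast
qed

lemma rep_digits: "rep t d ==> rep t d' ==> d n = d' n"
proof (induction n arbitrary: t d d')
 case 0
 obtain s where "t = gr (d 0) s" using repE[OF 0(1)] by blast
 moreover obtain s' where "t = gr (d' 0) s'" using repE[OF 0(2)] by blast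
 ultimately show ?case using gr_eq by metis
next
 case (Suc n)
 obtain s where s: "t = gr (d 0) s" "rep s (\<lambda>k. d (Suc k))" using repE[OF Suc.prems(1)] by blast
 obtain s' where s': "t = gr (d' 0) s'" "rep s' (\<lambda>k. d' (Suc k))" using repE[OF Suc.prems(2)] by blast
 have "s = s'" using s(1) s'(1) gr_eq by metis
 thus ?case using Suc.IH[OF s(2)] s'(2) by blast
qed

lemma rep_digits_eq: "rep t d ==> rep t d' ==> d = d'" by (rule ext) (rule rep_digits)

text \<open>After \<open>n\<close> digits the two remainders lie in the same unit interval, so the
  reals differ by at most 1 divided by the \<open>n\<close>-th power of 2.\<close>

lemma rep_real:
 assumes "rep s d" "rep t d"
 shows "s = t"
proof (rule ccontr)
 assume "s ~= t"
 obtain b where b: "b 0 = s" "ALL n. b n = gr (d n) (b (Suc n))" using assms(1) unfolding rep_def by blast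
 obtain c where c: "c 0 = t" "ALL n. c n = gr (d n) (c (Suc n))" using assms(2) unfolding rep_def by blast
 obtain n where n: "(1 / 2) ^ n < \<bar>s - t\<bar>" using real_arch_pow_inv[of "\<bar>s - t\<bar>" "1 / 2"] \<open>s ~= t\<close> by auto
 have "\<bar>s - t\<bar> = \<bar>iter gr d n (b n) - iter gr d n (c n)\<bar>"
  using iter_chain[of b gr d n, OF b(2)] iter_chain[of c gr d n, OF c(2)] b(1) c(1) by (simp only:)
 also have "\<dots> <= \<bar>b n - c n\<bar> / 2 ^ n" by (rule iter_gr_lip)
 also have "\<dots> <= 1 / 2 ^ n"
 proof (rule divide_right_mono)
  have "of_int (d n) < b n" "b n < of_int (d n) + 1" "of_int (d n) < c n" "c n < of_int (d n) + 1"
   using gr_bounds[of "d n" "b (Suc n)"] gr_bounds[of "d n" "c (Suc n)"] b(2)[rule_format, of n] c(2)[rule_format, of n]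
   by (simp_all only:)
  thus "\<bar>b n - c n\<bar> <= 1" by linarith
 qed simp
 finally show False using n by (simp add: power_one_over)
qed

text \<open>Each image lies strictly between two points of the previous one, namely the images of
  the ends of the unit named by the next digit, so \<open>chain_Inter\<close> yields a common point.
  Injectivity of the iterates recovers the remainders.\<close>

lemma rep_exists: "EX t. rep t d"
proof -
 have dec: "iter gr d (Suc n) ` UNIV <= iter gr d n ` UNIV" for n by auto
 have mono: "iter gr d n ` UNIV <= iter gr d m ` UNIV" if "m <= n" for m n
  using lift_Suc_antimono_le[of "\<lambda>n. iter gr d n ` UNIV", OF dec that] .
 have "EX a:UNIV. ALL U:range (\<lambda>n. iter gr d n ` UNIV). a : U"
 proof (rule R.chain_Inter)
  show "ALL U:range (\<lambda>n. iter gr d n ` UNIV). R.cvx U & U ~= {}"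
  proof
   fix U assume "U : range (\<lambda>n. iter gr d n ` UNIV)"
   then obtain n where n: "U = iter gr d n ` UNIV" by blast
   have "R.endl U" unfolding n by (rule gr_iter(5))
   thus "R.cvx U & U ~= {}" using R.endlD(1,3) by blast
  qed
  show "ALL U:range (\<lambda>n. iter gr d n ` UNIV). ALL V:range (\<lambda>n. iter gr d n ` UNIV). U <= V \<or> V <= U"
  proof (intro ballI; elim rangeE; hypsubst)
   fix m n
   show "iter gr d m ` UNIV <= iter gr d n ` UNIV \<or> iter gr d n ` UNIV <= iter gr d m ` UNIV"
    using mono nat_le_linear by meson
  qed
  show "ALL U:range (\<lambda>n. iter gr d n ` UNIV). EX V:range (\<lambda>n. iter gr d n ` UNIV). EX u:U. EX v:U. ALL x:V. u < x & x < v"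
  proof
   fix U assume "U : range (\<lambda>n. iter gr d n ` UNIV)"
   then obtain n where n: "U = iter gr d n ` UNIV" by blast
   have "iter gr d n (of_int (d n)) < x & x < iter gr d n (of_int (d n) + 1)" if x: "x : iter gr d (Suc n) ` UNIV" for x
   proof -
    obtain y where "x = iter gr d n (gr (d n) y)" using x by auto
    thus ?thesis
     using gr_iter(2)[of "of_int (d n)" "gr (d n) y" d n] gr_iter(2)[of "gr (d n) y" "of_int (d n) + 1" d n]
      gr_bounds[of "d n" y] by simp
   qed
   moreover have "iter gr d n (of_int (d n)) : U" "iter gr d n (of_int (d n) + 1) : U" unfolding n by (rule rangeI)+
   ultimately have "EX u:U. EX v:U. ALL x:iter gr d (Suc n) ` UNIV. u < x & x < v" by meson
   thus "EX V:range (\<lambda>n. iter gr d n ` UNIV). EX u:U. EX v:U. ALL x:V. u < x & x < v"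
    by (rule bexI[of _ "iter gr d (Suc n) ` UNIV"]) (rule rangeI)
  qed
 qed
 then obtain t where t': "ALL U:range (\<lambda>n. iter gr d n ` UNIV). t : U" by (rule bexE)
 have t: "ALL n. t : iter gr d n ` UNIV"
 proof
  fix n show "t : iter gr d n ` UNIV" using t'[rule_format, OF rangeI[of _ n]] .
 qed
 hence "ALL n. EX x. t = iter gr d n x" by blast
 then obtain b where b: "ALL n. t = iter gr d n (b n)" by metis
 have "b n = gr (d n) (b (Suc n))" for n
 proof -
  have "iter gr d n (b n) = iter gr d n (gr (d n) (b (Suc n)))"
   using b[rule_format, of n] b[rule_format, of "Suc n"] by simp
  thus ?thesis using siso_eq[OF gr_iter(4)] by blast
 qed
 moreover have "b 0 = t" using b[rule_format, of 0] by simp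
 ultimately show ?thesis unfolding rep_def by blast
qed

text \<open>The order of reals is the lexicographic order of expansions: with equal earlier digits
  the next digit cannot decrease, and distinct reals have distinct expansions.\<close>

lemma rep_less:
 assumes "s < t" "rep s d" "rep t d'"
 obtains n where "!!k. k < n ==> d k = d' k" "d n < d' n"
proof -
 have le: "s < t ==> rep s d ==> rep t d' ==> (!!k. k < n ==> d k = d' k) ==> d n <= d' n" for n s t d d'
 proof (induction n arbitrary: s t d d')
  case 0
  obtain x where "s = gr (d 0) x" using repE[OF 0(2)] by blast
  moreover obtain y where "t = gr (d' 0) y" using repE[OF 0(3)] by blast
  ultimately have "real_of_int (d 0) < of_int (d' 0) + 1" using gr_bounds[of "d 0" x] gr_bounds[of "d' 0" y] 0(1) by linarith
  thus ?case by linarith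
 next
  case (Suc n)
  obtain x where x: "s = gr (d 0) x" "rep x (\<lambda>k. d (Suc k))" using repE[OF Suc.prems(2)] by blast
  obtain y where y: "t = gr (d' 0) y" "rep y (\<lambda>k. d' (Suc k))" using repE[OF Suc.prems(3)] by blast
  have "d 0 = d' 0" using Suc.prems(4) by simp
  hence "x < y" using Suc.prems(1) x(1) y(1) gr_less by metis
  thus ?case using Suc.IH[OF _ x(2) y(2)] Suc.prems(4) by simp
 qed
 have "EX n. d n ~= d' n"
 proof (rule ccontr)
  assume "~ ?thesis"
  hence "d = d'" by blast
  thus False using rep_real assms by blast
 qed
 hence n: "d (LEAST n. d n ~= d' n) ~= d' (LEAST n. d n ~= d' n)" by (rule LeastI_ex)
 have eq: "d k = d' k" if "k < (LEAST n. d n ~= d' n)" for k using not_less_Least[OF that] by blast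
 show ?thesis using that[OF eq] le[OF assms eq] n by fastforce
qed

section \<open>The dense homogeneous set of reals\<close>

context zsys
begin

definition D :: "real set" where
 "D = {t. EX d. rep t d & nondeg (JJ d)}"

definition dg :: "real => nat => int" where
 "dg t = (SOME d. rep t d & nondeg (JJ d))"

lemma dg:
 assumes "t : D"
 shows "rep t (dg t) & nondeg (JJ (dg t))"
proof -
 have "EX d. rep t d & nondeg (JJ d)" using assms unfolding D_def by blast
 thus ?thesis unfolding dg_def by (rule someI_ex)
qed

lemma dg_eq: "t : D ==> rep t d ==> dg t = d" using dg rep_digits_eq by blast

text \<open>Putting a digit in front applies one injective unit map to the nested intersection and
  so does not affect degeneracy. Hence every \<open>gr z\<close> preserves \<open>D\<close> as a
  colour.\<close>

lemma D_gr: "gr z t : D \<longleftrightarrow> t : D"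
proof
 assume "gr z t : D"
 then obtain d where "rep (gr z t) d" "nondeg (JJ d)" unfolding D_def by blast
 thus "t : D" unfolding D_def using rep_cons nondeg_JJ by blast
next
 assume "t : D"
 then obtain d where d: "rep t d" "nondeg (JJ d)" unfolding D_def by blast
 have "rep (gr z t) (case_nat z d)" unfolding rep_cons using d(1) by simp
 moreover have "nondeg (JJ (case_nat z d))" unfolding nondeg_JJ[of "case_nat z d"] using d(2) by simp
 ultimately show "gr z t : D" unfolding D_def by blast
qed

text \<open>Being outside \<open>D\<close>, the integers can serve as division points in the sums of
  gaps.\<close>

lemma D_int: "real_of_int z ~: D"
proof
 assume "real_of_int z : D"
 then obtain d where "rep (real_of_int z) d" unfolding D_def by blast
 then obtain s where "real_of_int z = gr (d 0) s" by (rule repE)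
 hence "real_of_int (d 0) < of_int z" "real_of_int z < of_int (d 0) + 1" using gr_bounds[of "d 0" s] by simp_all
 hence "d 0 < z" "z < d 0 + 1" by linarith+
 thus False by simp
qed

lemma D_int': "real_of_int z + 1 ~: D" using D_int[of "z + 1"] by simp

lemma D_ne: "EX t. t : D" using rep_exists[of "\<lambda>_. 0"] nondeg_JJ_0 unfolding D_def by blast

lemma sim_unit: "R.sim D UNIV (R.Ivl (of_int z) (of_int z + 1))" unfolding R.sim_def using siso_gr D_gr by blast

lemma unit_cases: "(EX z. a = real_of_int z) \<or> (EX z. a : R.Ivl (of_int z) (of_int z + 1))"
proof (cases "a = of_int \<lfloor>a\<rfloor>")
 case False
 hence "of_int \<lfloor>a\<rfloor> < a" using of_int_floor_le[of a] by linarith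
 hence "a : R.Ivl (of_int \<lfloor>a\<rfloor>) (of_int \<lfloor>a\<rfloor> + 1)" unfolding R.Ivl_def using floor_correct[of a] by simp
 thus ?thesis by blast
qed blast

lemma iter_gr_small:
 assumes b: "ALL n. b n = gr (d n) (b (Suc n))" and r: "!!n. \<bar>r n - b n\<bar> <= 1" and e: "0 < e"
 shows "EX n. \<bar>iter gr d n (r n) - b 0\<bar> < e"
proof -
 obtain n where n: "(1 / 2) ^ n < e" using real_arch_pow_inv[OF e, of "1 / 2"] by auto
 have "\<bar>iter gr d n (r n) - b 0\<bar> = \<bar>iter gr d n (r n) - iter gr d n (b n)\<bar>"
  using iter_chain[of b gr d n, OF b] by (simp only:)
 also have "\<dots> <= \<bar>r n - b n\<bar> / 2 ^ n" by (rule iter_gr_lip)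
 also have "\<dots> <= 1 / 2 ^ n" by (rule divide_right_mono[OF r]) simp
 also have "\<dots> < e" using n by (simp add: power_one_over)
 finally show ?thesis by blast
qed

lemma gr_near:
 assumes "b = gr z c"
 shows "\<bar>(of_int z + 1) - b\<bar> <= 1" "\<bar>of_int z - b\<bar> <= 1"
 using gr_bounds[of z c] assms by linarith+

text \<open>The general contraction argument with \<open>D\<close> as colour and the integers as
  division points; the negative integers form the reference sequence, and the slope bound makes the
  right ends converge.\<close>

lemma sim_Up_D: "R.sim D UNIV (R.Up a)"
proof (rule R.contracting_Up[of D gr real_of_int "\<lambda>z. real_of_int z + 1"])
 show "R.coin D" unfolding R.coin_def
 proof (intro exI[of _ "\<lambda>n. - real n"] conjI allI ballI)
  fix n
  show "- real n ~: D" using D_int[of "- int n"] by simp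
  have e: "- real (Suc n) = of_int (- int n - 1)" "- real n = of_int (- int n - 1) + 1" by simp_all
  show "R.sim D UNIV (R.Ivl (- real (Suc n)) (- real n))" unfolding e by (rule sim_unit)
 next
  fix x :: real
  obtain n where "- x < real n" using reals_Archimedean2 by blast
  thus "EX n. - real n < x" by (intro exI[of _ n]) linarith
 qed auto
 show "ALL z. ALL x:UNIV. (gr z x : D) = (x : D)" using D_gr by blast
 show "ALL z. EX w. real_of_int z + 1 = real_of_int w"
 proof
  fix z show "EX w. real_of_int z + 1 = real_of_int w" by (rule exI[of _ "z + 1"]) simp
 qed
 show "ALL d b. (ALL n. b n : UNIV & b n = gr (d n) (b (Suc n))) -->
   (ALL x:UNIV. b 0 < x --> (EX n. iter gr d n (real_of_int (d n) + 1) < x))"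
 proof (intro allI impI ballI)
  fix d b and x :: real
  assume "ALL n. b n : UNIV & b n = gr (d n) (b (Suc n))" and x: "b 0 < x"
  hence b: "ALL n. b n = gr (d n) (b (Suc n))" by blast
  have "EX n. \<bar>iter gr d n (real_of_int (d n) + 1) - b 0\<bar> < x - b 0"
   by (rule iter_gr_small[OF b gr_near(1)[OF b[rule_format]]]) (use x in simp)
  then obtain n where "\<bar>iter gr d n (real_of_int (d n) + 1) - b 0\<bar> < x - b 0" by blast
  hence "iter gr d n (real_of_int (d n) + 1) < x" by linarith
  thus "EX n. iter gr d n (real_of_int (d n) + 1) < x" by blast
 qed
qed (use siso_gr D_int' unit_cases in auto)

text \<open>The same argument in the reversed order: left and right ends of the units change roles,
  and the nonnegative integers form the reference sequence.\<close>

lemma sim_Dn_D: "R.sim D UNIV (R.Dn a)"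
proof -
 have sg: "ALL z. siso (\<lambda>x y. y < x) (\<lambda>x y. y < x) (gr z) UNIV
   (clo.Ivl (\<lambda>x y. y < x) UNIV (real_of_int z + 1) (real_of_int z))" unfolding R.duals by (rule siso_gr)
 have un: "ALL a:UNIV. (EX z. a = real_of_int z + 1) \<or>
   (EX z. a : clo.Ivl (\<lambda>x y. y < x) UNIV (real_of_int z + 1) (real_of_int z))" unfolding R.duals
 proof
  fix a :: real
  have "EX w. a = real_of_int w + 1" if "a = real_of_int z" for z by (rule exI[of _ "z - 1"]) (use that in simp)
  thus "(EX z. a = real_of_int z + 1) \<or> (EX z. a : R.Ivl (real_of_int z) (real_of_int z + 1))"
   using unit_cases[of a] by blast
 qed
 have co: "clo.coin (\<lambda>x y. y < x) UNIV D" unfolding clo.coin_def[OF R.clo_dual] R.duals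
 proof (intro exI[of _ real] conjI allI ballI)
  fix n
  show "real n ~: D" using D_int[of "int n"] by simp
  have "R.Ivl (real n) (real (Suc n)) = R.Ivl (of_int (int n)) (of_int (int n) + 1)" by (simp add: add.commute)
  thus "R.sim D UNIV (R.Ivl (real n) (real (Suc n)))" using sim_unit[of "int n"] by metis
 next
  fix x :: real
  show "EX n. x < real n" by (rule reals_Archimedean2)
 qed auto
 have "lin.sim (\<lambda>x y. y < x) D UNIV (clo.Up (\<lambda>x y. y < x) UNIV a)"
 proof (rule clo.contracting_Up[OF R.clo_dual co sg])
  show "ALL z. ALL x:UNIV. (gr z x : D) = (x : D)" using D_gr by blast
  show "ALL z. EX w. real_of_int z = real_of_int w + 1"
  proof
   fix z show "EX w. real_of_int z = real_of_int w + 1" by (rule exI[of _ "z - 1"]) simp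
  qed
  show "ALL d b. (ALL n. b n : UNIV & b n = gr (d n) (b (Suc n))) -->
    (ALL x:UNIV. x < b 0 --> (EX n. x < iter gr d n (real_of_int (d n))))"
  proof (intro allI impI ballI)
   fix d b and x :: real
   assume "ALL n. b n : UNIV & b n = gr (d n) (b (Suc n))" and x: "x < b 0"
   hence b: "ALL n. b n = gr (d n) (b (Suc n))" by blast
   have "EX n. \<bar>iter gr d n (real_of_int (d n)) - b 0\<bar> < b 0 - x"
    by (rule iter_gr_small[OF b gr_near(2)[OF b[rule_format]]]) (use x in simp)
   then obtain n where "\<bar>iter gr d n (real_of_int (d n)) - b 0\<bar> < b 0 - x" by blast
   hence "x < iter gr d n (real_of_int (d n))" by linarith
   thus "EX n. x < iter gr d n (real_of_int (d n))" by blast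
  qed
 qed (use D_int un in auto)
 thus ?thesis unfolding R.duals .
qed

text \<open>Every open interval is the image of the line under a map preserving \<open>D\<close>,
  and \<open>D\<close> is nonempty.\<close>

lemma D_dense: "x < y ==> EX t:D. x < t & t < y"
proof -
 assume xy: "x < y"
 have "R.sim D UNIV {x<..<y}"
 proof (rule R.sim_convex[OF sim_Up_D sim_Dn_D])
  show "{x<..<y} ~= {}" using xy by simp
  fix z assume z: "z : {x<..<y}"
  show "EX w:{x<..<y}. z < w" using z Orderings.dense[of z y] by auto
  show "EX w:{x<..<y}. w < z" using z Orderings.dense[of x z] by auto
 qed auto
 then obtain f where f: "siso (<) (<) f UNIV {x<..<y}" "ALL t:UNIV. f t : D \<longleftrightarrow> t : D" unfolding R.sim_def by blast
 obtain t where "t : D" using D_ne by blast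
 hence "f t : D" "f t : {x<..<y}" using f(2) siso_mem[OF f(1), of t] by auto
 thus ?thesis by auto
qed

lemma closure_D: "closure D = UNIV"
proof -
 have "x : closure D" for x unfolding closure_approachable
 proof (intro allI impI)
  fix e :: real assume "0 < e"
  then obtain t where "t : D" "x < t" "t < x + e" using D_dense[of x "x + e"] by auto
  thus "EX y:D. dist y x < e" by (intro bexI[of _ t]) (auto simp: dist_real_def)
 qed
 thus ?thesis by blast
qed

text \<open>An endless convex subset of \<open>D\<close> is the trace on \<open>D\<close> of its
  hull in the line. A colour preserving isomorphism of the line onto the hull restricts to one of
  \<open>D\<close> onto the subset.\<close>

lemma HLOTS_D: "HLOTS (relation_of (<=) D)"
proof -
 interpret L: lots "(<=)" "(<)" "relation_of (<=) D" by (rule lots_relation_of)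
 show ?thesis unfolding L.HLOTS_iff Field_relation_of
 proof (intro conjI ballI allI impI)
  show "D ~= {}" using D_ne by blast
  show "EX y:D. x < y" for x using D_dense[of x "x + 1"] by auto
  show "EX y:D. y < x" for x using D_dense[of "x - 1" x] by auto
  show "EX z:D. x < z & z < y" if "x < y" for x y by (rule D_dense[OF that])
  fix U assume "L.endless U"
  hence U: "U <= D" "U ~= {}" "ALL x:U. ALL y:U. ALL z:D. x < z & z < y --> z : U"
   "ALL x:U. EX y:U. x < y" "ALL x:U. EX y:U. y < x" unfolding L.endless_def Field_relation_of by blast+
  define W where "W = R.chull U"
  have UW: "U <= W" unfolding W_def R.chull_def using U(4,5) by blast
  have WD: "W \<inter> D = U"
  proof
   show "W \<inter> D <= U" unfolding W_def R.chull_def using U(3) by blast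
  qed (use UW U(1) in blast)
  have "R.sim D UNIV W"
  proof (rule R.sim_convex[OF sim_Up_D sim_Dn_D])
   show "W ~= {}" using UW U(2) by blast
   show "z : W" if "x : W" "y : W" "x < z" "z < y" for x y z
    using that order_less_trans unfolding W_def R.chull_def by blast
   fix x assume "x : W"
   then obtain u v where uv: "u : U" "v : U" "u < x" "x < v" unfolding W_def R.chull_def by blast
   show "EX y:W. x < y" "EX y:W. y < x" using uv UW by blast+
  qed simp
  then obtain f where f: "siso (<) (<) f UNIV W" "ALL t:UNIV. f t : D \<longleftrightarrow> t : D" unfolding R.sim_def by blast
  have "f ` D = W \<inter> D"
  proof (intro equalityI subsetI)
   fix y assume "y : W \<inter> D"
   then obtain x where "f x = y" using siso_surj[OF f(1), of y] by blast
   thus "y : f ` D" using f(2) \<open>y : W \<inter> D\<close> by blast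
  qed (use f(2) siso_mem[OF f(1)] in blast)
  hence "siso (<) (<) f D U" using siso_subset[OF f(1), of D] WD by simp
  thus "EX f. siso (<) (<) f D U" by blast
 qed
qed

text \<open>There is a gap at 0: it is an integer, hence outside \<open>D\<close>, and density of
  \<open>D\<close> on both sides leaves the members below 0 without a supremum in
  \<open>D\<close>.\<close>

lemma IHLOTS_D: "IHLOTS (relation_of (<=) D)"
proof -
 interpret L: lots "(<=)" "(<)" "relation_of (<=) D" by (rule lots_relation_of)
 have "~ complete_lots (relation_of (<=) D)"
 proof
  assume "complete_lots (relation_of (<=) D)"
  moreover have "D ~= {}" "ALL x:D. EX y:D. x < y" "ALL x:D. EX y:D. y < x" "ALL x:D. ALL y:D. x < y --> (EX z:D. x < z & z < y)"
   using HLOTS_D unfolding L.HLOTS_iff Field_relation_of by blast+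
  ultimately have "clo (<=) (<) D" using L.complete_lots_iff unfolding Field_relation_of by blast
  then interpret C: clo "(<=)" "(<)" D .
  obtain u where u: "u : D" "0 < u" using D_dense[of 0 1] by auto
  obtain w where w: "w : D" "w < 0" using D_dense[of "- 1" 0] by auto
  have "EX s:D. (ALL x:{x:D. x < 0}. x <= s) & (ALL v:D. (ALL x:{x:D. x < 0}. x <= v) --> s <= v)"
   by (rule C.complete[of _ u]) (use u w in auto)
  then obtain s where s: "s : D" "ALL x:{x:D. x < 0}. x <= s" "ALL v:D. (ALL x:{x:D. x < 0}. x <= v) --> s <= v" by blast
  have "s ~= 0" using s(1) D_int[of 0] by auto
  then consider "s < 0" | "0 < s" by linarith
  thus False
  proof cases
   case 1
   then obtain t where "t : D" "s < t" "t < 0" using D_dense by blast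
   thus False using s(2) by auto
  next
   case 2
   then obtain t where t: "t : D" "0 < t" "t < s" using D_dense by blast
   hence "s <= t" using s(3) by auto
   thus False using t(3) by simp
  qed
 qed
 thus ?thesis unfolding IHLOTS_def using HLOTS_D by blast
qed

definition IS :: "real => 'a set" where
 "IS t = chull (JJ (dg t))"

text \<open>The ends are chosen one after the other: \<open>beD\<close> is chosen for the fixed
  value of \<open>alD\<close>, so that together they describe the same interval.\<close>

definition alD :: "real => 'a" where
 "alD t = (SOME a. EX b. a : A & b : A & a <. b & IS t = Ivl a b)"

definition beD :: "real => 'a" where
 "beD t = (SOME b. alD t : A & b : A & alD t <. b & IS t = Ivl (alD t) b)"

lemma endl_IS: "t : D ==> endl (IS t)" unfolding IS_def using endl_chull[OF cvx_JJ] dg by blast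

lemma IS_JJ: "IS t <= JJ (dg t)" unfolding IS_def by (rule chull_sub[OF cvx_JJ])

lemma IS_Ivl: "IS t <= Ivl (cz (dg t 0)) (cz (dg t 0 + 1))" using IS_JJ JJ_Ivl by blast

lemma ends_D:
 assumes t: "t : D"
 shows "alD t : A" "beD t : A" "alD t <. beD t" "IS t = Ivl (alD t) (beD t)"
proof -
 have "EX a b. a : A & b : A & a <. b & IS t = Ivl a b" by (rule endl_bounded[OF endl_IS[OF t] IS_Ivl cz(1,1)])
 hence "EX b. alD t : A & b : A & alD t <. b & IS t = Ivl (alD t) b" unfolding alD_def by (rule someI_ex)
 hence "alD t : A & beD t : A & alD t <. beD t & IS t = Ivl (alD t) (beD t)" unfolding beD_def by (rule someI_ex)
 thus "alD t : A" "beD t : A" "alD t <. beD t" "IS t = Ivl (alD t) (beD t)" by auto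
qed

lemma dg_gr:
 assumes t: "t : D"
 shows "dg (gr z t) 0 = z" "(\<lambda>k. dg (gr z t) (Suc k)) = dg t"
proof -
 have "gr z t : D" using D_gr t by blast
 hence "rep (gr z t) (dg (gr z t))" using dg by blast
 hence r: "dg (gr z t) 0 = z" "rep t (\<lambda>k. dg (gr z t) (Suc k))" using rep_cons by auto
 show "dg (gr z t) 0 = z" by (rule r(1))
 show "(\<lambda>k. dg (gr z t) (Suc k)) = dg t" using dg_eq[OF t r(2)] by simp
qed

lemma IS_gr: "t : D ==> IS (gr z t) = hz z ` IS t"
proof -
 assume t: "t : D"
 have "JJ (dg (gr z t)) = hz z ` JJ (dg t)" unfolding JJ_cons[of "dg (gr z t)"] dg_gr[OF t] ..
 moreover have "hz z ` chull (JJ (dg t)) = chull (hz z ` JJ (dg t))"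
  by (rule siso_chull[OF hz cvx_A endlD(1)[OF endl_Ivl[OF cz(1,1,2)]] JJ_A])
 ultimately show ?thesis unfolding IS_def by simp
qed

lemma D_iter: "t : D ==> iter gr d n t : D & IS (iter gr d n t) = iter hz d n ` IS t"
proof (induction n arbitrary: t)
 case (Suc n)
 have "gr (d n) t : D" using D_gr Suc.prems by blast
 thus ?case using Suc.IH IS_gr[OF Suc.prems] by (simp add: image_image)
qed simp

text \<open>A letter is an infinite integer word, and its interval the interior of the nested
  intersection; the isomorphism onto it is any one given by homogeneity. Lexicographic order
  separates the intervals, and \<open>endl_JJ_cases\<close> gives \<open>sub_or_end\<close>.\<close>

lemma build_D: "build (<=.) (<.) A (relation_of (<=) D)
 (\<lambda>t. SOME f. siso (<.) (<.) f A (Ivl (alD t) (beD t))) alD beD (\<lambda>n. cz (int n))"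
proof unfold_locales
 show "siso (<.) (<.) (SOME f. siso (<.) (<.) f A (Ivl (alD t) (beD t))) A (Ivl (alD t) (beD t))"
  if t: "t : Field (relation_of (<=) D)" for t
  using someI_ex[OF homog[OF endl_Ivl[OF ends_D(1-3)]]] t unfolding Field_relation_of by blast
 show "alD t : A" "beD t : A" "alD t <. beD t" if "t : Field (relation_of (<=) D)" for t
  using that ends_D unfolding Field_relation_of by blast+
 show "beD s <=. alD t" if "(s, t) : relation_of (<=) D" "s ~= t" for s t
 proof -
  have st: "s : D" "t : D" "s < t" using that unfolding relation_of_le by auto
  obtain n where n: "!!k. k < n ==> dg s k = dg t k" "dg s n < dg t n"
   using rep_less[OF st(3)] dg[OF st(1)] dg[OF st(2)] by blast
  show ?thesis
  proof (rule Ivl_less[OF ends_D(1-3)[OF st(1)] ends_D(1-3)[OF st(2)]])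
   fix x y assume "x : Ivl (alD s) (beD s)" "y : Ivl (alD t) (beD t)"
   hence "x : JJ (dg s)" "y : JJ (dg t)"
    using IS_JJ unfolding ends_D(4)[OF st(1), symmetric] ends_D(4)[OF st(2), symmetric] by auto
   thus "x <. y" using JJ_less[of n "dg s" "dg t" x y] n by blast
  qed
 qed
 obtain t0 where t0: "t0 : D" using D_ne by blast
 have gD: "gr z t0 : D" for z using D_gr t0 by blast
 have sub: "Ivl (alD (gr z t)) (beD (gr z t)) <= Ivl (cz z) (cz (z + 1))" if "t : D" for z t
  using IS_Ivl[of "gr z t"] ends_D(4)[of "gr z t"] D_gr[of z t] that dg_gr(1)[OF that] by simp
 have cl: "cz z <=. alD (gr z t)" "beD (gr z t) <=. cz (z + 1)" if "t : D" for z t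
  using Ivl_sub[OF sub[OF that] ends_D(1-3) cz(1) cz(1)] D_gr that by blast+
 show "EX s:Field (relation_of (<=) D). y <. alD s" if y: "y : A" for y
 proof -
  obtain z where "y <. cz z" using cz(4)[OF y] by blast
  hence "y <. alD (gr z t0)" using cl(1)[OF t0] less_le_trans by blast
  thus ?thesis unfolding Field_relation_of using gD by blast
 qed
 show "EX s:Field (relation_of (<=) D). beD s <. y" if y: "y : A" for y
 proof -
  obtain z where "cz z <. y" using cz(3)[OF y] by blast
  hence "beD (gr (z - 1) t0) <. y" using cl(2)[OF t0, of "z - 1"] le_less_trans by simp
  thus ?thesis unfolding Field_relation_of using gD by blast
 qed
 show "(EX s:Field (relation_of (<=) D). U <= Ivl (alD s) (beD s)) \<or>
   (EX s:Field (relation_of (<=) D). alD s : U \<or> beD s : U)" if U: "endl U" for U using endl_JJ_cases[OF U]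
 proof
  assume "EX d. U <= JJ d"
  then obtain d where d: "U <= JJ d" by blast
  have "nondeg (JJ d)" using nondeg_endl[OF U] d unfolding nondeg_def by blast
  moreover obtain t where t: "rep t d" using rep_exists by blast
  ultimately have tD: "t : D" unfolding D_def by blast
  have "U <= chull U" unfolding chull_def using endlD(2,4,5)[OF U] by blast
  also have "\<dots> <= IS t" unfolding IS_def dg_eq[OF tD t] by (rule chull_mono[OF d])
  finally show ?thesis unfolding Field_relation_of using ends_D(4)[OF tD] tD by blast
 next
  assume "EX d n W z. endl W & U = iter hz d n ` W & cz z : W"
  then obtain d n W z where W: "endl W" "U = iter hz d n ` W" "cz z : W" by blast
  obtain u where u: "u : W" "cz z <. u" using endlD(4)[OF W(1,3)] by blast
  have uA: "u : A" using u(1) endlD(2)[OF W(1)] by blast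
  obtain x where x: "x : A" "cz z <. x" "x <. u" "x <. cz (z + 1)"
   using dense_below[OF cz(1) uA cz(1) u(2) cz(2)] by blast
  have xW: "x : W" by (rule cvxD[OF endlD(1)[OF W(1)] W(3) u(1) x(1-3)])
  have "x : Ivl (cz z) (cz (z + 1))" unfolding Ivl_def using x by blast
  then obtain y where y: "y : A" "hz z y = x" using siso_surj[OF hz] by blast
  \<comment> \<open>The unit ending at \<open>cz w\<close> lies below \<open>y\<close>, so the
    letter starting with digits \<open>z\<close> and \<open>w - 1\<close> spans an interval inside
    \<open>(cz z, x)\<close>, a part of \<open>W\<close>. After the outer digits \<open>d\<close>,
    its left end lands in \<open>U\<close>.\<close>
  obtain w where w: "cz w <. y" using cz(3)[OF y(1)] by blast
  define t1 where "t1 = gr (w - 1) t0"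
  have t1: "t1 : D" "IS t1 <= Ivl (cz (w - 1)) (cz w)"
   unfolding t1_def using gD IS_Ivl[of "gr (w - 1) t0"] dg_gr(1)[OF t0, of "w - 1"] by simp_all
  have sub2: "hz z ` IS t1 <= Ivl (cz z) x"
  proof
   fix v assume "v : hz z ` IS t1"
   then obtain v' where v': "v' : IS t1" "v = hz z v'" by blast
   have v'A: "v' : A" "v' <. y" using t1(2) v'(1) w less_trans unfolding Ivl_def by blast+
   have "v <. x" unfolding v'(2) y(2)[symmetric] using siso_less[OF hz v'A(1) y(1)] v'A(2) by blast
   thus "v : Ivl (cz z) x" unfolding Ivl_def v'(2) using hz_A[OF v'A(1)] by blast
  qed
  define t where "t = iter gr d n (gr z t1)"
  have "gr z t1 : D" using D_gr t1(1) by blast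
  hence tD: "t : D" and It: "IS t = iter hz d n ` hz z ` IS t1"
   unfolding t_def using D_iter IS_gr[OF t1(1)] by simp_all
  have "Ivl (alD t) (beD t) <= Ivl (iter hz d n (cz z)) (iter hz d n x)"
   unfolding ends_D(4)[OF tD, symmetric] It hz_iter(3)[OF cz(1) x(1), symmetric] by (rule image_mono[OF sub2])
  hence le: "iter hz d n (cz z) <=. alD t" "beD t <=. iter hz d n x"
   using Ivl_sub[OF _ ends_D(1-3)[OF tD] hz_iter(1)[OF cz(1)] hz_iter(1)[OF x(1)]] by blast+
  have in': "iter hz d n (cz z) : U" "iter hz d n x : U" unfolding W(2) using W(3) xW by auto
  have lt: "alD t <. iter hz d n x" using ends_D(3)[OF tD] le(2) less_le_trans by blast
  have "alD t : U"
  proof (cases "iter hz d n (cz z) = alD t")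
   case False
   hence "iter hz d n (cz z) <. alD t" using le(1) by (simp add: less_le)
   thus ?thesis using cvxD[OF endlD(1)[OF U] in' ends_D(1)[OF tD] _ lt] by blast
  qed (use in' in simp)
  thus ?thesis unfolding Field_relation_of using tD by blast
 qed
qed (use homog cz_cof Linear_order_relation_of in auto)

end

section \<open>The equivalence\<close>

text \<open>A copy of the tree along an injection of the vertex type; it moves a tree of real words
  into the summand of the larger type over which the statement about arbitrary trees
  quantifies.\<close>

lemma coded_image:
 assumes T: "coded Y T1 T (\<lambda>p. p)" and ij: "inj \<phi>"
 shows "coded Y T1 \<lparr>verts = \<phi> ` T1, prec = map_prod \<phi> \<phi> ` prec T, sord = (\<lambda>v. map_prod \<phi> \<phi> ` sord T (inv \<phi> v))\<rparr> \<phi>"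
  (is "coded Y T1 ?T \<phi>")
proof -
 interpret coded Y T1 T "\<lambda>p. p" by (rule T)
 have mp: "(\<phi> a, \<phi> b) : map_prod \<phi> \<phi> ` r \<longleftrightarrow> (a, b) : r" for a b r
 proof
  assume "(\<phi> a, \<phi> b) : map_prod \<phi> \<phi> ` r"
  then obtain x y where "(x, y) : r" "\<phi> a = \<phi> x" "\<phi> b = \<phi> y" by auto
  thus "(a, b) : r" using injD[OF ij] by metis
 next
  assume "(a, b) : r"
  thus "(\<phi> a, \<phi> b) : map_prod \<phi> \<phi> ` r" by (rule map_prod_imageI)
 qed
 show ?thesis
 proof
  show "EX a:Field Y. EX b:Field Y. a ~= b" by (rule Y(2))
  show "inj_on \<phi> T1" using ij by (rule inj_on_subset) simp
  show "(\<phi> p, \<phi> q) : prec ?T \<longleftrightarrow> p \<subseteq>\<^sub>m q & p ~= q" if "p : T1" "q : T1" for p q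
   using prec[OF that] by (simp add: mp)
  show "(\<phi> (push p a), \<phi> (push p b)) : sord ?T (\<phi> p) \<longleftrightarrow> (a, b) : Y"
   if "p : T1" "a : Field Y" "b : Field Y" for p a b using sord[OF that] by (simp add: mp inv_f_f[OF ij])
 qed (use Y(1) sub emp one add in simp_all)
qed

lemma (in coded) Field_succ_order_root: "Field (succ_order T (tree_root T)) = succs T (tree_root T)"
proof -
 have "refl_on (succs T (tree_root T)) (succ_order T (tree_root T))"
  using linear_succ_order[OF emp] unfolding root_eq order_on_defs by blast
 thus ?thesis unfolding succ_order_def refl_on_def Field_def by auto
qed

lemma (in build) has_tree:
 fixes X :: "'a rel"
 assumes X: "lots (<=.) (<.) X" "Field X = A" and Y2: "EX a:Field Y. EX b:Field Y. a ~= b"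
 shows "has_additive_tree Y X" "coded Y VV (simple_tree Y\<lparr>verts := VV\<rparr>) (\<lambda>p. p)"
proof -
 have "subtree (simple_tree Y) VV & additive Y VV" by (rule iffD2[OF additive_subtree_iff[OF Ylin Y2] VV_additive])
 moreover show c: "coded Y VV (simple_tree Y\<lparr>verts := VV\<rparr>) (\<lambda>p. p)"
  by (rule coded_simple[OF Ylin Y2]) (use VV_additive in auto)
 ultimately show "has_additive_tree Y X" unfolding has_additive_tree_def using branches_VV[OF c X] by blast
qed

theorem theorem1p5:
  fixes X :: "'a rel"
  assumes "Linear_order X"
  shows
    "(CHLOTS X \<longleftrightarrow> has_additive_tree (relation_of (\<le>) (UNIV :: int set)) X) \<and>
     (CHLOTS X \<longleftrightarrow>
        (\<exists>D :: real set. IHLOTS (relation_of (\<le>) D) \<and> closure D = UNIV \<and>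
           has_additive_tree (relation_of (\<le>) D) X)) \<and>
     (CHLOTS X \<longleftrightarrow>
        (\<exists>T :: 'v vertex tree. bi_ordered_tree T \<and> Omega_bounded T \<and> reproductive T \<and>
           HLOTS (succ_order T (tree_root T)) \<and> completion_isomorphic (branch_space T) X))"
proof (intro conjI)
 obtain le lt where 1: "lin le lt" "!!x y. x : Field X ==> y : Field X ==> (x, y) : X \<longleftrightarrow> le x y"
  using linear_order_extend[OF assms] by metis
 interpret X: lots le lt X using 1 assms by (simp add: lots_def lots_axioms_def)
 have four: "CHLOTS X" if T: "bi_ordered_tree T" "Omega_bounded T" "reproductive T"
   "HLOTS (succ_order T (tree_root T))" "completion_isomorphic (branch_space T) X" for T :: "'v vertex tree"
 proof (rule tree_CHLOTS[OF T(1-3) _ T(5) assms])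
  let ?r = "tree_root T"
  have "EX! r. r : verts T & order_of T r = {}" using T(1) unfolding bi_ordered_tree_def semi_normal_tree_def by blast
  hence "?r : verts T & order_of T ?r = {}" unfolding tree_root_def by (rule theI')
  moreover have "succs T ?r ~= {}"
  proof
   assume "succs T ?r = {}"
   hence "succ_order T ?r = {}" unfolding succ_order_def by simp
   thus False using T(4) unfolding HLOTS_def by simp
  qed
  ultimately have "linear_order_on (succs T ?r) (succ_order T ?r)" using T(1) unfolding bi_ordered_tree_def by blast
  hence "refl_on (succs T ?r) (succ_order T ?r)" unfolding order_on_defs by blast
  hence "Field (succ_order T ?r) = succs T ?r" unfolding succ_order_def refl_on_def Field_def by auto
  thus "nice (\<lambda>a b. a ~= b & (a, b) : succ_order T ?r) (succs T ?r)" using nice_HLOTS[OF T(4)] by simp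
 qed
 have all: "has_additive_tree (relation_of (<=) (UNIV :: int set)) X &
   (EX D :: real set. IHLOTS (relation_of (<=) D) & closure D = UNIV & has_additive_tree (relation_of (<=) D) X) &
   (EX T :: 'v vertex tree. bi_ordered_tree T & Omega_bounded T & reproductive T &
      HLOTS (succ_order T (tree_root T)) & completion_isomorphic (branch_space T) X)" if H: "CHLOTS X"
 proof -
  obtain cz hz u v where "zsys le lt (Field X) cz hz u v" by (rule X.CHLOTS_zsys[OF H])
  then interpret Z: zsys le lt "Field X" cz hz u v .
  interpret BZ: build le lt "Field X" "relation_of (<=) (UNIV :: int set)" hz cz "\<lambda>z. cz (z + 1)" "\<lambda>n. cz (int n)"
   by (rule Z.build_int)
  have "EX a b :: int. a ~= b" by (intro exI[of _ 0] exI[of _ 1]) simp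
  hence 2: "has_additive_tree (relation_of (<=) (UNIV :: int set)) X"
   by (intro BZ.has_tree(1)[OF X.lots_axioms refl]) (simp add: Field_relation_of)
  let ?Y = "relation_of (<=) Z.D"
  interpret BD: build le lt "Field X" ?Y "\<lambda>t. SOME f. siso lt lt f (Field X) (Z.Ivl (Z.alD t) (Z.beD t))"
   Z.alD Z.beD "\<lambda>n. cz (int n)" by (rule Z.build_D)
  obtain a where a: "a : Z.D" "0 < a" "a < 1" using Z.D_dense[of 0 1] by auto
  obtain b where b: "b : Z.D" "1 < b" "b < 2" using Z.D_dense[of 1 2] by auto
  have "a ~= b" using a b by simp
  hence Y2: "EX a:Field ?Y. EX b:Field ?Y. a ~= b" unfolding Field_relation_of using a(1) b(1) by blast
  note tr = BD.has_tree[OF X.lots_axioms refl Y2]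
  \<comment> \<open>The tree built over \<open>D\<close> serves once more: the successors of its
    root are a copy of \<open>D\<close>, hence a homogeneous order.\<close>
  let ?T = "\<lparr>verts = Inr ` BD.VV, prec = map_prod Inr Inr ` prec (simple_tree ?Y\<lparr>verts := BD.VV\<rparr>),
   sord = (\<lambda>v. map_prod Inr Inr ` sord (simple_tree ?Y\<lparr>verts := BD.VV\<rparr>) (inv Inr v))\<rparr> :: 'v vertex tree"
  have cT: "coded ?Y BD.VV ?T Inr" by (rule coded_image[OF tr(2) inj_Inr])
  interpret C: coded ?Y BD.VV ?T Inr by (rule cT)
  have "HLOTS (succ_order ?T (tree_root ?T))"
  proof (rule HLOTS_transfer[OF Z.HLOTS_D])
   show "Linear_order (succ_order ?T (tree_root ?T))"
    unfolding C.Field_succ_order_root using C.linear_succ_order[OF C.emp] unfolding C.root_eq .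
  qed (unfold C.Field_succ_order_root, rule C.succ_order_root_siso)
  hence "EX T :: 'v vertex tree. bi_ordered_tree T & Omega_bounded T & reproductive T &
      HLOTS (succ_order T (tree_root T)) & completion_isomorphic (branch_space T) X"
   using C.bi_ordered C.rep BD.branches_VV[OF cT X.lots_axioms refl] by blast
  thus ?thesis using 2 tr(1) Z.IHLOTS_D Z.closure_D by blast
 qed
 show "CHLOTS X \<longleftrightarrow> has_additive_tree (relation_of (<=) (UNIV :: int set)) X"
  using all has_additive_tree_CHLOTS[OF Linear_order_relation_of nice_int_rel _ assms] by blast
 show "CHLOTS X \<longleftrightarrow> (EX D :: real set. IHLOTS (relation_of (<=) D) & closure D = UNIV &
      has_additive_tree (relation_of (<=) D) X)"
  using all has_additive_tree_CHLOTS[OF Linear_order_relation_of nice_HLOTS _ assms] unfolding IHLOTS_def by blast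
 show "CHLOTS X \<longleftrightarrow> (EX T :: 'v vertex tree. bi_ordered_tree T & Omega_bounded T & reproductive T &
      HLOTS (succ_order T (tree_root T)) & completion_isomorphic (branch_space T) X)" using all four by blast
qed

end
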